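(* Let $n\ge 2$ and let $\Omega\subset\mathbb{R}^n$ be a bounded $C^{1,1}$ domain. Then there exists a vector field $\mathbf{u}:\Omega\to\mathbb{R}^n$ such that: (i) $\mathbf{u}\in W^{2,q}(\Omega)\cap W^{1,s}_0(\Omega)$ for all $1<q<n$ and all $1<s<\infty$; (ii) $\operatorname{Tr}_{\partial\Omega}\nabla\mathbf{u}\not\equiv 0$; (iii) $\operatorname{div}\mathbf{u}\equiv 0$ in $\Omega$; (iv) $(1+|\mathbf{D}\mathbf{u}|)^{p-2}\notin A_\infty(\Omega_0)$ for every $p\in(1,\infty)$ with $p\neq 2$ and every nonempty open set $\Omega_0\subset\Omega$.
   Context: A domain is a nonempty connected open set. For a vector field $\mathbf{u}$, $\nabla\mathbf{u}$ is its weak gradient and $\mathbf{D}\mathbf{u}:=\frac12(\nabla\mathbf{u}+\nabla\mathbf{u}^\top)$ is the symmetric part of the gradient; $|\cdot|$ is the Euclidean norm. $W^{2,q}(\Omega)$ and $W^{1,s}_0(\Omega)$ are the usual Sobolev spaces (of vector fields), the subscript $0$ denoting zero trace on $\partial\Omega$. $\operatorname{Tr}_{\partial\Omega}$ is the Sobolev trace operator onto $\partial\Omega$, applied componentwise; $\not\equiv 0$ means not almost everywhere zero with respect to surface measure. A weight is a locally integrable non-negative function on $\mathbb{R}^n$. For a set $U\subset\mathbb{R}^n$, $\alpha\in(1,\infty)$ and $\alpha':=\frac{\alpha}{\alpha-1}$, a weight $\omega$ belongs to the Muckenhoupt class $A_\alpha(U)$ if $$\sup_{B\subset U}\ \frac{1}{|B|}\int_B\omega(\mathbf{x})\,d\mathbf{x}\left(\frac{1}{|B|}\int_B\omega^{1-\alpha'}(\mathbf{x})\,d\mathbf{x}\right)^{\alpha-1}<\infty,$$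 where the supremum is over all balls $B\subset U$. Moreover $A_\infty(U):=\bigcup_{\alpha>1}A_\alpha(U)$. In (iv) the function $(1+|\mathbf{D}\mathbf{u}|)^{p-2}$, defined on $\Omega$, is understood as extended by zero to all of $\mathbb{R}^n$. *)

theory Defs
  imports "HOL-Analysis.Analysis"
begin

section \<open>Weak derivatives and Sobolev spaces\<close>

primrec Ck :: "nat \<Rightarrow> ('a::euclidean_space \<Rightarrow> 'b::euclidean_space) \<Rightarrow> bool" where
  "Ck 0 f \<longleftrightarrow> continuous_on UNIV f"
| "Ck (Suc k) f \<longleftrightarrow>
     (\<forall>x. f differentiable (at x)) \<and> (\<forall>v. Ck k (\<lambda>x. frechet_derivative f (at x) v))"

definition test_function :: "'a::euclidean_space set \<Rightarrow> ('a \<Rightarrow> real) \<Rightarrow> bool" where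
  "test_function \<Omega> \<phi> \<longleftrightarrow>
     (\<forall>k. Ck k \<phi>) \<and> compact (closure {x. \<phi> x \<noteq> 0}) \<and> closure {x. \<phi> x \<noteq> 0} \<subseteq> \<Omega>"

definition locally_integrable_on ::
    "('a::euclidean_space \<Rightarrow> 'b::euclidean_space) \<Rightarrow> 'a set \<Rightarrow> bool" where
  "locally_integrable_on f \<Omega> \<longleftrightarrow> (\<forall>K. compact K \<and> K \<subseteq> \<Omega> \<longrightarrow> set_integrable lebesgue K f)"

text \<open>The weak derivative in direction \<open>v\<close>; it is unique up to null sets.\<close>

definition has_weak_derivative ::
    "'a::euclidean_space set \<Rightarrow> 'a \<Rightarrow> ('a \<Rightarrow> 'b::euclidean_space) \<Rightarrow> ('a \<Rightarrow> 'b) \<Rightarrow> bool" where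
  "has_weak_derivative \<Omega> v f g \<longleftrightarrow>
     locally_integrable_on f \<Omega> \<and> locally_integrable_on g \<Omega> \<and>
     (\<forall>\<phi>. test_function \<Omega> \<phi> \<longrightarrow>
        (LINT x:\<Omega>|lebesgue. frechet_derivative \<phi> (at x) v *\<^sub>R f x)
          = - (LINT x:\<Omega>|lebesgue. \<phi> x *\<^sub>R g x))"

text \<open>Row \<open>i\<close>, column \<open>j\<close> of \<open>G\<close> is the weak derivative of the \<open>i\<close>-th component in
  direction \<open>j\<close>.\<close>

definition has_weak_gradient ::
    "(real^'n) set \<Rightarrow> (real^'n \<Rightarrow> real^'n) \<Rightarrow> (real^'n \<Rightarrow> real^'n^'n) \<Rightarrow> bool" where
  "has_weak_gradient \<Omega> u G \<longleftrightarrow>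
     (\<forall>j. has_weak_derivative \<Omega> (axis j 1) u (\<lambda>x. column j (G x)))"

definition sym_part :: "real^'n^'n \<Rightarrow> real^'n^'n" where
  "sym_part A = (1/2) *\<^sub>R (A + transpose A)"

text \<open>The \<open>p\<close>-th power of the \<open>L\<^sup>p\<close> norm, as a nonnegative extended real.\<close>

definition Lp_energy :: "real \<Rightarrow> 'a measure \<Rightarrow> ('a \<Rightarrow> 'b::euclidean_space) \<Rightarrow> ennreal" where
  "Lp_energy p M f = (\<integral>\<^sup>+x. ennreal (norm (f x) powr p) \<partial>M)"

definition Lp_space :: "real \<Rightarrow> 'a measure \<Rightarrow> ('a \<Rightarrow> 'b::euclidean_space) set" where
  "Lp_space p M = {f \<in> borel_measurable M. Lp_energy p M f < \<infinity>}"

text \<open>\<open>sobolev k p \<Omega>\<close> is \<open>W\<^sup>k\<^sup>,\<^sup>p(\<Omega>)\<close>. Functions are total; only the values on \<open>\<Omega>\<close> matter.\<close>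

primrec sobolev ::
    "nat \<Rightarrow> real \<Rightarrow> 'a::euclidean_space set \<Rightarrow> ('a \<Rightarrow> 'b::euclidean_space) set" where
  "sobolev 0 p \<Omega> = Lp_space p (lebesgue_on \<Omega>)"
| "sobolev (Suc k) p \<Omega> =
     {f \<in> Lp_space p (lebesgue_on \<Omega>).
        \<forall>b\<in>Basis. \<exists>g. has_weak_derivative \<Omega> b f g \<and> g \<in> sobolev k p \<Omega>}"

definition W1_tendsto ::
    "real \<Rightarrow> 'a::euclidean_space set \<Rightarrow> (nat \<Rightarrow> 'a \<Rightarrow> 'b::euclidean_space) \<Rightarrow> ('a \<Rightarrow> 'b) \<Rightarrow> bool" where
  "W1_tendsto p \<Omega> \<phi> f \<longleftrightarrow>
     (\<lambda>k. Lp_energy p (lebesgue_on \<Omega>) (\<lambda>x. \<phi> k x - f x)) \<longlonglongrightarrow> 0 \<and>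
     (\<forall>b\<in>Basis. \<exists>\<psi>. (\<forall>k. has_weak_derivative \<Omega> b (\<lambda>x. \<phi> k x - f x) (\<psi> k)) \<and>
        (\<lambda>k. Lp_energy p (lebesgue_on \<Omega>) (\<psi> k)) \<longlonglongrightarrow> 0)"


section \<open>Surface measure and traces\<close>

text \<open>Normalised Hausdorff outer measure of dimension \<open>s\<close>. It is meant for \<open>s > 0\<close>, since
  \<open>0 powr 0 = 0\<close>. Covering sets have to be bounded because \<open>diameter\<close> is only meaningful
  for bounded sets.\<close>

definition hausdorff_outer :: "real \<Rightarrow> 'a::euclidean_space set \<Rightarrow> ennreal" where
  "hausdorff_outer s A =
     (SUP \<delta>\<in>{0<..}. INF C\<in>{C :: nat \<Rightarrow> 'a set.
          A \<subseteq> (\<Union>i. C i) \<and> (\<forall>i. bounded (C i) \<and> diameter (C i) \<le> \<delta>)}.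
        (\<Sum>i. ennreal (unit_ball_vol s * (diameter (C i) / 2) powr s)))"

definition hausdorff_measure :: "real \<Rightarrow> 'a::euclidean_space measure" where
  "hausdorff_measure s = measure_of UNIV (sets borel) (hausdorff_outer s)"

definition surface_measure :: "'a::euclidean_space set \<Rightarrow> 'a measure" where
  "surface_measure \<Omega> =
     restrict_space (hausdorff_measure (real DIM('a) - 1)) (frontier \<Omega>)"

text \<open>\<open>has_trace p \<Omega> f g\<close> says that \<open>g\<close> represents the Sobolev trace of \<open>f\<close>. The trace
  operator \<open>W\<^sup>1\<^sup>,\<^sup>p(\<Omega>) \<rightarrow> L\<^sup>p(\<partial>\<Omega>)\<close> is the continuous extension of the restriction map
  \<open>\<phi> \<mapsto> \<phi>|\<partial>\<Omega>\<close> from the dense subspace of functions in \<open>W\<^sup>1\<^sup>,\<^sup>p(\<Omega>)\<close> that are continuous on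
  the closure. On bounded Lipschitz domains \<open>g\<close> exists and is unique up to surface
  null sets. For vector- and matrix-valued \<open>f\<close> this is the componentwise trace.\<close>

definition has_trace ::
    "real \<Rightarrow> 'a::euclidean_space set \<Rightarrow> ('a \<Rightarrow> 'b::euclidean_space) \<Rightarrow> ('a \<Rightarrow> 'b) \<Rightarrow> bool" where
  "has_trace p \<Omega> f g \<longleftrightarrow>
     f \<in> sobolev 1 p \<Omega> \<and> g \<in> Lp_space p (surface_measure \<Omega>) \<and>
     (\<exists>\<phi>. (\<forall>k. \<phi> k \<in> sobolev 1 p \<Omega> \<and> continuous_on (closure \<Omega>) (\<phi> k)) \<and>
          W1_tendsto p \<Omega> \<phi> f \<and>
          (\<lambda>k. Lp_energy p (surface_measure \<Omega>) (\<lambda>x. \<phi> k x - g x)) \<longlonglongrightarrow> 0)"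

definition sobolev_zero_trace ::
    "real \<Rightarrow> 'a::euclidean_space set \<Rightarrow> ('a \<Rightarrow> 'b::euclidean_space) set" where
  "sobolev_zero_trace p \<Omega> = {f \<in> sobolev 1 p \<Omega>. has_trace p \<Omega> f (\<lambda>x. 0)}"


section \<open>Domains with \<open>C\<^sup>1\<^sup>,\<^sup>1\<close> boundary\<close>

definition C11_function :: "('a::euclidean_space \<Rightarrow> real) \<Rightarrow> bool" where
  "C11_function \<gamma> \<longleftrightarrow>
     (\<exists>\<gamma>' L. (\<forall>y. GDERIV \<gamma> y :> \<gamma>' y) \<and> L-lipschitz_on UNIV \<gamma>')"

text \<open>Near each boundary point, in suitably rotated coordinates, the set lies above the
  graph of a \<open>C\<^sup>1\<^sup>,\<^sup>1\<close> function. The unit vector \<open>e\<close> is the last coordinate axis, and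
  \<open>x - (x \<bullet> e) *\<^sub>R e\<close> is the projection of \<open>x\<close> to the other coordinates. A function on the
  hyperplane orthogonal to \<open>e\<close> is \<open>C\<^sup>1\<^sup>,\<^sup>1\<close> iff it is the restriction of a \<open>C\<^sup>1\<^sup>,\<^sup>1\<close> function on
  the whole space.\<close>

definition C11_boundary :: "'a::euclidean_space set \<Rightarrow> bool" where
  "C11_boundary \<Omega> \<longleftrightarrow>
     (\<forall>x0\<in>frontier \<Omega>. \<exists>r>0. \<exists>e \<gamma>. norm e = 1 \<and> C11_function \<gamma> \<and>
        \<Omega> \<inter> ball x0 r = {x \<in> ball x0 r. \<gamma> (x - (x \<bullet> e) *\<^sub>R e) < x \<bullet> e})"

definition bounded_C11_domain :: "'a::euclidean_space set \<Rightarrow> bool" where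
  "bounded_C11_domain \<Omega> \<longleftrightarrow>
     open \<Omega> \<and> connected \<Omega> \<and> \<Omega> \<noteq> {} \<and> bounded \<Omega> \<and> C11_boundary \<Omega>"


section \<open>Muckenhoupt weights\<close>

text \<open>Real powers of extended reals, with \<open>0\<close> to a negative power being \<open>\<infinity>\<close>.\<close>

definition enn_powr :: "ennreal \<Rightarrow> real \<Rightarrow> ennreal" where
  "enn_powr x a =
     (if a = 0 then 1
      else if (x = 0 \<and> a < 0) \<or> (x = \<infinity> \<and> 0 < a) then \<infinity>
      else ennreal (enn2real x powr a))"

definition weight :: "('a::euclidean_space \<Rightarrow> real) \<Rightarrow> bool" where
  "weight \<omega> \<longleftrightarrow> (\<forall>x. 0 \<le> \<omega> x) \<and> locally_integrable_on \<omega> UNIV"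

definition average :: "'a::euclidean_space set \<Rightarrow> ('a \<Rightarrow> ennreal) \<Rightarrow> ennreal" where
  "average B f = (\<integral>\<^sup>+x\<in>B. f x \<partial>lebesgue) / emeasure lebesgue B"

definition muckenhoupt :: "real \<Rightarrow> 'a::euclidean_space set \<Rightarrow> ('a \<Rightarrow> real) set" where
  "muckenhoupt \<alpha> U =
     {\<omega>. weight \<omega> \<and>
        (let \<alpha>' = \<alpha> / (\<alpha> - 1) in
          (SUP (x, r)\<in>{(x, r). 0 < r \<and> ball x r \<subseteq> U}.
             average (ball x r) (\<lambda>y. ennreal (\<omega> y)) *
             enn_powr (average (ball x r) (\<lambda>y. enn_powr (ennreal (\<omega> y)) (1 - \<alpha>'))) (\<alpha> - 1))
          < \<infinity>)}"

definition muckenhoupt_infty :: "'a::euclidean_space set \<Rightarrow> ('a \<Rightarrow> real) set" where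
  "muckenhoupt_infty U = (\<Union>\<alpha>\<in>{1<..}. muckenhoupt \<alpha> U)"

end

theory Submission
  imports Defs
begin

text \<open>The field is \<open>u = \<nabla>\<^sup>\<bottom>\<Psi>\<close> in the plane of two coordinates \<open>a\<close>, \<open>b\<close>, for a stream function
  \<open>\<Psi> = \<Sum>\<^sub>k (N\<^sub>k + B\<^sub>k)\<close> whose terms are of class \<open>C\<^sup>3\<close>.

  The \<open>B\<^sub>k\<close> are bumps on balls of radius \<open>r\<^sub>k\<close> with dense centres, scaled so that their second
  derivatives have size \<open>M\<^sub>k\<close>. Since \<open>r\<^sub>k\<close> is tiny compared with \<open>M\<^sub>k\<close>, the second derivatives
  are summable in every \<open>L\<^sup>s\<close> and the third ones in every \<open>L\<^sup>q\<close> with \<open>q < n\<close>. Since \<open>M\<^sub>k\<close> is large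
  compared with the sum of its predecessors, on the \<open>k\<close>-th ball \<open>1 + |Du|\<close> takes values of two
  incomparable sizes on fixed proportions of the ball (later bumps being negligible in measure),
  and their ratio tends to infinity. This contradicts every \<open>A\<^sub>\<alpha>\<close> condition.

  The \<open>N\<^sub>k\<close> produce the nonzero trace. Let \<open>g\<close> be a \<open>C\<^sup>1\<^sup>,\<^sup>1\<close> function defining \<open>\<Omega>\<close> near a boundary point
  and \<open>\<eta>\<close> a bump there. The function \<open>\<eta> g\<^sup>2\<close> has the right boundary behaviour, but no third
  derivatives. With mollifications \<open>g\<^sub>k\<close> of \<open>g\<close> at scale \<open>2\<^sup>-\<^sup>k\<close> and cutoffs \<open>\<theta>\<^sub>k\<close> to the strip
  \<open>|g\<^sub>k| \<lesssim> 2\<^sup>-\<^sup>k\<close>, the functions \<open>\<eta> \<theta>\<^sub>k (g\<^sub>k\<^sub>+\<^sub>1\<^sup>2 - g\<^sub>k\<^sup>2)\<close> have bounded third derivatives and supports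
  of volume \<open>O(2\<^sup>-\<^sup>k)\<close>, and they telescope to \<open>\<eta> g\<^sup>2\<close> at the boundary.\<close>

section \<open>Directional derivatives and functions of class \<open>C\<^sup>k\<close>\<close>

text \<open>All summands are classical C^3 functions, so weak derivatives are termwise series of
  classical ones, and Sobolev norms reduce to sizes and volumes of supports. Every bump lives well
  inside \<Omega>, so boundary values come from the N_k alone. The range q < n is a matter of
  scaling: third derivatives of a bump have size M/r on a ball of volume r^n, with q-th energy M^q
  r^(n-q), which a small r makes negligible as long as q < n. One sequence of radii must serve all
  exponents at once. At the boundary the obstacle is that g has only two derivatives. On the strip
  g_k is of order 2^-k and g_(k+1) - g_k of order 4^-k, so the k-th term has size 8^-k; three
  derivatives, each costing 2^k, just leave it bounded, and the volume of the strip supplies the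
  decay. That the trace is nonzero needs a lower bound for the Hausdorff measure of a graph, and
  that it is p-integrable an upper bound. Both come from translating along the axis of the graph and
  comparing volumes, so that neither an area formula nor Fubini's theorem enters.\<close>

definition dderiv :: "'a::euclidean_space \<Rightarrow> ('a \<Rightarrow> 'b::euclidean_space) \<Rightarrow> 'a \<Rightarrow> 'b" where
  "dderiv v f x = frechet_derivative f (at x) v"

lemma dderiv_eqI: "(f has_derivative f') (at x) \<Longrightarrow> dderiv v f x = f' v"
  by (simp add: dderiv_def frechet_derivative_at[symmetric])

lemma Ck_Suc: "Ck (Suc k) f \<longleftrightarrow> (\<forall>x. f differentiable (at x)) \<and> (\<forall>v. Ck k (dderiv v f))"
  by (simp add: dderiv_def[abs_def])

declare Ck.simps(2)[simp del]

lemma Ck_SucI: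
  assumes "\<And>x. (f has_derivative f' x) (at x)" "\<And>v. Ck k (\<lambda>x. f' x v)"
  shows "Ck (Suc k) f"
proof -
  have "dderiv v f = (\<lambda>x. f' x v)" for v
    using dderiv_eqI[OF assms(1)] by (auto simp: fun_eq_iff)
  then show ?thesis
    using assms by (auto simp: Ck_Suc differentiable_def)
qed

lemma Ck_dd: "Ck (Suc k) f \<Longrightarrow> Ck k (dderiv v f)"
  by (simp add: Ck_Suc)

lemma Ck_differentiable: "Ck (Suc k) f \<Longrightarrow> f differentiable (at x)"
  by (simp add: Ck_Suc)

lemma dderiv_has_derivative: "f differentiable (at x) \<Longrightarrow> (f has_derivative (\<lambda>v. dderiv v f x)) (at x)"
  unfolding dderiv_def frechet_derivative_works by simp

lemma Ck_has_derivative: "Ck (Suc k) f \<Longrightarrow> (f has_derivative (\<lambda>v. dderiv v f x)) (at x)"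
  by (intro dderiv_has_derivative Ck_differentiable)

lemma dderiv_scale: "f differentiable (at x) \<Longrightarrow> dderiv (c *\<^sub>R v) f x = c *\<^sub>R dderiv v f x"
  using linear_scale[OF has_derivative_linear[OF dderiv_has_derivative]] .

lemma Ck_continuous: "Ck k f \<Longrightarrow> continuous_on S f"
proof (cases k)
  case 0
  then show "Ck k f \<Longrightarrow> ?thesis" by (auto intro: continuous_on_subset)
next
  case (Suc m)
  then show "Ck k f \<Longrightarrow> ?thesis"
    by (meson Ck_differentiable continuous_at_imp_continuous_on differentiable_imp_continuous_within)
qed

lemma Ck_pred: "Ck (Suc k) f \<Longrightarrow> Ck k f"
proof (induction k arbitrary: f)
  case 0
  then show ?case by (simp add: Ck_continuous)
next
  case (Suc k)
  then show ?case unfolding Ck_Suc[of "Suc k" f] by (subst Ck_Suc) blast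
qed

lemma Ck_mono: "Ck k f \<Longrightarrow> j \<le> k \<Longrightarrow> Ck j f"
  by (induction k) (auto simp: le_Suc_eq dest: Ck_pred)

lemma Ck_const: "Ck k (\<lambda>x. c)"
proof (induction k arbitrary: c)
  case (Suc k)
  show ?case by (rule Ck_SucI[where f'="\<lambda>x v. 0"]) (auto simp: Suc)
qed simp

lemma Ck_linear:
  assumes "bounded_linear f"
  shows "Ck k f"
proof (cases k)
  case 0
  then show ?thesis using assms by (simp add: linear_continuous_on)
next
  case (Suc m)
  show ?thesis unfolding Suc
    by (rule Ck_SucI[where f'="\<lambda>x. f"]) (auto intro: bounded_linear_imp_has_derivative assms Ck_const)
qed

lemma dderiv_const [simp]: "dderiv v (\<lambda>x. c) x = 0"
  by (rule dderiv_eqI) simp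

lemma dderiv_add: "f differentiable at x \<Longrightarrow> g differentiable at x \<Longrightarrow>
    dderiv v (\<lambda>x. f x + g x) x = dderiv v f x + dderiv v g x"
  by (rule dderiv_eqI) (auto intro!: derivative_intros dderiv_has_derivative)

lemma dderiv_linear_compose: "bounded_linear h \<Longrightarrow> f differentiable at x \<Longrightarrow>
    dderiv v (\<lambda>x. h (f x)) x = h (dderiv v f x)"
  by (rule dderiv_eqI) (auto intro!: bounded_linear.has_derivative[of h] dderiv_has_derivative)

lemma Ck_add: "Ck k f \<Longrightarrow> Ck k g \<Longrightarrow> Ck k (\<lambda>x. f x + g x)"
proof (induction k arbitrary: f g)
  case (Suc k)
  show ?case
    by (rule Ck_SucI[where f'="\<lambda>x v. dderiv v f x + dderiv v g x"])
      (auto intro!: derivative_intros Ck_has_derivative Suc Ck_dd)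
qed (simp add: continuous_on_add)

lemma Ck_linear_compose:
  assumes h: "bounded_linear h"
  shows "Ck k f \<Longrightarrow> Ck k (\<lambda>x. h (f x))"
proof (induction k arbitrary: f)
  case 0
  then show ?case using h by (simp add: bounded_linear.continuous_on)
next
  case (Suc k)
  show ?case
    by (rule Ck_SucI[where f'="\<lambda>x v. h (dderiv v f x)"])
      (auto intro!: bounded_linear.has_derivative[OF h] Ck_has_derivative Suc Ck_dd)
qed

lemma Ck_minus: "Ck k f \<Longrightarrow> Ck k (\<lambda>x. - f x)"
  by (rule Ck_linear_compose[where h=uminus]) (auto intro: bounded_linear_minus bounded_linear_ident)

lemma Ck_diff: "Ck k f \<Longrightarrow> Ck k g \<Longrightarrow> Ck k (\<lambda>x. f x - g x)"
  using Ck_add[of k f "\<lambda>x. - g x"] Ck_minus by auto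

lemma Ck_sum: "(\<And>i. i \<in> I \<Longrightarrow> Ck k (f i)) \<Longrightarrow> Ck k (\<lambda>x. \<Sum>i\<in>I. f i x)"
  by (induction I rule: infinite_finite_induct) (auto intro: Ck_const Ck_add)

lemma dderiv_sum: "(\<And>i. i \<in> I \<Longrightarrow> f i differentiable at x) \<Longrightarrow>
    dderiv v (\<lambda>x. \<Sum>i\<in>I. f i x) x = (\<Sum>i\<in>I. dderiv v (f i) x)"
  by (induction I rule: infinite_finite_induct) (auto simp: dderiv_add)

lemma Ck_scaleR: "Ck k f \<Longrightarrow> Ck k g \<Longrightarrow> Ck k (\<lambda>x. f x *\<^sub>R g x)"
proof (induction k arbitrary: f g)
  case (Suc k)
  show ?case
    by (rule Ck_SucI[where f'="\<lambda>x v. f x *\<^sub>R dderiv v g x + dderiv v f x *\<^sub>R g x"])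
      (auto intro!: derivative_intros Ck_has_derivative Ck_add Suc.IH Suc.prems Ck_dd Ck_pred[OF Suc.prems(1)] Ck_pred[OF Suc.prems(2)])
qed (simp add: continuous_on_scaleR)

lemma dderiv_scaleR: "f differentiable at x \<Longrightarrow> g differentiable at x \<Longrightarrow>
    dderiv v (\<lambda>x. f x *\<^sub>R g x) x = f x *\<^sub>R dderiv v g x + dderiv v f x *\<^sub>R g x"
  by (rule dderiv_eqI) (auto intro!: has_derivative_scaleR dderiv_has_derivative)

lemma Ck_mult: "Ck k f \<Longrightarrow> Ck k g \<Longrightarrow> Ck k (\<lambda>x. f x * g x :: real)"
  using Ck_scaleR[of k f g] by simp

lemma dderiv_mult: "f differentiable at x \<Longrightarrow> g differentiable at x \<Longrightarrow>
    dderiv v (\<lambda>x. f x * g x) x = f x * dderiv v g x + dderiv v f x * g x" for f :: "_ \<Rightarrow> real"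
  using dderiv_scaleR[of f x g v] by simp

lemma has_derivative_compose_real:
  fixes \<theta> :: "real \<Rightarrow> real" and f :: "'a::euclidean_space \<Rightarrow> real"
  assumes "\<theta> differentiable (at (f x))" "f differentiable (at x)"
  shows "((\<lambda>x. \<theta> (f x)) has_derivative (\<lambda>v. dderiv v f x * dderiv 1 \<theta> (f x))) (at x)"
proof -
  have 1: "(\<theta> has_derivative (\<lambda>t. dderiv t \<theta> (f x))) (at (f x))"
    using assms(1) by (rule dderiv_has_derivative)
  have 2: "(f has_derivative (\<lambda>t. dderiv t f x)) (at x)"
    using assms(2) by (rule dderiv_has_derivative)
  have "(\<lambda>v. dderiv (dderiv v f x) \<theta> (f x)) = (\<lambda>v. dderiv v f x * dderiv 1 \<theta> (f x))"
  proof (rule ext)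
    fix v show "dderiv (dderiv v f x) \<theta> (f x) = dderiv v f x * dderiv 1 \<theta> (f x)"
      using dderiv_scale[OF assms(1), of "dderiv v f x" 1] unfolding real_scaleR_def mult_1_right .
  qed
  then show ?thesis
    using has_derivative_compose[OF 2 1] by (simp only:)
qed

lemma Ck_compose_real: "Ck k \<theta> \<Longrightarrow> Ck k f \<Longrightarrow> Ck k (\<lambda>x. \<theta> (f x))" for \<theta> f :: "_ \<Rightarrow> real"
proof (induction k arbitrary: \<theta> f)
  case 0
  then show ?case
    by simp (rule continuous_on_compose2[of UNIV \<theta>], auto)
next
  case (Suc k)
  show ?case
    by (rule Ck_SucI[OF has_derivative_compose_real[OF Ck_differentiable[OF Suc.prems(1)] Ck_differentiable[OF Suc.prems(2)]]])
      (rule Ck_mult[OF Ck_dd[OF Suc.prems(2)] Suc.IH[OF Ck_dd[OF Suc.prems(1)] Ck_pred[OF Suc.prems(2)]]])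
qed

lemma dderiv_compose_real: "\<theta> differentiable (at (f x)) \<Longrightarrow> f differentiable (at x) \<Longrightarrow>
   dderiv v (\<lambda>x. \<theta> (f x)) x = dderiv v f x * dderiv 1 \<theta> (f x)" for \<theta> f :: "_ \<Rightarrow> real"
  by (rule dderiv_eqI) (rule has_derivative_compose_real)

lemma dderiv_affine:
  assumes "f differentiable (at (c *\<^sub>R (x - a)))"
  shows "dderiv v (\<lambda>x. f (c *\<^sub>R (x - a))) x = c *\<^sub>R dderiv v f (c *\<^sub>R (x - a))"
proof -
  have 1: "(f has_derivative (\<lambda>t. dderiv t f (c *\<^sub>R (x - a)))) (at (c *\<^sub>R (x - a)))"
    using assms(1) by (rule dderiv_has_derivative)
  have 2: "((\<lambda>x. c *\<^sub>R (x - a)) has_derivative (\<lambda>v. c *\<^sub>R v)) (at x)"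
    by (auto intro!: derivative_eq_intros)
  show ?thesis
    by (rule trans[OF dderiv_eqI[OF has_derivative_compose[OF 2 1]]])
      (rule linear_scale[OF has_derivative_linear[OF 1]])
qed

lemma Ck_affine: "Ck k f \<Longrightarrow> Ck k (\<lambda>x. f (c *\<^sub>R (x - a)))"
proof (induction k arbitrary: f)
  case 0
  then show ?case
    by simp (rule continuous_on_compose2[of UNIV f], auto intro!: continuous_intros)
next
  case (Suc k)
  have "dderiv v (\<lambda>x. f (c *\<^sub>R (x - a))) = (\<lambda>x. c *\<^sub>R dderiv v f (c *\<^sub>R (x - a)))" for v
    by (rule ext) (rule dderiv_affine[OF Ck_differentiable[OF Suc.prems]])
  moreover have "Ck k (\<lambda>x. c *\<^sub>R dderiv v f (c *\<^sub>R (x - a)))" for v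
    by (rule Ck_linear_compose[OF bounded_linear_scaleR_right]) (rule Suc.IH[OF Ck_dd[OF Suc.prems]])
  moreover have "(\<lambda>x. f (c *\<^sub>R (x - a))) differentiable at x" for x
  proof -
    have "((\<lambda>x. c *\<^sub>R (x - a)) has_derivative (\<lambda>v. c *\<^sub>R v)) (at x)"
      by (auto intro!: derivative_eq_intros)
    from has_derivative_compose[OF this Ck_has_derivative[OF Suc.prems]] show ?thesis
      by (auto simp: differentiable_def)
  qed
  ultimately show ?case unfolding Ck_Suc by metis
qed

text \<open>No differentiability is assumed: \<open>frechet_derivative\<close> is a
  \<open>SOME\<close> term whose predicate depends only on the germ of the function, so even its
  default values agree.\<close>

lemma dderiv_cong_open:
  assumes "open U" "x \<in> U" "\<And>y. y \<in> U \<Longrightarrow> f y = g y"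
  shows "dderiv v f x = dderiv v g x"
proof -
  have "(f has_derivative D) (at x) = (g has_derivative D) (at x)" for D
    using has_derivative_transform_within_open[OF _ assms(1,2), of f D UNIV g]
      has_derivative_transform_within_open[OF _ assms(1,2), of g D UNIV f] assms(3) by metis
  then show ?thesis unfolding dderiv_def frechet_derivative_def by (simp only:)
qed

lemma dderiv_eq_0_open:
  assumes "open U" "x \<in> U" "\<And>y. y \<in> U \<Longrightarrow> f y = 0"
  shows "dderiv v f x = 0"
  using dderiv_cong_open[of U x f "\<lambda>_. 0" v] assms by simp

text \<open>The mean value theorem is applied twice: along \<open>v\<close> to the increment of
  \<open>f\<close> in direction \<open>w\<close>, then along \<open>w\<close> to
  \<open>dderiv v f\<close>.\<close>

lemma second_difference_mvt:
  fixes f :: "'a::euclidean_space \<Rightarrow> real"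
  assumes f: "Ck (Suc (Suc 0)) f" and t: "0 < t"
  shows "\<exists>s r. 0 \<le> s \<and> s \<le> t \<and> 0 \<le> r \<and> r \<le> t \<and>
      f (x + t *\<^sub>R v + t *\<^sub>R w) - f (x + t *\<^sub>R v) - f (x + t *\<^sub>R w) + f x
        = t * t * dderiv w (dderiv v f) (x + s *\<^sub>R v + r *\<^sub>R w)"
proof -
  have line: "((\<lambda>s. h (a + s *\<^sub>R v)) has_derivative (\<lambda>t. t * dderiv v h (a + s *\<^sub>R v))) (at s)"
    if h: "Ck (Suc 0) h" for h :: "'a \<Rightarrow> real" and a v s
  proof -
    have "((\<lambda>s. h (a + s *\<^sub>R v)) has_derivative (\<lambda>t. dderiv (t *\<^sub>R v) h (a + s *\<^sub>R v))) (at s)"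
      by (rule has_derivative_compose[OF _ Ck_has_derivative[OF h]]) (auto intro!: derivative_eq_intros)
    then show ?thesis by (simp only: dderiv_scale[OF Ck_differentiable[OF h]] real_scaleR_def)
  qed
  have "((\<lambda>s. f ((x + t *\<^sub>R w) + s *\<^sub>R v) - f (x + s *\<^sub>R v)) has_derivative
      (\<lambda>h. h * dderiv v f ((x + t *\<^sub>R w) + s *\<^sub>R v) - h * dderiv v f (x + s *\<^sub>R v))) (at s within {0..t})" for s
    by (rule has_derivative_at_withinI[OF has_derivative_diff[OF line line]]) (rule Ck_pred[OF f])+
  from mvt_simple[OF t this] obtain s where s: "0 < s" "s < t" and
    s': "(f ((x + t *\<^sub>R w) + t *\<^sub>R v) - f (x + t *\<^sub>R v)) - (f ((x + t *\<^sub>R w) + 0 *\<^sub>R v) - f (x + 0 *\<^sub>R v))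
       = (t - 0) * dderiv v f ((x + t *\<^sub>R w) + s *\<^sub>R v) - (t - 0) * dderiv v f (x + s *\<^sub>R v)"
    unfolding greaterThanLessThan_iff Bex_def by blast
  have "((\<lambda>r. dderiv v f ((x + s *\<^sub>R v) + r *\<^sub>R w)) has_derivative
        (\<lambda>h. h * dderiv w (dderiv v f) ((x + s *\<^sub>R v) + r *\<^sub>R w))) (at r within {0..t})" for r
    by (rule has_derivative_at_withinI[OF line]) (rule Ck_dd[OF f])
  from mvt_simple[OF t this] obtain r where r: "0 < r" "r < t" and
    r': "dderiv v f ((x + s *\<^sub>R v) + t *\<^sub>R w) - dderiv v f ((x + s *\<^sub>R v) + 0 *\<^sub>R w)
       = (t - 0) * dderiv w (dderiv v f) ((x + s *\<^sub>R v) + r *\<^sub>R w)"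
    unfolding greaterThanLessThan_iff Bex_def by blast
  have "f (x + t *\<^sub>R v + t *\<^sub>R w) - f (x + t *\<^sub>R v) - f (x + t *\<^sub>R w) + f x
    = t * (dderiv v f ((x + s *\<^sub>R v) + t *\<^sub>R w) - dderiv v f (x + s *\<^sub>R v))"
    using s' by (simp add: ac_simps right_diff_distrib)
  also have "\<dots> = t * t * dderiv w (dderiv v f) (x + s *\<^sub>R v + r *\<^sub>R w)"
    using r' by simp
  finally show ?thesis using s r by (intro exI[of _ s] exI[of _ r] conjI) auto
qed

text \<open>The second difference is symmetric in the two directions, and divided by the square of
  \<open>t\<close> it tends to either mixed derivative, by continuity of the second derivatives.
  This is what makes the fields solenoidal.\<close>

lemma dderiv_symmetric:
  fixes f :: "'a::euclidean_space \<Rightarrow> real"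
  assumes f: "Ck (Suc (Suc 0)) f"
  shows "dderiv v (dderiv w f) x = dderiv w (dderiv v f) x"
proof -
  have lim: "((\<lambda>t. Q t / (t * t)) \<longlongrightarrow> dderiv w (dderiv v f) x) (at_right 0)"
    if Q: "\<And>t. Q t = f (x + t *\<^sub>R v + t *\<^sub>R w) - f (x + t *\<^sub>R v) - f (x + t *\<^sub>R w) + f x" for Q v w
  proof -
    have "\<exists>s r. 0 < t \<longrightarrow> 0 \<le> s \<and> s \<le> t \<and> 0 \<le> r \<and> r \<le> t \<and>
        Q t = t * t * dderiv w (dderiv v f) (x + s *\<^sub>R v + r *\<^sub>R w)" for t
      using second_difference_mvt[OF f, of t x v w] unfolding Q by (cases "0 < t") blast+
    then obtain s r where sr: "\<And>t. 0 < t \<Longrightarrow> 0 \<le> s t \<and> s t \<le> t \<and> 0 \<le> r t \<and> r t \<le> t \<and>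
        Q t = t * t * dderiv w (dderiv v f) (x + s t *\<^sub>R v + r t *\<^sub>R w)"
      by metis
    have z: "(u \<longlongrightarrow> 0) (at_right 0)" if "\<And>t. 0 < t \<Longrightarrow> 0 \<le> u t \<and> u t \<le> t" for u :: "real \<Rightarrow> real"
      by (rule tendsto_sandwich[where f="\<lambda>_. 0" and h="\<lambda>t. t"])
        (use that in \<open>auto simp: eventually_at_filter\<close>)
    have "((\<lambda>t. x + s t *\<^sub>R v + r t *\<^sub>R w) \<longlongrightarrow> x + 0 *\<^sub>R v + 0 *\<^sub>R w) (at_right 0)"
      by (intro tendsto_intros z) (use sr in auto)
    moreover have "isCont (dderiv w (dderiv v f)) (x + 0 *\<^sub>R v + 0 *\<^sub>R w)"
      using Ck_continuous[OF Ck_dd[OF Ck_dd[OF f]], of UNIV] by (simp add: continuous_on_eq_continuous_at)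
    ultimately have "((\<lambda>t. dderiv w (dderiv v f) (x + s t *\<^sub>R v + r t *\<^sub>R w)) \<longlongrightarrow> dderiv w (dderiv v f) x) (at_right 0)"
      using isCont_tendsto_compose by fastforce
    moreover have "\<forall>\<^sub>F t in at_right 0. dderiv w (dderiv v f) (x + s t *\<^sub>R v + r t *\<^sub>R w) = Q t / (t * t)"
      using sr by (auto simp: eventually_at_filter)
    ultimately show ?thesis by (rule Lim_transform_eventually)
  qed
  define Q where "Q t = f (x + t *\<^sub>R v + t *\<^sub>R w) - f (x + t *\<^sub>R v) - f (x + t *\<^sub>R w) + f x" for t
  have "dderiv w (dderiv v f) x = dderiv v (dderiv w f) x"
  proof (rule tendsto_unique[OF _ lim lim])
    show "Q t = f (x + t *\<^sub>R w + t *\<^sub>R v) - f (x + t *\<^sub>R w) - f (x + t *\<^sub>R v) + f x" for t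
      by (simp add: Q_def ac_simps)
  qed (simp_all add: Q_def)
  then show ?thesis by simp
qed

section \<open>Quantitative bounds on derivatives, bumps and cutoffs\<close>

text \<open>All derivatives of order \<open>i \<le> j\<close> in coordinate directions are at most \<open>C l\<^sup>i\<close> at \<open>x\<close>.\<close>

primrec deriv_bound :: "nat \<Rightarrow> real \<Rightarrow> real \<Rightarrow> ('a::euclidean_space \<Rightarrow> real) \<Rightarrow> 'a \<Rightarrow> bool" where
  "deriv_bound 0 l C f x \<longleftrightarrow> \<bar>f x\<bar> \<le> C"
| "deriv_bound (Suc j) l C f x \<longleftrightarrow> \<bar>f x\<bar> \<le> C \<and> (\<forall>b\<in>Basis. deriv_bound j l (C * l) (dderiv b f) x)"

lemma deriv_bound_abs: "deriv_bound j l C f x \<Longrightarrow> \<bar>f x\<bar> \<le> C"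
  by (cases j) auto

lemma deriv_bound_mono: "deriv_bound j l C f x \<Longrightarrow> C \<le> D \<Longrightarrow> 0 \<le> l \<Longrightarrow> deriv_bound j l D f x"
proof (induction j arbitrary: C D f)
  case (Suc j)
  then have "C * l \<le> D * l" by (simp add: mult_right_mono)
  then show ?case using Suc by fastforce
qed simp

lemma deriv_bound_less: "deriv_bound (Suc j) l C f x \<Longrightarrow> deriv_bound j l C f x"
proof (induction j arbitrary: C f)
  case (Suc j)
  have "\<bar>f x\<bar> \<le> C" "\<And>b. b \<in> Basis \<Longrightarrow> deriv_bound (Suc j) l (C * l) (dderiv b f) x"
    using Suc.prems by auto
  with Suc.IH show ?case by simp
qed simp

text \<open>A larger rate is traded for a larger constant: each of at most \<open>j\<close>
  derivatives gives up a factor \<open>c\<close>. This compares bounds at different dyadic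
  scales.\<close>

lemma deriv_bound_rate:
  assumes "deriv_bound j (c * l) C f x" "1 \<le> c" "0 \<le> l"
  shows "deriv_bound j l (c ^ j * C) f x"
  using assms(1)
proof (induction j arbitrary: C f)
  case (Suc j)
  have C: "\<bar>f x\<bar> \<le> C" using Suc.prems by simp
  then have "0 \<le> C" by linarith
  then have "1 * C \<le> c ^ Suc j * C"
    using one_le_power[OF assms(2), of "Suc j"] by (intro mult_right_mono) (auto simp del: power_Suc)
  moreover have "deriv_bound j l (c ^ j * (C * (c * l))) (dderiv b f) x" if "b \<in> Basis" for b
    by (rule Suc.IH) (use Suc.prems that in auto)
  ultimately show ?case using C by (auto simp: ac_simps)
qed simp

lemma deriv_bound_cong_open:
  assumes "open U" "x \<in> U" "\<And>y. y \<in> U \<Longrightarrow> f y = g y"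
  shows "deriv_bound j l C f x \<longleftrightarrow> deriv_bound j l C g x"
  using assms(2,3)
proof (induction j arbitrary: C f g x)
  case (Suc j)
  have "deriv_bound j l (C * l) (dderiv b f) x \<longleftrightarrow> deriv_bound j l (C * l) (dderiv b g) x" for b
    using Suc.prems by (intro Suc.IH dderiv_cong_open[OF assms(1)]) auto
  then show ?case using Suc.prems by simp
qed simp

lemma deriv_bound_const: "\<bar>c\<bar> \<le> C \<Longrightarrow> 0 \<le> l \<Longrightarrow> deriv_bound j l C (\<lambda>_. c) x"
proof (induction j arbitrary: C c)
  case (Suc j)
  have "deriv_bound j l (C * l) (\<lambda>_. 0) x"
    by (rule Suc.IH) (use Suc.prems in auto)
  moreover have "dderiv b (\<lambda>_. c) = (\<lambda>_. 0)" for b :: 'a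
    by (rule ext) (rule dderiv_const)
  ultimately show ?case using Suc.prems by simp
qed simp

lemma deriv_bound_zero_open:
  assumes "open U" "x \<in> U" "\<And>y. y \<in> U \<Longrightarrow> f y = 0" "0 \<le> C" "0 \<le> l"
  shows "deriv_bound j l C f x"
  using deriv_bound_cong_open[OF assms(1,2), of f "\<lambda>_. 0"] assms(3-5) by (simp add: deriv_bound_const)

lemma deriv_bound_add:
  assumes "Ck j f" "Ck j g" "deriv_bound j l C f x" "deriv_bound j l D g x"
  shows "deriv_bound j l (C + D) (\<lambda>x. f x + g x) x"
  using assms
proof (induction j arbitrary: C D f g)
  case (Suc j)
  have "dderiv b (\<lambda>x. f x + g x) = (\<lambda>x. dderiv b f x + dderiv b g x)" for b
    by (rule ext) (intro dderiv_add Ck_differentiable[OF Suc.prems(1)] Ck_differentiable[OF Suc.prems(2)])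
  moreover have "deriv_bound j l (C * l + D * l) (\<lambda>x. dderiv b f x + dderiv b g x) x" if "b \<in> Basis" for b
    by (rule Suc.IH) (use Suc.prems that in \<open>auto intro: Ck_dd\<close>)
  moreover have "\<bar>f x + g x\<bar> \<le> C + D"
    using deriv_bound_abs[OF Suc.prems(3)] deriv_bound_abs[OF Suc.prems(4)] by linarith
  ultimately show ?case by (simp add: distrib_right)
qed auto

text \<open>Leibniz: an i-th derivative of the product has 2^i terms, each at most
  \<open>C * D * l ^ i\<close>. The rate is kept, only the constants multiply.\<close>

lemma deriv_bound_mult:
  assumes "Ck j f" "Ck j g" "deriv_bound j l C f x" "deriv_bound j l D g x"
  shows "deriv_bound j l (2 ^ j * C * D) (\<lambda>x. f x * g x) x"
  using assms
proof (induction j arbitrary: C D f g)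
  case 0
  then show ?case by (simp add: abs_mult mult_mono')
next
  case (Suc j)
  note f = Suc.prems(1) and g = Suc.prems(2)
  have fx: "\<bar>f x\<bar> \<le> C" and gx: "\<bar>g x\<bar> \<le> D" using Suc.prems(3,4) by auto
  then have "0 \<le> C" "0 \<le> D" by linarith+
  then have "1 * (C * D) \<le> 2 ^ Suc j * (C * D)"
    using one_le_power[of "2::real" "Suc j"] by (intro mult_right_mono) (auto simp del: power_Suc)
  moreover have "\<bar>f x * g x\<bar> \<le> C * D" using fx gx by (simp add: abs_mult mult_mono')
  ultimately have 1: "\<bar>f x * g x\<bar> \<le> 2 ^ Suc j * C * D" by simp
  have d: "dderiv b (\<lambda>x. f x * g x) = (\<lambda>x. f x * dderiv b g x + dderiv b f x * g x)" for b
    by (rule ext) (intro dderiv_mult Ck_differentiable[OF f] Ck_differentiable[OF g])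
  have "deriv_bound j l (2 ^ j * C * (D * l) + 2 ^ j * (C * l) * D) (\<lambda>x. f x * dderiv b g x + dderiv b f x * g x) x"
    if b: "b \<in> Basis" for b
  proof (rule deriv_bound_add)
    show "Ck j (\<lambda>x. f x * dderiv b g x)" by (rule Ck_mult[OF Ck_pred[OF f] Ck_dd[OF g]])
    show "Ck j (\<lambda>x. dderiv b f x * g x)" by (rule Ck_mult[OF Ck_dd[OF f] Ck_pred[OF g]])
    show "deriv_bound j l (2 ^ j * C * (D * l)) (\<lambda>x. f x * dderiv b g x) x"
      by (rule Suc.IH[OF Ck_pred[OF f] Ck_dd[OF g] deriv_bound_less[OF Suc.prems(3)]]) (use Suc.prems(4) b in auto)
    show "deriv_bound j l (2 ^ j * (C * l) * D) (\<lambda>x. dderiv b f x * g x) x"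
      by (rule Suc.IH[OF Ck_dd[OF f] Ck_pred[OF g] _ deriv_bound_less[OF Suc.prems(4)]]) (use Suc.prems(3) b in auto)
  qed
  moreover have "2 ^ j * C * (D * l) + 2 ^ j * (C * l) * D = 2 ^ Suc j * C * D * l"
    by (simp add: algebra_simps)
  ultimately show ?case using 1 by (simp add: d del: power_Suc)
qed

lemma deriv_bound_cmult: "Ck j f \<Longrightarrow> deriv_bound j l C f x \<Longrightarrow> deriv_bound j l (\<bar>c\<bar> * C) (\<lambda>x. c * f x) x"
proof (induction j arbitrary: C f)
  case 0
  then show ?case by (simp add: abs_mult mult_left_mono)
next
  case (Suc j)
  note f = Suc.prems(1)
  have "deriv_bound j l (\<bar>c\<bar> * (C * l)) (\<lambda>x. c * dderiv b f x) x" if "b \<in> Basis" for b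
    by (rule Suc.IH[OF Ck_dd[OF f]]) (use Suc.prems(2) that in auto)
  moreover have "dderiv b (\<lambda>x. c * f x) = (\<lambda>x. c * dderiv b f x)" for b
    by (rule ext) (rule dderiv_linear_compose[OF bounded_linear_mult_right Ck_differentiable[OF f]])
  moreover have "\<bar>c * f x\<bar> \<le> \<bar>c\<bar> * C"
    using Suc.prems(2) by (simp add: abs_mult mult_left_mono)
  ultimately show ?case by (simp add: mult.assoc)
qed

lemma deriv_bound_diff:
  assumes "Ck j f" "Ck j g" "deriv_bound j l C f x" "deriv_bound j l D g x"
  shows "deriv_bound j l (C + D) (\<lambda>x. f x - g x) x"
  using deriv_bound_add[OF assms(1) _ assms(3), of "\<lambda>x. (-1) * g x" D] deriv_bound_cmult[OF assms(2,4), of "-1"]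
    Ck_minus[OF assms(2)] by simp

lemma deriv_bound_affine:
  assumes "Ck j f" "deriv_bound j l C f (c *\<^sub>R (x - a))" "0 \<le> c"
  shows "deriv_bound j (c * l) C (\<lambda>x. f (c *\<^sub>R (x - a))) x"
  using assms(1,2)
proof (induction j arbitrary: C f)
  case (Suc j)
  note f = Suc.prems(1)
  have "deriv_bound j (c * l) (\<bar>c\<bar> * (C * l)) (\<lambda>x. c * dderiv b f (c *\<^sub>R (x - a))) x" if "b \<in> Basis" for b
    by (rule deriv_bound_cmult[OF Ck_affine[OF Ck_dd[OF f]] Suc.IH[OF Ck_dd[OF f]]]) (use Suc.prems(2) that in auto)
  moreover have "dderiv b (\<lambda>x. f (c *\<^sub>R (x - a))) = (\<lambda>x. c * dderiv b f (c *\<^sub>R (x - a)))" for b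
    by (rule ext) (simp only: dderiv_affine[OF Ck_differentiable[OF f]] real_scaleR_def)
  ultimately show ?case using Suc.prems(2) assms(3) by (simp add: ac_simps)
qed simp

text \<open>The order of quantifiers is the point: \<open>K\<close> depends on \<open>j\<close>,
  \<open>A\<close> and \<open>C\<close>, but not on the rate \<open>l\<close>. The chain rule yields
  one factor \<open>l\<close> for every derivative, while \<open>\<theta>\<close> is differentiated
  at unit rate. One constant thus serves the cutoffs at all scales.\<close>

lemma deriv_bound_compose:
  "\<exists>K. \<forall>l \<theta> f (x::'a::euclidean_space). 0 \<le> l \<and> Ck j \<theta> \<and> Ck j f \<and> deriv_bound j 1 A \<theta> (f x) \<and> deriv_bound j l C f x
      \<longrightarrow> deriv_bound j l K (\<lambda>x. \<theta> (f x)) x"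
proof (induction j)
  case 0
  show ?case by (intro exI[of _ A]) auto
next
  case (Suc j)
  then obtain K where K: "\<And>l \<theta> f (x::'a). 0 \<le> l \<Longrightarrow> Ck j \<theta> \<Longrightarrow> Ck j f \<Longrightarrow> deriv_bound j 1 A \<theta> (f x) \<Longrightarrow> deriv_bound j l C f x
      \<Longrightarrow> deriv_bound j l K (\<lambda>x. \<theta> (f x)) x" by blast
  show ?case
  proof (intro exI[of _ "max A (2 ^ j * C * K)"] allI impI, elim conjE)
    fix l \<theta> f and x :: 'a
    assume *: "0 \<le> l" "Ck (Suc j) \<theta>" "Ck (Suc j) f" "deriv_bound (Suc j) 1 A \<theta> (f x)" "deriv_bound (Suc j) l C f x"
    have d: "dderiv b (\<lambda>x. \<theta> (f x)) = (\<lambda>x. dderiv b f x * dderiv 1 \<theta> (f x))" for b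
      by (rule ext) (rule dderiv_compose_real[OF Ck_differentiable[OF *(2)] Ck_differentiable[OF *(3)]])
    have "deriv_bound j l (max A (2 ^ j * C * K) * l) (\<lambda>x. dderiv b f x * dderiv 1 \<theta> (f x)) x" if b: "b \<in> Basis" for b
    proof (rule deriv_bound_mono[OF deriv_bound_mult[where C="C * l" and D=K]])
      show "Ck j (\<lambda>x. dderiv 1 \<theta> (f x))"
        by (rule Ck_compose_real[OF Ck_dd[OF *(2)] Ck_pred[OF *(3)]])
      show "deriv_bound j l K (\<lambda>x. dderiv 1 \<theta> (f x)) x"
        by (rule K[OF *(1) Ck_dd[OF *(2)] Ck_pred[OF *(3)] _ deriv_bound_less[OF *(5)]]) (use *(4) in simp)
      have "2 ^ j * C * K * l \<le> max A (2 ^ j * C * K) * l"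
        using *(1) by (intro mult_right_mono) auto
      then show "2 ^ j * (C * l) * K \<le> max A (2 ^ j * C * K) * l" by (simp add: ac_simps)
    qed (use * b in \<open>auto intro: Ck_dd\<close>)
    moreover have "\<bar>\<theta> (f x)\<bar> \<le> max A (2 ^ j * C * K)" using deriv_bound_abs[OF *(4)] by simp
    ultimately show "deriv_bound (Suc j) l (max A (2 ^ j * C * K)) (\<lambda>x. \<theta> (f x)) x" by (simp add: d)
  qed
qed

lemma deriv_bound_compact:
  assumes "compact S"
  shows "Ck j f \<Longrightarrow> \<exists>A\<ge>0. \<forall>x\<in>S. deriv_bound j 1 A f x"
proof (induction j arbitrary: f)
  case (0 f)
  then have "compact (f ` S)" using assms by (intro compact_continuous_image Ck_continuous)
  then obtain A where "\<forall>x\<in>S. norm (f x) \<le> A" by (meson bounded_iff compact_imp_bounded imageI)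
  then show ?case by (intro exI[of _ "max A 0"]) auto
next
  case (Suc j)
  have "compact (f ` S)" using assms Suc.prems by (intro compact_continuous_image Ck_continuous)
  then obtain A where A: "\<forall>x\<in>S. norm (f x) \<le> A" by (meson bounded_iff compact_imp_bounded imageI)
  have "\<forall>b. \<exists>A\<ge>0. \<forall>x\<in>S. deriv_bound j 1 A (dderiv b f) x" using Suc by (auto intro: Ck_dd)
  then obtain B where B: "\<And>b. 0 \<le> B b" "\<And>b x. x \<in> S \<Longrightarrow> deriv_bound j 1 (B b) (dderiv b f) x" by metis
  have "deriv_bound (Suc j) 1 (\<bar>A\<bar> + (\<Sum>b\<in>Basis. B b)) f x" if x: "x \<in> S" for x
  proof -
    have "deriv_bound j 1 (\<bar>A\<bar> + (\<Sum>b\<in>Basis. B b)) (dderiv b f) x" if "b \<in> Basis" for b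
    proof (rule deriv_bound_mono[OF B(2)[OF x, of b]])
      have "B b \<le> (\<Sum>b\<in>Basis. B b)" by (rule member_le_sum) (use B that in auto)
      then show "B b \<le> \<bar>A\<bar> + (\<Sum>b\<in>Basis. B b)" by simp
    qed simp
    moreover have "\<bar>f x\<bar> \<le> \<bar>A\<bar>" using A x by force
    moreover have "0 \<le> (\<Sum>b\<in>Basis. B b)" using B by (simp add: sum_nonneg)
    ultimately show ?thesis by simp
  qed
  then show ?case using B by (intro exI[of _ "\<bar>A\<bar> + (\<Sum>b\<in>Basis. B b)"]) (auto simp: sum_nonneg)
qed

lemma deriv_bound_compact_support:
  assumes "Ck j f" "compact S" "\<And>x. x \<notin> S \<Longrightarrow> f x = 0"
  shows "\<exists>A\<ge>0. \<forall>x. deriv_bound j 1 A f x"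
proof -
  obtain A where A: "A \<ge> 0" "\<And>x. x \<in> S \<Longrightarrow> deriv_bound j 1 A f x" using deriv_bound_compact[OF assms(2,1)] by auto
  have "deriv_bound j 1 A f x" if "x \<notin> S" for x
    by (rule deriv_bound_zero_open[of "- S"]) (use assms(2,3) that A in \<open>auto intro: compact_imp_closed\<close>)
  with A show ?thesis by metis
qed

lemma dderiv_affine_form:
  fixes a w x :: "'a::euclidean_space"
  shows "dderiv b (\<lambda>y. \<alpha> + w \<bullet> (y - a)) x = w \<bullet> b"
  by (rule dderiv_eqI) (auto intro!: derivative_eq_intros)

lemma Ck_affine_form: "Ck j (\<lambda>y. \<alpha> + w \<bullet> (y - a))"
proof (cases j)
  case (Suc k)
  show ?thesis unfolding Suc
    by (rule Ck_SucI[where f'="\<lambda>x b. w \<bullet> b"]) (auto intro!: derivative_eq_intros Ck_const)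
qed (auto intro!: continuous_intros)

lemma deriv_bound_affine_form:
  fixes a w :: "'a::euclidean_space"
  assumes "\<bar>\<alpha>\<bar> \<le> C" "norm w \<le> C * l" "0 \<le> l"
  shows "deriv_bound j l C (\<lambda>y. \<alpha> + w \<bullet> (y - a)) a"
proof (cases j)
  case (Suc k)
  have "dderiv b (\<lambda>y. \<alpha> + w \<bullet> (y - a)) = (\<lambda>_. w \<bullet> b)" for b
    by (rule ext) (rule dderiv_affine_form)
  moreover have "\<bar>w \<bullet> b\<bar> \<le> C * l" if "b \<in> Basis" for b
    using Basis_le_norm[OF that, of w] assms(2) by linarith
  ultimately show ?thesis using assms unfolding Suc by (simp add: deriv_bound_const)
qed (use assms in simp)

text \<open>The truncated power; with a positive exponent \<open>m\<close> it is of class C^(m-1).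
  Three derivatives suffice for the stream function, and truncated powers keep the formulas
  polynomial.\<close>

definition pos_power :: "nat \<Rightarrow> real \<Rightarrow> real" where
  "pos_power m t = (max 0 t) ^ m"

lemma has_derivative_pp: "(pos_power (Suc (Suc m)) has_derivative (\<lambda>v. v * (real (Suc (Suc m)) * pos_power (Suc m) t))) (at t)"
proof -
  have "(pos_power (Suc (Suc m)) has_real_derivative (real (Suc (Suc m)) * pos_power (Suc m) t)) (at t)"
  proof (cases t "0::real" rule: linorder_cases)
    case less
    have "((\<lambda>_. 0::real) has_real_derivative (real (Suc (Suc m)) * pos_power (Suc m) t)) (at t)"
      using less by (simp add: pos_power_def)
    then show ?thesis
      by (rule has_field_derivative_transform_within_open[where S="{..<0}"]) (use less in \<open>auto simp: pos_power_def\<close>)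
  next
    case greater
    have "((\<lambda>t. t ^ Suc (Suc m)) has_real_derivative (real (Suc (Suc m)) * pos_power (Suc m) t)) (at t)"
      using greater DERIV_pow[of "Suc (Suc m)" t] by (simp add: pos_power_def del: power_Suc)
    then show ?thesis
      by (rule has_field_derivative_transform_within_open[where S="{0<..}"]) (use greater in \<open>auto simp: pos_power_def\<close>)
  next
    \<comment> \<open>At 0 the difference quotient is \<open>max 0 h ^ Suc m\<close> itself; the
      exponent being at least two, its limit is 0.\<close>
    case equal
    have "((\<lambda>h. max 0 h ^ Suc m) \<longlongrightarrow> max 0 0 ^ Suc m) (at (0::real))"
      by (intro tendsto_intros)
    moreover have "(pos_power (Suc (Suc m)) (0 + h) - pos_power (Suc (Suc m)) 0) / h = max 0 h ^ Suc m" if "h \<noteq> 0" for h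
      using that by (auto simp: pos_power_def max_def)
    ultimately have "(pos_power (Suc (Suc m)) has_real_derivative 0) (at 0)"
      unfolding DERIV_def by (simp cong: LIM_cong)
    then show ?thesis using equal by (simp add: pos_power_def)
  qed
  then show ?thesis by (simp add: has_field_derivative_def mult.commute[of _ "_ * _"])
qed

lemma Ck_pp: "Ck k (pos_power (Suc k))"
proof (induction k)
  case 0
  then show ?case by (auto simp: pos_power_def[abs_def] intro!: continuous_intros)
next
  case (Suc k)
  show ?case
    by (rule Ck_SucI[OF has_derivative_pp]) (intro Ck_mult Ck_const Suc)
qed

lemma has_derivative_norm_sq: "((\<lambda>x. x \<bullet> x) has_derivative (\<lambda>v. 2 * (x \<bullet> v))) (at x)"
  by (auto intro!: derivative_eq_intros simp: inner_commute)

lemma Ck_norm_sq: "Ck k (\<lambda>x::'a::euclidean_space. x \<bullet> x)"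
proof (cases k)
  case (Suc m)
  have "Ck m (\<lambda>x::'a. 2 * (x \<bullet> v))" for v
    by (rule Ck_linear) (intro bounded_linear_const_mult bounded_linear_inner_left)
  then show ?thesis unfolding Suc by (intro Ck_SucI[OF has_derivative_norm_sq])
qed (auto intro!: continuous_intros)

text \<open>Exponent 4 is the least for which the function is of class C^3 across the unit
  sphere.\<close>

definition bump :: "'a::euclidean_space \<Rightarrow> real" where
  "bump x = pos_power 4 (1 - x \<bullet> x)"

lemma Ck_bump: "Ck 3 bump"
proof -
  have "Ck 3 (pos_power 4)" using Ck_pp[of 3] by (simp add: eval_nat_numeral)
  then show ?thesis unfolding bump_def[abs_def]
    by (rule Ck_compose_real) (intro Ck_diff Ck_const Ck_norm_sq)
qed

lemma bump_nonneg: "0 \<le> bump x"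
  by (simp add: bump_def pos_power_def)

lemma bump_eq_0: "1 \<le> norm x \<Longrightarrow> bump x = 0"
  by (simp add: bump_def pos_power_def power2_norm_eq_inner[symmetric])

lemma bump_pos: "norm x < 1 \<Longrightarrow> 0 < bump x"
  using power_less_one_iff[of "norm x" 2] by (simp add: bump_def pos_power_def power2_norm_eq_inner[symmetric] max_def)

lemma bump_minus: "bump (- x) = bump x"
  by (simp add: bump_def)

lemma deriv_bound_bump: "\<exists>A\<ge>0. \<forall>x::'a::euclidean_space. deriv_bound 3 1 A bump x"
  by (rule deriv_bound_compact_support[OF Ck_bump compact_cball[of 0 1]]) (auto intro: bump_eq_0)

text \<open>Orthogonality removes the term with \<open>pos_power 3\<close>, and what remains has the
  sign of \<open>(x \<bullet> v) * (x \<bullet> w)\<close> inside the ball. So there is a whole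
  sector on which the mixed derivative is positive.\<close>

lemma dderiv_bump:
  fixes x :: "'a::euclidean_space"
  assumes "v \<bullet> w = 0"
  shows "dderiv v (dderiv w bump) x = 48 * pos_power 2 (1 - x \<bullet> x) * (x \<bullet> v) * (x \<bullet> w)"
proof -
  have 1: "((\<lambda>x::'a. pos_power (Suc (Suc m)) (1 - x \<bullet> x)) has_derivative
      (\<lambda>v. (- (2 * (x \<bullet> v))) * (real (Suc (Suc m)) * pos_power (Suc m) (1 - x \<bullet> x)))) (at x)" for m x
    by (rule has_derivative_compose[OF _ has_derivative_pp])
      (auto intro!: derivative_eq_intros simp: inner_commute)
  have "dderiv w bump = (\<lambda>x::'a. (- 8 * (x \<bullet> w)) * pos_power 3 (1 - x \<bullet> x))"
  proof
    fix x :: 'a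
    show "dderiv w bump x = (- 8 * (x \<bullet> w)) * pos_power 3 (1 - x \<bullet> x)"
      using dderiv_eqI[OF 1, of w 2 x] unfolding bump_def[abs_def] by (simp add: eval_nat_numeral)
  qed
  moreover have "dderiv v (\<lambda>x::'a. (- 8 * (x \<bullet> w)) * pos_power 3 (1 - x \<bullet> x)) x
     = (- 8 * (x \<bullet> w)) * (- (2 * (x \<bullet> v)) * (3 * pos_power 2 (1 - x \<bullet> x)))
       + (- 8 * (v \<bullet> w)) * pos_power 3 (1 - x \<bullet> x)"
  proof (rule dderiv_eqI)
    have "((\<lambda>x::'a. pos_power 3 (1 - x \<bullet> x)) has_derivative (\<lambda>v. (- (2 * (x \<bullet> v))) * (3 * pos_power 2 (1 - x \<bullet> x)))) (at x)"
      using 1[of 1 x] by (simp add: eval_nat_numeral)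
    then show "((\<lambda>x::'a. (- 8 * (x \<bullet> w)) * pos_power 3 (1 - x \<bullet> x)) has_derivative
      (\<lambda>v. (- 8 * (x \<bullet> w)) * (- (2 * (x \<bullet> v)) * (3 * pos_power 2 (1 - x \<bullet> x)))
       + (- 8 * (v \<bullet> w)) * pos_power 3 (1 - x \<bullet> x))) (at x)"
      by (intro has_derivative_mult) (auto intro!: derivative_eq_intros)
  qed
  ultimately show ?thesis using assms by simp
qed

text \<open>A smooth step: the fourth difference of \<open>t\<^sup>4\<close> is the constant \<open>24\<close>.\<close>

definition cutoff :: "real \<Rightarrow> real" where
  "cutoff s = 1 - (pos_power 4 (s - 1) - 4 * pos_power 4 (s - 2) + 6 * pos_power 4 (s - 3) - 4 * pos_power 4 (s - 4) + pos_power 4 (s - 5)) / 24"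

lemma Ck_cutoff: "Ck 3 cutoff"
proof -
  have "Ck 3 (pos_power 4)" using Ck_pp[of 3] by (simp add: eval_nat_numeral)
  then have p: "Ck 3 (\<lambda>s. pos_power 4 (s - c))" for c using Ck_affine[of 3 "pos_power 4" 1 c] by simp
  have "Ck 3 (\<lambda>s. 1 - (pos_power 4 (s - 1) - 4 * pos_power 4 (s - 2) + 6 * pos_power 4 (s - 3) - 4 * pos_power 4 (s - 4) + pos_power 4 (s - 5)) * (1/24))"
    by (intro Ck_diff Ck_const Ck_mult Ck_add p)
  then show ?thesis by (simp add: cutoff_def[abs_def])
qed

lemma cutoff_eq_1: "s \<le> 1 \<Longrightarrow> cutoff s = 1"
  by (simp add: cutoff_def pos_power_def)

lemma cutoff_eq_0: "5 \<le> s \<Longrightarrow> cutoff s = 0"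
  by (simp add: cutoff_def pos_power_def max_def power4_eq_xxxx algebra_simps)

section \<open>Hausdorff measure\<close>

text \<open>The gaps may depend on the pair. In the induction step only finitely many of them
  matter, and their minimum separates the last set from the union of the others.\<close>

lemma metric_outer_separated_sum:
  fixes \<mu> :: "'a::metric_space set \<Rightarrow> ennreal"
  assumes add: "\<And>A B d. 0 < d \<Longrightarrow> (\<And>x y. x \<in> A \<Longrightarrow> y \<in> B \<Longrightarrow> d \<le> dist x y) \<Longrightarrow> \<mu> A + \<mu> B \<le> \<mu> (A \<union> B)"
    and sep: "\<And>i j. i < j \<Longrightarrow> \<exists>d>0. \<forall>x\<in>R i. \<forall>y\<in>R j. d \<le> dist x y"
    and e: "\<mu> {} = 0"
  shows "(\<Sum>i<n::nat. \<mu> (R i)) \<le> \<mu> (\<Union>i<n. R i)"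
proof (induction n)
  case (Suc n)
  have "\<exists>d>0. \<forall>i<m. \<forall>x\<in>R i. \<forall>y\<in>R n. d \<le> dist x y" if "m \<le> n" for m
    using that
  proof (induction m)
    case 0
    show ?case by (intro exI[of _ 1]) auto
  next
    case (Suc m)
    then obtain d1 d2 where "d1 > 0" "\<forall>i<m. \<forall>x\<in>R i. \<forall>y\<in>R n. d1 \<le> dist x y"
      "d2 > 0" "\<forall>x\<in>R m. \<forall>y\<in>R n. d2 \<le> dist x y" using sep[of m n] by auto
    then show ?case
      by (intro exI[of _ "min d1 d2"]) (auto simp: less_Suc_eq min_le_iff_disj)
  qed
  then obtain d where d: "d > 0" "\<forall>i<n. \<forall>x\<in>R i. \<forall>y\<in>R n. d \<le> dist x y" by blast
  have "(\<Sum>i<Suc n. \<mu> (R i)) \<le> \<mu> (\<Union>i<n. R i) + \<mu> (R n)"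
    using Suc by (simp add: add_right_mono)
  also have "\<dots> \<le> \<mu> ((\<Union>i<n. R i) \<union> R n)"
    by (rule add[OF d(1)]) (use d(2) in auto)
  also have "(\<Union>i<n. R i) \<union> R n = (\<Union>i<Suc n. R i)" by (auto simp: less_Suc_eq)
  finally show ?case .
qed (simp add: e)

text \<open>The sets \<open>A\<^sub>n\<close> of points at distance at least \<open>1/(n+1)\<close> from the closed set \<open>F\<close> exhaust \<open>A - F\<close>.
  The layers \<open>R\<^sub>n\<close> between them with indices of equal parity are separated, which makes the sum
  of their measures finite.\<close>

lemma metric_outer_closed:
  fixes \<mu> :: "'a::metric_space set \<Rightarrow> ennreal"
  assumes e: "\<mu> {} = 0" and mono: "\<And>A B. A \<subseteq> B \<Longrightarrow> \<mu> A \<le> \<mu> B"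
    and sub: "\<And>A::nat \<Rightarrow> 'a set. \<mu> (\<Union>i. A i) \<le> (\<Sum>i. \<mu> (A i))"
    and add: "\<And>A B d. 0 < d \<Longrightarrow> (\<And>x y. x \<in> A \<Longrightarrow> y \<in> B \<Longrightarrow> d \<le> dist x y) \<Longrightarrow> \<mu> A + \<mu> B \<le> \<mu> (A \<union> B)"
    and F: "closed F"
  shows "\<mu> (A \<inter> F) + \<mu> (A - F) \<le> \<mu> A"
proof (cases "F = {} \<or> \<mu> A = \<infinity>")
  case True
  then show ?thesis using e by auto
next
  case False
  then have F0: "F \<noteq> {}" and fin: "\<mu> A < \<infinity>" by (auto simp: less_top)
  define An where "An n = {x \<in> A. infdist x F \<ge> 1 / real (Suc n)}" for n
  define R where "R n = An (Suc n) - An n" for n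
  have R: "1 / real (Suc (Suc n)) \<le> infdist x F" "infdist x F < 1 / real (Suc n)" "x \<in> A" if "x \<in> R n" for n x
    using that by (auto simp: R_def An_def)
  \<comment> \<open>The distance to \<open>F\<close> is 1-Lipschitz. It is at least 1/(i+2) on
    \<open>R i\<close> and less than 1/(j+1) on \<open>R j\<close>, so adjacent layers may touch and
    an index gap of two is needed.\<close>
  have sepR: "\<exists>d>0. \<forall>x\<in>R i. \<forall>y\<in>R j. d \<le> dist x y" if "Suc i < j" for i j
  proof (intro exI[of _ "1 / real (Suc (Suc i)) - 1 / real (Suc j)"] conjI ballI)
    show "1 / real (Suc (Suc i)) - 1 / real (Suc j) > 0" using that divide_strict_left_mono[of "real (Suc (Suc i))" "real (Suc j)" 1] by simp
    fix x y assume "x \<in> R i" "y \<in> R j"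
    then show "1 / real (Suc (Suc i)) - 1 / real (Suc j) \<le> dist x y"
      using R(1)[of x i] R(2)[of y j] infdist_triangle[of x F y] by simp
  qed
  have RA: "(\<Union>i. R (f i)) \<subseteq> A" for f :: "nat \<Rightarrow> nat" using R(3) by auto
  have half: "(\<Sum>i. \<mu> (R (f i))) \<le> \<mu> A" if f: "\<And>i j. i < j \<Longrightarrow> Suc (f i) < f j" for f
  proof (rule suminf_le_const[OF summableI])
    fix n
    have "(\<Sum>i<n. \<mu> (R (f i))) \<le> \<mu> (\<Union>i<n. R (f i))"
      by (rule metric_outer_separated_sum[where \<mu>=\<mu>, OF add _ e]) (auto intro: sepR f)
    also have "\<dots> \<le> \<mu> A" by (rule mono) (use RA in blast)
    finally show "(\<Sum>i<n. \<mu> (R (f i))) \<le> \<mu> A" .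
  qed
  have RI: "\<mu> (R n) \<noteq> \<infinity>" for n using mono[of "R n" A] R(3) fin by (auto simp: subset_iff top_unique)
  define r where "r n = enn2real (\<mu> (R n))" for n
  have r: "\<mu> (R n) = ennreal (r n)" "0 \<le> r n" for n
    using RI by (auto simp: r_def less_top)
  have "summable r"
  proof (rule summableI_nonneg_bounded[where x="2 * enn2real (\<mu> A)"])
    fix n
    have "(\<Sum>i<n. \<mu> (R i)) \<le> (\<Sum>i\<in>((\<lambda>i. 2 * i) ` {..<n} \<union> (\<lambda>i. Suc (2 * i)) ` {..<n}). \<mu> (R i))"
    proof (rule sum_mono2)
      show "{..<n} \<subseteq> (\<lambda>i. 2 * i) ` {..<n} \<union> (\<lambda>i. Suc (2 * i)) ` {..<n}"
      proof
        fix i assume "i \<in> {..<n}"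
        then show "i \<in> (\<lambda>i. 2 * i) ` {..<n} \<union> (\<lambda>i. Suc (2 * i)) ` {..<n}"
          by (cases "even i") (auto elim!: evenE oddE intro!: image_eqI[of _ _ "i div 2"])
      qed
    qed auto
    also have "\<dots> \<le> (\<Sum>i\<in>(\<lambda>i. 2 * i) ` {..<n}. \<mu> (R i)) + (\<Sum>i\<in>(\<lambda>i. Suc (2 * i)) ` {..<n}. \<mu> (R i))"
      by (subst sum.union_disjoint) (auto, presburger)
    also have "(\<Sum>i\<in>(\<lambda>i. 2 * i) ` {..<n}. \<mu> (R i)) = (\<Sum>i<n. \<mu> (R (2 * i)))"
      by (subst sum.reindex) (auto simp: inj_on_def)
    also have "(\<Sum>i\<in>(\<lambda>i. Suc (2 * i)) ` {..<n}. \<mu> (R i)) = (\<Sum>i<n. \<mu> (R (Suc (2 * i))))"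
      by (subst sum.reindex) (auto simp: inj_on_def)
    also have "(\<Sum>i<n. \<mu> (R (2 * i))) \<le> \<mu> A"
      by (rule order_trans[OF sum_le_suminf half[of "\<lambda>i. 2 * i"]]) auto
    also have "(\<Sum>i<n. \<mu> (R (Suc (2 * i)))) \<le> \<mu> A"
      by (rule order_trans[OF sum_le_suminf half[of "\<lambda>i. Suc (2 * i)"]]) auto
    finally have "ennreal (\<Sum>i<n. r i) \<le> \<mu> A + \<mu> A" using r by (simp add: sum_ennreal)
    also have "\<dots> = ennreal (2 * enn2real (\<mu> A))"
      using fin by (cases "\<mu> A") (auto simp: ennreal_plus[symmetric] simp del: ennreal_plus)
    finally show "(\<Sum>i<n. r i) \<le> 2 * enn2real (\<mu> A)" by (simp add: ennreal_le_iff)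
  qed (use r in auto)
  \<comment> \<open>The layers from \<open>n\<close> on fill what \<open>An n\<close> misses: a
    point off the closed set \<open>F\<close> has positive distance from it and enters the
    increasing sets at some least index.\<close>
  have tail: "\<mu> (A - F) \<le> \<mu> (An n) + ennreal (\<Sum>k. r (k + n))" for n
  proof -
    have "A - F \<subseteq> An n \<union> (\<Union>k. R (k + n))"
    proof
      fix x assume x: "x \<in> A - F"
      have "infdist x F > 0" using x F F0 infdist_pos_not_in_closed by auto
      then obtain m where m: "1 / real (Suc m) < infdist x F" using nat_approx_posE by metis
      have ex: "\<exists>k. x \<in> An (k + n)"
      proof
        have "1 / real (Suc (m + n)) \<le> 1 / real (Suc m)" by (simp add: field_simps)
        then show "x \<in> An (m + n)" using m x by (auto simp: An_def)
      qed
      define k where "k = (LEAST k. x \<in> An (k + n))"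
      have k: "x \<in> An (k + n)" unfolding k_def using ex by (rule LeastI_ex)
      show "x \<in> An n \<union> (\<Union>k. R (k + n))"
      proof (cases k)
        case 0 then show ?thesis using k by simp
      next
        case (Suc j)
        then have "x \<notin> An (j + n)" unfolding k_def using not_less_Least[of j] by (metis lessI)
        then have "x \<in> R (j + n)" using k Suc by (simp add: R_def)
        then show ?thesis by blast
      qed
    qed
    then have "\<mu> (A - F) \<le> \<mu> (\<Union>i. case i of 0 \<Rightarrow> An n | Suc k \<Rightarrow> R (k + n))"
    proof (intro mono subsetI)
      fix x assume *: "A - F \<subseteq> An n \<union> (\<Union>k. R (k + n))" and "x \<in> A - F"
      then consider "x \<in> An n" | k where "x \<in> R (k + n)" by blast
      then show "x \<in> (\<Union>i. case i of 0 \<Rightarrow> An n | Suc k \<Rightarrow> R (k + n))"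
      proof cases
        case 1
        then show ?thesis by (intro UN_I[of 0]) auto
      next
        case (2 k)
        then show ?thesis by (intro UN_I[of "Suc k"]) auto
      qed
    qed
    also have "\<dots> \<le> (\<Sum>i. \<mu> (case i of 0 \<Rightarrow> An n | Suc k \<Rightarrow> R (k + n)))" by (rule sub)
    also have "\<dots> = \<mu> (An n) + (\<Sum>k. \<mu> (R (k + n)))"
      by (subst suminf_offset[where i=1]) auto
    also have "(\<Sum>k. \<mu> (R (k + n))) = ennreal (\<Sum>k. r (k + n))"
      using r \<open>summable r\<close> by (simp add: suminf_ennreal2 summable_ignore_initial_segment)
    finally show ?thesis .
  qed
  have An: "\<mu> (A \<inter> F) + \<mu> (An n) \<le> \<mu> A" for n
  proof -
    have "\<mu> (A \<inter> F) + \<mu> (An n) \<le> \<mu> (A \<inter> F \<union> An n)"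
    proof (rule add[of "1 / real (Suc n)"])
      fix x y assume "x \<in> A \<inter> F" "y \<in> An n"
      then show "1 / real (Suc n) \<le> dist x y"
        using infdist_le[of x F y] by (auto simp: An_def dist_commute)
    qed simp
    also have "\<dots> \<le> \<mu> A" by (rule mono) (auto simp: An_def)
    finally show ?thesis .
  qed
  show ?thesis
  proof (rule ennreal_le_epsilon)
    fix \<epsilon> :: real assume "0 < \<epsilon>"
    then obtain n where "norm (\<Sum>k. r (k + n)) < \<epsilon>"
      using suminf_exist_split[OF _ \<open>summable r\<close>] by blast
    then have n: "ennreal (\<Sum>k. r (k + n)) \<le> ennreal \<epsilon>" by (intro ennreal_leI) auto
    have "\<mu> (A \<inter> F) + \<mu> (A - F) \<le> \<mu> (A \<inter> F) + (\<mu> (An n) + ennreal \<epsilon>)"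
      by (intro add_left_mono order_trans[OF tail[of n]] n)
    also have "\<dots> \<le> \<mu> A + ennreal \<epsilon>" using An[of n] by (simp add: add.assoc[symmetric] add_right_mono)
    finally show "\<mu> (A \<inter> F) + \<mu> (A - F) \<le> \<mu> A + ennreal \<epsilon>" .
  qed
qed

text \<open>Caratheodory's criterion: the measurable sets of an outer measure form a
  \<sigma>-algebra, and additivity on separated sets puts the closed sets among them, hence all
  Borel sets.\<close>

lemma metric_outer_measure_space:
  fixes \<mu> :: "'a::metric_space set \<Rightarrow> ennreal"
  assumes e: "\<mu> {} = 0" and mono: "\<And>A B. A \<subseteq> B \<Longrightarrow> \<mu> A \<le> \<mu> B"
    and sub: "\<And>A::nat \<Rightarrow> 'a set. \<mu> (\<Union>i. A i) \<le> (\<Sum>i. \<mu> (A i))"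
    and add: "\<And>A B d. 0 < d \<Longrightarrow> (\<And>x y. x \<in> A \<Longrightarrow> y \<in> B \<Longrightarrow> d \<le> dist x y) \<Longrightarrow> \<mu> A + \<mu> B \<le> \<mu> (A \<union> B)"
  shows "measure_space UNIV (sets borel) \<mu>"
proof -
  interpret sigma_algebra UNIV "Pow (UNIV :: 'a set)" by (rule sigma_algebra_Pow)
  have out: "outer_measure_space (Pow UNIV) \<mu>"
    unfolding outer_measure_space_def positive_def increasing_def countably_subadditive_def
    using e mono sub by auto
  let ?L = "lambda_system UNIV (Pow UNIV) \<mu>"
  have ms: "measure_space UNIV ?L \<mu>"
    by (rule caratheodory_lemma[OF out])
  then have L: "sigma_algebra UNIV ?L" by (simp add: measure_space_def)
  have "closed F \<Longrightarrow> F \<in> ?L" for F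
  proof -
    assume F: "closed F"
    have "\<mu> A \<le> \<mu> (A \<inter> F) + \<mu> (A - F)" for A
    proof -
      have "\<mu> A \<le> \<mu> (\<Union>i. case i of 0 \<Rightarrow> A \<inter> F | Suc i \<Rightarrow> case i of 0 \<Rightarrow> A - F | Suc _ \<Rightarrow> {})"
      proof (rule mono, rule subsetI)
        fix x assume "x \<in> A"
        then show "x \<in> (\<Union>i. case i of 0 \<Rightarrow> A \<inter> F | Suc i \<Rightarrow> case i of 0 \<Rightarrow> A - F | Suc _ \<Rightarrow> {})"
          by (intro UN_I[of "if x \<in> F then 0 else Suc 0"]) auto
      qed
      also have "\<dots> \<le> (\<Sum>i. \<mu> (case i of 0 \<Rightarrow> A \<inter> F | Suc i \<Rightarrow> case i of 0 \<Rightarrow> A - F | Suc _ \<Rightarrow> {}))"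
        by (rule sub)
      also have "\<dots> = (\<Sum>i<2. \<mu> (case i of 0 \<Rightarrow> A \<inter> F | Suc i \<Rightarrow> case i of 0 \<Rightarrow> A - F | Suc _ \<Rightarrow> {}))"
        by (rule suminf_finite) (auto simp: e split: nat.split)
      also have "\<dots> = \<mu> (A \<inter> F) + \<mu> (A - F)" by (simp add: eval_nat_numeral)
      finally show ?thesis .
    qed
    with metric_outer_closed[OF e mono sub add F] show "F \<in> ?L"
      unfolding lambda_system_eq by (auto intro!: antisym)
  qed
  then have "sigma_sets UNIV (Collect closed) \<subseteq> ?L"
    using L by (intro sigma_algebra.sigma_sets_subset) auto
  then have sets: "sets (borel :: 'a measure) \<subseteq> ?L"
    by (simp add: borel_eq_closed)
  have "countably_additive (sets borel) \<mu>"
    using ms sets unfolding measure_space_def countably_additive_def by (meson subset_trans subsetD)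
  then show ?thesis
    unfolding measure_space_def positive_def using e sets.sigma_algebra_axioms[of borel] by auto
qed

text \<open>The content of size \<open>\<delta>\<close> inside \<open>hausdorff_outer\<close>. It is
  countably subadditive for each \<open>\<delta>\<close>, but additive only on sets farther apart
  than \<open>\<delta>\<close>; hence it is treated separately before the supremum is taken.\<close>

definition hausdorff_pre :: "real \<Rightarrow> real \<Rightarrow> 'a::euclidean_space set \<Rightarrow> ennreal" where
  "hausdorff_pre s \<delta> A = (INF C\<in>{C :: nat \<Rightarrow> 'a set.
          A \<subseteq> (\<Union>i. C i) \<and> (\<forall>i. bounded (C i) \<and> diameter (C i) \<le> \<delta>)}.
        (\<Sum>i. ennreal (unit_ball_vol s * (diameter (C i) / 2) powr s)))"

lemma hausdorff_outer_pre: "hausdorff_outer s A = (SUP \<delta>\<in>{0<..}. hausdorff_pre s \<delta> A)"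
  by (simp add: hausdorff_outer_def hausdorff_pre_def)

lemma hausdorff_pre_le:
  "A \<subseteq> (\<Union>i. C i) \<Longrightarrow> (\<And>i. bounded (C i)) \<Longrightarrow> (\<And>i. diameter (C i) \<le> \<delta>) \<Longrightarrow>
   hausdorff_pre s \<delta> A \<le> (\<Sum>i. ennreal (unit_ball_vol s * (diameter (C i) / 2) powr s))"
  unfolding hausdorff_pre_def by (intro INF_lower) auto

lemma hausdorff_pre_mono: "A \<subseteq> B \<Longrightarrow> hausdorff_pre s \<delta> A \<le> hausdorff_pre s \<delta> B"
  unfolding hausdorff_pre_def by (intro INF_superset_mono) auto

lemma hausdorff_pre_antimono: "\<delta> \<le> \<delta>' \<Longrightarrow> hausdorff_pre s \<delta>' A \<le> hausdorff_pre s \<delta> A"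
  unfolding hausdorff_pre_def by (intro INF_superset_mono) (auto intro: order_trans)

lemma hausdorff_pre_le_outer: "0 < \<delta> \<Longrightarrow> hausdorff_pre s \<delta> A \<le> hausdorff_outer s A"
  unfolding hausdorff_outer_pre by (intro SUP_upper) auto

lemma hausdorff_pre_approx:
  assumes "hausdorff_pre s \<delta> A < c"
  obtains C :: "nat \<Rightarrow> 'a::euclidean_space set" where "A \<subseteq> (\<Union>i. C i)" "\<And>i. bounded (C i)" "\<And>i. diameter (C i) \<le> \<delta>"
    "(\<Sum>i. ennreal (unit_ball_vol s * (diameter (C i) / 2) powr s)) < c"
proof -
  have "\<exists>C\<in>{C :: nat \<Rightarrow> 'a set. A \<subseteq> (\<Union>i. C i) \<and> (\<forall>i. bounded (C i) \<and> diameter (C i) \<le> \<delta>)}.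
      (\<Sum>i. ennreal (unit_ball_vol s * (diameter (C i) / 2) powr s)) < c"
    using assms unfolding hausdorff_pre_def INF_less_iff .
  then show ?thesis using that by auto
qed

lemma hausdorff_pre_empty: "0 < \<delta> \<Longrightarrow> hausdorff_pre s \<delta> {} = 0"
  using hausdorff_pre_le[of "{}" "\<lambda>_. {}" \<delta> s] by simp

lemma hausdorff_pre_subadditive:
  fixes A :: "nat \<Rightarrow> 'a::euclidean_space set"
  shows "hausdorff_pre s \<delta> (\<Union>i. A i) \<le> (\<Sum>i. hausdorff_pre s \<delta> (A i))"
proof (rule ennreal_le_epsilon)
  fix \<epsilon> :: real assume fin: "(\<Sum>i. hausdorff_pre s \<delta> (A i)) < top" and \<epsilon>: "0 < \<epsilon>"
  define w where "w C = ennreal (unit_ball_vol s * (diameter C / 2) powr s)" for C :: "'a set"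
  have "\<exists>C. A i \<subseteq> (\<Union>j. C j) \<and> (\<forall>j. bounded (C j) \<and> diameter (C j) \<le> \<delta>) \<and>
      (\<Sum>j. w (C j)) < hausdorff_pre s \<delta> (A i) + ennreal (\<epsilon> * (1 / 2) ^ Suc i)" for i
  proof -
    have "hausdorff_pre s \<delta> (A i) < top" using fin ennreal_suminf_lessD by blast
    then have "hausdorff_pre s \<delta> (A i) < hausdorff_pre s \<delta> (A i) + ennreal (\<epsilon> * (1 / 2) ^ Suc i)"
      using \<epsilon> by (cases "hausdorff_pre s \<delta> (A i)")
        (auto simp: ennreal_plus[symmetric] ennreal_less_iff simp del: ennreal_plus)
    from hausdorff_pre_approx[OF this] show ?thesis unfolding w_def by metis
  qed
  then obtain C where C: "\<And>i. A i \<subseteq> (\<Union>j. C i j)" "\<And>i j. bounded (C i j)" "\<And>i j. diameter (C i j) \<le> \<delta>"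
    "\<And>i. (\<Sum>j. w (C i j)) < hausdorff_pre s \<delta> (A i) + ennreal (\<epsilon> * (1 / 2) ^ Suc i)" by metis
  define D where "D n = (case prod_decode n of (i, j) \<Rightarrow> C i j)" for n
  have "hausdorff_pre s \<delta> (\<Union>i. A i) \<le> (\<Sum>n. w (D n))"
    unfolding w_def
  proof (rule hausdorff_pre_le)
    show "(\<Union>i. A i) \<subseteq> (\<Union>n. D n)"
    proof
      fix x assume "x \<in> (\<Union>i. A i)"
      then obtain i j where "x \<in> C i j" using C(1) by blast
      then have "x \<in> D (prod_encode (i, j))" by (simp add: D_def)
      then show "x \<in> (\<Union>n. D n)" by blast
    qed
  qed (auto simp: D_def C split: prod.split)
  also have "\<dots> = (\<Sum>i. \<Sum>j. w (C i j))"
    using suminf_ennreal_2dimen[of "\<lambda>i. \<Sum>j. w (C i j)" "\<lambda>(i, j). w (C i j)"]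
    by (simp add: D_def split_beta)
  also have "\<dots> \<le> (\<Sum>i. hausdorff_pre s \<delta> (A i) + ennreal (\<epsilon> * (1 / 2) ^ Suc i))"
    by (intro suminf_le summableI less_imp_le C(4))
  also have "\<dots> = (\<Sum>i. hausdorff_pre s \<delta> (A i)) + (\<Sum>i. ennreal (\<epsilon> * (1 / 2) ^ Suc i))"
    by (rule suminf_add[symmetric]) auto
  also have "(\<Sum>i. ennreal (\<epsilon> * (1 / 2) ^ Suc i)) = ennreal \<epsilon>"
    using \<epsilon> sums_mult[OF power_half_series, of \<epsilon>] by (intro suminf_ennreal_eq) auto
  finally show "hausdorff_pre s \<delta> (\<Union>i. A i) \<le> (\<Sum>i. hausdorff_pre s \<delta> (A i)) + ennreal \<epsilon>" .
qed

text \<open>A covering set of diameter at most \<open>\<delta>\<close> cannot meet both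
  \<open>A\<close> and \<open>B\<close>, so every cover of the union splits into a cover of
  \<open>A\<close> and one of \<open>B\<close>.\<close>

lemma hausdorff_pre_separated:
  fixes A B :: "'a::euclidean_space set"
  assumes d: "\<And>x y. x \<in> A \<Longrightarrow> y \<in> B \<Longrightarrow> \<delta> < dist x y" and \<delta>: "0 < \<delta>"
  shows "hausdorff_pre s \<delta> A + hausdorff_pre s \<delta> B \<le> hausdorff_pre s \<delta> (A \<union> B)"
  unfolding hausdorff_pre_def[of s \<delta> "A \<union> B"]
proof (intro INF_greatest, elim CollectE conjE)
  fix C :: "nat \<Rightarrow> 'a set"
  assume C: "A \<union> B \<subseteq> (\<Union>i. C i)" "\<forall>i. bounded (C i) \<and> diameter (C i) \<le> \<delta>"
  define w where "w C = ennreal (unit_ball_vol s * (diameter C / 2) powr s)" for C :: "'a set"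
  define D where "D i = (if C i \<inter> A = {} then {} else C i)" for i
  define E where "E i = (if C i \<inter> B = {} then {} else C i)" for i
  have "D i = {} \<or> E i = {}" for i
  proof (rule ccontr)
    assume "\<not> ?thesis"
    then obtain x y where "x \<in> C i" "x \<in> A" "y \<in> C i" "y \<in> B" by (auto simp: D_def E_def split: if_splits)
    then show False using d[of x y] diameter_bounded_bound[of "C i" x y] C(2)[rule_format, of i] by auto
  qed
  moreover have "D i = {} \<or> D i = C i" "E i = {} \<or> E i = C i" for i by (auto simp: D_def E_def)
  \<comment> \<open>An emptied slot costs nothing: \<open>diameter {} = 0\<close>, and
    \<open>0 powr s = 0\<close> even for s = 0.\<close>
  ultimately have le: "w (D i) + w (E i) \<le> w (C i)" for i
    by (metis add.left_neutral add.right_neutral order_refl zero_le w_def diameter_empty div_0 powr_0 powr_zero_eq_one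
        powr_eq_0_iff mult_zero_right ennreal_0)
  have "hausdorff_pre s \<delta> A \<le> (\<Sum>i. w (D i))"
    unfolding w_def
  proof (rule hausdorff_pre_le)
    show "A \<subseteq> (\<Union>i. D i)"
    proof
      fix x assume "x \<in> A"
      moreover then obtain i where "x \<in> C i" using C(1) by blast
      ultimately show "x \<in> (\<Union>i. D i)" unfolding D_def by (intro UN_I[of i]) auto
    qed
  qed (use C \<delta> in \<open>auto simp: D_def\<close>)
  moreover have "hausdorff_pre s \<delta> B \<le> (\<Sum>i. w (E i))"
    unfolding w_def
  proof (rule hausdorff_pre_le)
    show "B \<subseteq> (\<Union>i. E i)"
    proof
      fix x assume "x \<in> B"
      moreover then obtain i where "x \<in> C i" using C(1) by blast
      ultimately show "x \<in> (\<Union>i. E i)" unfolding E_def by (intro UN_I[of i]) auto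
    qed
  qed (use C \<delta> in \<open>auto simp: E_def\<close>)
  ultimately have "hausdorff_pre s \<delta> A + hausdorff_pre s \<delta> B \<le> (\<Sum>i. w (D i)) + (\<Sum>i. w (E i))"
    by (rule add_mono)
  also have "\<dots> = (\<Sum>i. w (D i) + w (E i))" by (rule suminf_add) auto
  also have "\<dots> \<le> (\<Sum>i. w (C i))" by (intro suminf_le le summableI)
  finally show "hausdorff_pre s \<delta> A + hausdorff_pre s \<delta> B \<le> (\<Sum>i. ennreal (unit_ball_vol s * (diameter (C i) / 2) powr s))"
    by (simp add: w_def)
qed

lemma hausdorff_outer_measure_space:
  "measure_space UNIV (sets borel) (hausdorff_outer s :: 'a::euclidean_space set \<Rightarrow> ennreal)"
proof (rule metric_outer_measure_space)
  show "hausdorff_outer s ({} :: 'a set) = 0"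
    by (simp add: hausdorff_outer_pre hausdorff_pre_empty)
  show "hausdorff_outer s A \<le> hausdorff_outer s B" if "A \<subseteq> B" for A B :: "'a set"
    unfolding hausdorff_outer_pre by (intro SUP_mono') (rule hausdorff_pre_mono[OF that])
  show "hausdorff_outer s (\<Union>i. A i) \<le> (\<Sum>i. hausdorff_outer s (A i))" for A :: "nat \<Rightarrow> 'a set"
    unfolding hausdorff_outer_pre[of s "\<Union>i. A i"]
  proof (rule SUP_least)
    fix \<delta> :: real assume "\<delta> \<in> {0<..}"
    then show "hausdorff_pre s \<delta> (\<Union>i. A i) \<le> (\<Sum>i. hausdorff_outer s (A i))"
      by (intro order_trans[OF hausdorff_pre_subadditive] suminf_le summableI hausdorff_pre_le_outer) auto
  qed
  show "hausdorff_outer s A + hausdorff_outer s B \<le> hausdorff_outer s (A \<union> B)"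
    if d: "0 < d" "\<And>x y. x \<in> A \<Longrightarrow> y \<in> B \<Longrightarrow> d \<le> dist x y" for A B :: "'a set" and d
  proof -
    have "hausdorff_pre s \<delta>1 A + hausdorff_pre s \<delta>2 B \<le> hausdorff_outer s (A \<union> B)"
      if \<delta>: "0 < \<delta>1" "0 < \<delta>2" for \<delta>1 \<delta>2
    proof -
      \<comment> \<open>Shrinking the size only raises the contents, so one size below
        \<open>\<delta>1\<close>, \<open>\<delta>2\<close> and strictly below the gap
        \<open>d\<close> suffices.\<close>
      define \<delta> where "\<delta> = min (min \<delta>1 \<delta>2) (d / 2)"
      have \<delta>': "0 < \<delta>" "\<delta> \<le> \<delta>1" "\<delta> \<le> \<delta>2" "\<delta> < d" using \<delta> d(1) by (auto simp: \<delta>_def)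
      have "hausdorff_pre s \<delta>1 A + hausdorff_pre s \<delta>2 B \<le> hausdorff_pre s \<delta> A + hausdorff_pre s \<delta> B"
        by (intro add_mono hausdorff_pre_antimono \<delta>')
      also have "\<dots> \<le> hausdorff_pre s \<delta> (A \<union> B)"
        by (intro hausdorff_pre_separated) (use d(2) \<delta>' in \<open>auto intro: less_le_trans\<close>)
      also have "\<dots> \<le> hausdorff_outer s (A \<union> B)" by (rule hausdorff_pre_le_outer[OF \<delta>'(1)])
      finally show ?thesis .
    qed
    then have "(SUP \<delta>\<in>{0<..}. hausdorff_pre s \<delta> A + hausdorff_pre s \<delta>2 B) \<le> hausdorff_outer s (A \<union> B)"
      if "0 < \<delta>2" for \<delta>2 using that by (intro SUP_least) auto
    then have "hausdorff_outer s A + hausdorff_pre s \<delta>2 B \<le> hausdorff_outer s (A \<union> B)" if "0 < \<delta>2" for \<delta>2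
      using that by (simp add: ennreal_SUP_add_left hausdorff_outer_pre[of s A])
    then have "(SUP \<delta>\<in>{0<..}. hausdorff_outer s A + hausdorff_pre s \<delta> B) \<le> hausdorff_outer s (A \<union> B)"
      by (intro SUP_least) auto
    then show ?thesis
      by (simp add: ennreal_SUP_add_right hausdorff_outer_pre[of s B])
  qed
qed

lemma sets_hausdorff_measure [measurable_cong, simp]: "sets (hausdorff_measure s) = sets borel"
  unfolding hausdorff_measure_def using sets.sigma_sets_eq[of borel] by (simp add: sets_measure_of)

lemma space_hausdorff_measure [simp]: "space (hausdorff_measure s) = UNIV"
  using sets_eq_imp_space_eq[OF sets_hausdorff_measure] by simp

lemma emeasure_hausdorff_measure:
  assumes "A \<in> sets borel"
  shows "emeasure (hausdorff_measure s) A = hausdorff_outer s A"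
proof (rule emeasure_measure_of[OF hausdorff_measure_def])
  show "positive (sets (hausdorff_measure s)) (hausdorff_outer s)"
    "countably_additive (sets (hausdorff_measure s)) (hausdorff_outer s)"
    using hausdorff_outer_measure_space by (auto simp: measure_space_def)
qed (use assms in auto)

section \<open>Volume and surface of Lipschitz graphs\<close>

text \<open>Translation along \<open>e\<close> raises \<open>g\<close>, so shifts of the strip by
  multiples of \<open>3 * \<epsilon>\<close> are pairwise disjoint, and about
  \<open>1 / (3 * \<epsilon>)\<close> of them stay within distance 1 of the ball. Comparing volumes
  gives a bound linear in \<open>\<epsilon>\<close>.\<close>

lemma strip_volume:
  fixes g :: "'a::euclidean_space \<Rightarrow> real"
  assumes cont: "continuous_on UNIV g" and shift: "\<And>x t. g (x + t *\<^sub>R e) = g x + t" and e: "norm e = 1"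
    and \<epsilon>: "0 < \<epsilon>" and \<rho>: "0 \<le> \<rho>"
  shows "measure lebesgue {x \<in> cball x0 \<rho>. \<bar>g x\<bar> \<le> \<epsilon>} \<le> 6 * unit_ball_vol (real DIM('a)) * (\<rho> + 1) ^ DIM('a) * \<epsilon>"
proof -
  let ?S = "{x \<in> cball x0 \<rho>. \<bar>g x\<bar> \<le> \<epsilon>}"
  define m where "m = nat \<lceil>1 / (3 * \<epsilon>)\<rceil>"
  have m: "1 / (3 * \<epsilon>) \<le> real m" unfolding m_def by (rule real_nat_ceiling_ge)
  have jm: "3 * real j * \<epsilon> \<le> 1" if "j < m" for j
  proof -
    have "real j < 1 / (3 * \<epsilon>)" using that unfolding m_def by linarith
    then show ?thesis using \<epsilon> by (simp add: field_simps)
  qed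
  have "closed (g -` {-\<epsilon>..\<epsilon>})" using cont by (intro closed_vimage) auto
  then have "closed (cball x0 \<rho> \<inter> g -` {-\<epsilon>..\<epsilon>})" by auto
  also have "cball x0 \<rho> \<inter> g -` {-\<epsilon>..\<epsilon>} = ?S" by auto
  finally have clS: "closed ?S" .
  then have lmS: "?S \<in> lmeasurable"
    by (intro lmeasurable_compact) (auto simp: compact_eq_bounded_closed intro: bounded_subset[OF bounded_cball])
  define F where "F j = (+) ((3 * real j * \<epsilon>) *\<^sub>R e) ` ?S" for j
  have lmF: "F j \<in> lmeasurable" for j unfolding F_def by (rule measurable_translation[OF lmS])
  have gF: "\<bar>g y - 3 * real j * \<epsilon>\<bar> \<le> \<epsilon>" if y: "y \<in> F j" for y j
  proof -
    obtain x where "y = x + (3 * real j * \<epsilon>) *\<^sub>R e" "\<bar>g x\<bar> \<le> \<epsilon>" using y by (auto simp: F_def add.commute)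
    then show ?thesis by (simp add: shift)
  qed
  have disj: "pairwise (\<lambda>i j. disjnt (F i) (F j)) {..<m}"
  proof (rule pairwiseI)
    fix i j :: nat assume "i \<noteq> j"
    have False if y: "y \<in> F i" "y \<in> F j" for y
    proof -
      have "\<bar>3 * real i * \<epsilon> - 3 * real j * \<epsilon>\<bar> \<le> 2 * \<epsilon>" using gF[OF y(1)] gF[OF y(2)] by linarith
      also have "3 * real i * \<epsilon> - 3 * real j * \<epsilon> = (3 * \<epsilon>) * (real i - real j)" by (simp add: algebra_simps)
      finally have 1: "(3 * \<epsilon>) * \<bar>real i - real j\<bar> \<le> 2 * \<epsilon>" using \<epsilon> by (simp add: abs_mult)
      have "1 \<le> \<bar>real i - real j\<bar>" using \<open>i \<noteq> j\<close> by linarith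
      then have "(3 * \<epsilon>) * 1 \<le> (3 * \<epsilon>) * \<bar>real i - real j\<bar>" using \<epsilon> by (intro mult_left_mono) auto
      then show False using 1 \<epsilon> by linarith
    qed
    then show "disjnt (F i) (F j)" by (auto simp: disjnt_def)
  qed
  have "real m * measure lebesgue ?S = (\<Sum>j<m. measure lebesgue (F j))"
    by (simp add: F_def measure_translation)
  also have "\<dots> = measure lebesgue (\<Union>j<m. F j)"
    by (rule measure_UNION'[symmetric]) (use lmF disj in auto)
  also have "\<dots> \<le> measure lebesgue (cball x0 (\<rho> + 1))"
  proof (rule measure_mono_fmeasurable)
    show "(\<Union>j<m. F j) \<subseteq> cball x0 (\<rho> + 1)"
    proof (safe)
      fix y j assume j: "j < m" "y \<in> F j"
      then obtain x where x: "y = x + (3 * real j * \<epsilon>) *\<^sub>R e" "dist x0 x \<le> \<rho>" by (auto simp: F_def add.commute)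
      have "dist x0 y \<le> dist x0 x + dist x y" by (rule dist_triangle)
      also have "dist x y = 3 * real j * \<epsilon>" using \<epsilon> by (simp add: x(1) dist_norm e)
      finally show "y \<in> cball x0 (\<rho> + 1)" using x(2) jm[OF j(1)] by simp
    qed
  qed (use lmF in auto)
  finally have 1: "real m * measure lebesgue ?S \<le> unit_ball_vol (real DIM('a)) * (\<rho> + 1) ^ DIM('a)"
    using \<rho> by (simp add: content_cball)
  have "1 / (3 * \<epsilon>) * measure lebesgue ?S \<le> real m * measure lebesgue ?S"
    using m by (intro mult_right_mono) auto
  with 1 have "1 / (3 * \<epsilon>) * measure lebesgue ?S \<le> unit_ball_vol (real DIM('a)) * (\<rho> + 1) ^ DIM('a)" by linarith
  then have "measure lebesgue ?S \<le> 3 * (unit_ball_vol (real DIM('a)) * (\<rho> + 1) ^ DIM('a) * \<epsilon>)"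
    using \<epsilon> by (simp add: field_simps)
  also have "\<dots> \<le> 6 * (unit_ball_vol (real DIM('a)) * (\<rho> + 1) ^ DIM('a) * \<epsilon>)"
    using \<epsilon> \<rho> by (intro mult_right_mono) auto
  finally show ?thesis by (simp add: mult.assoc)
qed

section \<open>Packing bounds and the finite surface measure of a graph\<close>

lemma packing_bound:
  fixes P :: "'a::euclidean_space set"
  assumes P: "finite P" "P \<subseteq> cball x0 R" and r: "0 < r" "0 \<le> R"
    and sep: "\<And>x y. x \<in> P \<Longrightarrow> y \<in> P \<Longrightarrow> x \<noteq> y \<Longrightarrow> 2 * r \<le> dist x y"
  shows "real (card P) * r ^ DIM('a) \<le> (R + r) ^ DIM('a)"
proof -
  have "real (card P) * (unit_ball_vol (real DIM('a)) * r ^ DIM('a)) = (\<Sum>p\<in>P. measure lebesgue (ball p r))"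
    using r by (simp add: content_ball)
  also have "\<dots> = measure lebesgue (\<Union>p\<in>P. ball p r)"
  proof (rule measure_UNION'[symmetric])
    show "pairwise (\<lambda>i j. disjnt (ball i r) (ball j r)) P"
    proof (rule pairwiseI)
      fix x y assume "x \<in> P" "y \<in> P" "x \<noteq> y"
      then have "2 * r \<le> dist x y" by (rule sep)
      then show "disjnt (ball x r) (ball y r)"
        using dist_triangle_half_l[of x _ "2 * r" y] by (fastforce simp: disjnt_def dist_commute)
    qed
  qed (use P in auto)
  also have "\<dots> \<le> measure lebesgue (cball x0 (R + r))"
  proof (rule measure_mono_fmeasurable)
    show "(\<Union>p\<in>P. ball p r) \<subseteq> cball x0 (R + r)"
    proof safe
      fix p x assume "p \<in> P" "x \<in> ball p r"
      then have "dist x0 p \<le> R" "dist p x < r" using P by auto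
      then show "x \<in> cball x0 (R + r)" using dist_triangle[of x0 x p] by simp
    qed
  qed (use P in auto)
  also have "\<dots> = unit_ball_vol (real DIM('a)) * (R + r) ^ DIM('a)" using r by (simp add: content_cball)
  finally have "unit_ball_vol (real DIM('a)) * (real (card P) * r ^ DIM('a)) \<le> unit_ball_vol (real DIM('a)) * (R + r) ^ DIM('a)"
    by (simp add: ac_simps)
  moreover have "0 < unit_ball_vol (real DIM('a))" by simp
  ultimately show ?thesis by (simp only: mult_le_cancel_left_pos)
qed

text \<open>Translating separated points of the graph along \<open>e\<close> turns them into a separated set that
  fills a neighbourhood, so that the volume bounds their number.\<close>

lemma graph_packing:
  fixes g :: "'a::euclidean_space \<Rightarrow> real"
  assumes shift: "\<And>x t. g (x + t *\<^sub>R e) = g x + t" and e: "norm e = 1" and \<rho>: "0 \<le> \<rho>"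
    and lip: "\<And>x y. x \<in> cball x0 (\<rho> + 1) \<Longrightarrow> y \<in> cball x0 (\<rho> + 1) \<Longrightarrow> \<bar>g x - g y\<bar> \<le> K * dist x y" and K: "1 \<le> K"
    and S: "finite S" "S \<subseteq> {x \<in> cball x0 \<rho>. g x = 0}"
    and \<delta>: "0 < \<delta>" "\<delta> \<le> 1"
    and sep: "\<And>x y. x \<in> S \<Longrightarrow> y \<in> S \<Longrightarrow> x \<noteq> y \<Longrightarrow> \<delta> \<le> dist x y"
  shows "real (card S) * \<delta> ^ (DIM('a) - 1) \<le> (2 * K * (\<rho> + 2)) ^ DIM('a)"
proof -
  define m where "m = nat \<lceil>1 / \<delta>\<rceil>"
  have m: "1 / \<delta> \<le> real m" unfolding m_def by (rule real_nat_ceiling_ge)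
  have jm: "real j * \<delta> \<le> 1" if "j < m" for j
  proof -
    have "real j < 1 / \<delta>" using that unfolding m_def by linarith
    then show ?thesis using \<delta> by (simp add: field_simps)
  qed
  define h where "h = (\<lambda>(p, j). p + (real j * \<delta>) *\<^sub>R e)"
  have gh: "g (h (p, j)) = real j * \<delta>" if "p \<in> S" for p j
    using S that by (auto simp: h_def shift)
  have hb: "h (p, j) \<in> cball x0 (\<rho> + 1)" if p: "p \<in> S" and j: "j < m" for p j
  proof -
    have "dist x0 (h (p, j)) \<le> dist x0 p + dist p (h (p, j))" by (rule dist_triangle)
    also have "dist p (h (p, j)) = real j * \<delta>" using \<delta> by (simp add: h_def dist_norm e)
    finally show ?thesis using p S jm[OF j] by auto
  qed
  \<comment> \<open>Equal shifts preserve the distance. For different shifts the values of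
    \<open>g\<close> differ by at least \<open>\<delta>\<close>, which the Lipschitz bound turns
    into a distance of at least \<open>\<delta> / K\<close>, twice the packing radius.\<close>
  have sepP: "2 * (\<delta> / (2 * K)) \<le> dist (h (p, i)) (h (q, j))"
    if p: "p \<in> S" "i < m" and q: "q \<in> S" "j < m" and ne: "(p, i) \<noteq> (q, j)" for p i q j
  proof (cases "i = j")
    case True
    then have "\<delta> \<le> dist p q" using ne p q by (intro sep) auto
    moreover have "dist (h (p, i)) (h (q, j)) = dist p q" using True by (simp add: h_def)
    moreover have "\<delta> / K \<le> \<delta> / 1" using K \<delta> by (intro divide_left_mono) auto
    ultimately show ?thesis by simp
  next
    case False
    then have "1 \<le> \<bar>real i - real j\<bar>" by linarith
    then have "1 * \<delta> \<le> \<bar>real i - real j\<bar> * \<delta>" using \<delta> by (intro mult_right_mono) auto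
    also have "\<dots> = \<bar>g (h (p, i)) - g (h (q, j))\<bar>"
      using \<delta> p q by (simp add: gh left_diff_distrib[symmetric] abs_mult)
    also have "\<dots> \<le> K * dist (h (p, i)) (h (q, j))" by (intro lip hb p q)
    finally show ?thesis using K by (simp add: field_simps)
  qed
  let ?P = "h ` (S \<times> {..<m})"
  have inj: "inj_on h (S \<times> {..<m})"
  proof (rule inj_onI, clarify)
    fix p i q j assume "p \<in> S" "i < m" "q \<in> S" "j < m" "h (p, i) = h (q, j)"
    then show "p = q \<and> i = j"
      using sepP[of p i q j] \<delta> K by (cases "(p, i) = (q, j)") (auto simp: field_simps)
  qed
  have n0: "DIM('a) = Suc (DIM('a) - 1)" using DIM_positive[where 'a='a] by linarith
  have "real (card ?P) * (\<delta> / (2 * K)) ^ DIM('a) \<le> (\<rho> + 1 + \<delta> / (2 * K)) ^ DIM('a)"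
  proof (rule packing_bound)
    show "?P \<subseteq> cball x0 (\<rho> + 1)" using hb by auto
    show "2 * (\<delta> / (2 * K)) \<le> dist x y" if "x \<in> ?P" "y \<in> ?P" "x \<noteq> y" for x y
      using that sepP by fastforce
  qed (use S \<delta> \<rho> K in auto)
  also have "\<dots> \<le> (\<rho> + 2) ^ DIM('a)"
  proof (rule power_mono)
    have "\<delta> / (2 * K) \<le> 1 / 1" using \<delta> K by (intro frac_le) auto
    then show "\<rho> + 1 + \<delta> / (2 * K) \<le> \<rho> + 2" by simp
  qed (use \<delta> K \<rho> in auto)
  finally have 1: "real (card S) * real m * \<delta> ^ DIM('a) \<le> (2 * K) ^ DIM('a) * (\<rho> + 2) ^ DIM('a)"
    using inj K by (simp add: card_image card_cartesian_product power_divide field_simps)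
  have "real (card S) * \<delta> ^ (DIM('a) - 1) * 1 \<le> real (card S) * \<delta> ^ (DIM('a) - 1) * (real m * \<delta>)"
    using m \<delta> by (intro mult_left_mono) (auto simp: field_simps)
  also have "\<dots> = real (card S) * real m * (\<delta> ^ (DIM('a) - 1) * \<delta>)" by (simp only: ac_simps)
  also have "\<delta> ^ (DIM('a) - 1) * \<delta> = \<delta> ^ DIM('a)" by (metis n0 power_Suc2)
  also note 1
  finally show ?thesis by (simp add: power_mult_distrib)
qed

text \<open>A maximal \<open>\<delta>\<close>-separated subset is a \<open>\<delta>\<close>-net, so
  balls of radius \<open>\<delta>\<close> about its points cover the set. Their number times the
  power n-1 of \<open>\<delta>\<close> is, up to a constant, the cost of the cover, and the packing
  estimate bounds it independently of \<open>\<delta>\<close>.\<close>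

lemma hausdorff_outer_graph_finite:
  fixes g :: "'a::euclidean_space \<Rightarrow> real"
  assumes shift: "\<And>x t. g (x + t *\<^sub>R e) = g x + t" and e: "norm e = 1" and \<rho>: "0 \<le> \<rho>"
    and lip: "\<And>x y. x \<in> cball x0 (\<rho> + 1) \<Longrightarrow> y \<in> cball x0 (\<rho> + 1) \<Longrightarrow> \<bar>g x - g y\<bar> \<le> K * dist x y" and K: "1 \<le> K"
    and n2: "2 \<le> DIM('a)"
  shows "hausdorff_outer (real DIM('a) - 1) {x \<in> cball x0 \<rho>. g x = 0} < \<infinity>"
proof -
  let ?A = "{x \<in> cball x0 \<rho>. g x = 0}" and ?s = "real DIM('a) - 1"
  define C0 where "C0 = (2 * K * (\<rho> + 2)) ^ DIM('a)"
  have pre: "hausdorff_pre ?s (2 * \<delta>) ?A \<le> ennreal (unit_ball_vol ?s * C0)" if \<delta>: "0 < \<delta>" "\<delta> \<le> 1" for \<delta>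
  proof -
    define sep where "sep S \<longleftrightarrow> finite S \<and> S \<subseteq> ?A \<and> (\<forall>x\<in>S. \<forall>y\<in>S. x \<noteq> y \<longrightarrow> \<delta> \<le> dist x y)" for S
    have bound: "real (card S) * \<delta> ^ (DIM('a) - 1) \<le> C0" if "sep S" for S
      unfolding C0_def by (rule graph_packing[OF shift e \<rho> lip K]) (use that \<delta> in \<open>auto simp: sep_def\<close>)
    have "card S < Suc (nat \<lceil>C0 / \<delta> ^ (DIM('a) - 1)\<rceil>)" if "sep S" for S
    proof -
      have "real (card S) \<le> C0 / \<delta> ^ (DIM('a) - 1)" using bound[OF that] \<delta> by (simp add: field_simps)
      then show ?thesis by linarith
    qed
    moreover have "sep {}" by (simp add: sep_def)
    \<comment> \<open>A separated set of largest cardinality exists because packing bounds the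
      cardinalities.\<close>
    ultimately obtain S where S: "sep S" "\<And>T. sep T \<Longrightarrow> card T \<le> card S"
      using ex_has_greatest_nat[of sep "{}" card "Suc (nat \<lceil>C0 / \<delta> ^ (DIM('a) - 1)\<rceil>)"] by (metis)
    have cov: "?A \<subseteq> (\<Union>p\<in>S. cball p \<delta>)"
    proof
      fix x assume x: "x \<in> ?A"
      show "x \<in> (\<Union>p\<in>S. cball p \<delta>)"
      proof (rule ccontr)
        assume *: "x \<notin> (\<Union>p\<in>S. cball p \<delta>)"
        then have "x \<notin> S" using \<delta> by auto
        have "sep (insert x S)" using S(1) x * by (auto simp: sep_def dist_commute not_le intro: less_imp_le)
        then have "card (insert x S) \<le> card S" by (rule S(2))
        with \<open>x \<notin> S\<close> S(1) show False by (simp add: sep_def)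
      qed
    qed
    obtain f where f: "bij_betw f {0..<card S} S" using S(1) ex_bij_betw_nat_finite[of S] unfolding sep_def by blast
    define C where "C i = (if i < card S then cball (f i) \<delta> else {})" for i
    have "hausdorff_pre ?s (2 * \<delta>) ?A \<le> (\<Sum>i. ennreal (unit_ball_vol ?s * (diameter (C i) / 2) powr ?s))"
    proof (rule hausdorff_pre_le)
      show "?A \<subseteq> (\<Union>i. C i)"
      proof
        fix x assume "x \<in> ?A"
        then obtain p where "p \<in> S" "x \<in> cball p \<delta>" using cov by blast
        moreover obtain i where "i < card S" "f i = p" using f \<open>p \<in> S\<close> unfolding bij_betw_def by (metis atLeastLessThan_iff imageE)
        ultimately show "x \<in> (\<Union>i. C i)" by (intro UN_I[of i]) (auto simp: C_def)
      qed
    qed (use \<delta> in \<open>auto simp: C_def\<close>)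
    also have "\<dots> = (\<Sum>i<card S. ennreal (unit_ball_vol ?s * (diameter (C i) / 2) powr ?s))"
      by (rule suminf_finite) (auto simp: C_def)
    also have "\<dots> = (\<Sum>i<card S. ennreal (unit_ball_vol ?s * \<delta> ^ (DIM('a) - 1)))"
    proof (rule sum.cong)
      fix i assume "i \<in> {..<card S}"
      moreover have "\<delta> powr ?s = \<delta> ^ (DIM('a) - 1)"
        using \<delta> n2 powr_realpow[of \<delta> "DIM('a) - 1"] by (simp add: of_nat_diff)
      ultimately show "ennreal (unit_ball_vol ?s * (diameter (C i) / 2) powr ?s) = ennreal (unit_ball_vol ?s * \<delta> ^ (DIM('a) - 1))"
        using \<delta> by (simp add: C_def)
    qed simp
    also have "\<dots> = ennreal (unit_ball_vol ?s * (real (card S) * \<delta> ^ (DIM('a) - 1)))"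
      using n2 \<delta> by (simp add: ennreal_of_nat_eq_real_of_nat ennreal_mult[symmetric] ac_simps)
    also have "\<dots> \<le> ennreal (unit_ball_vol ?s * C0)"
      using n2 by (intro ennreal_leI mult_left_mono bound S(1)) auto
    finally show ?thesis .
  qed
  have "hausdorff_outer ?s ?A \<le> ennreal (unit_ball_vol ?s * C0)"
    unfolding hausdorff_outer_pre
  proof (rule SUP_least)
    fix d :: real assume "d \<in> {0<..}"
    then have "hausdorff_pre ?s (2 * min (d / 2) 1) ?A \<le> ennreal (unit_ball_vol ?s * C0)"
      by (intro pre) auto
    moreover have "hausdorff_pre ?s d ?A \<le> hausdorff_pre ?s (2 * min (d / 2) 1) ?A"
      by (rule hausdorff_pre_antimono) auto
    ultimately show "hausdorff_pre ?s d ?A \<le> ennreal (unit_ball_vol ?s * C0)" by order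
  qed
  then show ?thesis using le_less_trans by fastforce
qed

text \<open>A cylinder of length 2 over a set within distance \<open>R\<close> of a point is covered
  by about \<open>2 / R\<close> balls of radius \<open>2 * R\<close> strung along the axis, hence
  has volume of order R^(n-1). This converts a cover measured in dimension n-1 into one measured in
  dimension n.\<close>

lemma tube_measure:
  fixes c e :: "'a::euclidean_space"
  assumes e: "norm e = 1" and R: "0 < R" "R \<le> 2" and C: "\<And>x. x \<in> C \<Longrightarrow> dist c x < R"
  shows "\<exists>W. {x + t *\<^sub>R e | x t. x \<in> C \<and> \<bar>t\<bar> \<le> 1} \<subseteq> W \<and> W \<in> sets lebesgue \<and>
     emeasure lebesgue W \<le> ennreal (6 * 2 ^ DIM('a) * unit_ball_vol (real DIM('a)) * R ^ (DIM('a) - 1))"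
proof -
  \<comment> \<open>The centres are spaced by \<open>R\<close> along the parameters from -1 to 1;
    \<open>R \<le> 2\<close> absorbs the rounding, as then 2/R + 2 \<le> 6/R.\<close>
  define m where "m = nat \<lceil>2 / R\<rceil> + 1"
  have m: "real m \<le> 6 / R"
  proof -
    have "real m \<le> 2 / R + 2" unfolding m_def using R by (simp add: of_nat_ceiling) linarith
    moreover have "2 \<le> 4 / R" using R by (simp add: field_simps)
    moreover have "2 / R + 4 / R = 6 / R" by (simp add: add_divide_distrib[symmetric])
    ultimately show ?thesis by linarith
  qed
  define W where "W = (\<Union>j<m. ball (c + (real j * R - 1) *\<^sub>R e) (2 * R))"
  have n0: "DIM('a) = Suc (DIM('a) - 1)" using DIM_positive[where 'a='a] by linarith
  have "{x + t *\<^sub>R e | x t. x \<in> C \<and> \<bar>t\<bar> \<le> 1} \<subseteq> W"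
  proof clarify
    fix x and t :: real assume x: "x \<in> C" and t: "\<bar>t\<bar> \<le> 1"
    define j where "j = nat \<lfloor>(t + 1) / R\<rfloor>"
    have pos: "0 \<le> (t + 1) / R" using t R by auto
    have j: "real j \<le> (t + 1) / R" "(t + 1) / R < real j + 1"
      unfolding j_def using pos by linarith+
    have "(t + 1) / R \<le> 2 / R" using t R by (intro divide_right_mono) auto
    then have "j < m" using j(1) unfolding m_def by linarith
    have d: "\<bar>t + 1 - real j * R\<bar> < R" using j R by (simp add: field_simps abs_if)
    have eq: "(x + t *\<^sub>R e) - (c + (real j * R - 1) *\<^sub>R e) = (x - c) + (t + 1 - real j * R) *\<^sub>R e"
      by (simp add: algebra_simps)
    have "norm ((x + t *\<^sub>R e) - (c + (real j * R - 1) *\<^sub>R e)) \<le> norm (x - c) + norm ((t + 1 - real j * R) *\<^sub>R e)"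
      unfolding eq by (rule norm_triangle_ineq)
    also have "norm ((t + 1 - real j * R) *\<^sub>R e) = \<bar>t + 1 - real j * R\<bar>" using e by simp
    also have "norm (x - c) + \<bar>t + 1 - real j * R\<bar> < 2 * R" using d C[OF x] by (simp add: dist_norm norm_minus_commute)
    finally show "x + t *\<^sub>R e \<in> W" unfolding W_def using \<open>j < m\<close>
      by (intro UN_I[of j]) (auto simp: dist_norm norm_minus_commute)
  qed
  moreover have "emeasure lebesgue W \<le> ennreal (6 * 2 ^ DIM('a) * unit_ball_vol (real DIM('a)) * R ^ (DIM('a) - 1))"
  proof -
    have "emeasure lebesgue W \<le> (\<Sum>j<m. emeasure lebesgue (ball (c + (real j * R - 1) *\<^sub>R e) (2 * R)))"
      unfolding W_def by (rule emeasure_subadditive_finite) auto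
    also have "\<dots> = (\<Sum>j<m. ennreal (unit_ball_vol (real DIM('a)) * (2 * R) ^ DIM('a)))"
      using R by (simp add: emeasure_ball)
    also have "\<dots> = ennreal (real m * (unit_ball_vol (real DIM('a)) * (2 * R) ^ DIM('a)))"
      using R by (simp add: ennreal_of_nat_eq_real_of_nat ennreal_mult[symmetric])
    also have "\<dots> \<le> ennreal (6 / R * (unit_ball_vol (real DIM('a)) * (2 * R) ^ DIM('a)))"
      using m R by (intro ennreal_leI mult_right_mono) auto
    also have "6 / R * (unit_ball_vol (real DIM('a)) * (2 * R) ^ DIM('a)) = 6 * 2 ^ DIM('a) * unit_ball_vol (real DIM('a)) * R ^ (DIM('a) - 1)"
    proof -
      have "R ^ DIM('a) = R ^ (DIM('a) - 1) * R" by (metis n0 power_Suc2)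
      then show ?thesis using R by (simp add: power_mult_distrib)
    qed
    finally show ?thesis .
  qed
  ultimately show ?thesis by (intro exI[of _ W]) (auto simp: W_def)
qed

text \<open>If the measure vanished, \<open>A\<close> would have covers of arbitrarily small total
  cost. The tubes over the covering sets cover the ball, and their volumes are dominated by the
  costs, so the ball would be null.\<close>

lemma hausdorff_outer_pos:
  fixes A :: "'a::euclidean_space set"
  assumes e: "norm e = 1" and \<rho>: "0 < \<rho>" and n2: "2 \<le> DIM('a)"
    and tube: "ball x0 \<rho> \<subseteq> {x + t *\<^sub>R e | x t. x \<in> A \<and> \<bar>t\<bar> \<le> 1}"
  shows "0 < hausdorff_outer (real DIM('a) - 1) A"
proof (rule ccontr)
  let ?s = "real DIM('a) - 1" and ?n = "DIM('a) - 1"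
  let ?V = "unit_ball_vol (real DIM('a))" and ?v = "unit_ball_vol (real DIM('a) - 1)"
  assume "\<not> ?thesis"
  then have "hausdorff_pre ?s 1 A = 0" using hausdorff_pre_le_outer[of 1 ?s A] by auto
  \<comment> \<open>The factor \<open>6 * 2 ^ DIM('a) * ?V\<close> comes from the tubes and another
    2^(n-1), rounded up to 2^n, from passing to half the radius. Division by \<open>?v\<close>
    compensates the constant in the costs.\<close>
  define K where "K = 6 * 4 ^ DIM('a) * ?V / ?v"
  have v: "0 < ?v" using n2 by (intro unit_ball_vol_pos) auto
  have V: "0 < ?V" by simp
  have K: "0 < K" using v V by (simp add: K_def)
  have "emeasure lebesgue (ball x0 \<rho>) \<le> ennreal (2 * K * \<epsilon>)" if \<epsilon>: "0 < \<epsilon>" for \<epsilon>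
  proof -
    have "hausdorff_pre ?s 1 A < ennreal \<epsilon>" using \<open>hausdorff_pre ?s 1 A = 0\<close> \<epsilon> by simp
    then obtain C :: "nat \<Rightarrow> 'a set" where C: "A \<subseteq> (\<Union>i. C i)" "\<And>i. bounded (C i)" "\<And>i. diameter (C i) \<le> 1"
      "(\<Sum>i. ennreal (?v * (diameter (C i) / 2) powr ?s)) < ennreal \<epsilon>"
      by (rule hausdorff_pre_approx) blast
    have pw: "(d / 2) powr ?s = (d / 2) ^ ?n" if "0 \<le> d" for d
      using that n2 powr_realpow[of "d / 2" ?n] by (cases "d = 0") (auto simp: of_nat_diff)
    \<comment> \<open>A covering set may be a single point, of diameter 0, whereas tubes need a
      positive radius. Enlarging the i-th diameter costs at most
      \<open>\<epsilon> * (1 / 2) ^ Suc i\<close>, in total \<open>\<epsilon>\<close>.\<close>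
    have "\<exists>R. diameter (C i) < R \<and> R \<le> 2 \<and> ?v * (R / 2) ^ ?n \<le> ?v * (diameter (C i) / 2) ^ ?n + \<epsilon> * (1 / 2) ^ Suc i" for i
    proof -
      have "((\<lambda>R. ?v * (R / 2) ^ ?n) \<longlongrightarrow> ?v * (diameter (C i) / 2) ^ ?n) (at_right (diameter (C i)))"
        by (intro tendsto_intros) simp_all
      then have "\<forall>\<^sub>F R in at_right (diameter (C i)). ?v * (R / 2) ^ ?n < ?v * (diameter (C i) / 2) ^ ?n + \<epsilon> * (1 / 2) ^ Suc i"
        by (rule order_tendstoD) (use \<epsilon> in auto)
      moreover have "\<forall>\<^sub>F R in at_right (diameter (C i)). R < 2"
        using C(3)[of i] by (intro order_tendstoD(2)[OF tendsto_ident_at]) auto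
      moreover have "\<forall>\<^sub>F R in at_right (diameter (C i)). diameter (C i) < R" by (rule eventually_at_right_less)
      ultimately have "\<forall>\<^sub>F R in at_right (diameter (C i)). diameter (C i) < R \<and> R \<le> 2 \<and> ?v * (R / 2) ^ ?n \<le> ?v * (diameter (C i) / 2) ^ ?n + \<epsilon> * (1 / 2) ^ Suc i"
        by eventually_elim auto
      from eventually_happens[OF this] show ?thesis by simp
    qed
    then obtain R where R: "\<And>i. diameter (C i) < R i" "\<And>i. R i \<le> 2"
      "\<And>i. ?v * (R i / 2) ^ ?n \<le> ?v * (diameter (C i) / 2) ^ ?n + \<epsilon> * (1 / 2) ^ Suc i" by metis
    have R0: "0 < R i" for i using R(1)[of i] diameter_ge_0[OF C(2)[of i]] by linarith
    have "\<exists>W. {x + t *\<^sub>R e | x t. x \<in> C i \<and> \<bar>t\<bar> \<le> 1} \<subseteq> W \<and> W \<in> sets lebesgue \<and>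
       emeasure lebesgue W \<le> ennreal (6 * 2 ^ DIM('a) * ?V * R i ^ ?n)" for i
    proof (rule tube_measure[OF e R0 R(2)])
      fix x assume x: "x \<in> C i"
      then have "(SOME x. x \<in> C i) \<in> C i" by (rule someI)
      from diameter_bounded_bound[OF C(2) this x] R(1)[of i]
      show "dist (SOME x. x \<in> C i) x < R i" by linarith
    qed
    then have "\<exists>W. \<forall>i. {x + t *\<^sub>R e | x t. x \<in> C i \<and> \<bar>t\<bar> \<le> 1} \<subseteq> W i \<and> W i \<in> sets lebesgue \<and>
       emeasure lebesgue (W i) \<le> ennreal (6 * 2 ^ DIM('a) * ?V * R i ^ ?n)"
      by (intro choice allI)
    then obtain W where W: "\<And>i. {x + t *\<^sub>R e | x t. x \<in> C i \<and> \<bar>t\<bar> \<le> 1} \<subseteq> W i" "\<And>i. W i \<in> sets lebesgue"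
       "\<And>i. emeasure lebesgue (W i) \<le> ennreal (6 * 2 ^ DIM('a) * ?V * R i ^ ?n)" by blast
    have WK: "emeasure lebesgue (W i) \<le> ennreal K * (ennreal (?v * (diameter (C i) / 2) powr ?s) + ennreal (\<epsilon> * (1 / 2) ^ Suc i))" for i
    proof -
      have "6 * 2 ^ DIM('a) * ?V * R i ^ ?n \<le> K * (?v * (R i / 2) ^ ?n)"
      proof -
        have "2 ^ DIM('a) * 2 ^ ?n \<le> (4::real) ^ DIM('a)"
        proof -
          have "(2::real) ^ DIM('a) * 2 ^ ?n \<le> 2 ^ DIM('a) * 2 ^ DIM('a)"
            by (intro mult_left_mono power_increasing) auto
          also have "\<dots> = 4 ^ DIM('a)" by (simp add: power_mult_distrib[symmetric])
          finally show ?thesis .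
        qed
        then have "2 ^ DIM('a) \<le> (4::real) ^ DIM('a) / 2 ^ ?n" by (simp add: field_simps)
        then have "6 * 2 ^ DIM('a) * (?V * R i ^ ?n) \<le> 6 * (4 ^ DIM('a) / 2 ^ ?n) * (?V * R i ^ ?n)"
          using R0[of i] by (intro mult_right_mono mult_left_mono) auto
        also have "\<dots> = K * (?v * (R i / 2) ^ ?n)" using less_imp_neq[OF v] by (simp add: K_def power_divide)
        finally show ?thesis by (simp add: mult.assoc)
      qed
      also have "\<dots> \<le> K * (?v * (diameter (C i) / 2) ^ ?n + \<epsilon> * (1 / 2) ^ Suc i)"
        using R(3)[of i] K by (intro mult_left_mono) auto
      finally have "emeasure lebesgue (W i) \<le> ennreal (K * (?v * (diameter (C i) / 2) ^ ?n + \<epsilon> * (1 / 2) ^ Suc i))"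
        using W(3)[of i] by (meson ennreal_leI order_trans)
      also have "\<dots> = ennreal K * (ennreal (?v * (diameter (C i) / 2) powr ?s) + ennreal (\<epsilon> * (1 / 2) ^ Suc i))"
        using K v \<epsilon> diameter_ge_0[OF C(2)[of i]] by (simp add: ennreal_mult pw del: power_Suc)
      finally show ?thesis .
    qed
    have "ball x0 \<rho> \<subseteq> (\<Union>i. W i)"
    proof
      fix y assume "y \<in> ball x0 \<rho>"
      then obtain x t where "y = x + t *\<^sub>R e" "x \<in> A" "\<bar>t\<bar> \<le> 1" using tube by blast
      moreover then obtain i where "x \<in> C i" using C(1) by blast
      ultimately show "y \<in> (\<Union>i. W i)" using W(1)[of i] by blast
    qed
    then have "emeasure lebesgue (ball x0 \<rho>) \<le> emeasure lebesgue (\<Union>i. W i)"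
      using W(2) by (intro emeasure_mono) auto
    also have "\<dots> \<le> (\<Sum>i. emeasure lebesgue (W i))"
      using W(2) by (intro emeasure_subadditive_countably) auto
    also have "\<dots> \<le> (\<Sum>i. ennreal K * (ennreal (?v * (diameter (C i) / 2) powr ?s) + ennreal (\<epsilon> * (1 / 2) ^ Suc i)))"
      by (intro suminf_le WK summableI)
    also have "\<dots> = ennreal K * ((\<Sum>i. ennreal (?v * (diameter (C i) / 2) powr ?s)) + (\<Sum>i. ennreal (\<epsilon> * (1 / 2) ^ Suc i)))"
      by (simp add: ennreal_suminf_cmult suminf_add[symmetric] del: power_Suc)
    also have "(\<Sum>i. ennreal (\<epsilon> * (1 / 2) ^ Suc i)) = ennreal \<epsilon>"
      using \<epsilon> sums_mult[OF power_half_series, of \<epsilon>] by (intro suminf_ennreal_eq) auto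
    also have "ennreal K * ((\<Sum>i. ennreal (?v * (diameter (C i) / 2) powr ?s)) + ennreal \<epsilon>) \<le> ennreal K * (ennreal \<epsilon> + ennreal \<epsilon>)"
      using C(4) by (intro mult_left_mono add_right_mono) auto
    also have "\<dots> = ennreal (2 * K * \<epsilon>)"
      using K \<epsilon> by (simp add: ennreal_plus[symmetric] ennreal_mult[symmetric] algebra_simps del: ennreal_plus)
    finally show ?thesis .
  qed
  from this[of "?V * \<rho> ^ DIM('a) / (4 * K)"] show False
    using K V \<rho> by (simp add: emeasure_ball ennreal_le_iff)
qed

section \<open>Weak derivatives\<close>

lemma norm_increment_le:
  fixes f :: "'a::euclidean_space \<Rightarrow> 'b::euclidean_space"
  assumes f: "Ck (Suc 0) f" and B: "\<And>x. norm (dderiv v f x) \<le> B" and h: "0 \<le> h"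
  shows "norm (f (x + h *\<^sub>R v) - f x) \<le> B * h"
proof -
  have d: "((\<lambda>s. f (x + s *\<^sub>R v)) has_derivative (\<lambda>t. t *\<^sub>R dderiv v f (x + s *\<^sub>R v))) (at s within {0..h})" for s
  proof -
    have "((\<lambda>s. f (x + s *\<^sub>R v)) has_derivative (\<lambda>t. dderiv (t *\<^sub>R v) f (x + s *\<^sub>R v))) (at s)"
      by (rule has_derivative_compose[OF _ Ck_has_derivative[OF f]]) (auto intro!: derivative_eq_intros)
    then show ?thesis unfolding dderiv_scale[OF Ck_differentiable[OF f]] by (rule has_derivative_at_withinI)
  qed
  have "norm (f (x + h *\<^sub>R v) - f (x + 0 *\<^sub>R v)) \<le> B * norm (h - 0)"
  proof (rule differentiable_bound[OF _ d])
    show "onorm (\<lambda>t. t *\<^sub>R dderiv v f (x + s *\<^sub>R v)) \<le> B" for s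
      by (rule onorm_le) (use mult_right_mono[OF B[of "x + s *\<^sub>R v"] abs_ge_zero] in \<open>simp add: mult.commute\<close>)
  qed (use h in auto)
  then show ?thesis using h by simp
qed

lemma integral_translate:
  fixes f :: "'a::euclidean_space \<Rightarrow> 'b::euclidean_space"
  assumes "f \<in> borel_measurable borel"
  shows "(\<integral>x. f (x + c) \<partial>lborel) = (\<integral>x. f x \<partial>lborel)"
proof -
  have "(\<integral>x. f x \<partial>lborel) = (\<integral>x. f x \<partial>distr lborel borel ((+) c))" by (simp add: lborel_distr_plus)
  also have "\<dots> = (\<integral>x. f (c + x) \<partial>lborel)" using assms by (intro integral_distr) auto
  finally show ?thesis by (simp add: add.commute)
qed

text \<open>The integral of a difference quotient vanishes by translation invariance.\<close>

lemma integral_dd_eq_0: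
  fixes f :: "'a::euclidean_space \<Rightarrow> 'b::euclidean_space"
  assumes f: "Ck (Suc 0) f" and S: "compact S" "\<And>x. x \<notin> S \<Longrightarrow> f x = 0"
  shows "(\<integral>x. dderiv v f x \<partial>lborel) = 0"
proof -
  have df0: "dderiv v f x = 0" if "x \<notin> S" for x
    by (rule dderiv_eq_0_open[of "- S"]) (use S that in \<open>auto intro: compact_imp_closed\<close>)
  have "compact (dderiv v f ` S)" using S(1) by (intro compact_continuous_image Ck_continuous[OF Ck_dd[OF f]])
  then obtain B0 where B0: "\<forall>x\<in>S. norm (dderiv v f x) \<le> B0" by (meson bounded_iff compact_imp_bounded imageI)
  define B where "B = max B0 0"
  have B: "norm (dderiv v f x) \<le> B" for x
    using B0 df0[of x] by (cases "x \<in> S") (auto simp: B_def le_max_iff_disj)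
  define h where "h n = 1 / real (Suc n)" for n
  have h: "0 < h n" "h n \<le> 1" for n by (auto simp: h_def)
  define q where "q n x = (1 / h n) *\<^sub>R (f (x + h n *\<^sub>R v) - f x)" for n x
  have meas: "f \<in> borel_measurable borel" "dderiv v f \<in> borel_measurable borel"
    by (auto intro!: borel_measurable_continuous_onI Ck_continuous[OF f] Ck_continuous[OF Ck_dd[OF f]])
  have intf: "integrable lborel f"
  proof -
    have "(\<lambda>x. indicator S x *\<^sub>R f x) = f" using S(2) by (auto simp: fun_eq_iff indicator_def)
    then show ?thesis using borel_integrable_compact[OF S(1) Ck_continuous[OF f]] by simp
  qed
  have intft: "integrable lborel (\<lambda>x. f (x + c))" for c
  proof -
    have "integrable (distr lborel borel ((+) c)) f" using intf by (simp add: lborel_distr_plus)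
    then have "integrable lborel (\<lambda>x. f (c + x))" using meas by (subst (asm) integrable_distr_eq) auto
    then show ?thesis by (simp add: add.commute)
  qed
  have "(\<integral>x. q n x \<partial>lborel) = 0" for n
    unfolding q_def using intf intft meas by (simp add: integral_translate)
  moreover have "(\<lambda>n. \<integral>x. q n x \<partial>lborel) \<longlonglongrightarrow> (\<integral>x. dderiv v f x \<partial>lborel)"
  proof (rule integral_dominated_convergence)
    \<comment> \<open>All steps \<open>h n\<close> are at most 1, so every difference quotient
      vanishes outside the set swept by \<open>S\<close> along segments in direction
      \<open>- v\<close>. This compact set carries the dominating function.\<close>
    define T where "T = {x + y | x y. x \<in> S \<and> y \<in> (\<lambda>t. t *\<^sub>R (- v)) ` {0..1}}"
    have T: "compact T" unfolding T_def
      by (intro compact_sums S(1) compact_continuous_image) (auto intro!: continuous_intros)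
    have q0: "q n x = 0" if "x \<notin> T" for n x
    proof -
      have "x \<notin> S" using that unfolding T_def by (force intro: image_eqI[of _ _ 0])
      moreover have "x + h n *\<^sub>R v \<notin> S"
      proof
        assume "x + h n *\<^sub>R v \<in> S"
        moreover have "x = (x + h n *\<^sub>R v) + h n *\<^sub>R (- v)" by simp
        ultimately have "x \<in> T" unfolding T_def using h[of n] by (fastforce intro: less_imp_le)
        with that show False ..
      qed
      ultimately show ?thesis using S(2) by (simp add: q_def)
    qed
    show "integrable lborel (\<lambda>x. B * indicator T x)"
      using T by (intro integrable_mult_right integrable_real_indicator)
        (auto simp: borel_compact intro: emeasure_compact_finite[unfolded infinity_ennreal_def])
    show "AE x in lborel. norm (q n x) \<le> B * indicator T x" for n
    proof (rule AE_I2)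
      fix x
      have "norm (f (x + h n *\<^sub>R v) - f x) \<le> B * h n" by (rule norm_increment_le[OF f B less_imp_le[OF h(1)]])
      then have "norm (q n x) \<le> B" using h(1)[of n] unfolding q_def norm_scaleR
        by (simp add: field_simps)
      then show "norm (q n x) \<le> B * indicator T x" using q0 by (auto simp: indicator_def)
    qed
    show "AE x in lborel. (\<lambda>n. q n x) \<longlonglongrightarrow> dderiv v f x"
    proof (rule AE_I2)
      fix x
      have "((\<lambda>s. f (x + s *\<^sub>R v)) has_derivative (\<lambda>t. dderiv (t *\<^sub>R v) f (x + 0 *\<^sub>R v))) (at 0)"
        by (rule has_derivative_compose[OF _ Ck_has_derivative[OF f]]) (auto intro!: derivative_eq_intros)
      then have "((\<lambda>s. norm (f (x + (0 + s) *\<^sub>R v) - f (x + 0 *\<^sub>R v) - s *\<^sub>R dderiv v f (x + 0 *\<^sub>R v)) / norm s) \<longlongrightarrow> 0) (at 0)"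
        unfolding dderiv_scale[OF Ck_differentiable[OF f]] has_derivative_at by simp
      moreover have "filterlim h (at 0) sequentially"
        unfolding filterlim_at h_def using LIMSEQ_inverse_real_of_nat by (auto simp: inverse_eq_divide)
      ultimately have "(\<lambda>n. norm (f (x + (0 + h n) *\<^sub>R v) - f (x + 0 *\<^sub>R v) - h n *\<^sub>R dderiv v f (x + 0 *\<^sub>R v)) / norm (h n)) \<longlonglongrightarrow> 0"
        by (rule filterlim_compose)
      moreover have "norm (f (x + (0 + h n) *\<^sub>R v) - f (x + 0 *\<^sub>R v) - h n *\<^sub>R dderiv v f (x + 0 *\<^sub>R v)) / norm (h n)
         = norm (q n x - dderiv v f x)" for n
      proof -
        have "q n x - dderiv v f x = (1 / h n) *\<^sub>R (f (x + h n *\<^sub>R v) - f x - h n *\<^sub>R dderiv v f x)"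
          using h(1)[of n] by (simp add: q_def scaleR_diff_right)
        then show ?thesis using h(1)[of n] by simp
      qed
      ultimately have "(\<lambda>n. norm (q n x - dderiv v f x)) \<longlonglongrightarrow> 0" by simp
      then show "(\<lambda>n. q n x) \<longlonglongrightarrow> dderiv v f x"
        by (rule Lim_null[THEN iffD2, OF tendsto_norm_zero_cancel])
    qed
    show "q n \<in> borel_measurable lborel" for n
      unfolding q_def using meas by simp
  qed (use meas in auto)
  ultimately have "(\<lambda>n::nat. 0) \<longlonglongrightarrow> (\<integral>x. dderiv v f x \<partial>lborel)" by simp
  then show ?thesis by (simp add: LIMSEQ_const_iff)
qed

lemma test_function_props:
  assumes "test_function \<Omega> \<phi>"
  shows "Ck k \<phi>" and "\<exists>S. compact S \<and> S \<subseteq> \<Omega> \<and> (\<forall>x. x \<notin> S \<longrightarrow> \<phi> x = 0 \<and> dderiv v \<phi> x = 0)"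
    and "\<exists>B. \<forall>x. \<bar>\<phi> x\<bar> \<le> B \<and> \<bar>dderiv v \<phi> x\<bar> \<le> B"
proof -
  show C: "Ck k \<phi>" for k using assms by (simp add: test_function_def)
  let ?S = "closure {x. \<phi> x \<noteq> 0}"
  have S: "compact ?S" "?S \<subseteq> \<Omega>" using assms by (auto simp: test_function_def)
  have z: "\<phi> x = 0 \<and> dderiv v \<phi> x = 0" if "x \<notin> ?S" for x
  proof -
    have *: "\<phi> y = 0" if "y \<in> - ?S" for y using that closure_subset[of "{x. \<phi> x \<noteq> 0}"] by blast
    have "dderiv v \<phi> x = 0"
      by (rule dderiv_eq_0_open[of "- ?S"]) (use that in \<open>auto intro: *\<close>)
    then show ?thesis using *[of x] that by simp
  qed
  with S show "\<exists>S. compact S \<and> S \<subseteq> \<Omega> \<and> (\<forall>x. x \<notin> S \<longrightarrow> \<phi> x = 0 \<and> dderiv v \<phi> x = 0)" by blast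
  have "compact (\<phi> ` ?S)" "compact (dderiv v \<phi> ` ?S)"
    using S(1) by (auto intro!: compact_continuous_image Ck_continuous[OF C] Ck_continuous[OF Ck_dd[OF C]])
  then have "bounded (\<phi> ` ?S)" "bounded (dderiv v \<phi> ` ?S)" by (auto dest: compact_imp_bounded)
  then obtain B1 B2 where "\<forall>x\<in>?S. norm (\<phi> x) \<le> B1" "\<forall>x\<in>?S. norm (dderiv v \<phi> x) \<le> B2"
    unfolding bounded_iff by blast
  then have "\<bar>\<phi> x\<bar> \<le> max 0 (max B1 B2) \<and> \<bar>dderiv v \<phi> x\<bar> \<le> max 0 (max B1 B2)" for x
    using z[of x] by (cases "x \<in> ?S") (auto simp: le_max_iff_disj)
  then show "\<exists>B. \<forall>x. \<bar>\<phi> x\<bar> \<le> B \<and> \<bar>dderiv v \<phi> x\<bar> \<le> B" by blast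
qed

lemma set_integral_lebesgue_on:
  fixes f :: "'a::euclidean_space \<Rightarrow> 'b::euclidean_space"
  assumes "\<Omega> \<in> sets lebesgue"
  shows "(LINT x:\<Omega>|lebesgue. f x) = integral\<^sup>L (lebesgue_on \<Omega>) f"
  unfolding set_lebesgue_integral_def using assms by (simp add: integral_restrict_space)

lemma has_weak_derivativeI:
  fixes f g :: "'a::euclidean_space \<Rightarrow> 'b::euclidean_space"
  assumes \<Omega>: "\<Omega> \<in> sets lebesgue"
    and f: "integrable (lebesgue_on \<Omega>) f" and g: "integrable (lebesgue_on \<Omega>) g"
    and eq: "\<And>\<phi>. test_function \<Omega> \<phi> \<Longrightarrow>
      (\<integral>x. dderiv v \<phi> x *\<^sub>R f x \<partial>lebesgue_on \<Omega>) = - (\<integral>x. \<phi> x *\<^sub>R g x \<partial>lebesgue_on \<Omega>)"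
  shows "has_weak_derivative \<Omega> v f g"
proof -
  have *: "locally_integrable_on h \<Omega>" if h: "integrable (lebesgue_on \<Omega>) h" for h :: "'a \<Rightarrow> 'b"
    unfolding locally_integrable_on_def
  proof (intro allI impI, elim conjE)
    fix K :: "'a set" assume K: "compact K" "K \<subseteq> \<Omega>"
    have "set_integrable lebesgue \<Omega> h"
      using h \<Omega> by (simp add: set_integrable_def integrable_restrict_space)
    then show "set_integrable lebesgue K h"
      by (rule set_integrable_subset) (use K in \<open>auto intro: lmeasurable_compact fmeasurableD\<close>)
  qed
  show ?thesis
    unfolding has_weak_derivative_def using *[OF f] *[OF g] eq
    by (auto simp: set_integral_lebesgue_on[OF \<Omega>] dderiv_def)
qed

lemma has_weak_derivativeD:
  assumes "has_weak_derivative \<Omega> v f g" "test_function \<Omega> \<phi>" "\<Omega> \<in> sets lebesgue"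
  shows "(\<integral>x. dderiv v \<phi> x *\<^sub>R f x \<partial>lebesgue_on \<Omega>) = - (\<integral>x. \<phi> x *\<^sub>R g x \<partial>lebesgue_on \<Omega>)"
  using assms unfolding has_weak_derivative_def by (simp add: set_integral_lebesgue_on[OF assms(3)] dderiv_def)

lemma integrable_test_mult:
  fixes f :: "'a::euclidean_space \<Rightarrow> 'b::euclidean_space"
  assumes "test_function \<Omega> \<phi>" "integrable (lebesgue_on \<Omega>) f"
  shows "integrable (lebesgue_on \<Omega>) (\<lambda>x. \<phi> x *\<^sub>R f x)" "integrable (lebesgue_on \<Omega>) (\<lambda>x. dderiv v \<phi> x *\<^sub>R f x)"
proof -
  obtain B where B: "\<And>x. \<bar>\<phi> x\<bar> \<le> B \<and> \<bar>dderiv v \<phi> x\<bar> \<le> B" using test_function_props(3)[OF assms(1)] by blast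
  have "0 \<le> B" using B[of 0] by linarith
  have *: "integrable (lebesgue_on \<Omega>) (\<lambda>x. \<psi> x *\<^sub>R f x)"
    if "continuous_on UNIV \<psi>" "\<And>x. \<bar>\<psi> x\<bar> \<le> B" for \<psi> :: "'a \<Rightarrow> real"
  proof (rule Bochner_Integration.integrable_bound[where f="\<lambda>x. B *\<^sub>R f x"])
    have "\<psi> \<in> borel_measurable (lebesgue_on \<Omega>)"
      using that(1) by (intro measurable_restrict_space1 measurable_completion) (auto intro: borel_measurable_continuous_onI)
    then show "(\<lambda>x. \<psi> x *\<^sub>R f x) \<in> borel_measurable (lebesgue_on \<Omega>)" using assms(2) by simp
    show "AE x in lebesgue_on \<Omega>. norm (\<psi> x *\<^sub>R f x) \<le> norm (B *\<^sub>R f x)"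
      using that(2) \<open>0 \<le> B\<close> by (auto intro!: mult_right_mono)
  qed (use assms in auto)
  show "integrable (lebesgue_on \<Omega>) (\<lambda>x. \<phi> x *\<^sub>R f x)" "integrable (lebesgue_on \<Omega>) (\<lambda>x. dderiv v \<phi> x *\<^sub>R f x)"
    using B by (auto intro!: * Ck_continuous[OF test_function_props(1)[OF assms(1)]]
        Ck_continuous[OF Ck_dd[OF test_function_props(1)[OF assms(1)]]])
qed

lemma has_weak_derivative_diff:
  fixes f g f' g' :: "'a::euclidean_space \<Rightarrow> 'b::euclidean_space"
  assumes \<Omega>: "\<Omega> \<in> sets lebesgue"
    and i: "integrable (lebesgue_on \<Omega>) f" "integrable (lebesgue_on \<Omega>) g"
      "integrable (lebesgue_on \<Omega>) f'" "integrable (lebesgue_on \<Omega>) g'"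
    and h: "has_weak_derivative \<Omega> v f g" "has_weak_derivative \<Omega> v f' g'"
  shows "has_weak_derivative \<Omega> v (\<lambda>x. f x - f' x) (\<lambda>x. g x - g' x)"
proof (rule has_weak_derivativeI[OF \<Omega>])
  fix \<phi> assume t: "test_function \<Omega> \<phi>"
  show "(\<integral>x. dderiv v \<phi> x *\<^sub>R (f x - f' x) \<partial>lebesgue_on \<Omega>) = - (\<integral>x. \<phi> x *\<^sub>R (g x - g' x) \<partial>lebesgue_on \<Omega>)"
    using has_weak_derivativeD[OF h(1) t \<Omega>] has_weak_derivativeD[OF h(2) t \<Omega>]
    by (simp add: scaleR_diff_right Bochner_Integration.integral_diff integrable_test_mult[OF t] i)
qed (use i in auto)

lemma continuous_borel_measurable_lebesgue_on:
  fixes f :: "'a::euclidean_space \<Rightarrow> 'b::euclidean_space"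
  shows "continuous_on UNIV f \<Longrightarrow> f \<in> borel_measurable (lebesgue_on \<Omega>)"
  by (intro measurable_restrict_space1 measurable_completion) (auto intro: borel_measurable_continuous_onI)

lemma continuous_bounded_on:
  fixes f :: "'a::euclidean_space \<Rightarrow> 'b::euclidean_space"
  assumes "bounded \<Omega>" "continuous_on UNIV f"
  obtains B where "0 \<le> B" "\<And>x. x \<in> \<Omega> \<Longrightarrow> norm (f x) \<le> B"
proof -
  have "compact (f ` closure \<Omega>)"
    using assms by (intro compact_continuous_image) (auto simp: compact_eq_bounded_closed intro: continuous_on_subset)
  then obtain B where "\<forall>x\<in>closure \<Omega>. norm (f x) \<le> B" by (meson bounded_iff compact_imp_bounded imageI)
  then show ?thesis using closure_subset[of \<Omega>] by (intro that[of "max 0 B"]) (auto simp: le_max_iff_disj)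
qed

lemma integrable_continuous_bounded:
  fixes f :: "'a::euclidean_space \<Rightarrow> 'b::euclidean_space"
  assumes "bounded \<Omega>" "\<Omega> \<in> sets lebesgue" "continuous_on UNIV f"
  shows "integrable (lebesgue_on \<Omega>) f"
proof -
  obtain B where B: "\<And>x. x \<in> \<Omega> \<Longrightarrow> norm (f x) \<le> B" using continuous_bounded_on[OF assms(1,3)] by blast
  have "emeasure lebesgue \<Omega> < \<infinity>" using assms(1,2) bounded_set_imp_lmeasurable fmeasurableD2 less_top
    by (metis infinity_ennreal_def)
  then have "finite_measure (lebesgue_on \<Omega>)"
    using assms(2) by (intro finite_measureI) (simp add: emeasure_restrict_space space_restrict_space)
  then show ?thesis
    by (rule finite_measure.integrable_const_bound[where B=B])
      (use B in \<open>auto intro!: continuous_borel_measurable_lebesgue_on assms(3) simp: space_restrict_space\<close>)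
qed

text \<open>Integration by parts over the whole space: the product
  \<open>\<phi> x *\<^sub>R f x\<close> has compact support inside \<Omega>, so the integral of its
  derivative vanishes.\<close>

lemma has_weak_derivative_Ck:
  fixes f :: "'a::euclidean_space \<Rightarrow> 'b::euclidean_space"
  assumes \<Omega>: "open \<Omega>" "bounded \<Omega>" and f: "Ck (Suc 0) f"
  shows "has_weak_derivative \<Omega> v f (dderiv v f)"
proof (rule has_weak_derivativeI)
  show s: "\<Omega> \<in> sets lebesgue" using \<Omega> by auto
  show "integrable (lebesgue_on \<Omega>) f" "integrable (lebesgue_on \<Omega>) (dderiv v f)"
    by (intro integrable_continuous_bounded \<Omega> s Ck_continuous[OF f] Ck_continuous[OF Ck_dd[OF f]])+
  note i = this
  fix \<phi> assume t: "test_function \<Omega> \<phi>"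
  obtain S where S: "compact S" "S \<subseteq> \<Omega>" "\<And>x. x \<notin> S \<Longrightarrow> \<phi> x = 0 \<and> dderiv v \<phi> x = 0"
    using test_function_props(2)[OF t] by blast
  have \<phi>: "Ck (Suc 0) \<phi>" by (rule test_function_props(1)[OF t])
  have d: "dderiv v (\<lambda>x. \<phi> x *\<^sub>R f x) = (\<lambda>x. \<phi> x *\<^sub>R dderiv v f x + dderiv v \<phi> x *\<^sub>R f x)"
    by (rule ext) (rule dderiv_scaleR[OF Ck_differentiable[OF \<phi>] Ck_differentiable[OF f]])
  have c: "continuous_on UNIV (\<lambda>x. \<phi> x *\<^sub>R dderiv v f x + dderiv v \<phi> x *\<^sub>R f x)"
    by (intro continuous_intros Ck_continuous[OF \<phi>] Ck_continuous[OF f] Ck_continuous[OF Ck_dd[OF f]] Ck_continuous[OF Ck_dd[OF \<phi>]])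
  have "(\<integral>x. \<phi> x *\<^sub>R dderiv v f x + dderiv v \<phi> x *\<^sub>R f x \<partial>lebesgue_on \<Omega>)
    = (\<integral>x. indicator \<Omega> x *\<^sub>R (\<phi> x *\<^sub>R dderiv v f x + dderiv v \<phi> x *\<^sub>R f x) \<partial>lebesgue)"
    using s by (simp add: integral_restrict_space)
  also have "(\<lambda>x. indicator \<Omega> x *\<^sub>R (\<phi> x *\<^sub>R dderiv v f x + dderiv v \<phi> x *\<^sub>R f x)) = (\<lambda>x. \<phi> x *\<^sub>R dderiv v f x + dderiv v \<phi> x *\<^sub>R f x)"
  proof
    fix x show "indicator \<Omega> x *\<^sub>R (\<phi> x *\<^sub>R dderiv v f x + dderiv v \<phi> x *\<^sub>R f x) = \<phi> x *\<^sub>R dderiv v f x + dderiv v \<phi> x *\<^sub>R f x"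
    proof (cases "x \<in> \<Omega>")
      case False
      with S(2) have "x \<notin> S" by blast
      with S(3)[OF this] show ?thesis by simp
    qed simp
  qed
  also have "integral\<^sup>L lebesgue \<dots> = integral\<^sup>L lborel \<dots>"
    using c by (intro integral_completion) (auto intro: borel_measurable_continuous_onI)
  also have "\<dots> = 0"
    unfolding d[symmetric] by (rule integral_dd_eq_0[OF Ck_scaleR[OF \<phi> f] S(1)]) (simp add: S(3))
  finally have "(\<integral>x. \<phi> x *\<^sub>R dderiv v f x \<partial>lebesgue_on \<Omega>) + (\<integral>x. dderiv v \<phi> x *\<^sub>R f x \<partial>lebesgue_on \<Omega>) = 0"
    by (subst (asm) Bochner_Integration.integral_add) (auto intro!: integrable_test_mult[OF t] i)
  then show "(\<integral>x. dderiv v \<phi> x *\<^sub>R f x \<partial>lebesgue_on \<Omega>) = - (\<integral>x. \<phi> x *\<^sub>R dderiv v f x \<partial>lebesgue_on \<Omega>)"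
    by (simp add: add_eq_0_iff2 add_eq_0_iff)
qed

section \<open>Series in Sobolev spaces\<close>

text \<open>Decay is asked of p-th powers and not of norms, since this is what small supports give:
  the energy of a bounded function is at most a power times a volume. The rate 1/2 is fixed while
  \<open>C\<close> may depend on \<open>p\<close>.\<close>

definition geometric_energy :: "real \<Rightarrow> 'a measure \<Rightarrow> (nat \<Rightarrow> 'a \<Rightarrow> 'b::euclidean_space) \<Rightarrow> bool" where
  "geometric_energy p M f \<longleftrightarrow> (\<exists>C\<ge>0. \<forall>k. Lp_energy p M (f k) \<le> ennreal (C * (1 / 2) ^ k))"

lemma Lp_energy_mono:
  assumes "\<And>x. x \<in> space M \<Longrightarrow> norm (f x) \<le> norm (g x)" "0 \<le> p"
  shows "Lp_energy p M f \<le> Lp_energy p M g"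
  unfolding Lp_energy_def by (intro nn_integral_mono ennreal_leI powr_mono2) (use assms in auto)

lemma Lp_energy_add:
  fixes f g :: "'a \<Rightarrow> 'b::euclidean_space"
  assumes [measurable]: "f \<in> borel_measurable M" "g \<in> borel_measurable M" and p: "0 \<le> p"
  shows "Lp_energy p M (\<lambda>x. f x + g x) \<le> ennreal (2 powr p) * (Lp_energy p M f + Lp_energy p M g)"
proof -
  have "norm (f x + g x) powr p \<le> 2 powr p * (norm (f x) powr p + norm (g x) powr p)" for x
  proof -
    have "norm (f x + g x) \<le> 2 * max (norm (f x)) (norm (g x))"
      using norm_triangle_ineq[of "f x" "g x"] by linarith
    then have "norm (f x + g x) powr p \<le> (2 * max (norm (f x)) (norm (g x))) powr p"
      using p by (intro powr_mono2) auto
    also have "\<dots> = 2 powr p * (max (norm (f x)) (norm (g x)) powr p)"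
      by (rule powr_mult)
    also have "\<dots> \<le> 2 powr p * (norm (f x) powr p + norm (g x) powr p)"
      by (intro mult_left_mono) (auto simp: max_def)
    finally show ?thesis .
  qed
  then have "Lp_energy p M (\<lambda>x. f x + g x) \<le> (\<integral>\<^sup>+x. ennreal (2 powr p) * (ennreal (norm (f x) powr p) + ennreal (norm (g x) powr p)) \<partial>M)"
    unfolding Lp_energy_def
    by (intro nn_integral_mono) (simp add: ennreal_mult[symmetric] ennreal_plus[symmetric] ennreal_leI del: ennreal_plus)
  also have "\<dots> = ennreal (2 powr p) * (Lp_energy p M f + Lp_energy p M g)"
    unfolding Lp_energy_def by (simp add: nn_integral_cmult nn_integral_add)
  finally show ?thesis .
qed

lemma geometric_energy_mono:
  assumes "geometric_energy p M g" "\<And>k x. x \<in> space M \<Longrightarrow> norm (f k x) \<le> norm (g k x)" "0 \<le> p"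
  shows "geometric_energy p M f"
proof -
  have "Lp_energy p M (f k) \<le> Lp_energy p M (g k)" for k
    by (rule Lp_energy_mono[OF assms(2,3)])
  then show ?thesis using assms(1) unfolding geometric_energy_def by (meson order_trans)
qed

lemma geometric_energy_add:
  fixes f g :: "nat \<Rightarrow> 'a \<Rightarrow> 'b::euclidean_space"
  assumes "geometric_energy p M f" "geometric_energy p M g" "0 \<le> p"
    and "\<And>k. f k \<in> borel_measurable M" "\<And>k. g k \<in> borel_measurable M"
  shows "geometric_energy p M (\<lambda>k x. f k x + g k x)"
proof -
  obtain C D where C: "C \<ge> 0" "\<And>k. Lp_energy p M (f k) \<le> ennreal (C * (1 / 2) ^ k)"
    and D: "D \<ge> 0" "\<And>k. Lp_energy p M (g k) \<le> ennreal (D * (1 / 2) ^ k)"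
    using assms(1,2) unfolding geometric_energy_def by auto
  have "Lp_energy p M (\<lambda>x. f k x + g k x) \<le> ennreal (2 powr p * (C + D) * (1 / 2) ^ k)" for k
  proof -
    have "Lp_energy p M (\<lambda>x. f k x + g k x) \<le> ennreal (2 powr p) * (Lp_energy p M (f k) + Lp_energy p M (g k))"
      by (rule Lp_energy_add) (use assms in auto)
    also have "\<dots> \<le> ennreal (2 powr p) * (ennreal (C * (1 / 2) ^ k) + ennreal (D * (1 / 2) ^ k))"
      by (intro mult_left_mono add_mono C D) auto
    also have "\<dots> = ennreal (2 powr p * (C + D) * (1 / 2) ^ k)"
      using C(1) D(1) by (simp add: ennreal_plus[symmetric] ennreal_mult[symmetric] algebra_simps del: ennreal_plus)
    finally show ?thesis .
  qed
  then show ?thesis unfolding geometric_energy_def using C(1) D(1)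
    by (intro exI[of _ "2 powr p * (C + D)"]) auto
qed

text \<open>Each \<open>a k\<close> is at most \<open>z powr (1 / p)\<close> times the k-th power of
  \<open>(2 / 3) powr (1 / p)\<close>, which is below 1. The p-th power of the geometric sum is then
  linear in \<open>z\<close>, so that the bound can be integrated.\<close>

lemma summable_root_bound:
  fixes a :: "nat \<Rightarrow> real"
  assumes a: "\<And>k. 0 \<le> a k" and p: "0 < p" and z: "0 \<le> z" "\<And>k. (3 / 2) ^ k * a k powr p \<le> z"
  shows "summable a" and "(\<Sum>k. a k) powr p \<le> z * (1 / (1 - (2 / 3) powr (1 / p))) powr p"
proof -
  define \<theta> where "\<theta> = (2 / 3 :: real) powr (1 / p)"
  have \<theta>: "0 < \<theta>" "\<theta> < 1"
    unfolding \<theta>_def using p powr_less_mono2[of "1 / p" "2 / 3" 1] by auto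
  have le: "a k \<le> z powr (1 / p) * \<theta> ^ k" for k
  proof -
    have "a k powr p \<le> z * (2 / 3) ^ k"
      using z(2)[of k] by (simp add: field_simps power_divide)
    then have "(a k powr p) powr (1 / p) \<le> (z * (2 / 3) ^ k) powr (1 / p)"
      using p by (intro powr_mono2) auto
    also have "(a k powr p) powr (1 / p) = a k" using a p by (simp add: powr_powr)
    also have "(z * (2 / 3) ^ k) powr (1 / p) = z powr (1 / p) * \<theta> ^ k"
    proof -
      have "((2 / 3 :: real) ^ k) powr (1 / p) = \<theta> ^ k"
        unfolding \<theta>_def by (simp add: powr_realpow[symmetric] powr_powr mult.commute)
      then show ?thesis using z(1) by (simp add: powr_mult)
    qed
    finally show ?thesis .
  qed
  have sg: "summable (\<lambda>k. z powr (1 / p) * \<theta> ^ k)"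
    using \<theta> by (intro summable_mult summable_geometric) auto
  show s: "summable a"
    by (rule summable_comparison_test[OF _ sg]) (use le a in auto)
  have "(\<Sum>k. a k) \<le> (\<Sum>k. z powr (1 / p) * \<theta> ^ k)" by (rule suminf_le[OF le s sg])
  also have "\<dots> = z powr (1 / p) * (1 / (1 - \<theta>))"
    using \<theta> by (simp add: suminf_mult suminf_geometric summable_geometric)
  finally have "(\<Sum>k. a k) powr p \<le> (z powr (1 / p) * (1 / (1 - \<theta>))) powr p"
    using p suminf_nonneg[OF s a] by (intro powr_mono2) auto
  also have "\<dots> = z * (1 / (1 - \<theta>)) powr p"
    using \<theta> z(1) p by (simp only: powr_mult) (simp add: powr_powr)
  finally show "(\<Sum>k. a k) powr p \<le> z * (1 / (1 - (2 / 3) powr (1 / p))) powr p" unfolding \<theta>_def .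
qed

text \<open>Weighting the \<open>k\<close>-th term by \<open>(3/2)\<^sup>k\<close> replaces Minkowski's inequality.\<close>

lemma geometric_energy_tail:
  fixes f :: "nat \<Rightarrow> 'a \<Rightarrow> 'b::euclidean_space"
  assumes [measurable]: "\<And>k. f k \<in> borel_measurable M" and p: "0 < p" and f: "geometric_energy p M f"
  shows "AE x in M. summable (\<lambda>k. norm (f k x))"
    and "\<exists>K\<ge>0. \<forall>m. (\<integral>\<^sup>+x. ennreal ((\<Sum>k. norm (f (k + m) x)) powr p) \<partial>M) \<le> ennreal (K * (1 / 2) ^ m)"
proof -
  obtain C where C: "C \<ge> 0" "\<And>k. Lp_energy p M (f k) \<le> ennreal (C * (1 / 2) ^ k)"
    using f unfolding geometric_energy_def by auto
  \<comment> \<open>The weight 3/2 lies strictly between 1 and 2: it grows, so that the pointwise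
    roots are summable, and yet the decay 1/2 of the energies beats it, leaving the ratio
    3/4.\<close>
  define Z where "Z m x = (\<Sum>k. ennreal ((3 / 2) ^ k) * ennreal (norm (f (k + m) x) powr p))" for m x
  have [measurable]: "Z m \<in> borel_measurable M" for m unfolding Z_def by measurable
  have ZI: "(\<integral>\<^sup>+x. Z m x \<partial>M) \<le> ennreal (4 * C * (1 / 2) ^ m)" for m
  proof -
    have "(\<integral>\<^sup>+x. Z m x \<partial>M) = (\<Sum>k. \<integral>\<^sup>+x. ennreal ((3 / 2) ^ k) * ennreal (norm (f (k + m) x) powr p) \<partial>M)"
      unfolding Z_def by (rule nn_integral_suminf) measurable
    also have "\<dots> = (\<Sum>k. ennreal ((3 / 2) ^ k) * Lp_energy p M (f (k + m)))"
      unfolding Lp_energy_def by (intro suminf_cong nn_integral_cmult) measurable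
    also have "\<dots> \<le> (\<Sum>k. ennreal ((3 / 2) ^ k) * ennreal (C * (1 / 2) ^ (k + m)))"
      by (intro suminf_le mult_left_mono C summableI) auto
    also have "\<dots> = (\<Sum>k. ennreal (C * (1 / 2) ^ m * (3 / 4) ^ k))"
    proof (rule suminf_cong)
      fix k
      have "(3 / 2 :: real) ^ k * (C * (1 / 2) ^ (k + m)) = C * (1 / 2) ^ m * (3 / 4) ^ k"
        by (simp add: power_add power_mult_distrib[symmetric] ac_simps)
      then show "ennreal ((3 / 2) ^ k) * ennreal (C * (1 / 2) ^ (k + m)) = ennreal (C * (1 / 2) ^ m * (3 / 4) ^ k)"
        using C(1) by (simp add: ennreal_mult[symmetric])
    qed
    also have "\<dots> = ennreal (C * (1 / 2) ^ m * (1 / (1 - 3 / 4)))"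
      using C(1) by (intro suminf_ennreal_eq sums_mult geometric_sums) auto
    finally show ?thesis by (simp add: ac_simps)
  qed
  have fin: "AE x in M. Z m x \<noteq> \<infinity>" for m
    by (rule nn_integral_PInf_AE) (use ZI[of m] in \<open>auto simp: less_top[symmetric] top_unique\<close>)
  have bnd: "(3 / 2) ^ k * norm (f (k + m) x) powr p \<le> enn2real (Z m x)" if "Z m x \<noteq> \<infinity>" for k m x
  proof -
    have "ennreal ((3 / 2) ^ k * norm (f (k + m) x) powr p) \<le> Z m x"
      unfolding Z_def using sum_le_suminf[of "\<lambda>k. ennreal ((3 / 2) ^ k) * ennreal (norm (f (k + m) x) powr p)" "{k}"]
      by (simp add: ennreal_mult)
    also have "\<dots> = ennreal (enn2real (Z m x))" using that by (simp add: less_top)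
    finally show ?thesis by (simp add: ennreal_le_iff)
  qed
  show "AE x in M. summable (\<lambda>k. norm (f k x))"
    using fin[of 0]
  proof eventually_elim
    case (elim x)
    show ?case by (rule summable_root_bound(1)[OF norm_ge_zero p enn2real_nonneg]) (use bnd[OF elim] in simp)
  qed
  define L where "L = (1 / (1 - (2 / 3 :: real) powr (1 / p))) powr p"
  have "(\<integral>\<^sup>+x. ennreal ((\<Sum>k. norm (f (k + m) x)) powr p) \<partial>M) \<le> ennreal (4 * C * L * (1 / 2) ^ m)" for m
  proof -
    have "(\<integral>\<^sup>+x. ennreal ((\<Sum>k. norm (f (k + m) x)) powr p) \<partial>M) \<le> (\<integral>\<^sup>+x. Z m x * ennreal L \<partial>M)"
    proof (rule nn_integral_mono_AE)
      show "AE x in M. ennreal ((\<Sum>k. norm (f (k + m) x)) powr p) \<le> Z m x * ennreal L"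
        using fin[of m]
      proof eventually_elim
        case (elim x)
        have "(\<Sum>k. norm (f (k + m) x)) powr p \<le> enn2real (Z m x) * L" unfolding L_def
          by (rule summable_root_bound(2)[OF norm_ge_zero p enn2real_nonneg]) (use bnd[OF elim] in simp)
        then have "ennreal ((\<Sum>k. norm (f (k + m) x)) powr p) \<le> ennreal (enn2real (Z m x) * L)" by (rule ennreal_leI)
        also have "\<dots> = Z m x * ennreal L" using elim by (simp add: ennreal_mult L_def less_top)
        finally show ?case .
      qed
    qed
    also have "\<dots> = (\<integral>\<^sup>+x. Z m x \<partial>M) * ennreal L" by (rule nn_integral_multc) measurable
    also have "\<dots> \<le> ennreal (4 * C * (1 / 2) ^ m) * ennreal L" by (intro mult_right_mono ZI) auto
    also have "\<dots> = ennreal (4 * C * L * (1 / 2) ^ m)" using C(1) by (simp add: ennreal_mult[symmetric] L_def ac_simps)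
    finally show ?thesis .
  qed
  then show "\<exists>K\<ge>0. \<forall>m. (\<integral>\<^sup>+x. ennreal ((\<Sum>k. norm (f (k + m) x)) powr p) \<partial>M) \<le> ennreal (K * (1 / 2) ^ m)"
    using C(1) by (intro exI[of _ "4 * C * L"]) (auto simp: L_def)
qed

lemma geometric_energy_partial_sums:
  fixes f :: "nat \<Rightarrow> 'a \<Rightarrow> 'b::euclidean_space"
  assumes m[measurable]: "\<And>k. f k \<in> borel_measurable M" and p: "0 < p" and f: "geometric_energy p M f"
  shows "(\<lambda>m. Lp_energy p M (\<lambda>x. (\<Sum>k<m. f k x) - (\<Sum>k. f k x))) \<longlonglongrightarrow> 0"
    and "(\<lambda>x. \<Sum>k. f k x) \<in> Lp_space p M"
proof -
  obtain K where K: "K \<ge> 0" "\<And>m. (\<integral>\<^sup>+x. ennreal ((\<Sum>k. norm (f (k + m) x)) powr p) \<partial>M) \<le> ennreal (K * (1 / 2) ^ m)"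
    using geometric_energy_tail(2)[OF m p f] by auto
  have le: "Lp_energy p M (\<lambda>x. (\<Sum>k<m. f k x) - (\<Sum>k. f k x)) \<le> ennreal (K * (1 / 2) ^ m)" for m
  proof (rule order_trans[OF _ K(2)])
    show "Lp_energy p M (\<lambda>x. (\<Sum>k<m. f k x) - (\<Sum>k. f k x)) \<le> (\<integral>\<^sup>+x. ennreal ((\<Sum>k. norm (f (k + m) x)) powr p) \<partial>M)"
      unfolding Lp_energy_def
    proof (rule nn_integral_mono_AE)
      show "AE x in M. ennreal (norm ((\<Sum>k<m. f k x) - (\<Sum>k. f k x)) powr p) \<le> ennreal ((\<Sum>k. norm (f (k + m) x)) powr p)"
        using geometric_energy_tail(1)[OF m p f]
      proof eventually_elim
        case (elim x)
        have "(\<Sum>k. f k x) = (\<Sum>k. f (k + m) x) + (\<Sum>k<m. f k x)"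
          by (rule suminf_split_initial_segment[OF summable_norm_cancel[OF elim]])
        then have "norm ((\<Sum>k<m. f k x) - (\<Sum>k. f k x)) = norm (\<Sum>k. f (k + m) x)" by simp
        also have "\<dots> \<le> (\<Sum>k. norm (f (k + m) x))"
          by (rule summable_norm[OF summable_ignore_initial_segment[OF elim]])
        finally show ?case using p by (intro ennreal_leI powr_mono2) auto
      qed
    qed
  qed
  have "(\<lambda>m. ennreal (K * (1 / 2) ^ m)) \<longlonglongrightarrow> ennreal (K * 0)"
    by (intro tendsto_ennrealI tendsto_intros LIMSEQ_power_zero) auto
  then have h: "(\<lambda>m. ennreal (K * (1 / 2) ^ m)) \<longlonglongrightarrow> 0" by simp
  show "(\<lambda>m. Lp_energy p M (\<lambda>x. (\<Sum>k<m. f k x) - (\<Sum>k. f k x))) \<longlonglongrightarrow> 0"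
    by (rule tendsto_sandwich[OF _ _ tendsto_const h]) (use le in auto)
  \<comment> \<open>For m = 0 the partial sum is empty, so the tail estimate bounds the whole
    sum.\<close>
  have "Lp_energy p M (\<lambda>x. \<Sum>k. f k x) < \<infinity>"
    using le[of 0] by (simp add: Lp_energy_def le_less_trans[OF _ ennreal_less_top])
  then show "(\<lambda>x. \<Sum>k. f k x) \<in> Lp_space p M" by (simp add: Lp_space_def)
qed

lemma geometric_energy_integrable:
  fixes f :: "nat \<Rightarrow> 'a \<Rightarrow> 'b::euclidean_space"
  assumes m[measurable]: "\<And>k. f k \<in> borel_measurable M" and f: "geometric_energy 1 M f"
  shows "integrable M (\<lambda>x. \<Sum>k. f k x)" "integrable M (f k)" "summable (\<lambda>k. \<integral>x. norm (f k x) \<partial>M)"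
proof -
  show "integrable M (\<lambda>x. \<Sum>k. f k x)"
    using geometric_energy_partial_sums(2)[OF m zero_less_one f] by (auto simp: Lp_space_def Lp_energy_def integrable_iff_bounded)
  obtain C where C: "C \<ge> 0" "\<And>k. (\<integral>\<^sup>+x. ennreal (norm (f k x)) \<partial>M) \<le> ennreal (C * (1 / 2) ^ k)"
    using f unfolding geometric_energy_def Lp_energy_def by auto
  show i: "integrable M (f k)" for k
    using C(2)[of k] by (simp add: integrable_iff_bounded le_less_trans[OF _ ennreal_less_top])
  have "(\<integral>x. norm (f k x) \<partial>M) \<le> C * (1 / 2) ^ k" for k
  proof -
    have "(\<integral>\<^sup>+x. ennreal (norm (f k x)) \<partial>M) = ennreal (\<integral>x. norm (f k x) \<partial>M)"
      by (rule nn_integral_eq_integral[OF integrable_norm[OF i]]) simp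
    then have "ennreal (\<integral>x. norm (f k x) \<partial>M) \<le> ennreal (C * (1 / 2) ^ k)"
      using C(2)[of k] by simp
    then show ?thesis using C(1) by (simp add: ennreal_le_iff)
  qed
  then have "\<exists>N. \<forall>k\<ge>N. norm (\<integral>x. norm (f k x) \<partial>M) \<le> C * (1 / 2) ^ k" by simp
  then show "summable (\<lambda>k. \<integral>x. norm (f k x) \<partial>M)"
    by (rule summable_comparison_test) (intro summable_mult summable_geometric, simp)
qed

lemma integral_bounded_mult_suminf:
  fixes f :: "nat \<Rightarrow> 'a \<Rightarrow> 'b::euclidean_space"
  assumes m[measurable]: "\<And>k. f k \<in> borel_measurable M" "\<psi> \<in> borel_measurable M" and f: "geometric_energy 1 M f"
    and B: "\<And>x. \<bar>\<psi> x\<bar> \<le> B"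
  shows "(\<lambda>k. \<integral>x. \<psi> x *\<^sub>R f k x \<partial>M) sums (\<integral>x. \<psi> x *\<^sub>R (\<Sum>k. f k x) \<partial>M)"
proof -
  note fi = geometric_energy_integrable[OF m(1) f]
  have B0: "0 \<le> B" using B[of undefined] by linarith
  have i: "integrable M (\<lambda>x. \<psi> x *\<^sub>R f k x)" for k
    by (rule Bochner_Integration.integrable_bound[where f="\<lambda>x. B *\<^sub>R f k x"])
      (use fi(2) B B0 in \<open>auto intro!: mult_right_mono\<close>)
  have AEs: "AE x in M. summable (\<lambda>k. norm (f k x))"
    by (rule geometric_energy_tail(1)[OF m(1) _ f]) auto
  have "(\<lambda>k. \<integral>x. \<psi> x *\<^sub>R f k x \<partial>M) sums (\<integral>x. (\<Sum>k. \<psi> x *\<^sub>R f k x) \<partial>M)"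
  proof (rule sums_integral[OF i])
    show "AE x in M. summable (\<lambda>k. norm (\<psi> x *\<^sub>R f k x))"
      using AEs by eventually_elim (auto intro: summable_mult)
    show "summable (\<lambda>k. \<integral>x. norm (\<psi> x *\<^sub>R f k x) \<partial>M)"
    proof (rule summable_comparison_test[OF _ summable_mult[OF fi(3), of B]])
      have "(\<integral>x. norm (\<psi> x *\<^sub>R f k x) \<partial>M) \<le> (\<integral>x. B * norm (f k x) \<partial>M)" for k
        by (rule integral_mono[OF integrable_norm[OF i]]) (use fi(2)[of k] B in \<open>auto intro!: mult_right_mono\<close>)
      then show "\<exists>N. \<forall>k\<ge>N. norm (\<integral>x. norm (\<psi> x *\<^sub>R f k x) \<partial>M) \<le> B * (\<integral>x. norm (f k x) \<partial>M)"
        by (intro exI[of _ 0]) simp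
    qed
  qed
  also have "(\<integral>x. (\<Sum>k. \<psi> x *\<^sub>R f k x) \<partial>M) = (\<integral>x. \<psi> x *\<^sub>R (\<Sum>k. f k x) \<partial>M)"
  proof (rule integral_cong_AE)
    show "AE x in M. (\<Sum>k. \<psi> x *\<^sub>R f k x) = \<psi> x *\<^sub>R (\<Sum>k. f k x)"
      using AEs by eventually_elim (auto dest: summable_norm_cancel intro: suminf_scaleR_right[symmetric])
  qed measurable
  finally show ?thesis .
qed

text \<open>Test functions and their derivatives are bounded, so decay of the L^1 energies lets the
  sum pass through both integrals, and term by term the identity holds for classical
  derivatives.\<close>

lemma has_weak_derivative_series:
  fixes f :: "nat \<Rightarrow> 'a::euclidean_space \<Rightarrow> 'b::euclidean_space"
  assumes \<Omega>: "open \<Omega>" "bounded \<Omega>" and f: "\<And>k. Ck (Suc 0) (f k)"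
    and e: "geometric_energy 1 (lebesgue_on \<Omega>) f" "geometric_energy 1 (lebesgue_on \<Omega>) (\<lambda>k. dderiv v (f k))"
  shows "has_weak_derivative \<Omega> v (\<lambda>x. \<Sum>k. f k x) (\<lambda>x. \<Sum>k. dderiv v (f k) x)"
proof (rule has_weak_derivativeI)
  show s: "\<Omega> \<in> sets lebesgue" using \<Omega> by auto
  have m: "f k \<in> borel_measurable (lebesgue_on \<Omega>)" "dderiv v (f k) \<in> borel_measurable (lebesgue_on \<Omega>)" for k
    by (intro continuous_borel_measurable_lebesgue_on Ck_continuous[OF f] Ck_continuous[OF Ck_dd[OF f]])+
  show "integrable (lebesgue_on \<Omega>) (\<lambda>x. \<Sum>k. f k x)" "integrable (lebesgue_on \<Omega>) (\<lambda>x. \<Sum>k. dderiv v (f k) x)"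
    by (rule geometric_energy_integrable(1)[OF m(1) e(1)], rule geometric_energy_integrable(1)[OF m(2) e(2)])
  fix \<phi> assume t: "test_function \<Omega> \<phi>"
  obtain B where B: "\<And>x. \<bar>\<phi> x\<bar> \<le> B \<and> \<bar>dderiv v \<phi> x\<bar> \<le> B" using test_function_props(3)[OF t] by blast
  have \<phi>: "Ck (Suc 0) \<phi>" by (rule test_function_props(1)[OF t])
  have m\<phi>: "\<phi> \<in> borel_measurable (lebesgue_on \<Omega>)" "dderiv v \<phi> \<in> borel_measurable (lebesgue_on \<Omega>)"
    by (intro continuous_borel_measurable_lebesgue_on Ck_continuous[OF \<phi>] Ck_continuous[OF Ck_dd[OF \<phi>]])+
  have 1: "(\<lambda>k. \<integral>x. dderiv v \<phi> x *\<^sub>R f k x \<partial>lebesgue_on \<Omega>) sums (\<integral>x. dderiv v \<phi> x *\<^sub>R (\<Sum>k. f k x) \<partial>lebesgue_on \<Omega>)"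
    by (rule integral_bounded_mult_suminf[OF m(1) m\<phi>(2) e(1)]) (use B in auto)
  have "(\<lambda>k. \<integral>x. \<phi> x *\<^sub>R dderiv v (f k) x \<partial>lebesgue_on \<Omega>) sums (\<integral>x. \<phi> x *\<^sub>R (\<Sum>k. dderiv v (f k) x) \<partial>lebesgue_on \<Omega>)"
    by (rule integral_bounded_mult_suminf[OF m(2) m\<phi>(1) e(2)]) (use B in auto)
  from sums_minus[OF this]
  have "(\<lambda>k. \<integral>x. dderiv v \<phi> x *\<^sub>R f k x \<partial>lebesgue_on \<Omega>) sums - (\<integral>x. \<phi> x *\<^sub>R (\<Sum>k. dderiv v (f k) x) \<partial>lebesgue_on \<Omega>)"
    by (simp add: has_weak_derivativeD[OF has_weak_derivative_Ck[OF \<Omega> f] t s])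
  with 1 show "(\<integral>x. dderiv v \<phi> x *\<^sub>R (\<Sum>k. f k x) \<partial>lebesgue_on \<Omega>) = - (\<integral>x. \<phi> x *\<^sub>R (\<Sum>k. dderiv v (f k) x) \<partial>lebesgue_on \<Omega>)"
    by (rule sums_unique2)
qed

lemma bounded_Lp_space:
  fixes f :: "'a \<Rightarrow> 'b::euclidean_space"
  assumes "f \<in> borel_measurable M" "emeasure M (space M) < \<infinity>" "\<And>x. x \<in> space M \<Longrightarrow> norm (f x) \<le> B" "0 \<le> p"
  shows "Lp_energy p M f \<le> ennreal (B powr p) * emeasure M (space M)" "f \<in> Lp_space p M"
proof -
  have "Lp_energy p M f \<le> (\<integral>\<^sup>+x. ennreal (B powr p) \<partial>M)"
    unfolding Lp_energy_def by (intro nn_integral_mono ennreal_leI powr_mono2) (use assms in auto)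
  then show 1: "Lp_energy p M f \<le> ennreal (B powr p) * emeasure M (space M)" by simp
  also have "\<dots> < \<infinity>" using assms(2) by (simp add: ennreal_mult_less_top)
  finally show "f \<in> Lp_space p M" using assms(1) by (simp add: Lp_space_def)
qed

lemma emeasure_lebesgue_on_bounded:
  "bounded \<Omega> \<Longrightarrow> \<Omega> \<in> sets lebesgue \<Longrightarrow> emeasure (lebesgue_on \<Omega>) (space (lebesgue_on \<Omega>)) < \<infinity>"
  using fmeasurableD2[OF bounded_set_imp_lmeasurable, of \<Omega>]
  by (simp add: emeasure_restrict_space space_restrict_space less_top del: emeasure_completion)

lemma Ck_Lp_space:
  fixes f :: "'a::euclidean_space \<Rightarrow> 'b::euclidean_space"
  assumes "open \<Omega>" "bounded \<Omega>" "continuous_on UNIV f" "0 \<le> p"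
  shows "f \<in> Lp_space p (lebesgue_on \<Omega>)"
proof -
  obtain B where B: "\<And>x. x \<in> \<Omega> \<Longrightarrow> norm (f x) \<le> B" using continuous_bounded_on[OF assms(2,3)] by blast
  show ?thesis
    by (rule bounded_Lp_space(2)[OF continuous_borel_measurable_lebesgue_on[OF assms(3)] emeasure_lebesgue_on_bounded, where B=B])
      (use assms B in \<open>auto simp: space_restrict_space\<close>)
qed

lemma Ck_sobolev_1:
  fixes f :: "'a::euclidean_space \<Rightarrow> 'b::euclidean_space"
  assumes "open \<Omega>" "bounded \<Omega>" "Ck (Suc 0) f" "0 \<le> p"
  shows "f \<in> sobolev 1 p \<Omega>"
  using Ck_Lp_space[OF assms(1,2) Ck_continuous[OF assms(3)] assms(4)] has_weak_derivative_Ck[OF assms(1-3)]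
    Ck_Lp_space[OF assms(1,2) Ck_continuous[OF Ck_dd[OF assms(3)]] assms(4)] by auto

text \<open>Exponent 1 is asked besides \<open>p\<close> because weak derivatives are tested by
  integrals, while \<open>p\<close> controls the norms. The partial sums are C^1, which makes them
  candidates for the approximating sequence in the definition of the trace.\<close>

lemma sobolev_series:
  fixes f :: "nat \<Rightarrow> 'a::euclidean_space \<Rightarrow> 'b::euclidean_space"
  assumes \<Omega>: "open \<Omega>" "bounded \<Omega>" and p: "1 \<le> p" and f: "\<And>k. Ck (Suc 0) (f k)"
    and e: "\<And>q. q \<in> {1, p} \<Longrightarrow> geometric_energy q (lebesgue_on \<Omega>) f"
      "\<And>q b. q \<in> {1, p} \<Longrightarrow> b \<in> Basis \<Longrightarrow> geometric_energy q (lebesgue_on \<Omega>) (\<lambda>k. dderiv b (f k))"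
  shows "(\<lambda>x. \<Sum>k. f k x) \<in> sobolev 1 p \<Omega>"
    and "W1_tendsto p \<Omega> (\<lambda>m x. \<Sum>k<m. f k x) (\<lambda>x. \<Sum>k. f k x)"
proof -
  have s: "\<Omega> \<in> sets lebesgue" using \<Omega> by auto
  have m: "f k \<in> borel_measurable (lebesgue_on \<Omega>)" "dderiv v (f k) \<in> borel_measurable (lebesgue_on \<Omega>)" for k v
    by (intro continuous_borel_measurable_lebesgue_on Ck_continuous[OF f] Ck_continuous[OF Ck_dd[OF f]])+
  have p0: "0 < p" using p by simp
  have h: "has_weak_derivative \<Omega> b (\<lambda>x. \<Sum>k. f k x) (\<lambda>x. \<Sum>k. dderiv b (f k) x)" if "b \<in> Basis" for b
    by (rule has_weak_derivative_series[OF \<Omega> f]) (use e that in auto)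
  have L: "(\<lambda>x. \<Sum>k. f k x) \<in> Lp_space p (lebesgue_on \<Omega>)"
    by (rule geometric_energy_partial_sums(2)[OF m(1) p0]) (use e in auto)
  have Ld: "(\<lambda>x. \<Sum>k. dderiv b (f k) x) \<in> Lp_space p (lebesgue_on \<Omega>)" if "b \<in> Basis" for b
    by (rule geometric_energy_partial_sums(2)[OF m(2) p0]) (use e that in auto)
  show "(\<lambda>x. \<Sum>k. f k x) \<in> sobolev 1 p \<Omega>" using h L Ld by auto
  show "W1_tendsto p \<Omega> (\<lambda>m x. \<Sum>k<m. f k x) (\<lambda>x. \<Sum>k. f k x)"
    unfolding W1_tendsto_def
  proof (intro conjI ballI)
    show "(\<lambda>m. Lp_energy p (lebesgue_on \<Omega>) (\<lambda>x. (\<Sum>k<m. f k x) - (\<Sum>k. f k x))) \<longlonglongrightarrow> 0"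
      by (rule geometric_energy_partial_sums(1)[OF m(1) p0]) (use e in auto)
    fix b :: 'a assume b: "b \<in> Basis"
    have "(\<lambda>m. Lp_energy p (lebesgue_on \<Omega>) (\<lambda>x. (\<Sum>k<m. dderiv b (f k) x) - (\<Sum>k. dderiv b (f k) x))) \<longlonglongrightarrow> 0"
      by (rule geometric_energy_partial_sums(1)[OF m(2) p0]) (use e b in auto)
    moreover have "has_weak_derivative \<Omega> b (\<lambda>x. (\<Sum>k<m. f k x) - (\<Sum>k. f k x)) (\<lambda>x. (\<Sum>k<m. dderiv b (f k) x) - (\<Sum>k. dderiv b (f k) x))" for m
    proof (rule has_weak_derivative_diff[OF s _ _ _ _ _ h[OF b]])
      have C: "Ck (Suc 0) (\<lambda>x. \<Sum>k<m. f k x)" by (intro Ck_sum f)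
      have d: "dderiv b (\<lambda>x. \<Sum>k<m. f k x) = (\<lambda>x. \<Sum>k<m. dderiv b (f k) x)"
        by (rule ext) (intro dderiv_sum Ck_differentiable[OF f])
      show "has_weak_derivative \<Omega> b (\<lambda>x. \<Sum>k<m. f k x) (\<lambda>x. \<Sum>k<m. dderiv b (f k) x)"
        using has_weak_derivative_Ck[OF \<Omega> C, of b] by (simp only: d)
      show "integrable (lebesgue_on \<Omega>) (\<lambda>x. \<Sum>k<m. f k x)"
        by (intro integrable_continuous_bounded \<Omega> s Ck_continuous[OF C])
      show "integrable (lebesgue_on \<Omega>) (\<lambda>x. \<Sum>k<m. dderiv b (f k) x)"
        using integrable_continuous_bounded[OF \<Omega>(2) s Ck_continuous[OF Ck_dd[OF C]], of b] by (simp only: d)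
      show "integrable (lebesgue_on \<Omega>) (\<lambda>x. \<Sum>k. f k x)"
        by (rule geometric_energy_integrable(1)[OF m(1)]) (use e in auto)
      show "integrable (lebesgue_on \<Omega>) (\<lambda>x. \<Sum>k. dderiv b (f k) x)"
        by (rule geometric_energy_integrable(1)[OF m(2)]) (use e b in auto)
    qed
    ultimately show "\<exists>\<psi>. (\<forall>m. has_weak_derivative \<Omega> b (\<lambda>x. (\<Sum>k<m. f k x) - (\<Sum>k. f k x)) (\<psi> m)) \<and>
        (\<lambda>m. Lp_energy p (lebesgue_on \<Omega>) (\<psi> m)) \<longlonglongrightarrow> 0" 
      by (intro exI[of _ "\<lambda>m x. (\<Sum>k<m. dderiv b (f k) x) - (\<Sum>k. dderiv b (f k) x)"]) blast
  qed
qed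

section \<open>Mollification\<close>

lemma deriv_bound_rate_mono: "deriv_bound j l C f x \<Longrightarrow> l \<le> l' \<Longrightarrow> 0 \<le> l' \<Longrightarrow> deriv_bound j l' C f x"
proof (induction j arbitrary: C f)
  case (Suc j)
  have C: "\<bar>f x\<bar> \<le> C" using Suc.prems by simp
  then have "C * l \<le> C * l'" using Suc.prems(2) by (intro mult_left_mono) auto
  with Suc.IH[OF _ Suc.prems(2,3)] Suc.prems have "deriv_bound j l' (C * l') (dderiv b f) x" if "b \<in> Basis" for b
    using that deriv_bound_mono[of j l' "C * l" "dderiv b f" x "C * l'"] by auto
  with C show ?case by simp
qed simp

text \<open>A fixed box as domain lets differentiation under the integral take place over a compact
  set. For a kernel supported in the \<epsilon>-ball this is the full convolution at points whose
  \<epsilon>-ball lies in the box.\<close>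

definition conv :: "'a::euclidean_space \<Rightarrow> 'a \<Rightarrow> ('a \<Rightarrow> real) \<Rightarrow> ('a \<Rightarrow> real) \<Rightarrow> 'a \<Rightarrow> real" where
  "conv a b \<kappa> f x = integral (cbox a b) (\<lambda>y. \<kappa> (x - y) * f y)"

lemma continuous_on_conv_kernel:
  fixes \<kappa> f :: "'a::euclidean_space \<Rightarrow> real"
  assumes "continuous_on UNIV \<kappa>" "continuous_on UNIV f"
  shows "continuous_on S (\<lambda>(x, y). \<kappa> (x - y) * f y)" "continuous_on T (\<lambda>y. \<kappa> (x - y) * f y)"
proof -
  show "continuous_on S (\<lambda>(x, y). \<kappa> (x - y) * f y)" unfolding split_beta
    by (intro continuous_intros continuous_on_compose2[OF assms(1)] continuous_on_compose2[OF assms(2)]) auto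
  show "continuous_on T (\<lambda>y. \<kappa> (x - y) * f y)"
    by (intro continuous_intros continuous_on_compose2[OF assms(1)] continuous_on_subset[OF assms(2)]) auto
qed

lemma has_derivative_conv:
  fixes \<kappa> f :: "'a::euclidean_space \<Rightarrow> real"
  assumes \<kappa>: "Ck (Suc 0) \<kappa>" and f: "continuous_on UNIV f"
  shows "(conv a b \<kappa> f has_derivative (\<lambda>v. conv a b (dderiv v \<kappa>) f x)) (at x)"
proof -
  define F where "F x y = Blinfun (\<lambda>v. dderiv v \<kappa> (x - y) * f y)" for x y
  have lin: "bounded_linear (\<lambda>v. dderiv v \<kappa> z)" for z
    using Ck_has_derivative[OF \<kappa>] by (rule has_derivative_bounded_linear)
  have F: "blinfun_apply (F x y) = (\<lambda>v. dderiv v \<kappa> (x - y) * f y)" for x y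
    unfolding F_def by (rule bounded_linear_Blinfun_apply) (intro bounded_linear_mult_const lin)
  have cF: "continuous_on S (\<lambda>(x, y). F x y)" for S
    by (rule continuous_on_blinfun_componentwise)
      (use continuous_on_conv_kernel(1)[OF Ck_continuous[OF Ck_dd[OF \<kappa>]] f] in \<open>simp add: split_beta F\<close>)
  have "((\<lambda>x. integral (cbox a b) (\<lambda>y. \<kappa> (x - y) * f y)) has_derivative blinfun_apply (integral (cbox a b) (F x))) (at x within UNIV)"
  proof (rule leibniz_rule)
    fix x y assume "y \<in> cbox a b"
    have "((\<lambda>x. \<kappa> (x - y)) has_derivative (\<lambda>v. dderiv v \<kappa> (x - y))) (at x)"
      by (rule has_derivative_compose[OF _ Ck_has_derivative[OF \<kappa>]]) (auto intro!: derivative_eq_intros)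
    then show "((\<lambda>x. \<kappa> (x - y) * f y) has_derivative blinfun_apply (F x y)) (at x within UNIV)"
      unfolding F by (rule has_derivative_mult_left)
  next
    show "(\<lambda>y. \<kappa> (x - y) * f y) integrable_on cbox a b" for x
      by (intro integrable_continuous continuous_on_conv_kernel(2) Ck_continuous[OF \<kappa>] f)
  qed (auto intro: cF)
  moreover have "blinfun_apply (integral (cbox a b) (F x)) = (\<lambda>v. conv a b (dderiv v \<kappa>) f x)"
  proof
    fix v
    have "F x integrable_on cbox a b"
      using continuous_on_compose2[OF cF[of UNIV] continuous_on_Pair[OF continuous_on_const continuous_on_id]]
      by (intro integrable_continuous) auto
    then show "blinfun_apply (integral (cbox a b) (F x)) v = conv a b (dderiv v \<kappa>) f x"
      using blinfun_apply_integral[of "F x" "cbox a b" v] unfolding conv_def F by simp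
  qed
  ultimately show ?thesis by (simp add: conv_def[abs_def])
qed

lemma dderiv_conv: "Ck (Suc 0) \<kappa> \<Longrightarrow> continuous_on UNIV f \<Longrightarrow> dderiv v (conv a b \<kappa> f) = conv a b (dderiv v \<kappa>) f"
  by (rule ext) (rule dderiv_eqI[OF has_derivative_conv])

lemma Ck_conv: "Ck k \<kappa> \<Longrightarrow> continuous_on UNIV f \<Longrightarrow> Ck k (conv a b \<kappa> f)"
proof (induction k arbitrary: \<kappa>)
  case 0
  then show ?case unfolding conv_def[abs_def]
    by (simp add: integral_continuous_on_param continuous_on_conv_kernel)
next
  case (Suc k)
  show ?case
    by (rule Ck_SucI[OF has_derivative_conv[OF Ck_mono[OF Suc.prems(1)] Suc.prems(2)]])
      (use Suc.IH[OF Ck_dd[OF Suc.prems(1)] Suc.prems(2)] in \<open>auto simp: eta_contract_eq\<close>)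
qed

lemma conv_eq_lborel:
  fixes \<kappa> f :: "'a::euclidean_space \<Rightarrow> real"
  assumes c: "continuous_on UNIV \<kappa>" "continuous_on UNIV f" and \<kappa>: "\<And>z. \<epsilon> < norm z \<Longrightarrow> \<kappa> z = 0"
    and Q: "cball x \<epsilon> \<subseteq> cbox a b"
  shows "integrable lborel (\<lambda>y. \<kappa> (x - y) * f y)" "conv a b \<kappa> f x = (\<integral>y. \<kappa> (x - y) * f y \<partial>lborel)"
proof -
  have i: "integrable lborel (\<lambda>y. indicator (cbox a b) y *\<^sub>R (\<kappa> (x - y) * f y))"
    by (intro borel_integrable_compact compact_cbox continuous_on_conv_kernel c)
  have e: "(\<lambda>y. indicator (cbox a b) y *\<^sub>R (\<kappa> (x - y) * f y)) = (\<lambda>y. \<kappa> (x - y) * f y)"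
  proof
    fix y
    have "y \<notin> cball x \<epsilon>" if "y \<notin> cbox a b" using that Q by blast
    then show "indicator (cbox a b) y *\<^sub>R (\<kappa> (x - y) * f y) = \<kappa> (x - y) * f y"
      using \<kappa>[of "x - y"] by (cases "y \<in> cbox a b") (auto simp: dist_norm)
  qed
  show "integrable lborel (\<lambda>y. \<kappa> (x - y) * f y)" using i by (simp only: e)
  have "(LINT y:cbox a b|lborel. \<kappa> (x - y) * f y) = conv a b \<kappa> f x"
    unfolding conv_def by (rule set_borel_integral_eq_integral(2)) (use i in \<open>simp add: set_integrable_def\<close>)
  then show "conv a b \<kappa> f x = (\<integral>y. \<kappa> (x - y) * f y \<partial>lborel)"
    unfolding set_lebesgue_integral_def by (simp only: e)
qed

lemma conv_bound:
  fixes \<kappa> f :: "'a::euclidean_space \<Rightarrow> real"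
  assumes c: "continuous_on UNIV \<kappa>" "continuous_on UNIV f" and \<kappa>: "\<And>z. \<epsilon> < norm z \<Longrightarrow> \<kappa> z = 0"
    and Q: "cball x \<epsilon> \<subseteq> cbox a b" and \<epsilon>: "0 \<le> \<epsilon>"
    and A: "\<And>z. \<bar>\<kappa> z\<bar> \<le> A" and F: "\<And>y. y \<in> cball x \<epsilon> \<Longrightarrow> \<bar>f y\<bar> \<le> F"
  shows "\<bar>conv a b \<kappa> f x\<bar> \<le> A * (F * (unit_ball_vol (real DIM('a)) * \<epsilon> ^ DIM('a)))"
proof -
  have L: "integrable lborel (\<lambda>y. \<kappa> (x - y) * f y)" "conv a b \<kappa> f x = (\<integral>y. \<kappa> (x - y) * f y \<partial>lborel)"
    using conv_eq_lborel[OF c _ Q] \<kappa> by auto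
  have A0: "0 \<le> A" using A[of 0] by linarith
  have F0: "0 \<le> F" using F[of x] \<epsilon> by force
  have "\<bar>conv a b \<kappa> f x\<bar> \<le> (\<integral>y. \<bar>\<kappa> (x - y) * f y\<bar> \<partial>lborel)"
    using integral_norm_bound[of lborel "\<lambda>y. \<kappa> (x - y) * f y"] by (simp add: L(2))
  also have "\<dots> \<le> (\<integral>y. A * F * indicator (cball x \<epsilon>) y \<partial>lborel)"
  proof (rule integral_mono)
    show "integrable lborel (\<lambda>y. A * F * indicator (cball x \<epsilon>) y)"
      by (intro integrable_mult_right integrable_real_indicator) (auto simp: emeasure_cball \<epsilon>)
    show "\<bar>\<kappa> (x - y) * f y\<bar> \<le> A * F * indicator (cball x \<epsilon>) y" for y
    proof (cases "y \<in> cball x \<epsilon>")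
      case True
      then show ?thesis using A[of "x - y"] F[OF True] by (simp add: abs_mult mult_mono')
    next
      case False
      then show ?thesis using \<kappa>[of "x - y"] by (simp add: dist_norm)
    qed
  qed (use L(1) in auto)
  also have "\<dots> = A * F * measure lborel (cball x \<epsilon>)" by simp
  also have "\<dots> = A * (F * (unit_ball_vol (real DIM('a)) * \<epsilon> ^ DIM('a)))"
    using \<epsilon> by (simp add: content_cball)
  finally show ?thesis .
qed

text \<open>All derivatives fall on the kernel, hence \<open>f\<close> enters only through its size
  on the ball about \<open>x\<close>. This locality allows a different affine function to be
  subtracted at each point.\<close>

lemma conv_bd:
  fixes \<kappa> f :: "'a::euclidean_space \<Rightarrow> real"
  assumes "Ck j \<kappa>" and f: "continuous_on UNIV f" and "\<And>z. \<epsilon> < norm z \<Longrightarrow> \<kappa> z = 0"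
    and Q: "cball x \<epsilon> \<subseteq> cbox a b" and \<epsilon>: "0 \<le> \<epsilon>"
    and "\<And>z. deriv_bound j l A \<kappa> z" and F: "\<And>y. y \<in> cball x \<epsilon> \<Longrightarrow> \<bar>f y\<bar> \<le> F"
  shows "deriv_bound j l (A * (F * (unit_ball_vol (real DIM('a)) * \<epsilon> ^ DIM('a)))) (conv a b \<kappa> f) x"
  using assms(1,3,6)
proof (induction j arbitrary: A \<kappa>)
  case 0
  show ?case
    using conv_bound[OF Ck_continuous[OF 0(1)] f _ Q \<epsilon> _ F] 0 by simp
next
  case (Suc j)
  note \<kappa> = Suc.prems(1)
  let ?W = "F * (unit_ball_vol (real DIM('a)) * \<epsilon> ^ DIM('a))"
  have "\<bar>conv a b \<kappa> f x\<bar> \<le> A * ?W"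
    by (rule conv_bound[OF Ck_continuous[OF \<kappa>] f _ Q \<epsilon> _ F]) (use Suc.prems deriv_bound_abs in blast)+
  moreover have "deriv_bound j l (A * l * ?W) (conv a b (dderiv v \<kappa>) f) x" if v: "v \<in> Basis" for v
  proof (rule Suc.IH[OF Ck_dd[OF \<kappa>]])
    show "dderiv v \<kappa> z = 0" if "\<epsilon> < norm z" for z
      by (rule dderiv_eq_0_open[of "- cball 0 \<epsilon>"]) (use that Suc.prems(2) in auto)
    show "deriv_bound j l (A * l) (dderiv v \<kappa>) z" for z using Suc.prems(3)[of z] v by simp
  qed
  ultimately show ?case by (simp add: dderiv_conv[OF Ck_mono[OF \<kappa>] f] ac_simps)
qed

lemma conv_diff:
  fixes \<kappa> f h :: "'a::euclidean_space \<Rightarrow> real"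
  assumes c: "continuous_on UNIV \<kappa>" "continuous_on UNIV f" "continuous_on UNIV h"
  shows "conv a b \<kappa> (\<lambda>y. f y - h y) x = conv a b \<kappa> f x - conv a b \<kappa> h x"
  unfolding conv_def right_diff_distrib
  by (rule integral_diff) (intro integrable_continuous continuous_on_conv_kernel(2) c)+

lemma lborel_integral_reflect:
  fixes h :: "'a::euclidean_space \<Rightarrow> real"
  assumes [measurable]: "h \<in> borel_measurable borel"
  shows "(\<integral>y. h (x - y) \<partial>lborel) = (\<integral>z. h z \<partial>lborel)"
proof -
  have "lborel = distr lborel borel (\<lambda>y::'a. x + (-1) *\<^sub>R y)"
    using lborel_affine[of "-1" x] by (simp add: density_1)
  then have "(\<integral>z. h z \<partial>lborel) = (\<integral>z. h z \<partial>distr lborel borel (\<lambda>y. x + (-1) *\<^sub>R y))" by simp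
  also have "\<dots> = (\<integral>y. h (x + (-1) *\<^sub>R y) \<partial>lborel)" by (rule integral_distr) auto
  finally show ?thesis by simp
qed

text \<open>Evenness of the kernel cancels the linear part about \<open>x\<close>, and mass one
  keeps the value. Reproduction of affine functions is the source of the second-order accuracy of
  the mollification.\<close>

lemma conv_affine_form:
  fixes \<kappa> :: "'a::euclidean_space \<Rightarrow> real"
  assumes c: "continuous_on UNIV \<kappa>" and \<kappa>: "\<And>z. \<epsilon> < norm z \<Longrightarrow> \<kappa> z = 0"
    and Q: "cball x \<epsilon> \<subseteq> cbox a b"
    and even: "\<And>z. \<kappa> (- z) = \<kappa> z" and one: "(\<integral>z. \<kappa> z \<partial>lborel) = 1"
  shows "conv a b \<kappa> (\<lambda>y. \<alpha> + w \<bullet> (y - p)) x = \<alpha> + w \<bullet> (x - p)"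
proof -
  have z: "(\<lambda>y. indicator (cball 0 \<epsilon>) y *\<^sub>R (\<kappa> y * h y)) = (\<lambda>y. \<kappa> y * h y)" for h
    using \<kappa> by (auto simp: fun_eq_iff indicator_def not_le)
  have i: "integrable lborel (\<lambda>y. \<kappa> y * h y)" if "continuous_on UNIV h" for h
  proof -
    have "integrable lborel (\<lambda>y. indicator (cball 0 \<epsilon>) y *\<^sub>R (\<kappa> y * h y))"
      by (intro borel_integrable_compact compact_cball continuous_intros continuous_on_subset[OF c] continuous_on_subset[OF that]) auto
    then show ?thesis by (simp only: z)
  qed
  have [measurable]: "\<kappa> \<in> borel_measurable borel" using c by (rule borel_measurable_continuous_onI)
  have "(\<integral>z. \<kappa> (0 - z) * (w \<bullet> (0 - z)) \<partial>lborel) = (\<integral>z. \<kappa> z * (w \<bullet> z) \<partial>lborel)"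
    by (rule lborel_integral_reflect[of "\<lambda>z. \<kappa> z * (w \<bullet> z)" 0]) measurable
  then have odd: "(\<integral>z. \<kappa> z * (w \<bullet> z) \<partial>lborel) = 0" by (simp add: even)
  have "conv a b \<kappa> (\<lambda>y. \<alpha> + w \<bullet> (y - p)) x = (\<integral>y. \<kappa> (x - y) * (\<alpha> + w \<bullet> (y - p)) \<partial>lborel)"
    by (rule conv_eq_lborel(2)[OF c _ \<kappa> Q]) (intro continuous_intros)
  also have "\<dots> = (\<integral>y. (\<lambda>z. \<kappa> z * (\<alpha> + w \<bullet> (x - z - p))) (x - y) \<partial>lborel)" by simp
  also have "\<dots> = (\<integral>z. \<kappa> z * (\<alpha> + w \<bullet> (x - z - p)) \<partial>lborel)"
    by (rule lborel_integral_reflect) measurable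
  also have "\<dots> = (\<integral>z. (\<alpha> + w \<bullet> (x - p)) * \<kappa> z - \<kappa> z * (w \<bullet> z) \<partial>lborel)"
    by (intro Bochner_Integration.integral_cong) (auto simp: algebra_simps inner_diff_right)
  also have "\<dots> = \<alpha> + w \<bullet> (x - p)"
    using i[of "\<lambda>_. 1"] i[OF continuous_on_inner[OF continuous_on_const continuous_on_id], of w]
    by (subst Bochner_Integration.integral_diff) (auto simp: one odd)
  finally show ?thesis .
qed

text \<open>Normalised by its own mass, which is only estimated from below and never computed. The
  form \<open>z - 0\<close> is the shape of \<open>Ck_affine\<close> and
  \<open>deriv_bound_affine\<close>.\<close>

definition moll_kernel :: "real \<Rightarrow> 'a::euclidean_space \<Rightarrow> real" where
  "moll_kernel \<epsilon> z = inverse (\<integral>y. bump ((1 / \<epsilon>) *\<^sub>R (y - 0)) \<partial>(lborel :: 'a measure)) * bump ((1 / \<epsilon>) *\<^sub>R (z - 0))"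

text \<open>On the ball of half the radius the rescaled bump is at least (3/4)^4. The mass is thus
  at least a fixed proportion of the volume of the \<epsilon>-ball, whatever \<epsilon> is.\<close>

lemma bump_scale_mass:
  assumes \<epsilon>: "0 < \<epsilon>"
  shows "(3 / 4) ^ 4 / 2 ^ DIM('a) * (unit_ball_vol (real DIM('a)) * \<epsilon> ^ DIM('a))
    \<le> (\<integral>y. bump ((1 / \<epsilon>) *\<^sub>R (y - 0)) \<partial>(lborel :: 'a::euclidean_space measure))"
    "integrable (lborel :: 'a measure) (\<lambda>y. bump ((1 / \<epsilon>) *\<^sub>R (y - 0)))"
proof -
  let ?h = "\<lambda>y::'a. bump ((1 / \<epsilon>) *\<^sub>R (y - 0))"
  have z: "(\<lambda>y. indicator (cball 0 \<epsilon>) y *\<^sub>R ?h y) = ?h"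
    using \<epsilon> by (auto simp: fun_eq_iff indicator_def field_simps intro!: bump_eq_0)
  have "integrable lborel (\<lambda>y. indicator (cball 0 \<epsilon>) y *\<^sub>R ?h y)"
    by (intro borel_integrable_compact compact_cball Ck_continuous[OF Ck_affine[OF Ck_bump]])
  then show i: "integrable lborel ?h" by (simp only: z)
  have "(3 / 4) ^ 4 / 2 ^ DIM('a) * (unit_ball_vol (real DIM('a)) * \<epsilon> ^ DIM('a))
      = (\<integral>y. (3 / 4) ^ 4 * indicator (cball (0::'a) (\<epsilon> / 2)) y \<partial>lborel)"
    using \<epsilon> by (simp add: content_cball power_divide)
  also have "\<dots> \<le> (\<integral>y. ?h y \<partial>lborel)"
  proof (rule integral_mono[OF _ i])
    show "integrable lborel (\<lambda>y. (3 / 4) ^ 4 * indicator (cball (0::'a) (\<epsilon> / 2)) y :: real)"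
      using \<epsilon> by (intro integrable_mult_right integrable_real_indicator) (auto simp: emeasure_cball)
    fix y :: 'a
    show "(3 / 4) ^ 4 * indicator (cball 0 (\<epsilon> / 2)) y \<le> ?h y"
    proof (cases "y \<in> cball 0 (\<epsilon> / 2)")
      case True
      then have "norm ((1 / \<epsilon>) *\<^sub>R y) \<le> 1 / 2" using \<epsilon> by (simp add: field_simps)
      then have "(norm ((1 / \<epsilon>) *\<^sub>R y))\<^sup>2 \<le> (1 / 2)\<^sup>2" by (intro power_mono) auto
      then have *: "3 / 4 \<le> 1 - ((1 / \<epsilon>) *\<^sub>R y) \<bullet> ((1 / \<epsilon>) *\<^sub>R y)"
        unfolding power2_norm_eq_inner by (simp add: power2_eq_square)
      have "(3 / 4) ^ 4 \<le> pos_power 4 (1 - ((1 / \<epsilon>) *\<^sub>R y) \<bullet> ((1 / \<epsilon>) *\<^sub>R y))"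
        unfolding pos_power_def by (rule power_mono[OF order_trans[OF * max.cobounded2[of _ 0]]]) simp
      then show ?thesis using True by (simp add: bump_def)
    qed (use bump_nonneg in auto)
  qed
  finally show "(3 / 4) ^ 4 / 2 ^ DIM('a) * (unit_ball_vol (real DIM('a)) * \<epsilon> ^ DIM('a)) \<le> (\<integral>y. ?h y \<partial>lborel)" .
qed

lemma moll_kernel:
  fixes z :: "'a::euclidean_space"
  assumes \<epsilon>: "0 < \<epsilon>"
  shows "Ck 3 (moll_kernel \<epsilon> :: 'a \<Rightarrow> real)" "\<epsilon> < norm z \<Longrightarrow> moll_kernel \<epsilon> z = 0" "moll_kernel \<epsilon> (- z) = moll_kernel \<epsilon> z"
    "(\<integral>z. moll_kernel \<epsilon> z \<partial>(lborel :: 'a measure)) = 1"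
proof -
  have "0 < (3 / 4) ^ 4 / 2 ^ DIM('a) * (unit_ball_vol (real DIM('a)) * \<epsilon> ^ DIM('a))" using \<epsilon> by simp
  with bump_scale_mass(1)[OF \<epsilon>, where 'a='a]
  have pos: "0 < (\<integral>y. bump ((1 / \<epsilon>) *\<^sub>R (y - 0)) \<partial>(lborel :: 'a measure))" by linarith
  show "Ck 3 (moll_kernel \<epsilon> :: 'a \<Rightarrow> real)" unfolding moll_kernel_def[abs_def]
    by (intro Ck_mult Ck_const Ck_affine Ck_bump)
  show "\<epsilon> < norm z \<Longrightarrow> moll_kernel \<epsilon> z = 0"
    using \<epsilon> by (auto simp: moll_kernel_def field_simps intro!: bump_eq_0)
  show "moll_kernel \<epsilon> (- z) = moll_kernel \<epsilon> z"
    using bump_minus[of "(1 / \<epsilon>) *\<^sub>R z"] by (simp add: moll_kernel_def)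
  show "(\<integral>z. moll_kernel \<epsilon> z \<partial>(lborel :: 'a measure)) = 1"
    using pos unfolding moll_kernel_def by simp
qed

text \<open>\<open>A\<close> is independent of \<open>\<epsilon>\<close>: the inverse mass of the
  kernel cancels against the volume of the \<epsilon>-ball on which \<open>f\<close> is integrated,
  and only a factor 1/\<epsilon> per derivative is left.\<close>

lemma moll_bd:
  "\<exists>A\<ge>0. \<forall>\<epsilon> a b f (F::real) (x::'a::euclidean_space). 0 < \<epsilon> \<longrightarrow> continuous_on UNIV f \<longrightarrow> cball x \<epsilon> \<subseteq> cbox a b \<longrightarrow>
     (\<forall>y\<in>cball x \<epsilon>. \<bar>f y\<bar> \<le> F) \<longrightarrow> deriv_bound 3 (1 / \<epsilon>) (A * F) (conv a b (moll_kernel \<epsilon>) f) x"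
proof -
  obtain A where A: "0 \<le> A" "\<And>x::'a. deriv_bound 3 1 A bump x" using deriv_bound_bump by blast
  show ?thesis
  proof (intro exI[of _ "A * (2 ^ DIM('a) / (3 / 4) ^ 4)"] conjI allI impI)
    fix \<epsilon> F :: real and a b x :: 'a and f :: "'a \<Rightarrow> real"
    assume \<epsilon>: "0 < \<epsilon>" and f: "continuous_on UNIV f" and Q: "cball x \<epsilon> \<subseteq> cbox a b" and F: "\<forall>y\<in>cball x \<epsilon>. \<bar>f y\<bar> \<le> F"
    let ?W = "unit_ball_vol (real DIM('a)) * \<epsilon> ^ DIM('a)"
    define I where "I = (\<integral>y. bump ((1 / \<epsilon>) *\<^sub>R (y - 0)) \<partial>(lborel :: 'a measure))"
    have I: "(3 / 4) ^ 4 / 2 ^ DIM('a) * ?W \<le> I" unfolding I_def by (rule bump_scale_mass(1)[OF \<epsilon>])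
    have W: "0 < ?W" using \<epsilon> by simp
    then have "0 < (3 / 4) ^ 4 / 2 ^ DIM('a) * ?W" by (intro mult_pos_pos[of "(3 / 4) ^ 4 / 2 ^ DIM('a)" ?W]) auto
    then have I0: "0 < I" using I by linarith
    have "deriv_bound 3 (1 / \<epsilon> * 1) (\<bar>inverse I\<bar> * A) (moll_kernel \<epsilon>) z" for z :: 'a
      unfolding moll_kernel_def[abs_def] I_def[symmetric]
      by (rule deriv_bound_cmult[OF Ck_affine[OF Ck_bump] deriv_bound_affine[OF Ck_bump A(2)]]) (use \<epsilon> in auto)
    then have "deriv_bound 3 (1 / \<epsilon>) (\<bar>inverse I\<bar> * A * (F * ?W)) (conv a b (moll_kernel \<epsilon>) f) x"
      by (intro conv_bd moll_kernel(1,2) \<epsilon> f Q less_imp_le[OF \<epsilon>]) (use F in auto)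
    then show "deriv_bound 3 (1 / \<epsilon>) (A * (2 ^ DIM('a) / (3 / 4) ^ 4) * F) (conv a b (moll_kernel \<epsilon>) f) x"
    proof (rule deriv_bound_mono)
      have F0: "0 \<le> F" using F[rule_format, of x] \<epsilon> by force
      have "?W / I \<le> 2 ^ DIM('a) / (3 / 4) ^ 4" using I I0 by (simp add: field_simps)
      then have le: "A * F * (?W / I) \<le> A * F * (2 ^ DIM('a) / (3 / 4) ^ 4)" using A(1) F0 by (intro mult_left_mono) auto
      have eq: "\<bar>inverse I\<bar> * A * (F * W) = A * F * (W / I)" for W
        using I0 by (simp add: divide_inverse)
      have "\<bar>inverse I\<bar> * A * (F * ?W) = A * F * (?W / I)" by (rule eq)
      also note le
      also have "A * F * (2 ^ DIM('a) / (3 / 4) ^ 4) = A * (2 ^ DIM('a) / (3 / 4) ^ 4) * F" by simp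
      finally show "\<bar>inverse I\<bar> * A * (F * ?W) \<le> A * (2 ^ DIM('a) / (3 / 4) ^ 4) * F" .
    qed (use \<epsilon> in auto)
  qed (use A in auto)
qed

section \<open>The part of the stream function at the boundary\<close>

lemma dderiv_diff: "f differentiable at x \<Longrightarrow> g differentiable at x \<Longrightarrow>
    dderiv v (\<lambda>x. f x - g x) x = dderiv v f x - dderiv v g x"
  by (rule dderiv_eqI) (auto intro!: derivative_intros dderiv_has_derivative)

lemma taylor_lipschitz_gradient:
  fixes g :: "'a::euclidean_space \<Rightarrow> real"
  assumes g: "\<And>y. GDERIV g y :> g' y" and lip: "L-lipschitz_on UNIV g'"
  shows "\<bar>g y - (g x + g' x \<bullet> (y - x))\<bar> \<le> L * (dist x y)\<^sup>2"
proof -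
  have L: "0 \<le> L" using lip by (rule lipschitz_on_nonneg)
  have "norm (g y - g x - (y - x) \<bullet> g' x) \<le> norm (y - x) * (L * dist x y)"
  proof (rule differentiable_bound_linearization[where S="cball x (dist x y)" and f'="\<lambda>z h. h \<bullet> g' z"])
    show "x + t *\<^sub>R (y - x) \<in> cball x (dist x y)" if "t \<in> {0..1}" for t
      using that by (auto simp: dist_norm norm_minus_commute mult_left_le_one_le)
    show "(g has_derivative (\<lambda>h. h \<bullet> g' z)) (at z within cball x (dist x y))" for z
      using g[of z] unfolding gderiv_def by (rule has_derivative_at_withinI)
    show "onorm ((\<lambda>h. h \<bullet> g' z) - (\<lambda>h. h \<bullet> g' x)) \<le> L * dist x y" if z: "z \<in> cball x (dist x y)" for z
    proof (rule onorm_le)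
      fix h
      have "norm (g' z - g' x) \<le> L * dist z x" using lipschitz_onD[OF lip, of z x] by (simp add: dist_norm)
      also have "\<dots> \<le> L * dist x y" using z L by (intro mult_left_mono) (auto simp: dist_commute)
      finally have "norm (g' z - g' x) \<le> L * dist x y" .
      moreover have "\<bar>h \<bullet> (g' z - g' x)\<bar> \<le> norm h * norm (g' z - g' x)" by (rule Cauchy_Schwarz_ineq2)
      ultimately have "\<bar>h \<bullet> (g' z - g' x)\<bar> \<le> norm h * (L * dist x y)"
        by (meson mult_left_mono norm_ge_zero order_trans)
      then show "norm (((\<lambda>h. h \<bullet> g' z) - (\<lambda>h. h \<bullet> g' x)) h) \<le> L * dist x y * norm h"
        by (simp add: inner_diff_right mult.commute)
    qed
  qed auto
  then show ?thesis by (simp add: inner_commute dist_norm norm_minus_commute power2_eq_square ac_simps algebra_simps)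
qed

lemma half_powers:
  "1 / (1 / 2) ^ k = (2::real) ^ k" "((1 / 2 :: real) ^ k)\<^sup>2 = (1 / 4) ^ k"
  "(1 / 4 :: real) ^ k * 2 ^ k = (1 / 2) ^ k" "(1 / 2 :: real) ^ k * 2 ^ k = 1"
  "(1 / 4 :: real) ^ k * (1 / 2) ^ k = (1 / 8) ^ k"
  by (simp_all only: power2_eq_square power_mult_distrib[symmetric]) (simp_all add: power_one_over)

text \<open>The radius \<open>r + 2\<close> leaves room for a unit neighbourhood of each point of
  \<open>cball x0 r\<close> and for mollification radii up to 1 around its points. \<open>A\<close>
  is the constant of \<open>moll_bd\<close>, fixed here so as to be shared by all scales.\<close>

locale graph_mollification =
  fixes g :: "'a::euclidean_space \<Rightarrow> real" and g' :: "'a \<Rightarrow> 'a" and L A r :: real and x0 a b :: 'a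
  assumes g: "\<And>y. GDERIV g y :> g' y" and lip: "L-lipschitz_on UNIV g'"
    and r: "0 < r" and box: "cball x0 (r + 2) \<subseteq> cbox a b" and A0: "0 \<le> A"
    and A: "\<And>\<epsilon> f F x. 0 < \<epsilon> \<Longrightarrow> continuous_on UNIV f \<Longrightarrow> cball x \<epsilon> \<subseteq> cbox a b \<Longrightarrow>
      (\<And>y. y \<in> cball x \<epsilon> \<Longrightarrow> \<bar>f y\<bar> \<le> F) \<Longrightarrow> deriv_bound 3 (1 / \<epsilon>) (A * F) (conv a b (moll_kernel \<epsilon>) f) x"
begin

definition G :: "nat \<Rightarrow> 'a \<Rightarrow> real" where
  "G k = conv a b (moll_kernel ((1 / 2) ^ k)) g"

lemma L0: "0 \<le> L"
  using lip by (rule lipschitz_on_nonneg)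

lemma continuous_g: "continuous_on UNIV g"
  using g unfolding gderiv_def by (meson continuous_at_imp_continuous_on has_derivative_continuous)

lemma Ck_G: "Ck 3 (G k)"
  unfolding G_def by (intro Ck_conv moll_kernel(1) continuous_g) simp

lemma CkG: "Ck (Suc (Suc (Suc 0))) (G k)"
  using Ck_G[of k] by (simp add: eval_nat_numeral)

text \<open>Mollification keeps the affine Taylor polynomial of \<open>g\<close> at
  \<open>x\<close>, and the remainder is at most L \<epsilon>^2 on the \<epsilon>-ball, while each
  derivative costs 1/\<epsilon>. One bound thus says at \<open>x\<close> that values differ by
  O(4^-k) and first derivatives by O(2^-k), that second derivatives stay bounded and that third ones
  are O(2^k).\<close>

lemma G_approx:
  assumes x: "x \<in> cball x0 r"
  shows "deriv_bound 3 (2 ^ k) (A * L * (1 / 4) ^ k) (\<lambda>y. G k y - (g x + g' x \<bullet> (y - x))) x"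
proof -
  define \<epsilon> where "\<epsilon> = (1 / 2 :: real) ^ k"
  have \<epsilon>: "0 < \<epsilon>" "\<epsilon> \<le> 1" by (auto simp: \<epsilon>_def power_le_one)
  define l where "l y = g x + g' x \<bullet> (y - x)" for y
  have cl: "continuous_on UNIV l" unfolding l_def[abs_def] by (intro continuous_intros)
  have sub: "cball y \<epsilon> \<subseteq> cbox a b" if "y \<in> ball x 1" for y
  proof -
    have "cball y \<epsilon> \<subseteq> cball x0 (r + 2)"
    proof
      fix z assume "z \<in> cball y \<epsilon>"
      then show "z \<in> cball x0 (r + 2)"
        using that x \<epsilon>(2) dist_triangle[of x0 z x] dist_triangle[of x z y] by auto
    qed
    then show ?thesis using box by blast
  qed
  have "deriv_bound 3 (1 / \<epsilon>) (A * (L * \<epsilon>\<^sup>2)) (conv a b (moll_kernel \<epsilon>) (\<lambda>y. g y - l y)) x"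
  proof (rule A[OF \<epsilon>(1)])
    show "continuous_on UNIV (\<lambda>y. g y - l y)" by (intro continuous_intros continuous_g cl)
    show "cball x \<epsilon> \<subseteq> cbox a b" by (rule sub) auto
    fix y assume y: "y \<in> cball x \<epsilon>"
    have "\<bar>g y - l y\<bar> \<le> L * (dist x y)\<^sup>2" unfolding l_def by (rule taylor_lipschitz_gradient[OF g lip])
    also have "\<dots> \<le> L * \<epsilon>\<^sup>2" using y L0 by (intro mult_left_mono power_mono) auto
    finally show "\<bar>g y - l y\<bar> \<le> L * \<epsilon>\<^sup>2" .
  qed
  then have 1: "deriv_bound 3 (2 ^ k) (A * L * (1 / 4) ^ k) (conv a b (moll_kernel \<epsilon>) (\<lambda>y. g y - l y)) x"
    by (simp add: \<epsilon>_def half_powers mult.assoc)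
  \<comment> \<open>The identity is needed on a neighbourhood and not merely at \<open>x\<close>,
    since it is to be differentiated.\<close>
  have "conv a b (moll_kernel \<epsilon>) (\<lambda>y. g y - l y) y = G k y - l y" if y: "y \<in> ball x 1" for y
  proof -
    have "conv a b (moll_kernel \<epsilon>) (\<lambda>y. g y - l y) y = G k y - conv a b (moll_kernel \<epsilon>) l y"
      unfolding G_def \<epsilon>_def[symmetric]
      by (rule conv_diff[OF Ck_continuous[OF moll_kernel(1)] continuous_g cl]) (rule \<epsilon>)
    also have "conv a b (moll_kernel \<epsilon>) l y = l y"
      unfolding l_def[abs_def]
      by (rule conv_affine_form[OF Ck_continuous[OF moll_kernel(1)[OF \<epsilon>(1)]] moll_kernel(2)[OF \<epsilon>(1)] sub[OF y]])
        (auto simp: moll_kernel(3,4)[OF \<epsilon>(1)])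
    finally show ?thesis .
  qed
  then have "deriv_bound 3 (2 ^ k) (A * L * (1 / 4) ^ k) (\<lambda>y. G k y - l y) x"
    using deriv_bound_cong_open[of "ball x 1" x "conv a b (moll_kernel \<epsilon>) (\<lambda>y. g y - l y)" "\<lambda>y. G k y - l y" 3] 1 by simp
  then show ?thesis by (simp add: l_def)
qed

lemma G_derivatives:
  assumes x: "x \<in> cball x0 r"
  shows "\<bar>G k x - g x\<bar> \<le> A * L * (1 / 4) ^ k"
    and "c \<in> Basis \<Longrightarrow> \<bar>dderiv c (G k) x - g' x \<bullet> c\<bar> \<le> A * L * (1 / 2) ^ k"
    and "c \<in> Basis \<Longrightarrow> \<bar>dderiv c (dderiv c (G k)) x\<bar> \<le> A * L"
proof -
  let ?h = "\<lambda>y. G k y - (g x + g' x \<bullet> (y - x))"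
  note deriv_bound = G_approx[OF x, of k]
  show "\<bar>G k x - g x\<bar> \<le> A * L * (1 / 4) ^ k" using deriv_bound_abs[OF deriv_bound] by simp
  assume c: "c \<in> Basis"
  have d: "dderiv c ?h = (\<lambda>y. dderiv c (G k) y - g' x \<bullet> c)"
  proof
    fix y
    have "dderiv c ?h y = dderiv c (G k) y - dderiv c (\<lambda>y. g x + g' x \<bullet> (y - x)) y"
      by (rule dderiv_diff[OF Ck_differentiable[OF CkG] Ck_differentiable[OF Ck_affine_form]])
    then show "dderiv c ?h y = dderiv c (G k) y - g' x \<bullet> c" by (simp add: dderiv_affine_form)
  qed
  have deriv_bound2: "deriv_bound 2 (2 ^ k) (A * L * (1 / 4) ^ k * 2 ^ k) (\<lambda>y. dderiv c (G k) y - g' x \<bullet> c) x"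
    using deriv_bound c unfolding eval_nat_numeral deriv_bound.simps(2) d[symmetric] by blast
  show "\<bar>dderiv c (G k) x - g' x \<bullet> c\<bar> \<le> A * L * (1 / 2) ^ k"
    using deriv_bound_abs[OF deriv_bound2] half_powers(3)[of k] by (simp add: mult.assoc)
  have d2: "dderiv c (\<lambda>y. dderiv c (G k) y - g' x \<bullet> c) x = dderiv c (dderiv c (G k)) x"
    by (subst dderiv_diff[OF Ck_differentiable[OF Ck_dd[OF CkG]]]) auto
  have "deriv_bound 1 (2 ^ k) (A * L * (1 / 4) ^ k * 2 ^ k * 2 ^ k) (dderiv c (\<lambda>y. dderiv c (G k) y - g' x \<bullet> c)) x"
    using deriv_bound2 c unfolding eval_nat_numeral deriv_bound.simps(2) by auto
  from deriv_bound_abs[OF this] show "\<bar>dderiv c (dderiv c (G k)) x\<bar> \<le> A * L"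
    using half_powers(3,4)[of k] by (simp add: d2 mult.assoc)
qed

definition eta :: "'a \<Rightarrow> real" where
  "eta x = bump ((1 / r) *\<^sub>R (x - x0))"

lemma Ck_eta: "Ck 3 eta"
  unfolding eta_def[abs_def] by (rule Ck_affine[OF Ck_bump])

lemma eta_eq_0: "x \<notin> cball x0 r \<Longrightarrow> eta x = 0"
  unfolding eta_def using r
  by (intro bump_eq_0) (simp only: norm_scaleR, simp add: dist_norm norm_minus_commute field_simps)

text \<open>A square in place of an absolute value keeps the cutoff C^3 where \<open>G k\<close>
  vanishes. \<open>cutoff (W k x)\<close> is 1 as long as \<open>G k x\<close> is at most 2^-k in
  absolute value, and 0 beyond sqrt 5 times that.\<close>

definition W :: "nat \<Rightarrow> 'a \<Rightarrow> real" where
  "W k x = (2 ^ k * G k x) * (2 ^ k * G k x)"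

text \<open>The last factor is a difference of squares, kept factored because on the strip left by
  the cutoff the difference of the mollifications is of order 4^-k and their sum of order
  2^-k.\<close>

definition T :: "nat \<Rightarrow> 'a \<Rightarrow> real" where
  "T k x = (cutoff (W k x) * eta x) * ((G (Suc k) x - G k x) * (G (Suc k) x + G k x))"

lemma Ck_W: "Ck 3 (W k)"
  unfolding W_def[abs_def] by (intro Ck_mult Ck_const Ck_G)

lemma Ck_cutoff_W: "Ck 3 (\<lambda>x. cutoff (W k x))"
  by (rule Ck_compose_real[OF Ck_cutoff Ck_W])

lemma Ck_T: "Ck 3 (T k)"
  unfolding T_def[abs_def] by (intro Ck_mult Ck_cutoff_W Ck_eta Ck_diff Ck_add Ck_G)

text \<open>Stated with a neighbourhood so that the derivatives at \<open>x\<close> vanish too; the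
  strict inequality makes the region open.\<close>

lemma T_zero:
  assumes "x \<notin> cball x0 r \<or> 5 < W k x"
  shows "\<exists>U. open U \<and> x \<in> U \<and> (\<forall>y\<in>U. T k y = 0)"
proof (intro exI conjI ballI)
  let ?U = "- cball x0 r \<union> W k -` {5<..}"
  have "open (W k -` {5<..})" using Ck_continuous[OF Ck_W, of UNIV k] by (intro open_vimage) auto
  then show "open ?U" by auto
  show "x \<in> ?U" using assms by auto
  show "T k y = 0" if "y \<in> ?U" for y
    using that eta_eq_0[of y] cutoff_eq_0[of "W k y"] by (auto simp: T_def)
qed

lemma W_small:
  assumes "x \<in> cball x0 r" "W k x \<le> 5"
  shows "\<bar>G k x\<bar> \<le> 3 * (1 / 2) ^ k" "\<bar>g x\<bar> \<le> (3 + A * L) * (1 / 2) ^ k"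
proof -
  have "(2 ^ k * G k x)\<^sup>2 \<le> 3\<^sup>2" using assms(2) by (simp add: W_def power2_eq_square)
  then have "\<bar>2 ^ k * G k x\<bar> \<le> 3" using power2_le_imp_le[of "\<bar>2 ^ k * G k x\<bar>" 3] by (simp only: power2_abs)
  then have "2 ^ k * \<bar>G k x\<bar> \<le> 3" by (simp add: abs_mult)
  then show 1: "\<bar>G k x\<bar> \<le> 3 * (1 / 2) ^ k" by (simp add: field_simps power_one_over)
  have "(1 / 4 :: real) ^ k \<le> (1 / 2) ^ k" by (intro power_mono) auto
  then have "A * L * (1 / 4) ^ k \<le> A * L * (1 / 2) ^ k" using A0 L0 by (intro mult_left_mono) auto
  then show "\<bar>g x\<bar> \<le> (3 + A * L) * (1 / 2) ^ k"
    using 1 G_derivatives(1)[OF assms(1), of k] by (simp add: distrib_right)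
qed

text \<open>The factors are of order 1, 4^-k and 2^-k, and each derivative of any of them costs at
  most 2^k, so the product is of order 8^-k at rate 2^k. Away from the strip the function vanishes
  near the point.\<close>

lemma T_bd: "\<exists>C\<ge>0. \<forall>k x. deriv_bound 3 (2 ^ k) (C * (1 / 8) ^ k) (T k) x"
proof -
  have "continuous_on UNIV g'" using lip by (rule lipschitz_on_continuous_on)
  then have "compact (g' ` cball x0 r)"
    by (intro compact_continuous_image) (auto intro: continuous_on_subset)
  then have "bounded (g' ` cball x0 r)" by (rule compact_imp_bounded)
  then obtain D0 where D0: "\<And>x. x \<in> cball x0 r \<Longrightarrow> norm (g' x) \<le> D0" unfolding bounded_iff by blast
  define D where "D = 3 + A * L + \<bar>D0\<bar>"
  have AL: "0 \<le> A * L" using A0 L0 by simp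
  have D: "3 + A * L \<le> D" "\<And>x. x \<in> cball x0 r \<Longrightarrow> norm (g' x) \<le> D" "0 \<le> D"
    using D0 AL by (fastforce simp: D_def)+
  define C2 where "C2 = 3 * (A * L) + 2 * D"
  obtain A1 where A1: "\<And>s. s \<in> {0..5} \<Longrightarrow> deriv_bound 3 1 A1 cutoff s" using deriv_bound_compact[OF compact_Icc Ck_cutoff] by blast
  obtain A2 where A2: "0 \<le> A2" "\<And>x. deriv_bound 3 1 A2 eta x"
    using deriv_bound_compact_support[OF Ck_eta compact_cball[of x0 r] eta_eq_0] by auto
  \<comment> \<open>\<open>K0\<close> is fixed before \<open>k\<close>: here the uniformity of
    \<open>deriv_bound_compose\<close> in the rate is used.\<close>
  obtain K0 where K0: "\<And>l \<theta> f (x::'a). 0 \<le> l \<Longrightarrow> Ck 3 \<theta> \<Longrightarrow> Ck 3 f \<Longrightarrow> deriv_bound 3 1 A1 \<theta> (f x) \<Longrightarrow> deriv_bound 3 l (2 ^ 3 * C2 * C2) f x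
      \<Longrightarrow> deriv_bound 3 l K0 (\<lambda>x. \<theta> (f x)) x"
    using deriv_bound_compose[of 3 A1 "2 ^ 3 * C2 * C2", where 'a='a] by blast
  define K where "K = max 0 K0"
  define C where "C = 2 ^ 3 * (2 ^ 3 * K * A2) * (2 ^ 3 * (3 * (A * L)) * C2)"
  have C2: "0 \<le> C2" using D AL by (simp add: C2_def)
  have C0: "0 \<le> C" using A0 L0 A2(1) C2 unfolding C_def K_def by (intro mult_nonneg_nonneg) auto
  have "deriv_bound 3 (2 ^ k) (C * (1 / 8) ^ k) (T k) x" for k x
  proof (cases "x \<in> cball x0 r \<and> W k x \<le> 5")
    case False
    then obtain U where "open U" "x \<in> U" "\<forall>y\<in>U. T k y = 0" using T_zero[of x k] by (auto simp: not_le)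
    then show ?thesis using C0 by (intro deriv_bound_zero_open[of U]) auto
  next
    case True
    then have x: "x \<in> cball x0 r" and w: "W k x \<le> 5" by auto
    define l where "l y = g x + g' x \<bullet> (y - x)" for y
    have Cl: "Ck 3 l" unfolding l_def[abs_def] by (rule Ck_affine_form)
    \<comment> \<open>On the strip the value of \<open>l\<close> at \<open>x\<close> is at most D
      2^-k. Its gradient has norm at most D, which is D 2^-k times one factor 2^k.\<close>
    have l: "deriv_bound 3 (2 ^ k) (D * (1 / 2) ^ k) l x"
      unfolding l_def[abs_def]
    proof (rule deriv_bound_affine_form)
      have "(3 + A * L) * (1 / 2) ^ k \<le> D * (1 / 2) ^ k" using D(1) by (intro mult_right_mono) auto
      then show "\<bar>g x\<bar> \<le> D * (1 / 2) ^ k" using W_small(2)[OF x w] by linarith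
      show "norm (g' x) \<le> D * (1 / 2) ^ k * 2 ^ k" using D(2)[OF x] half_powers(4)[of k] by (simp add: mult.assoc)
    qed simp
    have h0: "deriv_bound 3 (2 ^ k) (A * L * (1 / 4) ^ k) (\<lambda>y. G k y - l y) x"
      unfolding l_def by (rule G_approx[OF x])
    \<comment> \<open>For \<open>Suc k\<close> the bound holds at rate 2^(k+1). Passing to 2^k costs
      2^3, of which the constant 4^-(k+1) pays a factor 4; a factor 2 remains.\<close>
    have h1: "deriv_bound 3 (2 ^ k) (2 * (A * L) * (1 / 4) ^ k) (\<lambda>y. G (Suc k) y - l y) x"
    proof -
      have "deriv_bound 3 (2 * 2 ^ k) (A * L * (1 / 4) ^ Suc k) (\<lambda>y. G (Suc k) y - l y) x"
        unfolding l_def using G_approx[OF x, of "Suc k"] by simp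
      from deriv_bound_rate[OF this] show ?thesis by (simp add: mult.assoc)
    qed
    have Ch: "Ck 3 (\<lambda>y. G j y - l y)" for j by (intro Ck_diff Ck_G Cl)
    have P: "deriv_bound 3 (2 ^ k) (3 * (A * L) * (1 / 4) ^ k) (\<lambda>y. G (Suc k) y - G k y) x"
      using deriv_bound_diff[OF Ch Ch h1 h0] by (simp add: algebra_simps)
    have le: "(1 / 4 :: real) ^ k \<le> (1 / 2) ^ k" by (intro power_mono) auto
    have ALle: "c * (A * L) * (1 / 4) ^ k \<le> c * (A * L) * (1 / 2) ^ k" if "0 \<le> c" for c
      using AL le that by (intro mult_left_mono) auto
    have S: "deriv_bound 3 (2 ^ k) (C2 * (1 / 2) ^ k) (\<lambda>y. G (Suc k) y + G k y) x"
    proof -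
      have "deriv_bound 3 (2 ^ k) (3 * (A * L) * (1 / 4) ^ k + 2 * (D * (1 / 2) ^ k)) (\<lambda>y. ((G (Suc k) y - l y) + (G k y - l y)) + 2 * l y) x"
        using deriv_bound_add[OF Ck_add[OF Ch Ch] Ck_mult[OF Ck_const Cl] deriv_bound_add[OF Ch Ch h1 h0] deriv_bound_cmult[OF Cl l, of 2]]
        by (simp add: algebra_simps)
      then have "deriv_bound 3 (2 ^ k) (C2 * (1 / 2) ^ k) (\<lambda>y. ((G (Suc k) y - l y) + (G k y - l y)) + 2 * l y) x"
        by (rule deriv_bound_mono) (use ALle[of 3] in \<open>auto simp: C2_def algebra_simps\<close>)
      then show ?thesis by (simp add: algebra_simps)
    qed
    have Gk: "deriv_bound 3 (2 ^ k) (C2 * (1 / 2) ^ k) (G k) x"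
    proof -
      have "deriv_bound 3 (2 ^ k) (A * L * (1 / 4) ^ k + D * (1 / 2) ^ k) (\<lambda>y. (G k y - l y) + l y) x"
        by (rule deriv_bound_add[OF Ch Cl h0 l])
      then have "deriv_bound 3 (2 ^ k) (C2 * (1 / 2) ^ k) (\<lambda>y. (G k y - l y) + l y) x"
      proof (rule deriv_bound_mono)
        have "A * L * (1 / 4) ^ k + D * (1 / 2) ^ k \<le> A * L * (1 / 2) ^ k + D * (1 / 2) ^ k" using ALle[of 1] by simp
        also have "\<dots> = (A * L + D) * (1 / 2) ^ k" by (simp add: distrib_right)
        also have "\<dots> \<le> C2 * (1 / 2) ^ k" using AL D(3) by (intro mult_right_mono) (auto simp: C2_def)
        finally show "A * L * (1 / 4) ^ k + D * (1 / 2) ^ k \<le> C2 * (1 / 2) ^ k" .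
      qed simp
      then show ?thesis by simp
    qed
    have 1: "deriv_bound 3 (2 ^ k) C2 (\<lambda>y. 2 ^ k * G k y) x"
      using deriv_bound_cmult[OF Ck_G Gk, of "2 ^ k"] half_powers(4)[of k] by (simp add: ac_simps)
    have Wb: "deriv_bound 3 (2 ^ k) (2 ^ 3 * C2 * C2) (W k) x"
      unfolding W_def[abs_def] by (rule deriv_bound_mult[OF _ _ 1 1]) (intro Ck_mult Ck_const Ck_G)+
    have "deriv_bound 3 (2 ^ k) K0 (\<lambda>x. cutoff (W k x)) x"
      by (rule K0[OF _ Ck_cutoff Ck_W A1 Wb]) (use w in \<open>auto simp: W_def\<close>)
    then have cw: "deriv_bound 3 (2 ^ k) K (\<lambda>x. cutoff (W k x)) x" by (rule deriv_bound_mono) (auto simp: K_def)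
    have et: "deriv_bound 3 (2 ^ k) A2 eta x" by (rule deriv_bound_rate_mono[OF A2(2)]) auto
    have "deriv_bound 3 (2 ^ k) (2 ^ 3 * (2 ^ 3 * K * A2) * (2 ^ 3 * (3 * (A * L) * (1 / 4) ^ k) * (C2 * (1 / 2) ^ k))) (T k) x"
      unfolding T_def[abs_def]
      by (intro deriv_bound_mult Ck_mult Ck_cutoff_W Ck_eta Ck_diff Ck_add Ck_G cw et P S)
    moreover have "2 ^ 3 * (2 ^ 3 * K * A2) * (2 ^ 3 * (3 * (A * L) * (1 / 4) ^ k) * (C2 * (1 / 2) ^ k)) = C * (1 / 8) ^ k"
      by (simp add: C_def half_powers(5)[symmetric])
    ultimately show ?thesis by simp
  qed
  with C0 show ?thesis by blast
qed

section \<open>Telescoping and the values of the derivatives on the graph\<close>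

definition R :: "nat \<Rightarrow> 'a \<Rightarrow> real" where
  "R k x = eta x * (G k x * G k x)"

lemma Ck_R: "Ck 3 (R k)"
  unfolding R_def[abs_def] by (intro Ck_mult Ck_eta Ck_G)

text \<open>Where \<open>g\<close> vanishes, 2^k \<open>G k\<close> is of order 2^-k, so for large
  \<open>k\<close> the cutoff is 1 nearby. The neighbourhood may shrink with \<open>k\<close>; for
  derivatives at \<open>x\<close> this is enough.\<close>

lemma T_telescope:
  assumes x: "x \<in> cball x0 r" "g x = 0" and k: "(A * L)\<^sup>2 * (1 / 4) ^ k < 1"
  shows "\<exists>U. open U \<and> x \<in> U \<and> (\<forall>y\<in>U. T k y = R (Suc k) y - R k y)"
proof (intro exI conjI ballI)
  let ?U = "W k -` {..<1}"
  show "open ?U" using Ck_continuous[OF Ck_W, of UNIV k] by (intro open_vimage) auto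
  have "\<bar>G k x\<bar> \<le> A * L * (1 / 4) ^ k" using G_derivatives(1)[OF x(1), of k] x(2) by simp
  then have "2 ^ k * \<bar>G k x\<bar> \<le> 2 ^ k * (A * L * (1 / 4) ^ k)" by (intro mult_left_mono) auto
  also have "\<dots> = A * L * (1 / 2) ^ k" using half_powers(3)[of k] by (simp add: ac_simps)
  finally have "\<bar>2 ^ k * G k x\<bar> \<le> A * L * (1 / 2) ^ k" by (simp add: abs_mult)
  then have "\<bar>2 ^ k * G k x\<bar>\<^sup>2 \<le> (A * L * (1 / 2) ^ k)\<^sup>2" by (intro power_mono) auto
  also have "\<dots> = (A * L)\<^sup>2 * (1 / 4) ^ k" by (simp only: power_mult_distrib half_powers(2))
  finally show "x \<in> ?U" using k by (simp add: W_def power2_eq_square)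
  show "T k y = R (Suc k) y - R k y" if "y \<in> ?U" for y
    using that cutoff_eq_1[of "W k y"] by (simp add: T_def R_def algebra_simps)
qed

text \<open>Every term with a factor \<open>G k x\<close> dies out. The second derivatives of
  \<open>G k\<close> are merely bounded, as \<open>g\<close> is only C^(1,1), but they occur
  multiplied by \<open>G k\<close>. What survives is twice the square of the first
  derivative.\<close>

lemma R_limits:
  assumes x: "x \<in> cball x0 r" "g x = 0" and c: "c \<in> Basis"
  shows "(\<lambda>k. dderiv c (R k) x) \<longlonglongrightarrow> 0" "(\<lambda>k. dderiv c (dderiv c (R k)) x) \<longlonglongrightarrow> 2 * eta x * (g' x \<bullet> c)\<^sup>2"
proof -
  have geo: "(\<lambda>k. A * L * q ^ k) \<longlonglongrightarrow> 0" if "\<bar>q\<bar> < 1" for q :: real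
    using tendsto_mult_right_zero[OF LIMSEQ_power_zero, of q "A * L"] that by simp
  have G0: "(\<lambda>k. G k x) \<longlonglongrightarrow> 0"
    by (rule Lim_null_comparison[OF _ geo[of "1 / 4"]]) (use G_derivatives(1)[OF x(1)] x(2) in auto)
  have "(\<lambda>k. dderiv c (G k) x - g' x \<bullet> c) \<longlonglongrightarrow> 0"
    by (rule Lim_null_comparison[OF _ geo[of "1 / 2"]]) (use G_derivatives(2)[OF x(1) c] in auto)
  then have G1: "(\<lambda>k. dderiv c (G k) x) \<longlonglongrightarrow> g' x \<bullet> c" by (rule Lim_null[THEN iffD2])
  have GG2: "(\<lambda>k. G k x * dderiv c (dderiv c (G k)) x) \<longlonglongrightarrow> 0"
  proof (rule Lim_null_comparison[OF _ tendsto_mult_left_zero[OF tendsto_rabs_zero[OF G0]]])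
    show "\<forall>\<^sub>F k in sequentially. norm (G k x * dderiv c (dderiv c (G k)) x) \<le> \<bar>G k x\<bar> * (A * L)"
      using G_derivatives(3)[OF x(1) c] by (intro always_eventually allI) (simp add: abs_mult mult_left_mono)
  qed
  have ce: "Ck (Suc (Suc (Suc 0))) eta" using Ck_eta by (simp add: eval_nat_numeral)
  note dG = Ck_differentiable[OF CkG] Ck_differentiable[OF Ck_dd[OF CkG]]
  note de = Ck_differentiable[OF ce] Ck_differentiable[OF Ck_dd[OF ce]]
  have D: "dderiv c (R k) = (\<lambda>x. eta x * (G k x * dderiv c (G k) x + dderiv c (G k) x * G k x) + dderiv c eta x * (G k x * G k x))" for k
    unfolding R_def[abs_def]
    by (rule ext) (simp only: dderiv_mult dG de differentiable_mult)
  have D2: "dderiv c (dderiv c (R k)) x = eta x * ((G k x * dderiv c (dderiv c (G k)) x + dderiv c (G k) x * dderiv c (G k) x)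
      + (dderiv c (G k) x * dderiv c (G k) x + dderiv c (dderiv c (G k)) x * G k x))
      + dderiv c eta x * (G k x * dderiv c (G k) x + dderiv c (G k) x * G k x)
      + (dderiv c eta x * (G k x * dderiv c (G k) x + dderiv c (G k) x * G k x) + dderiv c (dderiv c eta) x * (G k x * G k x))" for k
    unfolding D by (simp only: dderiv_mult dderiv_add dG de differentiable_mult differentiable_add)
  have "(\<lambda>k. eta x * (G k x * dderiv c (G k) x + dderiv c (G k) x * G k x) + dderiv c eta x * (G k x * G k x)) \<longlonglongrightarrow>
     eta x * (0 * (g' x \<bullet> c) + (g' x \<bullet> c) * 0) + dderiv c eta x * (0 * 0)"
    by (intro tendsto_intros G0 G1)
  then show "(\<lambda>k. dderiv c (R k) x) \<longlonglongrightarrow> 0" by (simp add: D)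
  have "(\<lambda>k. eta x * ((G k x * dderiv c (dderiv c (G k)) x + dderiv c (G k) x * dderiv c (G k) x)
      + (dderiv c (G k) x * dderiv c (G k) x + G k x * dderiv c (dderiv c (G k)) x))
      + dderiv c eta x * (G k x * dderiv c (G k) x + dderiv c (G k) x * G k x)
      + (dderiv c eta x * (G k x * dderiv c (G k) x + dderiv c (G k) x * G k x) + dderiv c (dderiv c eta) x * (G k x * G k x)))
     \<longlonglongrightarrow> eta x * ((0 + (g' x \<bullet> c) * (g' x \<bullet> c)) + ((g' x \<bullet> c) * (g' x \<bullet> c) + 0))
      + dderiv c eta x * (0 * (g' x \<bullet> c) + (g' x \<bullet> c) * 0)
      + (dderiv c eta x * (0 * (g' x \<bullet> c) + (g' x \<bullet> c) * 0) + dderiv c (dderiv c eta) x * (0 * 0))"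
    by (intro tendsto_intros G0 G1 GG2)
  then show "(\<lambda>k. dderiv c (dderiv c (R k)) x) \<longlonglongrightarrow> 2 * eta x * (g' x \<bullet> c)\<^sup>2"
    by (simp add: D2 power2_eq_square ac_simps)
qed

lemma boundary_sequence:
  "\<exists>N C. 0 \<le> C \<and> (\<forall>k. Ck 3 (N k)) \<and> (\<forall>k x. deriv_bound 3 (2 ^ k) (C * (1 / 8) ^ k) (N k) x) \<and>
    (\<forall>k x. (\<exists>U. open U \<and> x \<in> U \<and> (\<forall>y\<in>U. N k y = 0)) \<or> (x \<in> cball x0 r \<and> \<bar>g x\<bar> \<le> C * (1 / 2) ^ k)) \<and>
    (\<forall>x\<in>cball x0 r. g x = 0 \<longrightarrow> (\<forall>c\<in>Basis. (\<lambda>k. dderiv c (N k) x) sums 0 \<and>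
        (\<lambda>k. dderiv c (dderiv c (N k)) x) sums (2 * eta x * (g' x \<bullet> c)\<^sup>2)))"
proof -
  have "(\<lambda>k. (A * L)\<^sup>2 * (1 / 4 :: real) ^ k) \<longlonglongrightarrow> 0"
    by (intro tendsto_mult_right_zero LIMSEQ_power_zero) auto
  then have "\<forall>\<^sub>F k in sequentially. (A * L)\<^sup>2 * (1 / 4) ^ k < 1" by (rule order_tendstoD) simp
  then obtain m0 where m0: "\<And>k. m0 \<le> k \<Longrightarrow> (A * L)\<^sup>2 * (1 / 4) ^ k < 1" unfolding eventually_sequentially by blast
  define m where "m = Suc m0"
  obtain C where C: "0 \<le> C" "\<And>k x. deriv_bound 3 (2 ^ k) (C * (1 / 8) ^ k) (T k) x" using T_bd by blast
  have "\<exists>A\<ge>0. \<forall>x. deriv_bound 3 1 A (R m) x"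
    by (rule deriv_bound_compact_support[OF Ck_R compact_cball[of x0 r]]) (simp add: R_def eta_eq_0)
  then obtain A2 where A2: "0 \<le> A2" "\<And>x. deriv_bound 3 1 A2 (R m) x" by blast
  have "compact (g ` cball x0 r)" by (intro compact_continuous_image continuous_on_subset[OF continuous_g]) auto
  then have "bounded (g ` cball x0 r)" by (rule compact_imp_bounded)
  then obtain B where B: "\<And>x. x \<in> cball x0 r \<Longrightarrow> \<bar>g x\<bar> \<le> B" unfolding bounded_iff real_norm_def by blast
  have AL: "0 \<le> A * L" using A0 L0 by simp
  define C' where "C' = C + A2 + \<bar>B\<bar> + 3 + A * L"
  have C': "C \<le> C'" "A2 \<le> C'" "B \<le> C'" "3 + A * L \<le> C'" "0 \<le> C'" using C A2 AL by (auto simp: C'_def)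
  \<comment> \<open>Telescoping starts at \<open>m\<close>, from which on the cutoff is 1 near each
    point of the graph. \<open>R m\<close> is put in front so that the partial sums have the
    derivatives of a single \<open>R j\<close> there. As \<open>m\<close> is \<open>Suc m0\<close>,
    the term of index k \<ge> 1 is \<open>T (m0 + k)\<close>.\<close>
  define N where "N k = (case k of 0 \<Rightarrow> R m | Suc k \<Rightarrow> T (m + k))" for k
  have 1: "Ck 3 (N k)" for k by (auto simp: N_def Ck_R Ck_T split: nat.split)
  have 2: "deriv_bound 3 (2 ^ k) (C' * (1 / 8) ^ k) (N k) x" for k x
  proof (cases k)
    case 0
    then show ?thesis using deriv_bound_mono[OF A2(2) C'(2)] by (simp add: N_def)
  next
    case (Suc j)
    have "2 ^ (m + j) = 2 ^ m0 * (2 ^ k :: real)" by (simp add: Suc m_def power_add)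
    then have "deriv_bound 3 (2 ^ m0 * 2 ^ k) (C * (1 / 8) ^ (m + j)) (N k) x"
      using C(2)[of "m + j" x] by (simp add: N_def Suc)
    then have "deriv_bound 3 (2 ^ k) ((2 ^ m0) ^ 3 * (C * (1 / 8) ^ (m + j))) (N k) x" by (rule deriv_bound_rate) auto
    \<comment> \<open>Shifting the index by \<open>m0\<close> costs (2^m0)^3 through the rate and
      gains 8^-m0 in the constant; the two cancel exactly.\<close>
    moreover have "((2::real) ^ m0) ^ 3 * (1 / 8) ^ (m + j) = (1 / 8) ^ k"
    proof -
      have "((2::real) ^ m0) ^ 3 = 8 ^ m0" by (simp add: power_mult[symmetric] mult.commute[of m0] power_mult)
      moreover have "(1 / 8 :: real) ^ (m + j) = (1 / 8) ^ m0 * (1 / 8) ^ k" by (simp add: Suc m_def power_add)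
      moreover have "(8::real) ^ m0 * (1 / 8) ^ m0 = 1" by (simp add: power_mult_distrib[symmetric])
      ultimately show ?thesis by (simp only: mult.assoc[symmetric] mult_1)
    qed
    ultimately have "deriv_bound 3 (2 ^ k) (C * (1 / 8) ^ k) (N k) x" by (simp add: mult.left_commute)
    then show ?thesis by (rule deriv_bound_mono) (use C' in \<open>auto intro: mult_right_mono\<close>)
  qed
  have 3: "(\<exists>U. open U \<and> x \<in> U \<and> (\<forall>y\<in>U. N k y = 0)) \<or> (x \<in> cball x0 r \<and> \<bar>g x\<bar> \<le> C' * (1 / 2) ^ k)" for k x
  proof (cases k)
    case 0
    show ?thesis
    proof (cases "x \<in> cball x0 r")
      case True
      then show ?thesis using B[OF True] C'(3) 0 by simp
    next
      case False
      then show ?thesis using eta_eq_0 0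
        by (intro disjI1 exI[of _ "- cball x0 r"]) (auto simp: N_def R_def)
    qed
  next
    case (Suc j)
    show ?thesis
    proof (cases "x \<in> cball x0 r \<and> W (m + j) x \<le> 5")
      case True
      have "\<bar>g x\<bar> \<le> (3 + A * L) * (1 / 2) ^ (m + j)" using W_small(2) True by blast
      also have "\<dots> \<le> C' * (1 / 2) ^ k"
        using C'(4,5) AL by (intro mult_mono power_decreasing) (auto simp: Suc m_def)
      finally show ?thesis using True by blast
    next
      case False
      then show ?thesis using T_zero[of x "m + j"] by (auto simp: N_def Suc not_le)
    qed
  qed
  have 4: "(\<lambda>k. dderiv c (N k) x) sums 0 \<and> (\<lambda>k. dderiv c (dderiv c (N k)) x) sums (2 * eta x * (g' x \<bullet> c)\<^sup>2)"
    if x: "x \<in> cball x0 r" "g x = 0" and c: "c \<in> Basis" for x c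
  proof -
    have cR: "Ck (Suc (Suc (Suc 0))) (R k)" for k using Ck_R[of k] by (simp add: eval_nat_numeral)
    have step: "dderiv c (N (Suc k)) x = dderiv c (R (Suc (m + k))) x - dderiv c (R (m + k)) x \<and>
        dderiv c (dderiv c (N (Suc k))) x = dderiv c (dderiv c (R (Suc (m + k)))) x - dderiv c (dderiv c (R (m + k))) x" for k
    proof -
      obtain U where U: "open U" "x \<in> U" "\<And>y. y \<in> U \<Longrightarrow> T (m + k) y = R (Suc (m + k)) y - R (m + k) y"
        using T_telescope[OF x m0, of "m + k"] by (auto simp: m_def)
      have d: "dderiv c (N (Suc k)) y = dderiv c (R (Suc (m + k))) y - dderiv c (R (m + k)) y" if y: "y \<in> U" for y
      proof -
        have "dderiv c (N (Suc k)) y = dderiv c (\<lambda>y. R (Suc (m + k)) y - R (m + k) y) y"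
          by (rule dderiv_cong_open[OF U(1) y]) (simp add: N_def U(3))
        also have "\<dots> = dderiv c (R (Suc (m + k))) y - dderiv c (R (m + k)) y"
          by (rule dderiv_diff[OF Ck_differentiable[OF cR] Ck_differentiable[OF cR]])
        finally show ?thesis .
      qed
      have "dderiv c (dderiv c (N (Suc k))) x = dderiv c (\<lambda>y. dderiv c (R (Suc (m + k))) y - dderiv c (R (m + k)) y) x"
        by (rule dderiv_cong_open[OF U(1,2) d])
      also have "\<dots> = dderiv c (dderiv c (R (Suc (m + k)))) x - dderiv c (dderiv c (R (m + k))) x"
        by (rule dderiv_diff[OF Ck_differentiable[OF Ck_dd[OF cR]] Ck_differentiable[OF Ck_dd[OF cR]]])
      finally show ?thesis using d[OF U(2)] by blast
    qed
    have s: "(\<Sum>k<Suc n. dderiv c (N k) x) = dderiv c (R (n + m)) x \<and> (\<Sum>k<Suc n. dderiv c (dderiv c (N k)) x) = dderiv c (dderiv c (R (n + m))) x" for n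
    proof (induction n)
      case 0
      show ?case by (simp add: N_def)
    next
      case (Suc n)
      then show ?case using step[of n] by (simp add: add.commute)
    qed
    have "(\<lambda>n. \<Sum>k<Suc n. dderiv c (N k) x) \<longlonglongrightarrow> 0"
      using LIMSEQ_ignore_initial_segment[OF R_limits(1)[OF x c], of m] s by simp
    moreover have "(\<lambda>n. \<Sum>k<Suc n. dderiv c (dderiv c (N k)) x) \<longlonglongrightarrow> 2 * eta x * (g' x \<bullet> c)\<^sup>2"
      using LIMSEQ_ignore_initial_segment[OF R_limits(2)[OF x c], of m] s by simp
    ultimately show ?thesis unfolding sums_def by (blast intro: LIMSEQ_imp_Suc)
  qed
  show ?thesis
    by (intro exI[of _ N] exI[of _ C'] conjI allI ballI impI) (use 1 2 3 4 C' in blast)+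
qed

end

section \<open>Muckenhoupt weights and the positions of the bumps\<close>

lemma average_lower_bound:
  fixes x :: "'a::euclidean_space"
  assumes r: "0 < r" and E: "E \<in> sets lebesgue" "E \<subseteq> ball x r" and f: "0 \<le> f" "0 \<le> s"
    and m: "ennreal f * emeasure lebesgue (ball x r) \<le> emeasure lebesgue E"
    and h: "\<And>y. y \<in> E \<Longrightarrow> ennreal s \<le> h y"
  shows "ennreal (f * s) \<le> average (ball x r) h"
proof -
  define v where "v = unit_ball_vol (real DIM('a)) * r ^ DIM('a)"
  have "0 < v" "emeasure lebesgue (ball x r) = ennreal v" using r by (simp_all add: v_def emeasure_ball)
  then have B: "emeasure lebesgue (ball x r) \<noteq> 0" "emeasure lebesgue (ball x r) \<noteq> \<infinity>"
    by (simp_all add: ennreal_eq_0_iff)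
  have "ennreal (f * s) * emeasure lebesgue (ball x r) = ennreal s * (ennreal f * emeasure lebesgue (ball x r))"
    using f by (simp add: ennreal_mult ac_simps)
  also have "\<dots> \<le> ennreal s * emeasure lebesgue E" by (rule mult_left_mono[OF m]) simp
  also have "\<dots> = (\<integral>\<^sup>+y. ennreal s * indicator E y \<partial>lebesgue)" using E by (simp add: nn_integral_cmult_indicator)
  also have "\<dots> \<le> (\<integral>\<^sup>+y\<in>ball x r. h y \<partial>lebesgue)"
    by (rule nn_integral_mono) (use h E in \<open>auto simp: indicator_def\<close>)
  finally have "ennreal (f * s) * emeasure lebesgue (ball x r) / emeasure lebesgue (ball x r) \<le> average (ball x r) h"
    unfolding average_def by (rule divide_right_mono_ennreal)
  moreover have "ennreal (f * s) * emeasure lebesgue (ball x r) / emeasure lebesgue (ball x r) = ennreal (f * s)"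
    using B by (simp add: ennreal_times_divide[symmetric] ennreal_divide_self less_top)
  ultimately show ?thesis by simp
qed

lemma enn_powr_pos_mono: "ennreal s \<le> X \<Longrightarrow> 0 \<le> s \<Longrightarrow> 0 < a \<Longrightarrow> ennreal (s powr a) \<le> enn_powr X a"
  by (cases X) (auto simp: enn_powr_def ennreal_le_iff intro!: ennreal_leI powr_mono2)

lemma enn_powr_neg_mono: "0 \<le> w \<Longrightarrow> w \<le> t \<Longrightarrow> 0 < t \<Longrightarrow> a < 0 \<Longrightarrow> ennreal (t powr a) \<le> enn_powr (ennreal w) a"
  by (auto simp: enn_powr_def intro!: ennreal_leI powr_mono2')

text \<open>The two averages are bounded below on \<open>E1\<close> and on \<open>E2\<close>
  separately. Since (1 - \<alpha>') (\<alpha> - 1) = -1, the second factor contributes 1/t, and the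
  powers of the proportion combine to f^\<alpha>.\<close>

lemma muckenhoupt_lower_bound:
  fixes x :: "'a::euclidean_space"
  assumes r: "0 < r" and f: "0 < f" and st: "0 < s" "0 < t" and \<alpha>: "1 < \<alpha>"
    and E1: "E1 \<in> sets lebesgue" "E1 \<subseteq> ball x r" "ennreal f * emeasure lebesgue (ball x r) \<le> emeasure lebesgue E1"
      "\<And>y. y \<in> E1 \<Longrightarrow> s \<le> \<omega> y"
    and E2: "E2 \<in> sets lebesgue" "E2 \<subseteq> ball x r" "ennreal f * emeasure lebesgue (ball x r) \<le> emeasure lebesgue E2"
      "\<And>y. y \<in> E2 \<Longrightarrow> 0 \<le> \<omega> y \<and> \<omega> y \<le> t"
  shows "ennreal (f powr \<alpha> * (s / t)) \<le> average (ball x r) (\<lambda>y. ennreal (\<omega> y)) *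
     enn_powr (average (ball x r) (\<lambda>y. enn_powr (ennreal (\<omega> y)) (1 - \<alpha> / (\<alpha> - 1)))) (\<alpha> - 1)"
proof -
  define a where "a = 1 - \<alpha> / (\<alpha> - 1)"
  have a: "a < 0" "a * (\<alpha> - 1) = -1" using \<alpha> by (auto simp: a_def field_simps)
  have 1: "ennreal (f * s) \<le> average (ball x r) (\<lambda>y. ennreal (\<omega> y))"
    by (rule average_lower_bound[OF r E1(1,2) _ _ E1(3)]) (use f st E1(4) in \<open>auto intro: ennreal_leI\<close>)
  have "ennreal (f * t powr a) \<le> average (ball x r) (\<lambda>y. enn_powr (ennreal (\<omega> y)) a)"
    by (rule average_lower_bound[OF r E2(1,2) _ _ E2(3)]) (use f st E2(4) a in \<open>auto intro!: enn_powr_neg_mono\<close>)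
  then have 2: "ennreal ((f * t powr a) powr (\<alpha> - 1)) \<le> enn_powr (average (ball x r) (\<lambda>y. enn_powr (ennreal (\<omega> y)) a)) (\<alpha> - 1)"
    by (rule enn_powr_pos_mono) (use f \<alpha> in auto)
  have "(f * t powr a) powr (\<alpha> - 1) = f powr (\<alpha> - 1) / t"
    using f st a(2) by (simp add: powr_mult powr_powr powr_minus_divide)
  moreover have "f * f powr (\<alpha> - 1) = f powr \<alpha>" using f by (simp add: powr_diff)
  ultimately have "f * s * (f * t powr a) powr (\<alpha> - 1) = f powr \<alpha> * (s / t)" by (simp add: mult.assoc mult.left_commute)
  then have "ennreal (f powr \<alpha> * (s / t)) = ennreal (f * s) * ennreal ((f * t powr a) powr (\<alpha> - 1))"
    using f st by (simp add: ennreal_mult[symmetric])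
  also have "\<dots> \<le> average (ball x r) (\<lambda>y. ennreal (\<omega> y)) * enn_powr (average (ball x r) (\<lambda>y. enn_powr (ennreal (\<omega> y)) a)) (\<alpha> - 1)"
    by (rule mult_mono[OF 1 2]) auto
  finally show ?thesis unfolding a_def .
qed

text \<open>The proportion \<open>f\<close> is fixed before \<open>c\<close>: with fixed proportions
  and unbounded ratios \<open>s / t\<close> the condition fails for every \<alpha>.\<close>

lemma not_muckenhoupt_infty:
  fixes \<omega> :: "'a::euclidean_space \<Rightarrow> real"
  assumes f: "0 < f"
    and *: "\<And>c. \<exists>x r s t E1 E2. 0 < r \<and> ball x r \<subseteq> U \<and> 0 < s \<and> 0 < t \<and> c \<le> s / t \<and>
      E1 \<in> sets lebesgue \<and> E1 \<subseteq> ball x r \<and> ennreal f * emeasure lebesgue (ball x r) \<le> emeasure lebesgue E1 \<and>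
      (\<forall>y\<in>E1. s \<le> \<omega> y) \<and>
      E2 \<in> sets lebesgue \<and> E2 \<subseteq> ball x r \<and> ennreal f * emeasure lebesgue (ball x r) \<le> emeasure lebesgue E2 \<and>
      (\<forall>y\<in>E2. 0 \<le> \<omega> y \<and> \<omega> y \<le> t)"
  shows "\<omega> \<notin> muckenhoupt_infty U"
proof
  assume "\<omega> \<in> muckenhoupt_infty U"
  then obtain \<alpha> where \<alpha>: "1 < \<alpha>" and m: "\<omega> \<in> muckenhoupt \<alpha> U" by (auto simp: muckenhoupt_infty_def)
  define h where "h = (\<lambda>(x, r). average (ball x r) (\<lambda>y. ennreal (\<omega> y)) *
     enn_powr (average (ball x r) (\<lambda>y. enn_powr (ennreal (\<omega> y)) (1 - \<alpha> / (\<alpha> - 1)))) (\<alpha> - 1))"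
  define S where "S = (SUP z\<in>{(x, r). 0 < r \<and> ball x r \<subseteq> U}. h z)"
  have S: "S < \<infinity>" using m by (simp add: muckenhoupt_def Let_def S_def h_def)
  define c where "c = (enn2real S + 1) / f powr \<alpha>"
  obtain x r s t E1 E2 where w: "0 < r" "ball x r \<subseteq> U" "0 < s" "0 < t" "c \<le> s / t"
      "E1 \<in> sets lebesgue" "E1 \<subseteq> ball x r" "ennreal f * emeasure lebesgue (ball x r) \<le> emeasure lebesgue E1"
      "\<forall>y\<in>E1. s \<le> \<omega> y"
      "E2 \<in> sets lebesgue" "E2 \<subseteq> ball x r" "ennreal f * emeasure lebesgue (ball x r) \<le> emeasure lebesgue E2"
      "\<forall>y\<in>E2. 0 \<le> \<omega> y \<and> \<omega> y \<le> t"
    using *[of c] by blast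
  have "ennreal (enn2real S + 1) = ennreal (f powr \<alpha> * c)" using f by (simp add: c_def)
  also have "\<dots> \<le> ennreal (f powr \<alpha> * (s / t))" by (intro ennreal_leI mult_left_mono w) auto
  also have "\<dots> \<le> h (x, r)" unfolding h_def prod.case
    by (rule muckenhoupt_lower_bound[OF w(1) f w(3,4) \<alpha> w(6-8) _ w(10-12)]) (use w in auto)
  also have "\<dots> \<le> S" unfolding S_def by (rule SUP_upper) (use w in auto)
  also have "\<dots> = ennreal (enn2real S)" using S by simp
  finally show False by (simp add: ennreal_le_iff)
qed

section \<open>Amplitudes, radii and centres of the bumps\<close>

lemma sum_fact_mult: "1 + (\<Sum>j<k. real (Suc j) * fact (Suc j)) = (fact (Suc k) :: real)"
  by (induction k) (auto simp: algebra_simps)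

text \<open>As (k+1) (k+1)! = (k+2)! - (k+1)!, the earlier amplitudes telescope to (k+1)! - 1. So
  \<open>amp k\<close> exceeds their sum by a factor k+1, which tends to infinity, and that is all
  the oscillation requires.\<close>

definition amp :: "nat \<Rightarrow> real" where
  "amp k = real (Suc k) * fact (Suc k)"

lemma amp_ge_1: "1 \<le> amp k"
  using mult_mono[of 1 "real (Suc k)" 1 "fact (Suc k)"] by (simp add: amp_def fact_ge_1 del: fact_Suc)

text \<open>The inner power k beats \<open>amp k powr p\<close> for every p \<le> k, and the outer
  power k makes up for a small power s of the radius as soon as s \<ge> 1/k. Hence one radius serves
  all exponents, each from some index on.\<close>

definition rad_bound :: "nat \<Rightarrow> real" where
  "rad_bound k = ((1 / 2) ^ k / amp k ^ k) ^ k"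

lemma rad_bound_base: "0 < (1 / 2) ^ k / amp k ^ k" "(1 / 2) ^ k / amp k ^ k \<le> 1"
proof -
  have "1 \<le> amp k ^ k" using amp_ge_1 by (rule one_le_power)
  moreover have "(1 / 2 :: real) ^ k \<le> 1" by (simp add: power_le_one)
  ultimately show "0 < (1 / 2) ^ k / amp k ^ k" "(1 / 2) ^ k / amp k ^ k \<le> 1" by (auto simp: divide_le_eq_1)
qed

lemma rad_bound_pos: "0 < rad_bound k" and rad_bound_le_1: "rad_bound k \<le> 1"
  using rad_bound_base[of k] by (auto simp: rad_bound_def power_le_one)

lemma rad_bound_power:
  assumes r: "0 < r" "r \<le> rad_bound k" and p: "0 \<le> p" "p \<le> real k" and s: "1 \<le> real k * s"
  shows "amp k powr p * r powr s \<le> (1 / 2) ^ k"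
proof -
  define T where "T = (1 / 2) ^ k / amp k ^ k"
  have T: "0 < T" "T \<le> 1" unfolding T_def by (rule rad_bound_base)+
  have M: "1 \<le> amp k" by (rule amp_ge_1)
  have k: "0 < real k" using s by (cases "k = 0") auto
  then have s0: "0 \<le> s" using s by (metis less_le_not_le mult_nonneg_nonpos2 nle_le not_one_le_zero order_trans mult.commute)
  have "r powr s \<le> rad_bound k powr s" using r s0 by (intro powr_mono2) auto
  also have "\<dots> = T powr (real k * s)"
    unfolding rad_bound_def T_def[symmetric] using T by (simp add: powr_realpow[symmetric] powr_powr)
  also have "\<dots> \<le> T powr 1" using T s by (intro powr_mono') auto
  finally have 1: "r powr s \<le> T" using T by simp
  have "amp k powr p \<le> amp k powr real k" using M p by (intro powr_mono) auto
  also have "\<dots> = amp k ^ k" using M by (intro powr_realpow) auto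
  finally have 2: "amp k powr p \<le> amp k ^ k" .
  have "amp k powr p * r powr s \<le> amp k ^ k * T" by (rule mult_mono[OF 2 1]) (use M in auto)
  also have "\<dots> = (1 / 2) ^ k" using M by (simp add: T_def)
  finally show ?thesis .
qed

lemma rad_bound_mult: "0 < r \<Longrightarrow> r \<le> rad_bound k \<Longrightarrow> amp k * r \<le> (1 / 2) ^ k"
  using rad_bound_power[of r k 1 1] amp_ge_1[of k]
  by (cases "k = 0") (auto simp: rad_bound_def amp_def)

lemma eventually_rad_bound:
  assumes "\<And>k. 0 < r k" "\<And>k. r k \<le> rad_bound k" "0 \<le> p" "0 < s"
  shows "\<forall>\<^sub>F k in sequentially. amp k powr p * r k powr s \<le> (1 / 2) ^ k"
proof -
  have "\<forall>\<^sub>F k in sequentially. nat \<lceil>p\<rceil> + nat \<lceil>1 / s\<rceil> \<le> k" by (rule eventually_ge_at_top)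
  then show ?thesis
  proof eventually_elim
    case (elim k)
    then have k: "p \<le> real k" "1 / s \<le> real k" by linarith+
    then have "1 \<le> real k * s" using assms(4) by (simp add: field_simps)
    with k(1) show ?case by (intro rad_bound_power assms)
  qed
qed

text \<open>The centres form a dense sequence in which every point occurs infinitely often.\<close>

lemma bump_positions:
  fixes \<Omega> :: "'a::euclidean_space set"
  assumes \<Omega>: "open \<Omega>" "\<Omega> \<noteq> {}" and q: "0 < q" "q \<le> 1 / 2"
  obtains xs :: "nat \<Rightarrow> 'a" and rs :: "nat \<Rightarrow> real"
  where "\<And>k. 0 < rs k" "\<And>k. rs k \<le> rad_bound k" "\<And>k. cball (xs k) (2 * rs k) \<subseteq> \<Omega>" "\<And>k. rs (Suc k) \<le> q * rs k"
    "\<And>\<Omega>0 m. open \<Omega>0 \<Longrightarrow> \<Omega>0 \<noteq> {} \<Longrightarrow> \<Omega>0 \<subseteq> \<Omega> \<Longrightarrow> \<exists>k\<ge>m. ball (xs k) (2 * rs k) \<subseteq> \<Omega>0"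
proof -
  obtain D :: "'a set" where D: "countable D" "\<And>X. open X \<Longrightarrow> X \<noteq> {} \<Longrightarrow> \<exists>d\<in>D. d \<in> X"
    using countable_dense_exists by blast
  define D' where "D' = D \<inter> \<Omega>"
  have D': "countable D'" "D' \<noteq> {}" using D(1) D(2)[OF \<Omega>] by (auto simp: D'_def)
  define xs where "xs k = from_nat_into D' (fst (prod_decode k))" for k
  have xs: "xs k \<in> \<Omega>" for k using from_nat_into[OF D'(2)] by (auto simp: xs_def D'_def)
  have "\<exists>\<rho>>0. \<rho> \<le> rad_bound k \<and> cball (xs k) (2 * \<rho>) \<subseteq> \<Omega>" for k
  proof -
    obtain e where "0 < e" "cball (xs k) e \<subseteq> \<Omega>" using \<Omega>(1) xs[of k] open_contains_cball by blast
    then show ?thesis using rad_bound_pos[of k]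
      by (intro exI[of _ "min (e / 2) (rad_bound k)"]) (auto intro: order_trans[OF subset_cball])
  qed
  then obtain \<rho> where \<rho>: "\<And>k. 0 < \<rho> k" "\<And>k. \<rho> k \<le> rad_bound k" "\<And>k. cball (xs k) (2 * \<rho> k) \<subseteq> \<Omega>" by metis
  define rs where "rs = rec_nat (\<rho> 0) (\<lambda>k r. min (\<rho> (Suc k)) (q * r))"
  have rs: "rs 0 = \<rho> 0" "rs (Suc k) = min (\<rho> (Suc k)) (q * rs k)" for k by (auto simp: rs_def)
  have pos: "0 < rs k" for k by (induction k) (use \<rho>(1) q in \<open>auto simp: rs\<close>)
  have le: "rs k \<le> \<rho> k" for k by (cases k) (auto simp: rs)
  have "rs k \<le> (1 / 2) ^ k" for k
  proof (induction k)
    case 0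
    then show ?case using \<rho>(2)[of 0] rad_bound_le_1[of 0] by (simp add: rs)
  next
    case (Suc k)
    have "rs (Suc k) \<le> q * rs k" by (simp add: rs)
    also have "\<dots> \<le> 1 / 2 * (1 / 2) ^ k" using q Suc pos[of k] by (intro mult_mono) auto
    finally show ?case by simp
  qed
  note half = this
  show ?thesis
  proof (rule that[of rs xs])
    show "0 < rs k" "rs k \<le> rad_bound k" "rs (Suc k) \<le> q * rs k" for k
      using pos le[of k] \<rho>(2)[of k] by (auto simp: rs)
    show "cball (xs k) (2 * rs k) \<subseteq> \<Omega>" for k
      using \<rho>(3)[of k] le[of k] by (intro order_trans[OF subset_cball \<rho>(3)]) auto
    fix \<Omega>0 m assume \<Omega>0: "open \<Omega>0" "\<Omega>0 \<noteq> {}" "\<Omega>0 \<subseteq> \<Omega>"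
    then obtain d where d: "d \<in> D'" "d \<in> \<Omega>0" using D(2)[of \<Omega>0] by (auto simp: D'_def)
    then obtain i where i: "from_nat_into D' i = d" using D'(1) from_nat_into_surj by metis
    obtain e where e: "0 < e" "ball d e \<subseteq> \<Omega>0" using \<Omega>0(1) d(2) open_contains_ball by blast
    obtain j where j: "(1 / 2 :: real) ^ j < e / 2" using real_arch_pow_inv[of "e / 2" "1 / 2"] e by auto
    \<comment> \<open>The second component of the code is free. Putting \<open>m + j\<close> there
      makes the index large, and with it the radius small, while the centre stays
      \<open>d\<close>.\<close>
    define k where "k = prod_encode (i, m + j)"
    have k: "m + j \<le> k" unfolding k_def by (rule le_prod_encode_2)
    have "rs k \<le> (1 / 2) ^ j" using half[of k] power_decreasing[of j k "1 / 2 :: real"] k by linarith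
    then have "2 * rs k \<le> e" using j by linarith
    moreover have "xs k = d" by (simp add: xs_def k_def i)
    ultimately have "ball (xs k) (2 * rs k) \<subseteq> \<Omega>0" using e(2) by (auto intro: order_trans[OF subset_ball] simp: subset_iff)
    then show "\<exists>k\<ge>m. ball (xs k) (2 * rs k) \<subseteq> \<Omega>0" using k by (intro exI[of _ k]) auto
  qed
qed

section \<open>Criteria for geometric decay of energies\<close>

lemma Lp_energy_support:
  fixes f :: "'a::euclidean_space \<Rightarrow> 'b::euclidean_space"
  assumes \<Omega>: "\<Omega> \<in> sets lebesgue" and S: "S \<in> lmeasurable" "\<And>x. x \<in> \<Omega> \<Longrightarrow> x \<notin> S \<Longrightarrow> f x = 0"
    and K: "\<And>x. norm (f x) \<le> K" and p: "0 \<le> p"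
  shows "Lp_energy p (lebesgue_on \<Omega>) f \<le> ennreal (K powr p * measure lebesgue S)"
proof -
  have "Lp_energy p (lebesgue_on \<Omega>) f = (\<integral>\<^sup>+x. ennreal (norm (f x) powr p) * indicator \<Omega> x \<partial>lebesgue)"
    unfolding Lp_energy_def using \<Omega> by (simp add: nn_integral_restrict_space)
  also have "\<dots> \<le> (\<integral>\<^sup>+x. ennreal (K powr p) * indicator S x \<partial>lebesgue)"
  proof (rule nn_integral_mono)
    fix x :: 'a
    show "ennreal (norm (f x) powr p) * indicator \<Omega> x \<le> ennreal (K powr p) * indicator S x"
    proof (cases "x \<in> \<Omega> \<and> x \<notin> S")
      case True
      then show ?thesis using S(2) by simp
    next
      case False
      then show ?thesis using K[of x] p by (auto simp: indicator_def intro!: ennreal_leI powr_mono2)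
    qed
  qed
  also have "\<dots> = ennreal (K powr p) * emeasure lebesgue S"
    using S(1) by (intro nn_integral_cmult_indicator) auto
  also have "\<dots> = ennreal (K powr p * measure lebesgue S)"
    using S(1) by (simp add: emeasure_eq_measure2 ennreal_mult)
  finally show ?thesis .
qed

text \<open>Finitely many terms are absorbed into the constant. The radii of the bumps yield decay
  only from an index on that depends on the exponent.\<close>

lemma geometric_energyI:
  assumes e: "\<And>k. Lp_energy p M (f k) \<le> ennreal (e k)" and ev: "\<forall>\<^sub>F k in sequentially. e k \<le> D * (1 / 2) ^ k"
  shows "geometric_energy p M f"
proof -
  obtain m where m: "\<And>k. m \<le> k \<Longrightarrow> e k \<le> D * (1 / 2) ^ k" using ev unfolding eventually_sequentially by blast
  define C where "C = \<bar>D\<bar> + (\<Sum>k<m. \<bar>e k\<bar> * 2 ^ k)"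
  have s: "0 \<le> (\<Sum>k<m. \<bar>e k\<bar> * 2 ^ k)" by (intro sum_nonneg) auto
  have "e k \<le> C * (1 / 2) ^ k" for k
  proof (cases "k < m")
    case True
    have "\<bar>e k\<bar> * 2 ^ k \<le> (\<Sum>k<m. \<bar>e k\<bar> * 2 ^ k)" by (rule member_le_sum) (use True in auto)
    then have "\<bar>e k\<bar> * 2 ^ k \<le> C" by (simp add: C_def)
    then have "\<bar>e k\<bar> \<le> C / 2 ^ k" by (simp add: field_simps)
    then show ?thesis by (simp add: power_one_over)
  next
    case False
    have "D * (1 / 2) ^ k \<le> C * (1 / 2) ^ k" using s by (intro mult_right_mono) (auto simp: C_def)
    with m[of k] False show ?thesis by linarith
  qed
  then have "Lp_energy p M (f k) \<le> ennreal (C * (1 / 2) ^ k)" for k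
    using e[of k] by (meson ennreal_leI order_trans)
  moreover have "0 \<le> C" using s by (simp add: C_def)
  ultimately show ?thesis unfolding geometric_energy_def by blast
qed

lemma geometric_energy_sum:
  fixes f :: "'i \<Rightarrow> nat \<Rightarrow> 'a \<Rightarrow> 'b::euclidean_space"
  assumes "finite I" "0 \<le> p"
    and "\<And>i. i \<in> I \<Longrightarrow> geometric_energy p M (f i)" "\<And>i k. i \<in> I \<Longrightarrow> f i k \<in> borel_measurable M"
  shows "geometric_energy p M (\<lambda>k x. \<Sum>i\<in>I. f i k x)"
  using assms
proof (induction I rule: finite_induct)
  case empty
  show ?case unfolding geometric_energy_def Lp_energy_def by (intro exI[of _ 0]) simp
next
  case (insert i I)
  then have "geometric_energy p M (\<lambda>k x. f i k x + (\<Sum>i\<in>I. f i k x))"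
    by (intro geometric_energy_add) auto
  then show ?case using insert by simp
qed

lemma geometric_energy_sup:
  fixes f :: "nat \<Rightarrow> 'a::euclidean_space \<Rightarrow> 'b::euclidean_space"
  assumes \<Omega>: "open \<Omega>" "bounded \<Omega>" and p: "1 \<le> p" and f: "\<And>k x. norm (f k x) \<le> C * (1 / 2) ^ k"
  shows "geometric_energy p (lebesgue_on \<Omega>) f"
proof (rule geometric_energyI)
  have lm: "\<Omega> \<in> lmeasurable" using \<Omega> by (simp add: bounded_set_imp_lmeasurable)
  have C: "0 \<le> C" using order_trans[OF norm_ge_zero f[of 0]] by simp
  show "Lp_energy p (lebesgue_on \<Omega>) (f k) \<le> ennreal ((C * (1 / 2) ^ k) powr p * measure lebesgue \<Omega>)" for k
    by (rule Lp_energy_support[OF _ lm]) (use f p \<Omega> in auto)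
  have "(C * (1 / 2) ^ k) powr p * measure lebesgue \<Omega> \<le> C powr p * measure lebesgue \<Omega> * (1 / 2) ^ k" for k
  proof -
    have "((1 / 2 :: real) ^ k) powr p \<le> ((1 / 2) ^ k) powr 1"
      using p by (intro powr_mono') (auto simp: power_le_one)
    then have "((1 / 2 :: real) ^ k) powr p \<le> (1 / 2) ^ k" by simp
    then have "C powr p * measure lebesgue \<Omega> * ((1 / 2) ^ k) powr p \<le> C powr p * measure lebesgue \<Omega> * (1 / 2) ^ k"
      by (intro mult_left_mono) auto
    then show ?thesis using C by (simp add: powr_mult ac_simps)
  qed
  then show "\<forall>\<^sub>F k in sequentially. (C * (1 / 2) ^ k) powr p * measure lebesgue \<Omega> \<le> C powr p * measure lebesgue \<Omega> * (1 / 2) ^ k"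
    by simp
qed

section \<open>Solenoidal fields from stream functions\<close>

text \<open>The sign is put on the vector so that both terms have the form treated by
  \<open>Ck_combination\<close> and \<open>geometric_energy_combination\<close>.\<close>

definition rot :: "'n::finite \<Rightarrow> 'n \<Rightarrow> (real^'n \<Rightarrow> real) \<Rightarrow> real^'n \<Rightarrow> real^'n" where
  "rot a b F x = dderiv (axis b 1) F x *\<^sub>R axis a 1 + dderiv (axis a 1) F x *\<^sub>R (- axis b 1)"

text \<open>\<open>axis a (axis j 1)\<close> is the matrix unit at (a, j). Expansion in such units
  reduces regularity and energies to those of scalar derivatives.\<close>

definition grad_rot :: "'n::finite \<Rightarrow> 'n \<Rightarrow> (real^'n \<Rightarrow> real) \<Rightarrow> real^'n \<Rightarrow> real^'n^'n" where
  "grad_rot a b F x = (\<Sum>j\<in>UNIV. dderiv (axis j 1) (dderiv (axis b 1) F) x *\<^sub>R axis a (axis j 1)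
      + dderiv (axis j 1) (dderiv (axis a 1) F) x *\<^sub>R (- axis b (axis j 1)))"

lemma axis_component: "axis k y $ i = (if i = k then y else 0)"
  by (simp add: axis_def)

lemma norm_axis: "norm (axis k y :: 'b::real_normed_vector^'n::finite) = norm y"
proof -
  have "(\<Sum>i\<in>UNIV. (norm ((axis k y :: 'b^'n) $ i))\<^sup>2) = (\<Sum>i\<in>UNIV. if i = k then (norm y)\<^sup>2 else 0)"
    by (intro sum.cong) (auto simp: axis_component)
  then show ?thesis by (simp add: norm_vec_def L2_set_def)
qed

lemma grad_rot_entry:
  assumes "a \<noteq> b"
  shows "grad_rot a b F x $ i $ j =
    (if i = a then dderiv (axis j 1) (dderiv (axis b 1) F) x else if i = b then - dderiv (axis j 1) (dderiv (axis a 1) F) x else 0)"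
proof -
  have "grad_rot a b F x $ i $ j = (\<Sum>l\<in>UNIV. if l = j then
      (if i = a then dderiv (axis j 1) (dderiv (axis b 1) F) x else if i = b then - dderiv (axis j 1) (dderiv (axis a 1) F) x else 0) else 0)"
    unfolding grad_rot_def sum_component vector_add_component vector_scaleR_component vector_uminus_component axis_component
    using assms by (intro sum.cong) (auto simp: axis_component)
  then show ?thesis by simp
qed

lemma trace_grad_rot: "a \<noteq> b \<Longrightarrow> Ck 3 F \<Longrightarrow> trace (grad_rot a b F x) = 0"
proof -
  assume ab: "a \<noteq> b" and F: "Ck 3 F"
  have F2: "Ck (Suc (Suc 0)) F" using Ck_mono[OF F, of "Suc (Suc 0)"] by simp
  have "trace (grad_rot a b F x) = (\<Sum>i\<in>UNIV. (if i = a then dderiv (axis a 1) (dderiv (axis b 1) F) x else 0)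
      + (if i = b then - dderiv (axis b 1) (dderiv (axis a 1) F) x else 0))"
    unfolding trace_def grad_rot_entry[OF ab] using ab by (intro sum.cong) auto
  also have "\<dots> = 0" using dderiv_symmetric[OF F2, of "axis a 1" "axis b 1" x] by (simp add: sum.distrib)
  finally show ?thesis .
qed

lemma column_linear: "bounded_linear (\<lambda>A :: real^'n^'m. column j A)"
  unfolding linear_conv_bounded_linear[symmetric]
  by (rule linearI) (auto simp: column_def vec_eq_iff)

lemma dderiv_combination:
  fixes f h :: "'a::euclidean_space \<Rightarrow> real" and v w :: "'b::euclidean_space"
  assumes "f differentiable at x" "h differentiable at x"
  shows "dderiv c (\<lambda>x. f x *\<^sub>R v + h x *\<^sub>R w) x = dderiv c f x *\<^sub>R v + dderiv c h x *\<^sub>R w"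
  by (rule dderiv_eqI) (auto intro!: has_derivative_add has_derivative_scaleR_left dderiv_has_derivative assms)

lemma Ck_combination:
  fixes f h :: "'a::euclidean_space \<Rightarrow> real" and v w :: "'b::euclidean_space"
  assumes "Ck k f" "Ck k h"
  shows "Ck k (\<lambda>x. f x *\<^sub>R v + h x *\<^sub>R w)"
  by (intro Ck_add Ck_scaleR Ck_const assms)

lemma geometric_energy_combination:
  fixes f h :: "nat \<Rightarrow> 'a \<Rightarrow> real" and v w :: "'b::euclidean_space"
  assumes "geometric_energy p M f" "geometric_energy p M h" "0 \<le> p" "norm v \<le> 1" "norm w \<le> 1"
    and [measurable]: "\<And>k. f k \<in> borel_measurable M" "\<And>k. h k \<in> borel_measurable M"
  shows "geometric_energy p M (\<lambda>k x. f k x *\<^sub>R v + h k x *\<^sub>R w)"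
proof (rule geometric_energy_add)
  show "geometric_energy p M (\<lambda>k x. f k x *\<^sub>R v)"
    by (rule geometric_energy_mono[OF assms(1) _ assms(3)]) (use assms(4) in \<open>auto intro: mult_left_le\<close>)
  show "geometric_energy p M (\<lambda>k x. h k x *\<^sub>R w)"
    by (rule geometric_energy_mono[OF assms(2) _ assms(3)]) (use assms(5) in \<open>auto intro: mult_left_le\<close>)
qed (use assms in auto)

text \<open>The gradient is one series of matrices, whose columns are known to agree with the series
  of columns only where it converges; hence a change on a null set has to be allowed.\<close>

lemma has_weak_derivative_cong_AE:
  fixes f g g' :: "'a::euclidean_space \<Rightarrow> 'b::euclidean_space"
  assumes \<Omega>: "\<Omega> \<in> sets lebesgue" and i: "integrable (lebesgue_on \<Omega>) f" "integrable (lebesgue_on \<Omega>) g"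
    and m: "g' \<in> borel_measurable (lebesgue_on \<Omega>)" and ae: "AE x in lebesgue_on \<Omega>. g x = g' x"
    and h: "has_weak_derivative \<Omega> v f g"
  shows "has_weak_derivative \<Omega> v f g'"
proof (rule has_weak_derivativeI[OF \<Omega> i(1)])
  show i': "integrable (lebesgue_on \<Omega>) g'"
    using integrable_cong_AE[OF _ m ae] i(2) by auto
  fix \<phi> assume t: "test_function \<Omega> \<phi>"
  have "(\<integral>x. \<phi> x *\<^sub>R g x \<partial>lebesgue_on \<Omega>) = (\<integral>x. \<phi> x *\<^sub>R g' x \<partial>lebesgue_on \<Omega>)"
    by (rule integral_cong_AE)
      (use integrable_test_mult(1)[OF t i(2)] integrable_test_mult(1)[OF t i'] ae in \<open>auto elim: eventually_mono\<close>)
  then show "(\<integral>x. dderiv v \<phi> x *\<^sub>R f x \<partial>lebesgue_on \<Omega>) = - (\<integral>x. \<phi> x *\<^sub>R g' x \<partial>lebesgue_on \<Omega>)"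
    using has_weak_derivativeD[OF h t \<Omega>] by simp
qed

text \<open>The uniform bound \<open>d1\<close> gives continuity up to the boundary,
  \<open>d2\<close> for all exponents gives W^(1,s), and \<open>d3\<close> below the dimension gives
  W^(2,q). Second derivatives carry energy bounds only, since the amplitudes of the bumps are
  unbounded.\<close>

locale stream_series =
  fixes \<Omega> :: "(real^'n::finite) set" and a b :: 'n and F :: "nat \<Rightarrow> real^'n \<Rightarrow> real" and K :: real
  assumes \<Omega>: "open \<Omega>" "bounded \<Omega>" and ab: "a \<noteq> b" and F: "\<And>k. Ck 3 (F k)"
    and d1: "\<And>k x c. c \<in> Basis \<Longrightarrow> \<bar>dderiv c (F k) x\<bar> \<le> K * (1 / 2) ^ k"
    and d2: "\<And>p c d. 1 \<le> p \<Longrightarrow> c \<in> Basis \<Longrightarrow> d \<in> Basis \<Longrightarrow>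
      geometric_energy p (lebesgue_on \<Omega>) (\<lambda>k. dderiv d (dderiv c (F k)))"
    and d3: "\<And>p c d e. 1 \<le> p \<Longrightarrow> p < real CARD('n) \<Longrightarrow> c \<in> Basis \<Longrightarrow> d \<in> Basis \<Longrightarrow> e \<in> Basis \<Longrightarrow>
      geometric_energy p (lebesgue_on \<Omega>) (\<lambda>k. dderiv e (dderiv d (dderiv c (F k))))"
    and n2: "2 \<le> CARD('n)"
begin

definition u :: "real^'n \<Rightarrow> real^'n" where "u x = (\<Sum>k. rot a b (F k) x)"
definition G :: "real^'n \<Rightarrow> real^'n^'n" where "G x = (\<Sum>k. grad_rot a b (F k) x)"

lemma F3: "Ck (Suc (Suc (Suc 0))) (F k)"
  using F[of k] by (simp add: eval_nat_numeral)

lemmas F_dd = Ck_dd[OF F3] Ck_dd[OF Ck_dd[OF F3]] Ck_dd[OF Ck_dd[OF Ck_dd[OF F3]]]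

lemma \<Omega>_sets: "\<Omega> \<in> sets lebesgue"
  using \<Omega> by auto

lemma axis_Basis: "axis i (1::real) \<in> Basis"
  by (simp add: axis_in_Basis_iff)

lemma Ck_rot: "Ck (Suc (Suc 0)) (rot a b (F k))"
  unfolding rot_def[abs_def] by (intro Ck_combination F_dd)

lemma dderiv_rot: "dderiv c (rot a b (F k)) = (\<lambda>x. dderiv c (dderiv (axis b 1) (F k)) x *\<^sub>R axis a 1 + dderiv c (dderiv (axis a 1) (F k)) x *\<^sub>R (- axis b 1))"
  unfolding rot_def[abs_def]
  by (rule ext) (intro dderiv_combination Ck_differentiable[OF F_dd(1)])

lemma dderiv2_rot: "dderiv d (dderiv c (rot a b (F k))) =
   (\<lambda>x. dderiv d (dderiv c (dderiv (axis b 1) (F k))) x *\<^sub>R axis a 1 + dderiv d (dderiv c (dderiv (axis a 1) (F k))) x *\<^sub>R (- axis b 1))"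
  unfolding dderiv_rot by (rule ext) (intro dderiv_combination Ck_differentiable[OF F_dd(2)])

lemma dderiv_rot_column: "dderiv (axis j 1) (rot a b (F k)) x = column j (grad_rot a b (F k) x)"
  using ab by (simp add: dderiv_rot vec_eq_iff column_def grad_rot_entry axis_def)

lemma Ck_grad_rot: "Ck (Suc 0) (grad_rot a b (F k))"
  unfolding grad_rot_def[abs_def] by (intro Ck_sum Ck_combination F_dd)

lemma dderiv_grad_rot: "dderiv c (grad_rot a b (F k)) = (\<lambda>x. \<Sum>j\<in>UNIV. dderiv c (dderiv (axis j 1) (dderiv (axis b 1) (F k))) x *\<^sub>R axis a (axis j 1)
      + dderiv c (dderiv (axis j 1) (dderiv (axis a 1) (F k))) x *\<^sub>R (- axis b (axis j 1)))"
proof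
  fix x
  have "dderiv c (grad_rot a b (F k)) x = (\<Sum>j\<in>UNIV. dderiv c (\<lambda>x. dderiv (axis j 1) (dderiv (axis b 1) (F k)) x *\<^sub>R axis a (axis j 1)
      + dderiv (axis j 1) (dderiv (axis a 1) (F k)) x *\<^sub>R (- axis b (axis j 1))) x)"
    unfolding grad_rot_def[abs_def]
    by (rule dderiv_sum) (rule Ck_differentiable[OF Ck_combination[OF F_dd(2) F_dd(2)]])
  also have "\<dots> = (\<Sum>j\<in>UNIV. dderiv c (dderiv (axis j 1) (dderiv (axis b 1) (F k))) x *\<^sub>R axis a (axis j 1)
      + dderiv c (dderiv (axis j 1) (dderiv (axis a 1) (F k))) x *\<^sub>R (- axis b (axis j 1)))"
    by (intro sum.cong refl dderiv_combination Ck_differentiable[OF F_dd(2)])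
  finally show "dderiv c (grad_rot a b (F k)) x = (\<Sum>j\<in>UNIV. dderiv c (dderiv (axis j 1) (dderiv (axis b 1) (F k))) x *\<^sub>R axis a (axis j 1)
      + dderiv c (dderiv (axis j 1) (dderiv (axis a 1) (F k))) x *\<^sub>R (- axis b (axis j 1)))" .
qed

lemma measurable_Ck: "Ck k f \<Longrightarrow> f \<in> borel_measurable (lebesgue_on \<Omega>)" for f :: "real^'n \<Rightarrow> 'b::euclidean_space"
  by (intro continuous_borel_measurable_lebesgue_on Ck_continuous)

lemma norm_rot: "norm (rot a b (F k) x) \<le> 2 * K * (1 / 2) ^ k"
proof -
  have "norm (rot a b (F k) x) \<le> \<bar>dderiv (axis b 1) (F k) x\<bar> + \<bar>dderiv (axis a 1) (F k) x\<bar>"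
    unfolding rot_def by (rule order_trans[OF norm_triangle_ineq]) (simp add: norm_axis)
  then show ?thesis using d1[OF axis_Basis, of b k x] d1[OF axis_Basis, of a k x] by simp
qed

lemma energy_rot:
  assumes p: "1 \<le> p"
  shows "geometric_energy p (lebesgue_on \<Omega>) (\<lambda>k. rot a b (F k))"
    "c \<in> Basis \<Longrightarrow> geometric_energy p (lebesgue_on \<Omega>) (\<lambda>k. dderiv c (rot a b (F k)))"
    "c \<in> Basis \<Longrightarrow> d \<in> Basis \<Longrightarrow> p < real CARD('n) \<Longrightarrow>
      geometric_energy p (lebesgue_on \<Omega>) (\<lambda>k. dderiv d (dderiv c (rot a b (F k))))"
proof -
  show "geometric_energy p (lebesgue_on \<Omega>) (\<lambda>k. rot a b (F k))"
    by (rule geometric_energy_sup[OF \<Omega> p norm_rot])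
  show "geometric_energy p (lebesgue_on \<Omega>) (\<lambda>k. dderiv c (rot a b (F k)))" if "c \<in> Basis"
    unfolding dderiv_rot
    by (rule geometric_energy_combination) (use p that in \<open>auto intro!: d2 axis_Basis measurable_Ck F_dd simp: norm_axis\<close>)
  show "geometric_energy p (lebesgue_on \<Omega>) (\<lambda>k. dderiv d (dderiv c (rot a b (F k))))"
    if "c \<in> Basis" "d \<in> Basis" "p < real CARD('n)"
    unfolding dderiv2_rot
    by (rule geometric_energy_combination) (use p that in \<open>auto intro!: d3 axis_Basis measurable_Ck F_dd simp: norm_axis\<close>)
qed

lemma energy_grad_rot:
  assumes p: "1 \<le> p"
  shows "geometric_energy p (lebesgue_on \<Omega>) (\<lambda>k. grad_rot a b (F k))"
    "c \<in> Basis \<Longrightarrow> p < real CARD('n) \<Longrightarrow> geometric_energy p (lebesgue_on \<Omega>) (\<lambda>k. dderiv c (grad_rot a b (F k)))"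
proof -
  show "geometric_energy p (lebesgue_on \<Omega>) (\<lambda>k. grad_rot a b (F k))"
    unfolding grad_rot_def[abs_def]
  proof (rule geometric_energy_sum)
    show "geometric_energy p (lebesgue_on \<Omega>) (\<lambda>k x. dderiv (axis j 1) (dderiv (axis b 1) (F k)) x *\<^sub>R axis a (axis j (1::real))
       + dderiv (axis j 1) (dderiv (axis a 1) (F k)) x *\<^sub>R (- axis b (axis j (1::real)) :: real^'n^'n))" for j
      by (rule geometric_energy_combination) (use p in \<open>auto intro!: d2 axis_Basis measurable_Ck F_dd simp: norm_axis\<close>)
  qed (simp, use p in simp, rule measurable_Ck, rule Ck_combination[OF F_dd(2) F_dd(2)])
  show "geometric_energy p (lebesgue_on \<Omega>) (\<lambda>k. dderiv c (grad_rot a b (F k)))" if "c \<in> Basis" "p < real CARD('n)"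
    unfolding dderiv_grad_rot
  proof (rule geometric_energy_sum)
    show "geometric_energy p (lebesgue_on \<Omega>) (\<lambda>k x. dderiv c (dderiv (axis j 1) (dderiv (axis b 1) (F k))) x *\<^sub>R axis a (axis j (1::real))
       + dderiv c (dderiv (axis j 1) (dderiv (axis a 1) (F k))) x *\<^sub>R (- axis b (axis j (1::real)) :: real^'n^'n))" for j
      by (rule geometric_energy_combination) (use p that in \<open>auto intro!: d3 axis_Basis measurable_Ck F_dd simp: norm_axis\<close>)
  qed (simp, use p in simp, rule measurable_Ck, rule Ck_combination[OF F_dd(3) F_dd(3)])
qed

lemma AE_summable: "AE x in lebesgue_on \<Omega>. summable (\<lambda>k. norm (grad_rot a b (F k) x))"
  by (rule geometric_energy_tail(1)[OF measurable_Ck[OF Ck_grad_rot] _ energy_grad_rot(1)[of 1]]) auto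

lemma has_weak_gradient_u: "has_weak_gradient \<Omega> u G"
  unfolding has_weak_gradient_def
proof
  fix j
  have m: "rot a b (F k) \<in> borel_measurable (lebesgue_on \<Omega>)" "dderiv c (rot a b (F k)) \<in> borel_measurable (lebesgue_on \<Omega>)"
     "grad_rot a b (F k) \<in> borel_measurable (lebesgue_on \<Omega>)" for k c
    by (intro measurable_Ck[OF Ck_rot] measurable_Ck[OF Ck_dd[OF Ck_rot]] measurable_Ck[OF Ck_grad_rot])+
  have e: "geometric_energy 1 (lebesgue_on \<Omega>) (\<lambda>k. rot a b (F k))"
    "geometric_energy 1 (lebesgue_on \<Omega>) (\<lambda>k. dderiv (axis j 1) (rot a b (F k)))"
    by (auto intro: energy_rot axis_Basis)
  have "has_weak_derivative \<Omega> (axis j 1) u (\<lambda>x. \<Sum>k. dderiv (axis j 1) (rot a b (F k)) x)"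
    unfolding u_def[abs_def]
    by (rule has_weak_derivative_series[OF \<Omega> Ck_pred[OF Ck_rot] e])
  then show "has_weak_derivative \<Omega> (axis j 1) u (\<lambda>x. column j (G x))"
  proof (rule has_weak_derivative_cong_AE[OF \<Omega>_sets, rotated 4])
    show "integrable (lebesgue_on \<Omega>) u" unfolding u_def[abs_def]
      by (rule geometric_energy_integrable(1)[OF m(1) e(1)])
    show "integrable (lebesgue_on \<Omega>) (\<lambda>x. \<Sum>k. dderiv (axis j 1) (rot a b (F k)) x)"
      by (rule geometric_energy_integrable(1)[OF m(2) e(2)])
    have "G \<in> borel_measurable (lebesgue_on \<Omega>)"
      unfolding G_def[abs_def] using m(3) by (intro borel_measurable_suminf)
    then show "(\<lambda>x. column j (G x)) \<in> borel_measurable (lebesgue_on \<Omega>)"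
      by (rule borel_measurable_continuous_on[OF linear_continuous_on[OF column_linear]])
    show "AE x in lebesgue_on \<Omega>. (\<Sum>k. dderiv (axis j 1) (rot a b (F k)) x) = column j (G x)"
      using AE_summable
    proof eventually_elim
      case (elim x)
      show ?case unfolding dderiv_rot_column G_def
        by (rule bounded_linear.suminf[OF column_linear summable_norm_cancel[OF elim], symmetric])
    qed
  qed
qed

lemma u_sobolev:
  assumes s: "1 \<le> s"
  shows "u \<in> sobolev 1 s \<Omega>" "s < real CARD('n) \<Longrightarrow> u \<in> sobolev 2 s \<Omega>"
proof -
  have e: "\<And>q. q \<in> {1, s} \<Longrightarrow> 1 \<le> q" using s by auto
  show 1: "u \<in> sobolev 1 s \<Omega>" unfolding u_def[abs_def]
    by (rule sobolev_series(1)[OF \<Omega> s Ck_pred[OF Ck_rot]])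
      (use e axis_Basis in \<open>auto intro!: energy_rot simp del: One_nat_def\<close>)
  show "u \<in> sobolev 2 s \<Omega>" if sn: "s < real CARD('n)"
  proof -
    have "(\<lambda>x. \<Sum>k. dderiv c (rot a b (F k)) x) \<in> sobolev 1 s \<Omega>" if c: "c \<in> Basis" for c
      by (rule sobolev_series(1)[OF \<Omega> s Ck_dd[OF Ck_rot]])
        (use e c sn n2 axis_Basis in \<open>auto intro!: energy_rot\<close>)
    moreover have "has_weak_derivative \<Omega> c u (\<lambda>x. \<Sum>k. dderiv c (rot a b (F k)) x)" if c: "c \<in> Basis" for c
      unfolding u_def[abs_def]
      by (rule has_weak_derivative_series[OF \<Omega> Ck_pred[OF Ck_rot]]) (auto intro: energy_rot c)
    moreover have "u \<in> Lp_space s (lebesgue_on \<Omega>)" using 1 by simp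
    ultimately show ?thesis unfolding numeral_2_eq_2 One_nat_def[symmetric] sobolev.simps(2)[of 1] by blast
  qed
qed

lemma continuous_u: "continuous_on UNIV u"
proof -
  have K: "0 \<le> K" using order_trans[OF norm_ge_zero norm_rot[of 0 0]] by simp
  have "uniform_limit UNIV (\<lambda>n x. \<Sum>k<n. rot a b (F k) x) u sequentially"
    unfolding u_def[abs_def]
    by (rule Weierstrass_m_test[OF norm_rot]) (use K in \<open>auto intro!: summable_mult summable_geometric\<close>)
  then show ?thesis
    by (rule uniform_limit_theorem[rotated])
      (auto intro!: always_eventually continuous_on_sum Ck_continuous[OF Ck_rot])
qed

lemma Lp_energy_zero: "0 < p \<Longrightarrow> (\<And>x. x \<in> space M \<Longrightarrow> f x = 0) \<Longrightarrow> Lp_energy p M f = 0"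
  unfolding Lp_energy_def by (subst nn_integral_0_iff_AE[THEN iffD2]) (auto cong: measurable_cong simp: AE_I2)

lemma space_surface [simp]: "space (surface_measure A) = frontier A" for A :: "'b::euclidean_space set"
  by (simp add: surface_measure_def space_restrict_space)

lemma measurable_surface: "f \<in> borel_measurable borel \<Longrightarrow> f \<in> borel_measurable (surface_measure A)"
  for A :: "'b::euclidean_space set" and f :: "'b \<Rightarrow> 'c::euclidean_space"
  unfolding surface_measure_def
  by (rule measurable_restrict_space1) (simp add: measurable_cong_sets[OF sets_hausdorff_measure refl])

text \<open>\<open>u\<close> is continuous on the whole space and lies in W^(1,s), so the constant
  sequence \<open>u\<close> is admissible in the definition of the trace, and its boundary values
  are 0.\<close>

lemma u_zero_trace:
  assumes s: "1 \<le> s" and z: "\<And>x. x \<in> frontier \<Omega> \<Longrightarrow> u x = 0"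
  shows "u \<in> sobolev_zero_trace s \<Omega>"
proof -
  have s0: "0 < s" using s by simp
  have "has_weak_derivative \<Omega> c (\<lambda>x. u x - u x) (\<lambda>x. 0)" for c
    using has_weak_derivative_Ck[OF \<Omega> Ck_const[of "Suc 0" "0 :: real^'n"], of c] by (simp add: dderiv_def[abs_def] dderiv_const[unfolded dderiv_def])
  then have "W1_tendsto s \<Omega> (\<lambda>k. u) u"
    unfolding W1_tendsto_def using s0 by (auto simp: Lp_energy_zero intro!: exI[of _ "\<lambda>k x. 0"])
  moreover have "Lp_energy s (surface_measure \<Omega>) (\<lambda>x. u x - 0) = 0" by (rule Lp_energy_zero[OF s0]) (simp add: z)
  moreover have "(\<lambda>x. 0 :: real^'n) \<in> Lp_space s (surface_measure \<Omega>)"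
    using s0 by (simp add: Lp_space_def Lp_energy_zero)
  ultimately show ?thesis
    unfolding sobolev_zero_trace_def has_trace_def using u_sobolev(1)[OF s]
    by (auto intro!: exI[of _ "\<lambda>k. u"] continuous_on_subset[OF continuous_u] simp del: One_nat_def)
qed

lemma AE_trace_G: "AE x in lebesgue_on \<Omega>. trace (G x) = 0"
  using AE_summable
proof eventually_elim
  case (elim x)
  have "bounded_linear (\<lambda>A :: real^'n^'n. trace A)"
    unfolding linear_conv_bounded_linear[symmetric]
    by (rule linearI) (auto simp: trace_def sum.distrib sum_distrib_left)
  from bounded_linear.suminf[OF this summable_norm_cancel[OF elim]]
  show ?case unfolding G_def by (simp add: trace_grad_rot[OF ab F])
qed

text \<open>The series represents its own trace. Its partial sums are C^1, converge in W^(1,p), and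
  on the boundary converge uniformly at rate 2^-m. Uniform convergence gives L^p convergence because
  all terms vanish on the boundary outside \<open>S\<close>, a set of finite surface
  measure.\<close>

lemma G_trace:
  assumes p: "1 \<le> p" "p < real CARD('n)" and D: "\<And>k x. x \<in> frontier \<Omega> \<Longrightarrow> norm (grad_rot a b (F k) x) \<le> D * (1 / 2) ^ k"
    and S: "S \<in> sets borel" "hausdorff_outer (real CARD('n) - 1) S < \<infinity>"
      "\<And>k x. x \<in> frontier \<Omega> \<Longrightarrow> x \<notin> S \<Longrightarrow> grad_rot a b (F k) x = 0"
  shows "has_trace p \<Omega> G G"
proof -
  let ?M = "surface_measure \<Omega>"
  have p0: "0 < p" using p by simp
  have e: "\<And>q. q \<in> {1, p} \<Longrightarrow> 1 \<le> q \<and> q < real CARD('n)" using p n2 by auto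
  have ser: "G \<in> sobolev 1 p \<Omega>" "W1_tendsto p \<Omega> (\<lambda>m x. \<Sum>k<m. grad_rot a b (F k) x) G"
    unfolding G_def[abs_def]
    by (rule sobolev_series(1)[OF \<Omega> p(1) Ck_grad_rot]; use e in \<open>auto intro!: energy_grad_rot simp del: One_nat_def\<close>)
      (rule sobolev_series(2)[OF \<Omega> p(1) Ck_grad_rot]; use e in \<open>auto intro!: energy_grad_rot simp del: One_nat_def\<close>)
  have mk: "grad_rot a b (F k) \<in> borel_measurable ?M" for k
    by (intro measurable_surface borel_measurable_continuous_onI Ck_continuous[OF Ck_grad_rot])
  have mG: "G \<in> borel_measurable ?M" unfolding G_def[abs_def] using mk by (rule borel_measurable_suminf)
  have fr: "frontier \<Omega> \<in> sets borel" by (simp add: frontier_closed borel_closed)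
  have muS: "emeasure ?M (S \<inter> frontier \<Omega>) < \<infinity>"
  proof -
    have "emeasure ?M (S \<inter> frontier \<Omega>) = emeasure (hausdorff_measure (real CARD('n) - 1)) (S \<inter> frontier \<Omega>)"
      unfolding surface_measure_def using S(1) fr by (subst emeasure_restrict_space) auto
    also have "\<dots> \<le> emeasure (hausdorff_measure (real CARD('n) - 1)) S"
      by (rule emeasure_mono) (use S(1) in auto)
    also have "\<dots> < \<infinity>" using S by (simp add: emeasure_hausdorff_measure)
    finally show ?thesis .
  qed
  have le: "Lp_energy p ?M (\<lambda>x. (\<Sum>k<m. grad_rot a b (F k) x) - G x) \<le> ennreal ((2 * \<bar>D\<bar> * (1 / 2) ^ m) powr p) * emeasure ?M (S \<inter> frontier \<Omega>)" for m
  proof -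
    have pt: "norm ((\<Sum>k<m. grad_rot a b (F k) x) - G x) \<le> 2 * \<bar>D\<bar> * (1 / 2) ^ m" if x: "x \<in> frontier \<Omega>" for x
    proof -
      have n: "norm (grad_rot a b (F k) x) \<le> \<bar>D\<bar> * (1 / 2) ^ k" for k
        by (rule order_trans[OF D[OF x]]) (intro mult_right_mono, auto)
      have s: "summable (\<lambda>k. norm (grad_rot a b (F k) x))"
        by (rule summable_comparison_test[where g="\<lambda>k. \<bar>D\<bar> * (1 / 2) ^ k"])
          (use n in \<open>auto intro!: summable_mult summable_geometric\<close>)
      have "G x = (\<Sum>k. grad_rot a b (F (k + m)) x) + (\<Sum>k<m. grad_rot a b (F k) x)"
        unfolding G_def by (rule suminf_split_initial_segment[OF summable_norm_cancel[OF s]])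
      then have "norm ((\<Sum>k<m. grad_rot a b (F k) x) - G x) = norm (\<Sum>k. grad_rot a b (F (k + m)) x)" by simp
      also have "\<dots> \<le> (\<Sum>k. norm (grad_rot a b (F (k + m)) x))"
        by (rule summable_norm[OF summable_ignore_initial_segment[OF s]])
      also have "\<dots> \<le> (\<Sum>k. \<bar>D\<bar> * (1 / 2) ^ m * (1 / 2) ^ k)"
      proof (rule suminf_le[OF _ summable_ignore_initial_segment[OF s]])
        show "norm (grad_rot a b (F (k + m)) x) \<le> \<bar>D\<bar> * (1 / 2) ^ m * (1 / 2) ^ k" for k
          using n[of "k + m"] by (simp add: power_add ac_simps)
      qed (intro summable_mult summable_geometric, simp)
      also have "\<dots> = 2 * \<bar>D\<bar> * (1 / 2) ^ m" by (simp add: suminf_mult summable_geometric suminf_geometric)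
      finally show ?thesis .
    qed
    have "Lp_energy p ?M (\<lambda>x. (\<Sum>k<m. grad_rot a b (F k) x) - G x)
      \<le> (\<integral>\<^sup>+x. ennreal ((2 * \<bar>D\<bar> * (1 / 2) ^ m) powr p) * indicator (S \<inter> frontier \<Omega>) x \<partial>?M)"
      unfolding Lp_energy_def
    proof (rule nn_integral_mono)
      fix x assume "x \<in> space ?M"
      then have x: "x \<in> frontier \<Omega>" by simp
      show "ennreal (norm ((\<Sum>k<m. grad_rot a b (F k) x) - G x) powr p) \<le> ennreal ((2 * \<bar>D\<bar> * (1 / 2) ^ m) powr p) * indicator (S \<inter> frontier \<Omega>) x"
      proof (cases "x \<in> S")
        case True
        then show ?thesis using x pt[OF x] p0 by (auto intro!: ennreal_leI powr_mono2)
      next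
        case False
        then show ?thesis using S(3)[OF x False] p0 by (simp add: G_def)
      qed
    qed
    also have "\<dots> = ennreal ((2 * \<bar>D\<bar> * (1 / 2) ^ m) powr p) * emeasure ?M (S \<inter> frontier \<Omega>)"
      by (rule nn_integral_cmult_indicator) (use S(1) in \<open>auto simp: surface_measure_def sets_restrict_space\<close>)
    finally show ?thesis .
  qed
  have "(\<lambda>m. 2 * \<bar>D\<bar> * (1 / 2) ^ m) \<longlonglongrightarrow> 0" by (intro tendsto_mult_right_zero LIMSEQ_power_zero) auto
  then have "(\<lambda>m. (2 * \<bar>D\<bar> * (1 / 2) ^ m) powr p) \<longlonglongrightarrow> 0"
    by (rule tendsto_zero_powrI[OF _ tendsto_const _ p0]) auto
  then have "(\<lambda>m. ennreal ((2 * \<bar>D\<bar> * (1 / 2) ^ m) powr p)) \<longlonglongrightarrow> ennreal 0" by (rule tendsto_ennrealI)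
  from ennreal_tendsto_cmult[OF _ this, of "emeasure ?M (S \<inter> frontier \<Omega>)"]
  have h: "(\<lambda>m. ennreal ((2 * \<bar>D\<bar> * (1 / 2) ^ m) powr p) * emeasure ?M (S \<inter> frontier \<Omega>)) \<longlonglongrightarrow> 0"
    using muS by (simp add: mult.commute)
  have lim: "(\<lambda>m. Lp_energy p ?M (\<lambda>x. (\<Sum>k<m. grad_rot a b (F k) x) - G x)) \<longlonglongrightarrow> 0"
    by (rule tendsto_sandwich[OF _ _ tendsto_const h]) (use le in auto)
  have GL: "G \<in> Lp_space p ?M"
  proof -
    have "Lp_energy p ?M G \<le> ennreal ((2 * \<bar>D\<bar> * (1 / 2) ^ 0) powr p) * emeasure ?M (S \<inter> frontier \<Omega>)"
      using le[of 0] by (simp add: Lp_energy_def)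
    also have "\<dots> < \<infinity>" using muS by (simp add: ennreal_mult_less_top)
    finally show ?thesis using mG by (simp add: Lp_space_def)
  qed
  have ps: "Ck (Suc 0) (\<lambda>x. \<Sum>k<m. grad_rot a b (F k) x)" for m by (intro Ck_sum Ck_grad_rot)
  have ps1: "(\<lambda>x. \<Sum>k<m. grad_rot a b (F k) x) \<in> sobolev 1 p \<Omega>" for m
    by (rule Ck_sobolev_1[OF \<Omega> ps]) (use p in auto)
  show ?thesis
    unfolding has_trace_def
    by (intro conjI ser GL exI[of _ "\<lambda>m x. \<Sum>k<m. grad_rot a b (F k) x"] allI ps1 lim Ck_continuous[OF ps])
qed

end

section \<open>Oscillation of a weight on the balls of the bumps\<close>

lemma radii_decay:
  fixes rs :: "nat \<Rightarrow> real"
  assumes "\<And>k. 0 < rs k" "\<And>k. rs (Suc k) \<le> q * rs k" "0 < q"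
  shows "rs (k + i) \<le> q ^ i * rs k"
proof (induction i)
  case (Suc i)
  have "rs (k + Suc i) \<le> q * rs (k + i)" using assms(2)[of "k + i"] by simp
  also have "\<dots> \<le> q * (q ^ i * rs k)" using Suc assms(3) by (intro mult_left_mono) auto
  finally show ?case by simp
qed simp

text \<open>The i-th radius after the k-th is at most q^i times it. In dimension n the volume
  factors q^(i n) are at most q^i, and their sum from i = 1 on is at most
  \<open>2 * q\<close>.\<close>

lemma tail_measure:
  fixes xs :: "nat \<Rightarrow> 'a::euclidean_space"
  assumes rs: "\<And>k. 0 < rs k" "\<And>k. rs (Suc k) \<le> q * rs k" and q: "0 < q" "q \<le> 1 / 2"
  shows "emeasure lebesgue (\<Union>i. cball (xs (k + Suc i)) (rs (k + Suc i)))
    \<le> ennreal (2 * q * (unit_ball_vol (real DIM('a)) * rs k ^ DIM('a)))"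
proof -
  let ?V = "unit_ball_vol (real DIM('a))"
  have "emeasure lebesgue (\<Union>i. cball (xs (k + Suc i)) (rs (k + Suc i)))
      \<le> (\<Sum>i. emeasure lebesgue (cball (xs (k + Suc i)) (rs (k + Suc i))))"
    by (rule emeasure_subadditive_countably) auto
  also have "\<dots> \<le> (\<Sum>i. ennreal (?V * rs k ^ DIM('a) * q * q ^ i))"
  proof (rule suminf_le[OF _ summableI summableI])
    fix i
    have "rs (k + Suc i) ^ DIM('a) \<le> (q ^ Suc i * rs k) ^ DIM('a)"
      using radii_decay[where rs=rs, OF rs q(1), of k "Suc i"] rs(1)[of "k + Suc i"] by (intro power_mono) auto
    also have "\<dots> = (q ^ Suc i) ^ DIM('a) * rs k ^ DIM('a)" by (rule power_mult_distrib)
    also have "\<dots> \<le> q ^ Suc i * rs k ^ DIM('a)"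
    proof (rule mult_right_mono)
      have "(q ^ Suc i) ^ DIM('a) \<le> (q ^ Suc i) ^ 1"
        using q DIM_positive[where 'a='a] by (intro power_decreasing) (auto simp: power_le_one mult_le_one)
      then show "(q ^ Suc i) ^ DIM('a) \<le> q ^ Suc i" by simp
    qed (use rs(1)[of k] in auto)
    finally have "?V * rs (k + Suc i) ^ DIM('a) \<le> ?V * (q ^ Suc i * rs k ^ DIM('a))" by (intro mult_left_mono) auto
    then show "emeasure lebesgue (cball (xs (k + Suc i)) (rs (k + Suc i))) \<le> ennreal (?V * rs k ^ DIM('a) * q * q ^ i)"
      using rs(1)[of "k + Suc i"] by (simp add: emeasure_cball ennreal_leI ac_simps)
  qed
  also have "\<dots> = ennreal (?V * rs k ^ DIM('a) * q * (1 / (1 - q)))"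
    using q rs(1)[of k] by (intro suminf_ennreal_eq sums_mult geometric_sums) auto
  also have "\<dots> \<le> ennreal (2 * q * (?V * rs k ^ DIM('a)))"
  proof (rule ennreal_leI)
    have "1 / (1 - q) \<le> 2" using q by (simp add: field_simps)
    then have "?V * rs k ^ DIM('a) * q * (1 / (1 - q)) \<le> ?V * rs k ^ DIM('a) * q * 2"
      using q rs(1)[of k] by (intro mult_left_mono) auto
    then show "?V * rs k ^ DIM('a) * q * (1 / (1 - q)) \<le> 2 * q * (?V * rs k ^ DIM('a))" by (simp add: ac_simps)
  qed
  finally show ?thesis .
qed

lemma emeasure_Diff_ge:
  assumes "A \<in> sets M" "T \<in> sets M" "ennreal c \<le> emeasure M A" "emeasure M T \<le> ennreal d" "0 \<le> d"
  shows "ennreal (c - d) \<le> emeasure M (A - T)"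
proof -
  have "ennreal c \<le> emeasure M ((A - T) \<union> T)"
    using assms by (intro order_trans[OF assms(3)] emeasure_mono) auto
  also have "\<dots> \<le> emeasure M (A - T) + emeasure M T" by (rule emeasure_subadditive) (use assms in auto)
  also have "\<dots> \<le> emeasure M (A - T) + ennreal d" by (intro add_left_mono assms)
  finally have "ennreal c - ennreal d \<le> emeasure M (A - T)" by (simp add: ennreal_minus_le_iff add.commute)
  then show ?thesis using assms(5) by (simp add: ennreal_minus)
qed

text \<open>In the ball of radius 2r about a centre, \<open>W\<close> is large on the small ball of
  radius r/8 and small on the shell between r and 2r, and both keep a fixed proportion after the
  later balls are removed. The factor 1/4 times 8^-n in \<open>q\<close> makes the removed volume at
  most half of that of the small ball.\<close>

lemma oscillating_weight_not_muckenhoupt: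
  fixes xs :: "nat \<Rightarrow> 'a::euclidean_space" and rs :: "nat \<Rightarrow> real" and W :: "'a \<Rightarrow> real"
  defines "q \<equiv> (1 / 4) * (1 / 8) ^ DIM('a)"
  defines "tail \<equiv> \<lambda>k. \<Union>i. cball (xs (k + Suc i)) (rs (k + Suc i))"
  assumes rs: "\<And>k. 0 < rs k" "\<And>k. rs (Suc k) \<le> q * rs k" and c0: "norm c0 \<le> 1 / 2"
    and W: "\<And>x. 0 \<le> W x" and K: "0 \<le> K1" "0 \<le> K2"
    and high: "\<And>k x. x \<in> ball (xs k + rs k *\<^sub>R c0) (rs k / 8) \<Longrightarrow> x \<notin> tail k \<Longrightarrow>
       fact (Suc k) * (real (Suc k) / 8 - K1) \<le> W x"
    and low: "\<And>k x. x \<in> ball (xs k) (2 * rs k) \<Longrightarrow> x \<notin> cball (xs k) (rs k) \<Longrightarrow> x \<notin> tail k \<Longrightarrow> W x \<le> K2 * fact (Suc k)"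
    and sub: "\<And>m. \<exists>k\<ge>m. ball (xs k) (2 * rs k) \<subseteq> \<Omega>0"
    and p: "\<sigma> \<noteq> 0" and \<omega>: "\<And>x. x \<in> \<Omega>0 \<Longrightarrow> \<omega> x = (1 + W x) powr \<sigma>"
  shows "\<omega> \<notin> muckenhoupt_infty \<Omega>0"
proof (rule not_muckenhoupt_infty)
  let ?V = "unit_ball_vol (real DIM('a))" and ?n = "DIM('a)"
  \<comment> \<open>The proportion is half of the ball of radius r/8, measured in the ball of radius
    2r.\<close>
  show "0 < (1 / 2) * (1 / 16 :: real) ^ ?n" by simp
  have q: "0 < q" "q \<le> 1 / 2"
    using power_le_one[of "1 / 8 :: real" ?n] by (auto simp: q_def)
  fix c :: real
  \<comment> \<open>The ratio of the two sizes of \<open>1 + W\<close> is unbounded in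
    \<open>k\<close>. The root of order |\<sigma>| anticipates the power taken by the weight, and
    \<open>\<bar>c\<bar>\<close> covers negative \<open>c\<close>.\<close>
  have "\<forall>\<^sub>F k in sequentially. \<bar>c\<bar> powr (1 / \<bar>\<sigma>\<bar>) < (real (Suc k) / 8 - K1) / (1 + K2)"
  proof -
    define X where "X = \<bar>c\<bar> powr (1 / \<bar>\<sigma>\<bar>)"
    have "\<forall>\<^sub>F k in sequentially. nat \<lceil>8 * (X * (1 + K2) + K1)\<rceil> \<le> k" by (rule eventually_ge_at_top)
    then have "\<forall>\<^sub>F k in sequentially. X < (real (Suc k) / 8 - K1) / (1 + K2)"
    proof eventually_elim
      case (elim k)
      then have "8 * (X * (1 + K2) + K1) < real (Suc k)" by linarith
      then show ?case using K(2) by (simp add: field_simps)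
    qed
    then show ?thesis unfolding X_def .
  qed
  then obtain m where m: "\<And>k. m \<le> k \<Longrightarrow> \<bar>c\<bar> powr (1 / \<bar>\<sigma>\<bar>) < (real (Suc k) / 8 - K1) / (1 + K2)"
    unfolding eventually_sequentially by blast
  obtain k where k: "m \<le> k" "ball (xs k) (2 * rs k) \<subseteq> \<Omega>0" using sub by blast
  define x where "x = xs k" define r where "r = rs k" define ft where "ft = (fact (Suc k) :: real)"
  have r: "0 < r" by (simp add: r_def rs)
  have ft: "1 \<le> ft" unfolding ft_def by (rule fact_ge_1)
  define H where "H = ft * (real (Suc k) / 8 - K1)"
  define Lo where "Lo = (1 + K2) * ft"
  have ratio: "\<bar>c\<bar> powr (1 / \<bar>\<sigma>\<bar>) < H / Lo"
    using m[OF k(1)] ft by (simp add: H_def Lo_def)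
  have Lo: "0 < Lo" using K ft by (simp add: Lo_def)
  have "0 < H / Lo" using ratio powr_ge_zero[of "\<bar>c\<bar>" "1 / \<bar>\<sigma>\<bar>"] by linarith
  then have H: "0 < H" using Lo by (simp add: zero_less_divide_iff)
  have c: "c \<le> (H / Lo) powr \<bar>\<sigma>\<bar>"
  proof -
    have "c \<le> (\<bar>c\<bar> powr (1 / \<bar>\<sigma>\<bar>)) powr \<bar>\<sigma>\<bar>" using p by (simp add: powr_powr)
    also have "\<dots> \<le> (H / Lo) powr \<bar>\<sigma>\<bar>" using ratio by (intro powr_mono2) auto
    finally show ?thesis .
  qed
  define T where "T = tail k"
  have T: "T \<in> sets lebesgue" "emeasure lebesgue T \<le> ennreal (2 * q * (?V * r ^ ?n))"
    unfolding T_def tail_def r_def using tail_measure[where rs=rs, OF rs q] by auto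
  define EH where "EH = ball (x + r *\<^sub>R c0) (r / 8) - T"
  define EL where "EL = ball x (2 * r) - (cball x r \<union> T)"
  have Vr: "0 < ?V * r ^ ?n" using r by simp
  have eq: "(1 / 2) * (1 / 16) ^ ?n * (?V * (2 * r) ^ ?n) = (1 / 2) * (1 / 8) ^ ?n * (?V * r ^ ?n)"
  proof -
    have "(1 / 16 :: real) ^ ?n * 2 ^ ?n = (1 / 8) ^ ?n" by (simp only: power_mult_distrib[symmetric]) simp
    then show ?thesis by (simp add: power_mult_distrib ac_simps)
  qed
  have fB: "ennreal ((1 / 2) * (1 / 16) ^ ?n) * emeasure lebesgue (ball x (2 * r)) = ennreal ((1 / 2) * (1 / 8) ^ ?n * (?V * r ^ ?n))"
    using r eq by (simp add: emeasure_ball ennreal_mult[symmetric])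
  have EHm: "ennreal ((1 / 2) * (1 / 16) ^ ?n) * emeasure lebesgue (ball x (2 * r)) \<le> emeasure lebesgue EH"
  proof -
    have "ennreal ((1 / 8) ^ ?n * (?V * r ^ ?n) - 2 * q * (?V * r ^ ?n)) \<le> emeasure lebesgue EH"
      unfolding EH_def
      by (rule emeasure_Diff_ge) (use T Vr q r in \<open>auto simp: emeasure_ball power_divide field_simps\<close>)
    also have "(1 / 8) ^ ?n * (?V * r ^ ?n) - 2 * q * (?V * r ^ ?n) = (1 / 2) * (1 / 8) ^ ?n * (?V * r ^ ?n)"
      by (simp add: q_def)
    finally show ?thesis using fB by simp
  qed
  have ELm: "ennreal ((1 / 2) * (1 / 16) ^ ?n) * emeasure lebesgue (ball x (2 * r)) \<le> emeasure lebesgue EL"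
  proof -
    have "emeasure lebesgue (cball x r \<union> T) \<le> emeasure lebesgue (cball x r) + emeasure lebesgue T"
      by (rule emeasure_subadditive) (use T in auto)
    also have "\<dots> \<le> ennreal (?V * r ^ ?n) + ennreal (2 * q * (?V * r ^ ?n))"
      using T(2) r by (intro add_mono) (auto simp: emeasure_cball)
    also have "\<dots> = ennreal ((1 + 2 * q) * (?V * r ^ ?n))"
      using Vr q by (subst ennreal_plus[symmetric]) (auto simp: algebra_simps)
    finally have "ennreal (2 ^ ?n * (?V * r ^ ?n) - (1 + 2 * q) * (?V * r ^ ?n)) \<le> emeasure lebesgue EL"
      unfolding EL_def
      by (intro emeasure_Diff_ge) (use T Vr q r in \<open>auto simp: emeasure_ball power_mult_distrib ac_simps\<close>)
    \<comment> \<open>In units of the ball of radius r the shell has volume 2^n - 1 \<ge> 1, and the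
      later balls take only \<open>2 * q\<close> of it.\<close>
    moreover have "(1 / 2) * (1 / 8) ^ ?n * (?V * r ^ ?n) \<le> 2 ^ ?n * (?V * r ^ ?n) - (1 + 2 * q) * (?V * r ^ ?n)"
    proof -
      have "(2::real) ^ 1 \<le> 2 ^ ?n" using DIM_positive[where 'a='a] by (intro power_increasing) auto
      moreover have "(1 / 8 :: real) ^ ?n \<le> (1 / 8) ^ 1" using DIM_positive[where 'a='a] by (intro power_decreasing) auto
      ultimately have "(1 / 2) * (1 / 8 :: real) ^ ?n \<le> 2 ^ ?n - (1 + 2 * q)" by (simp add: q_def)
      then have "(1 / 2) * (1 / 8 :: real) ^ ?n * (?V * r ^ ?n) \<le> (2 ^ ?n - (1 + 2 * q)) * (?V * r ^ ?n)"
        using Vr by (intro mult_right_mono) auto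
      then show ?thesis by (simp only: left_diff_distrib)
    qed
    ultimately show ?thesis unfolding fB by (meson ennreal_leI order_trans)
  qed
  have EHs: "EH \<in> sets lebesgue" "EH \<subseteq> ball x (2 * r)"
  proof -
    show "EH \<in> sets lebesgue" using T by (auto simp: EH_def)
    show "EH \<subseteq> ball x (2 * r)"
    proof
      fix y assume "y \<in> EH"
      then have "dist (x + r *\<^sub>R c0) y < r / 8" by (simp add: EH_def)
      moreover have "dist x (x + r *\<^sub>R c0) \<le> r * (1 / 2)" using r c0 by (simp add: dist_norm)
      ultimately show "y \<in> ball x (2 * r)" using dist_triangle[of x y "x + r *\<^sub>R c0"] r by simp
    qed
  qed
  have ELs: "EL \<in> sets lebesgue" unfolding EL_def by (intro sets.Diff sets.Un T(1)) auto
  have ELsub: "EL \<subseteq> ball x (2 * r)" by (auto simp: EL_def)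
  have hiW: "H \<le> 1 + W y" if "y \<in> EH" for y
    using high[of y k] that by (simp add: EH_def T_def x_def r_def H_def ft_def)
  have loW: "1 + W y \<le> Lo" if "y \<in> EL" for y
  proof -
    have "W y \<le> K2 * ft" using low[of y k] that by (simp add: EL_def T_def x_def r_def ft_def)
    then show ?thesis using ft by (simp add: Lo_def distrib_right)
  qed
  have om: "\<omega> y = (1 + W y) powr \<sigma>" if "y \<in> ball x (2 * r)" for y
    using \<omega> k(2) that by (auto simp: x_def r_def)
  have r2: "0 < 2 * r" and kx: "ball x (2 * r) \<subseteq> \<Omega>0" and pw: "0 < H powr \<sigma>" "0 < Lo powr \<sigma>"
    using r k(2) H Lo by (simp_all add: x_def r_def)
  have div: "H powr s / Lo powr s = (H / Lo) powr s" for s using H Lo by (simp add: powr_divide)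
  show "\<exists>x r s t E1 E2. 0 < r \<and> ball x r \<subseteq> \<Omega>0 \<and> 0 < s \<and> 0 < t \<and> c \<le> s / t \<and>
      E1 \<in> sets lebesgue \<and> E1 \<subseteq> ball x r \<and> ennreal ((1 / 2) * (1 / 16) ^ ?n) * emeasure lebesgue (ball x r) \<le> emeasure lebesgue E1 \<and>
      (\<forall>y\<in>E1. s \<le> \<omega> y) \<and>
      E2 \<in> sets lebesgue \<and> E2 \<subseteq> ball x r \<and> ennreal ((1 / 2) * (1 / 16) ^ ?n) * emeasure lebesgue (ball x r) \<le> emeasure lebesgue E2 \<and>
      (\<forall>y\<in>E2. 0 \<le> \<omega> y \<and> \<omega> y \<le> t)"
  \<comment> \<open>For negative \<sigma>, that is p < 2, the weight is large where
    \<open>1 + W\<close> is small, so the two sets exchange roles.\<close>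
  proof (cases "0 < \<sigma>")
    case True
    have 1: "H powr \<sigma> \<le> \<omega> y" if y: "y \<in> EH" for y
      unfolding om[OF subsetD[OF EHs(2) y]] using hiW[OF y] H True by (intro powr_mono2) auto
    have 2: "0 \<le> \<omega> y \<and> \<omega> y \<le> Lo powr \<sigma>" if y: "y \<in> EL" for y
      unfolding om[OF subsetD[OF ELsub y]] using loW[OF y] W[of y] True by (auto intro!: powr_mono2)
    have 3: "c \<le> H powr \<sigma> / Lo powr \<sigma>" using c True by (simp add: div)
    show ?thesis
      by (rule exI[of _ x], rule exI[of _ "2 * r"], rule exI[of _ "H powr \<sigma>"], rule exI[of _ "Lo powr \<sigma>"],
          rule exI[of _ EH], rule exI[of _ EL]) (intro conjI ballI 1 2 3 r2 kx pw EHs ELs ELsub EHm ELm)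
  next
    case False
    have 1: "Lo powr \<sigma> \<le> \<omega> y" if y: "y \<in> EL" for y
      unfolding om[OF subsetD[OF ELsub y]] using loW[OF y] W[of y] False by (intro powr_mono2') auto
    have 2: "0 \<le> \<omega> y \<and> \<omega> y \<le> H powr \<sigma>" if y: "y \<in> EH" for y
      unfolding om[OF subsetD[OF EHs(2) y]] using hiW[OF y] H False by (auto intro!: powr_mono2')
    have "Lo powr \<sigma> / H powr \<sigma> = (H / Lo) powr (- \<sigma>)" using H Lo by (simp add: powr_minus powr_divide field_simps)
    then have 3: "c \<le> Lo powr \<sigma> / H powr \<sigma>" using c False p by simp
    show ?thesis
      by (rule exI[of _ x], rule exI[of _ "2 * r"], rule exI[of _ "Lo powr \<sigma>"], rule exI[of _ "H powr \<sigma>"],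
          rule exI[of _ EL], rule exI[of _ EH]) (intro conjI ballI 1 2 3 r2 kx pw EHs ELs ELsub EHm ELm)
  qed
qed

section \<open>Superposition of bumps\<close>

lemma deriv_bound3_dd:
  assumes "deriv_bound 3 l C f x" "c \<in> Basis" "d \<in> Basis" "e \<in> Basis"
  shows "\<bar>dderiv c f x\<bar> \<le> C * l" "\<bar>dderiv d (dderiv c f) x\<bar> \<le> C * l * l" "\<bar>dderiv e (dderiv d (dderiv c f)) x\<bar> \<le> C * l * l * l"
  using assms unfolding eval_nat_numeral deriv_bound.simps by auto

lemma Ck3_Suc: "Ck 3 f \<Longrightarrow> Ck (Suc (Suc (Suc 0))) f"
  by (simp add: eval_nat_numeral)

lemma dderiv_add_Ck3:
  fixes f h :: "'a::euclidean_space \<Rightarrow> real"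
  assumes "Ck 3 f" "Ck 3 h"
  shows "dderiv c (\<lambda>x. f x + h x) = (\<lambda>x. dderiv c f x + dderiv c h x)"
    "dderiv d (dderiv c (\<lambda>x. f x + h x)) = (\<lambda>x. dderiv d (dderiv c f) x + dderiv d (dderiv c h) x)"
    "dderiv e (dderiv d (dderiv c (\<lambda>x. f x + h x))) = (\<lambda>x. dderiv e (dderiv d (dderiv c f)) x + dderiv e (dderiv d (dderiv c h)) x)"
proof -
  note f = Ck3_Suc[OF assms(1)] and h = Ck3_Suc[OF assms(2)]
  show 1: "dderiv c (\<lambda>x. f x + h x) = (\<lambda>x. dderiv c f x + dderiv c h x)"
    by (rule ext) (rule dderiv_add[OF Ck_differentiable[OF f] Ck_differentiable[OF h]])
  show 2: "dderiv d (dderiv c (\<lambda>x. f x + h x)) = (\<lambda>x. dderiv d (dderiv c f) x + dderiv d (dderiv c h) x)"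
    unfolding 1 by (rule ext) (rule dderiv_add[OF Ck_differentiable[OF Ck_dd[OF f]] Ck_differentiable[OF Ck_dd[OF h]]])
  show "dderiv e (dderiv d (dderiv c (\<lambda>x. f x + h x))) = (\<lambda>x. dderiv e (dderiv d (dderiv c f)) x + dderiv e (dderiv d (dderiv c h)) x)"
    unfolding 2 by (rule ext)
      (rule dderiv_add[OF Ck_differentiable[OF Ck_dd[OF Ck_dd[OF f]]] Ck_differentiable[OF Ck_dd[OF Ck_dd[OF h]]]])
qed

lemma dderiv_germ:
  fixes f h :: "'a::euclidean_space \<Rightarrow> real"
  assumes "open U" "x \<in> U" "\<And>y. y \<in> U \<Longrightarrow> f y = h y"
  shows "dderiv c f x = dderiv c h x" "dderiv d (dderiv c f) x = dderiv d (dderiv c h) x" "dderiv e (dderiv d (dderiv c f)) x = dderiv e (dderiv d (dderiv c h)) x"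
proof -
  have 1: "dderiv c f y = dderiv c h y" if "y \<in> U" for y c by (rule dderiv_cong_open[OF assms(1) that assms(3)])
  have 2: "dderiv d (dderiv c f) y = dderiv d (dderiv c h) y" if "y \<in> U" for y c d by (rule dderiv_cong_open[OF assms(1) that 1])
  show "dderiv c f x = dderiv c h x" "dderiv d (dderiv c f) x = dderiv d (dderiv c h) x" using 1 2 assms(2) by auto
  show "dderiv e (dderiv d (dderiv c f)) x = dderiv e (dderiv d (dderiv c h)) x" by (rule dderiv_cong_open[OF assms(1,2) 2])
qed

lemma dderiv_zero_germ:
  fixes f :: "'a::euclidean_space \<Rightarrow> real"
  assumes "open U" "x \<in> U" "\<And>y. y \<in> U \<Longrightarrow> f y = 0"
  shows "dderiv c f x = 0" "dderiv d (dderiv c f) x = 0" "dderiv e (dderiv d (dderiv c f)) x = 0"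
proof -
  have z: "dderiv c (\<lambda>_::'a. 0::real) = (\<lambda>_. 0)" for c by (rule ext) (rule dderiv_const)
  show "dderiv c f x = 0" "dderiv d (dderiv c f) x = 0" "dderiv e (dderiv d (dderiv c f)) x = 0"
    using dderiv_germ[OF assms(1,2), of f "\<lambda>_. 0"] assms(3) by (simp_all add: z)
qed

text \<open>The factor r^2 cancels the two factors 1/r of second derivatives, which therefore have
  size \<open>m\<close> for every radius; first derivatives have size m r and third ones
  m/r.\<close>

definition scaled_bump :: "real \<Rightarrow> real \<Rightarrow> 'a::euclidean_space \<Rightarrow> 'a \<Rightarrow> real" where
  "scaled_bump m r x0 x = m * r\<^sup>2 * bump ((1 / r) *\<^sub>R (x - x0))"

lemma Ck_scaled_bump: "Ck 3 (scaled_bump m r x0)"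
  unfolding scaled_bump_def[abs_def] by (intro Ck_mult Ck_const Ck_affine Ck_bump)

lemma scaled_bump_zero_germ:
  assumes "0 < r" "x \<notin> cball x0 r"
  shows "\<exists>U. open U \<and> x \<in> U \<and> (\<forall>y\<in>U. scaled_bump m r x0 y = 0)"
proof (intro exI[of _ "- cball x0 r"] conjI ballI)
  fix y assume "y \<in> - cball x0 r"
  then have "1 \<le> norm ((1 / r) *\<^sub>R (y - x0))"
    using assms(1) by (simp only: norm_scaleR) (simp add: dist_norm norm_minus_commute field_simps)
  then show "scaled_bump m r x0 y = 0" by (simp add: scaled_bump_def bump_eq_0)
qed (use assms in auto)

lemma scaled_bump_bd:
  fixes x x0 :: "'a::euclidean_space"
  assumes "\<And>z::'a. deriv_bound 3 1 A bump z" "0 < r" "0 \<le> m"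
  shows "deriv_bound 3 (1 / r) (m * r\<^sup>2 * A) (scaled_bump m r x0) x"
proof -
  have "deriv_bound 3 (1 / r * 1) (\<bar>m * r\<^sup>2\<bar> * A) (scaled_bump m r x0) x"
    unfolding scaled_bump_def[abs_def]
    by (rule deriv_bound_cmult[OF Ck_affine[OF Ck_bump] deriv_bound_affine[OF Ck_bump assms(1)]]) (use assms in simp)
  then show ?thesis using assms(3) by simp
qed

lemma dderiv2_scaled_bump:
  fixes x :: "'a::euclidean_space"
  assumes r: "0 < r" and vw: "v \<bullet> w = 0"
  shows "dderiv v (dderiv w (scaled_bump m r x0)) x = m * (48 * pos_power 2 (1 - ((1 / r) *\<^sub>R (x - x0)) \<bullet> ((1 / r) *\<^sub>R (x - x0)))
      * (((1 / r) *\<^sub>R (x - x0)) \<bullet> v) * (((1 / r) *\<^sub>R (x - x0)) \<bullet> w))"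
proof -
  have b: "Ck (Suc (Suc (Suc 0))) (bump :: 'a \<Rightarrow> real)" using Ck_bump by (rule Ck3_Suc)
  have 1: "dderiv w (scaled_bump m r x0) = (\<lambda>x. (m * r\<^sup>2 * (1 / r)) * dderiv w bump ((1 / r) *\<^sub>R (x - x0)))"
  proof
    fix x
    have "dderiv w (scaled_bump m r x0) x = m * r\<^sup>2 * dderiv w (\<lambda>x. bump ((1 / r) *\<^sub>R (x - x0))) x"
      unfolding scaled_bump_def[abs_def]
      by (rule dderiv_linear_compose[OF bounded_linear_mult_right Ck_differentiable[OF Ck_affine[OF b]]])
    then show "dderiv w (scaled_bump m r x0) x = (m * r\<^sup>2 * (1 / r)) * dderiv w bump ((1 / r) *\<^sub>R (x - x0))"
      by (simp only: dderiv_affine[OF Ck_differentiable[OF b]] real_scaleR_def mult.assoc)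
  qed
  have "dderiv v (dderiv w (scaled_bump m r x0)) x = (m * r\<^sup>2 * (1 / r)) * dderiv v (\<lambda>x. dderiv w bump ((1 / r) *\<^sub>R (x - x0))) x"
    unfolding 1
    by (rule dderiv_linear_compose[OF bounded_linear_mult_right Ck_differentiable[OF Ck_affine[OF Ck_dd[OF b]]]])
  also have "\<dots> = (m * r\<^sup>2 * (1 / r)) * ((1 / r) * dderiv v (dderiv w bump) ((1 / r) *\<^sub>R (x - x0)))"
    by (simp only: dderiv_affine[OF Ck_differentiable[OF Ck_dd[OF b]]] real_scaleR_def)
  also have "\<dots> = m * dderiv v (dderiv w bump) ((1 / r) *\<^sub>R (x - x0))" using r by (simp add: power2_eq_square)
  finally show ?thesis by (simp only: dderiv_bump[OF vw])
qed

text \<open>After rescaling, the ball of radius 1/8 about (v + w)/4 lies where both inner products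
  are at least 1/8 and |y| \<le> 5/8, so that 1 - |y|^2 \<ge> 1/2. The bounds multiply to 48/4/64 =
  3/16, which exceeds 1/8.\<close>

lemma dderiv2_scaled_bump_ge:
  fixes x :: "'a::euclidean_space"
  assumes r: "0 < r" and v: "v \<in> Basis" "w \<in> Basis" "v \<noteq> w" and m: "0 \<le> m"
    and x: "x \<in> ball (x0 + r *\<^sub>R ((1 / 4) *\<^sub>R (v + w))) (r / 8)"
  shows "m / 8 \<le> dderiv v (dderiv w (scaled_bump m r x0)) x"
proof -
  define y where "y = (1 / r) *\<^sub>R (x - x0)"
  have vw: "v \<bullet> w = 0" "v \<bullet> v = 1" "w \<bullet> w = 1" "w \<bullet> v = 0" using v by (auto simp: inner_Basis)
  have "y - (1 / 4) *\<^sub>R (v + w) = (1 / r) *\<^sub>R (x - (x0 + r *\<^sub>R ((1 / 4) *\<^sub>R (v + w))))"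
    using r by (simp add: y_def algebra_simps)
  then have "norm (y - (1 / 4) *\<^sub>R (v + w)) = (1 / r) * norm (x - (x0 + r *\<^sub>R ((1 / 4) *\<^sub>R (v + w))))"
    using r by simp
  also have "\<dots> \<le> (1 / r) * (r / 8)" using x r by (intro mult_left_mono) (auto simp: dist_norm norm_minus_commute)
  finally have ny: "norm (y - (1 / 4) *\<^sub>R (v + w)) \<le> 1 / 8" using r by simp
  have "\<bar>(y - (1 / 4) *\<^sub>R (v + w)) \<bullet> v\<bar> \<le> 1 / 8" "\<bar>(y - (1 / 4) *\<^sub>R (v + w)) \<bullet> w\<bar> \<le> 1 / 8"
    using Basis_le_norm[OF v(1), of "y - (1 / 4) *\<^sub>R (v + w)"] Basis_le_norm[OF v(2), of "y - (1 / 4) *\<^sub>R (v + w)"] ny by linarith+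
  then have "\<bar>y \<bullet> v - 1 / 4\<bar> \<le> 1 / 8" "\<bar>y \<bullet> w - 1 / 4\<bar> \<le> 1 / 8"
    by (simp_all add: inner_diff_left inner_add_left vw)
  then have yv: "1 / 8 \<le> y \<bullet> v" "1 / 8 \<le> y \<bullet> w" by linarith+
  have "norm ((1 / 4) *\<^sub>R (v + w)) \<le> 1 / 2" using norm_triangle_ineq[of v w] v by simp
  then have "norm y \<le> 5 / 8" using ny norm_triangle_sub[of y "(1 / 4) *\<^sub>R (v + w)"] by linarith
  then have "(norm y)\<^sup>2 \<le> (5 / 8)\<^sup>2" by (intro power_mono) auto
  then have "1 / 2 \<le> 1 - y \<bullet> y" by (simp add: power2_norm_eq_inner[symmetric] power2_eq_square)
  then have "(1 / 2)\<^sup>2 \<le> pos_power 2 (1 - y \<bullet> y)" unfolding pos_power_def by (intro power_mono) auto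
  then have p: "1 / 4 \<le> pos_power 2 (1 - y \<bullet> y)" by (simp add: power2_eq_square)
  have "48 * (1 / 4) * (1 / 8) * (1 / 8) \<le> 48 * pos_power 2 (1 - y \<bullet> y) * (y \<bullet> v) * (y \<bullet> w)"
    using p yv by (intro mult_mono) auto
  then have "1 / 8 \<le> 48 * pos_power 2 (1 - y \<bullet> y) * (y \<bullet> v) * (y \<bullet> w)"
    by (rule order_trans[rotated]) simp
  then have "m * (1 / 8) \<le> m * (48 * pos_power 2 (1 - y \<bullet> y) * (y \<bullet> v) * (y \<bullet> w))" using m by (intro mult_left_mono) auto
  then show ?thesis unfolding dderiv2_scaled_bump[OF r vw(1)] y_def[symmetric] by simp
qed

lemma sym_part_diag: "sym_part A $ i $ i = A $ i $ i"
  by (simp add: sym_part_def transpose_def)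

text \<open>Symmetrisation leaves the diagonal alone. This is why the oscillation is read off the
  entry (a, a), the mixed derivative D_a D_b of the stream function.\<close>

lemma norm_sym_part_ge: "\<bar>A $ i $ i\<bar> \<le> norm (sym_part A)"
proof -
  have "\<bar>sym_part A $ i $ i\<bar> \<le> norm (sym_part A $ i)" using component_le_norm_cart by blast
  also have "\<dots> \<le> norm (sym_part A)" by (rule Finite_Cartesian_Product.norm_nth_le)
  finally show ?thesis by (simp add: sym_part_diag)
qed

lemma norm_sym_part_le:
  fixes A :: "real^'n^'n"
  assumes "\<And>i j. \<bar>A $ i $ j\<bar> \<le> D"
  shows "norm (sym_part A) \<le> real CARD('n) * real CARD('n) * D"
proof -
  have e: "\<bar>sym_part A $ i $ j\<bar> \<le> D" for i j
    using assms[of i j] assms[of j i] by (simp add: sym_part_def transpose_def abs_le_iff)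
  have "norm (sym_part A) \<le> (\<Sum>i\<in>UNIV. norm (sym_part A $ i))"
    unfolding norm_vec_def by (rule L2_set_le_sum) simp
  also have "\<dots> \<le> (\<Sum>i\<in>(UNIV::'n set). \<Sum>j\<in>(UNIV::'n set). \<bar>sym_part A $ i $ j\<bar>)"
    by (intro sum_mono norm_le_l1_cart)
  also have "\<dots> \<le> (\<Sum>i\<in>(UNIV::'n set). \<Sum>j\<in>(UNIV::'n set). D)" by (intro sum_mono e)
  finally show ?thesis by simp
qed

lemma norm_grad_rot_le:
  fixes F :: "real^'n::finite \<Rightarrow> real"
  assumes "\<And>c d. c \<in> Basis \<Longrightarrow> d \<in> Basis \<Longrightarrow> \<bar>dderiv d (dderiv c F) x\<bar> \<le> D"
  shows "norm (grad_rot a b F x) \<le> real CARD('n) * (2 * D)"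
proof -
  have ax: "axis j (1::real) \<in> Basis" for j :: 'n by (simp add: axis_in_Basis_iff)
  have "norm (grad_rot a b F x) \<le> (\<Sum>j\<in>(UNIV::'n set). 2 * D)"
    unfolding grad_rot_def
  proof (rule sum_norm_le)
    fix j :: 'n
    have "norm (dderiv (axis j 1) (dderiv (axis b 1) F) x *\<^sub>R axis a (axis j (1::real))
       + dderiv (axis j 1) (dderiv (axis a 1) F) x *\<^sub>R (- axis b (axis j (1::real)) :: real^'n^'n))
      \<le> \<bar>dderiv (axis j 1) (dderiv (axis b 1) F) x\<bar> + \<bar>dderiv (axis j 1) (dderiv (axis a 1) F) x\<bar>"
      by (rule order_trans[OF norm_triangle_ineq]) (simp add: norm_axis)
    also have "\<dots> \<le> 2 * D" using assms[OF ax ax, of j b] assms[OF ax ax, of j a] by linarith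
    finally show "norm (dderiv (axis j 1) (dderiv (axis b 1) F) x *\<^sub>R axis a (axis j (1::real))
       + dderiv (axis j 1) (dderiv (axis a 1) F) x *\<^sub>R (- axis b (axis j (1::real)) :: real^'n^'n)) \<le> 2 * D" .
  qed
  then show ?thesis by simp
qed

lemma entry_linear: "bounded_linear (\<lambda>A :: real^'n^'m. A $ i $ j)"
  unfolding linear_conv_bounded_linear[symmetric] by (rule linearI) auto

text \<open>The terms \<open>N k\<close> enter only through derivative bounds and through sets
  \<open>S k\<close> of volume O(2^-k) outside which they vanish locally. The closed balls of twice
  the radii lie in \<Omega>, so each bump vanishes near the boundary.\<close>

locale bumps =
  fixes \<Omega> :: "(real^'n::finite) set" and N :: "nat \<Rightarrow> real^'n \<Rightarrow> real" and C A :: real and a b :: 'n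
    and xs :: "nat \<Rightarrow> real^'n" and rs :: "nat \<Rightarrow> real" and S :: "nat \<Rightarrow> (real^'n) set" and D :: real
  assumes \<Omega>: "open \<Omega>" "bounded \<Omega>" and ab: "a \<noteq> b" and n2: "2 \<le> CARD('n)"
    and N: "\<And>k. Ck 3 (N k)" "\<And>k x. deriv_bound 3 (2 ^ k) (C * (1 / 8) ^ k) (N k) x" and C: "0 \<le> C"
    and S: "\<And>k. S k \<in> lmeasurable" "\<And>k. measure lebesgue (S k) \<le> D * (1 / 2) ^ k"
      "\<And>k x. x \<notin> S k \<Longrightarrow> \<exists>U. open U \<and> x \<in> U \<and> (\<forall>y\<in>U. N k y = 0)"
    and A: "0 \<le> A" "\<And>z::real^'n. deriv_bound 3 1 A bump z"
    and rs: "\<And>k. 0 < rs k" "\<And>k. rs k \<le> rad_bound k" "\<And>k. cball (xs k) (2 * rs k) \<subseteq> \<Omega>"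
      "\<And>k. rs (Suc k) \<le> (1 / 4) * (1 / 8) ^ CARD('n) * rs k"
    and dense: "\<And>\<Omega>0 m. open \<Omega>0 \<Longrightarrow> \<Omega>0 \<noteq> {} \<Longrightarrow> \<Omega>0 \<subseteq> \<Omega> \<Longrightarrow> \<exists>k\<ge>m. ball (xs k) (2 * rs k) \<subseteq> \<Omega>0"
begin

definition B :: "nat \<Rightarrow> real^'n \<Rightarrow> real" where "B k = scaled_bump (amp k) (rs k) (xs k)"
definition F :: "nat \<Rightarrow> real^'n \<Rightarrow> real" where "F k = (\<lambda>x. N k x + B k x)"

lemma Ck_B: "Ck 3 (B k)" unfolding B_def by (rule Ck_scaled_bump)

lemma amp_pos: "0 < amp k" using amp_ge_1[of k] by linarith

lemma F_dd:
  "dderiv c (F k) = (\<lambda>x. dderiv c (N k) x + dderiv c (B k) x)"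
  "dderiv d (dderiv c (F k)) = (\<lambda>x. dderiv d (dderiv c (N k)) x + dderiv d (dderiv c (B k)) x)"
  "dderiv e (dderiv d (dderiv c (F k))) = (\<lambda>x. dderiv e (dderiv d (dderiv c (N k))) x + dderiv e (dderiv d (dderiv c (B k))) x)"
  unfolding F_def by (rule dderiv_add_Ck3[OF N(1) Ck_B])+

lemma N_dd:
  assumes "c \<in> Basis" "d \<in> Basis" "e \<in> Basis"
  shows "\<bar>dderiv c (N k) x\<bar> \<le> C * (1 / 2) ^ k" "\<bar>dderiv d (dderiv c (N k)) x\<bar> \<le> C * (1 / 2) ^ k" "\<bar>dderiv e (dderiv d (dderiv c (N k))) x\<bar> \<le> C"
proof -
  have p: "(1 / 8 :: real) ^ k * 2 ^ k = (1 / 4) ^ k" "(1 / 4 :: real) ^ k * 2 ^ k = (1 / 2) ^ k" "(1 / 2 :: real) ^ k * 2 ^ k = 1"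
    by (simp_all only: power_mult_distrib[symmetric]) simp_all
  note b = deriv_bound3_dd[OF N(2) assms, of k x]
  have "(1 / 4 :: real) ^ k \<le> (1 / 2) ^ k" by (intro power_mono) auto
  then have "C * (1 / 4) ^ k \<le> C * (1 / 2) ^ k" using C by (intro mult_left_mono)
  then show "\<bar>dderiv c (N k) x\<bar> \<le> C * (1 / 2) ^ k" using b(1) by (simp only: mult.assoc p)
  show "\<bar>dderiv d (dderiv c (N k)) x\<bar> \<le> C * (1 / 2) ^ k" using b(2) by (simp only: mult.assoc p)
  show "\<bar>dderiv e (dderiv d (dderiv c (N k))) x\<bar> \<le> C"
  proof -
    have "C * (1 / 8) ^ k * 2 ^ k * 2 ^ k * 2 ^ k = C * (((1 / 8) ^ k * 2 ^ k) * 2 ^ k * 2 ^ k)" by (simp only: mult.assoc)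
    also have "\<dots> = C" by (simp only: p)
    finally show ?thesis using b(3) by (simp only:)
  qed
qed

lemma B_dd:
  assumes "c \<in> Basis" "d \<in> Basis" "e \<in> Basis"
  shows "\<bar>dderiv c (B k) x\<bar> \<le> A * (1 / 2) ^ k" "\<bar>dderiv d (dderiv c (B k)) x\<bar> \<le> A * amp k"
    "\<bar>dderiv e (dderiv d (dderiv c (B k))) x\<bar> \<le> A * amp k / rs k"
proof -
  have "deriv_bound 3 (1 / rs k) (amp k * (rs k)\<^sup>2 * A) (B k) x"
    unfolding B_def by (rule scaled_bump_bd[OF A(2) rs(1) less_imp_le[OF amp_pos]])
  note b = deriv_bound3_dd[OF this assms]
  have r: "rs k \<noteq> 0" using rs(1)[of k] by simp
  have "A * (amp k * rs k) \<le> A * (1 / 2) ^ k" by (intro mult_left_mono rad_bound_mult rs A)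
  then show "\<bar>dderiv c (B k) x\<bar> \<le> A * (1 / 2) ^ k" using b(1) r by (simp add: power2_eq_square ac_simps)
  show "\<bar>dderiv d (dderiv c (B k)) x\<bar> \<le> A * amp k" using b(2) r by (simp add: power2_eq_square ac_simps)
  show "\<bar>dderiv e (dderiv d (dderiv c (B k))) x\<bar> \<le> A * amp k / rs k" using b(3) r by (simp add: power2_eq_square ac_simps)
qed

lemma B_zero_germ: "x \<notin> cball (xs k) (rs k) \<Longrightarrow> \<exists>U. open U \<and> x \<in> U \<and> (\<forall>y\<in>U. B k y = 0)"
  unfolding B_def by (rule scaled_bump_zero_germ[OF rs(1)])

lemma B_dd_zero:
  assumes "x \<notin> cball (xs k) (rs k)"
  shows "dderiv c (B k) x = 0" "dderiv d (dderiv c (B k)) x = 0" "dderiv e (dderiv d (dderiv c (B k))) x = 0"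
proof -
  obtain U where U: "open U" "x \<in> U" "\<And>y. y \<in> U \<Longrightarrow> B k y = 0" using B_zero_germ[OF assms] by blast
  show "dderiv c (B k) x = 0" "dderiv d (dderiv c (B k)) x = 0" "dderiv e (dderiv d (dderiv c (B k))) x = 0"
    by (rule dderiv_zero_germ[OF U(1,2)], erule U(3))+
qed

lemma N_dd_zero:
  assumes "x \<notin> S k"
  shows "dderiv e (dderiv d (dderiv c (N k))) x = 0"
proof -
  obtain U where U: "open U" "x \<in> U" "\<And>y. y \<in> U \<Longrightarrow> N k y = 0" using S(3)[OF assms] by blast
  show ?thesis by (rule dderiv_zero_germ(3)[OF U(1,2)], erule U(3))
qed

lemma outside: "x \<notin> \<Omega> \<Longrightarrow> x \<notin> cball (xs k) (rs k)"
  using rs(3)[of k] subset_cball[of "rs k" "2 * rs k" "xs k"] rs(1)[of k] by auto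

text \<open>A function of size A M r^-t on a ball of radius r has p-th energy of order M^p r^(n - t
  p), and the radii make this at most 2^-k eventually, provided t p < n. This always holds for
  second derivatives, t = 0, and for p < n in the case of third derivatives, t = 1.\<close>

lemma energy_bump:
  assumes f: "\<And>k x. \<bar>f k x\<bar> \<le> A * amp k * rs k powr (- t)" "\<And>k x. x \<notin> cball (xs k) (rs k) \<Longrightarrow> f k x = 0"
    and p: "0 \<le> p" and t: "t * p < real CARD('n)"
  shows "geometric_energy p (lebesgue_on \<Omega>) f"
proof (rule geometric_energyI)
  let ?V = "unit_ball_vol (real CARD('n))"
  show "Lp_energy p (lebesgue_on \<Omega>) (f k) \<le> ennreal ((A * amp k * rs k powr (- t)) powr p * measure lebesgue (cball (xs k) (rs k)))" for k
    by (rule Lp_energy_support) (use f p \<Omega> in auto)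
  have "\<forall>\<^sub>F k in sequentially. amp k powr p * rs k powr (real CARD('n) - t * p) \<le> (1 / 2) ^ k"
    by (rule eventually_rad_bound) (use rs p t in auto)
  then show "\<forall>\<^sub>F k in sequentially. (A * amp k * rs k powr (- t)) powr p * measure lebesgue (cball (xs k) (rs k)) \<le> A powr p * ?V * (1 / 2) ^ k"
  proof eventually_elim
    case (elim k)
    have "(A * amp k * rs k powr (- t)) powr p * measure lebesgue (cball (xs k) (rs k))
      = A powr p * amp k powr p * rs k powr (- t * p) * (?V * rs k powr real CARD('n))"
      using rs(1)[of k] A amp_pos[of k] by (simp add: content_cball powr_mult powr_powr powr_realpow)
    also have "\<dots> = A powr p * ?V * (amp k powr p * rs k powr (real CARD('n) - t * p))"
      using rs(1)[of k] by (simp add: powr_diff powr_minus field_simps)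
    also have "\<dots> \<le> A powr p * ?V * (1 / 2) ^ k" by (intro mult_left_mono elim) auto
    finally show ?case .
  qed
qed

lemma measurable_Ck: "Ck k f \<Longrightarrow> f \<in> borel_measurable (lebesgue_on \<Omega>)" for f :: "real^'n \<Rightarrow> real"
  by (intro continuous_borel_measurable_lebesgue_on Ck_continuous)

lemma stream: "stream_series \<Omega> a b F (C + A)"
proof
  show "Ck 3 (F k)" for k unfolding F_def by (intro Ck_add N Ck_B)
  show "\<bar>dderiv c (F k) x\<bar> \<le> (C + A) * (1 / 2) ^ k" if "c \<in> Basis" for k x c
    using N_dd(1)[OF that that that, of k x] B_dd(1)[OF that that that, of k x]
    by (simp add: F_dd(1) distrib_right)
  show "geometric_energy p (lebesgue_on \<Omega>) (\<lambda>k. dderiv d (dderiv c (F k)))" if p: "1 \<le> p" and cd: "c \<in> Basis" "d \<in> Basis" for p c d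
    unfolding F_dd(2)
  proof (rule geometric_energy_add)
    show "geometric_energy p (lebesgue_on \<Omega>) (\<lambda>k. dderiv d (dderiv c (N k)))"
      by (rule geometric_energy_sup[OF \<Omega> p]) (use N_dd(2)[OF cd cd(1)] in simp)
    show "geometric_energy p (lebesgue_on \<Omega>) (\<lambda>k. dderiv d (dderiv c (B k)))"
      by (rule energy_bump[where t=0]) (use B_dd(2)[OF cd cd(1)] B_dd_zero(2) p n2 rs(1) in \<open>auto simp: powr_zero_eq_one less_imp_neq[symmetric]\<close>)
  qed (use p in \<open>auto intro!: measurable_Ck Ck_dd[OF Ck_dd[OF Ck3_Suc[OF N(1)]]] Ck_dd[OF Ck_dd[OF Ck3_Suc[OF Ck_B]]]\<close>)
  show "geometric_energy p (lebesgue_on \<Omega>) (\<lambda>k. dderiv e (dderiv d (dderiv c (F k))))"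
    if p: "1 \<le> p" "p < real CARD('n)" and cd: "c \<in> Basis" "d \<in> Basis" "e \<in> Basis" for p c d e
    unfolding F_dd(3)
  proof (rule geometric_energy_add)
    show "geometric_energy p (lebesgue_on \<Omega>) (\<lambda>k. dderiv e (dderiv d (dderiv c (N k))))"
    proof (rule geometric_energyI)
      show "Lp_energy p (lebesgue_on \<Omega>) (dderiv e (dderiv d (dderiv c (N k)))) \<le> ennreal (C powr p * measure lebesgue (S k))" for k
        by (rule Lp_energy_support[OF _ S(1)]) (use N_dd(3)[OF cd] N_dd_zero p \<Omega> in auto)
      show "\<forall>\<^sub>F k in sequentially. C powr p * measure lebesgue (S k) \<le> C powr p * D * (1 / 2) ^ k"
        by (intro always_eventually allI) (simp add: mult.assoc mult_left_mono S(2))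
    qed
    show "geometric_energy p (lebesgue_on \<Omega>) (\<lambda>k. dderiv e (dderiv d (dderiv c (B k))))"
      by (rule energy_bump[where t=1])
        (use B_dd(3)[OF cd] B_dd_zero(3) p rs(1) in \<open>auto simp: powr_minus_divide less_imp_le\<close>)
  qed (use p in \<open>auto intro!: measurable_Ck Ck_dd[OF Ck_dd[OF Ck_dd[OF Ck3_Suc[OF N(1)]]]] Ck_dd[OF Ck_dd[OF Ck_dd[OF Ck3_Suc[OF Ck_B]]]]\<close>)
qed (use \<Omega> ab n2 in auto)

lemma F_outside:
  assumes "x \<notin> \<Omega>"
  shows "dderiv c (F k) x = dderiv c (N k) x" "dderiv d (dderiv c (F k)) x = dderiv d (dderiv c (N k)) x"
proof -
  show "dderiv c (F k) x = dderiv c (N k) x" unfolding F_dd(1) using B_dd_zero(1)[OF outside[OF assms]] by simp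
  show "dderiv d (dderiv c (F k)) x = dderiv d (dderiv c (N k)) x" unfolding F_dd(2) using B_dd_zero(2)[OF outside[OF assms]] by simp
qed

definition tail :: "nat \<Rightarrow> (real^'n) set" where
  "tail k = (\<Union>i. cball (xs (k + Suc i)) (rs (k + Suc i)))"

text \<open>Off the later balls no bump beyond the k-th contributes. The terms N_j add up to at most
  2 C and the earlier bumps to A ((k+1)! - 1), so everything but the k-th bump is of order
  (k+1)!.\<close>

lemma second_derivative_sum:
  assumes x: "x \<notin> tail k" and cd: "c \<in> Basis" "d \<in> Basis"
  shows "\<bar>(\<Sum>j. dderiv d (dderiv c (F j)) x) - dderiv d (dderiv c (B k)) x\<bar> \<le> (2 * C + A) * fact (Suc k)"
    and "summable (\<lambda>j. norm (grad_rot a b (F j) x))"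
proof -
  have B0: "dderiv d (dderiv c (B j)) x = 0" if "k < j" for j c d
  proof -
    have "x \<notin> cball (xs (k + Suc (j - Suc k))) (rs (k + Suc (j - Suc k)))" using x unfolding tail_def by blast
    then show ?thesis using that by (intro B_dd_zero(2)) simp
  qed
  have Cs: "(\<lambda>j. C * (1 / 2) ^ j) sums (C * 2)" using geometric_sums[of "1 / 2 :: real"] by (intro sums_mult) simp
  define h where "h j = (if j \<in> {..<k} then A * amp j else 0)" for j
  have hs: "h sums (\<Sum>j<k. A * amp j)" unfolding h_def by (rule sums_If_finite_set) simp
  define s where "s j = dderiv d (dderiv c (F j)) x - (if j = k then dderiv d (dderiv c (B k)) x else 0)" for j
  have Fs: "dderiv d (dderiv c (F j)) x = dderiv d (dderiv c (N j)) x + dderiv d (dderiv c (B j)) x" for j by (simp only: F_dd(2))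
  have s: "\<bar>s j\<bar> \<le> C * (1 / 2) ^ j + h j" for j
  proof (cases j k rule: linorder_cases)
    case less
    then have "s j = dderiv d (dderiv c (N j)) x + dderiv d (dderiv c (B j)) x" "h j = A * amp j" by (simp_all add: s_def h_def Fs)
    then show ?thesis using N_dd(2)[OF cd cd(1), of j x] B_dd(2)[OF cd cd(1), of j x] by linarith
  next
    case equal
    then have "s j = dderiv d (dderiv c (N j)) x" "h j = 0" by (simp_all add: s_def h_def Fs)
    then show ?thesis using N_dd(2)[OF cd cd(1), of j x] by simp
  next
    case greater
    then have "s j = dderiv d (dderiv c (N j)) x" "h j = 0" using B0[of j d c] by (simp_all add: s_def h_def Fs)
    then show ?thesis using N_dd(2)[OF cd cd(1), of j x] by simp
  qed
  note bs = sums_add[OF Cs hs]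
  have ss: "summable (\<lambda>j. \<bar>s j\<bar>)"
  proof (rule summable_comparison_test[OF _ sums_summable[OF bs]])
    show "\<exists>M. \<forall>j\<ge>M. norm \<bar>s j\<bar> \<le> C * (1 / 2) ^ j + h j" by (rule exI[of _ 0]) (simp add: s)
  qed
  define t where "t = dderiv d (dderiv c (B k)) x"
  have ks: "(\<lambda>j. if j = k then t else 0) sums t"
    using sums_single[of k "\<lambda>_. t"] by simp
  have "(\<lambda>j. s j + (if j = k then t else 0)) sums (suminf s + t)"
    by (rule sums_add[OF summable_sums[OF summable_rabs_cancel[OF ss]] ks])
  moreover have "(\<lambda>j. s j + (if j = k then t else 0)) = (\<lambda>j. dderiv d (dderiv c (F j)) x)"
    by (auto simp: s_def t_def)
  ultimately have "(\<lambda>j. dderiv d (dderiv c (F j)) x) sums (suminf s + t)" by simp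
  then have "(\<Sum>j. dderiv d (dderiv c (F j)) x) - dderiv d (dderiv c (B k)) x = suminf s" by (simp add: sums_iff t_def)
  also have "\<bar>suminf s\<bar> \<le> (\<Sum>j. \<bar>s j\<bar>)" by (rule summable_rabs[OF ss])
  also have "\<dots> \<le> (\<Sum>j. C * (1 / 2) ^ j + h j)" by (rule suminf_le[OF s ss sums_summable[OF bs]])
  also have "\<dots> = C * 2 + (\<Sum>j<k. A * amp j)" using bs by (simp add: sums_iff)
  also have "\<dots> = 2 * C + A * (fact (Suc k) - 1)"
    using sum_fact_mult[of k] by (simp add: amp_def sum_distrib_left[symmetric] del: fact_Suc of_nat_Suc)
  also have "\<dots> \<le> (2 * C + A) * fact (Suc k)"
  proof -
    have "2 * C * 1 \<le> 2 * C * fact (Suc k)" using C fact_ge_1[of "Suc k"] by (intro mult_left_mono) auto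
    then show ?thesis using A(1) by (simp add: algebra_simps del: fact_Suc)
  qed
  finally show "\<bar>(\<Sum>j. dderiv d (dderiv c (F j)) x) - dderiv d (dderiv c (B k)) x\<bar> \<le> (2 * C + A) * fact (Suc k)" .
  \<comment> \<open>Beyond index \<open>k\<close> only the terms N_j remain, with geometric bounds;
    finitely many earlier terms do not affect summability.\<close>
  have "norm (grad_rot a b (F j) x) \<le> real CARD('n) * (2 * (C * (1 / 2) ^ j))" if "k < j" for j
    by (rule norm_grad_rot_le) (use N_dd(2) B0[OF that] in \<open>simp only: F_dd(2) add_0_right\<close>)
  then have "\<exists>M. \<forall>j\<ge>M. norm (norm (grad_rot a b (F j) x)) \<le> real CARD('n) * (2 * (C * (1 / 2) ^ j))"
    by (intro exI[of _ "Suc k"]) auto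
  then show "summable (\<lambda>j. norm (grad_rot a b (F j) x))"
    by (rule summable_comparison_test) (intro summable_mult sums_summable[OF Cs])
qed

text \<open>Sum and entries are interchanged off the later balls, where the series converges
  absolutely; without convergence \<open>suminf\<close> would be a default value.\<close>

lemma G_entry:
  assumes "x \<notin> tail k"
  shows "(\<Sum>j. grad_rot a b (F j) x) $ i $ l =
    (if i = a then \<Sum>j. dderiv (axis l 1) (dderiv (axis b 1) (F j)) x else if i = b then - (\<Sum>j. dderiv (axis l 1) (dderiv (axis a 1) (F j)) x) else 0)"
proof -
  have ax: "axis j (1::real) \<in> Basis" for j :: 'n by (simp add: axis_in_Basis_iff)
  have s: "summable (\<lambda>j. grad_rot a b (F j) x)"
    by (rule summable_norm_cancel[OF second_derivative_sum(2)[OF assms ax ax]])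
  have e: "(\<Sum>j. grad_rot a b (F j) x) $ i $ l = (\<Sum>j. grad_rot a b (F j) x $ i $ l)"
    by (rule bounded_linear.suminf[OF entry_linear s])
  have se: "summable (\<lambda>j. grad_rot a b (F j) x $ b $ l)" by (rule bounded_linear.summable[OF entry_linear s])
  show ?thesis
  proof (cases "i = b")
    case True
    have "summable (\<lambda>j. - dderiv (axis l 1) (dderiv (axis a 1) (F j)) x)" using se ab by (simp add: grad_rot_entry[OF ab])
    then have "summable (\<lambda>j. dderiv (axis l 1) (dderiv (axis a 1) (F j)) x)" by (simp only: summable_minus_iff)
    then show ?thesis unfolding e grad_rot_entry[OF ab] using True ab by (simp add: suminf_minus)
  next
    case False
    then show ?thesis unfolding e grad_rot_entry[OF ab] by simp
  qed
qed

text \<open>On the small ball the k-th bump contributes at least \<open>amp k / 8\<close> to the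
  entry (a, a), and the rest is of order (k+1)!. In the shell that bump vanishes, so all entries are
  of order (k+1)!; passing to the norm costs the number n^2 of entries.\<close>

lemma weight_not_muckenhoupt:
  assumes \<Omega>0: "open \<Omega>0" "\<Omega>0 \<noteq> {}" "\<Omega>0 \<subseteq> \<Omega>" and p: "p \<noteq> 2"
  shows "(\<lambda>x. if x \<in> \<Omega> then (1 + norm (sym_part (\<Sum>j. grad_rot a b (F j) x))) powr (p - 2) else 0) \<notin> muckenhoupt_infty \<Omega>0"
proof (rule oscillating_weight_not_muckenhoupt[where xs=xs and rs=rs and \<sigma>="p - 2" and ?c0.0="(1 / 4) *\<^sub>R (axis a 1 + axis b 1)"
      and W="\<lambda>x. norm (sym_part (\<Sum>j. grad_rot a b (F j) x))" and ?K1.0="2 * C + A"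
      and ?K2.0="real CARD('n) * real CARD('n) * (2 * C + A)"])
  have ax: "axis j (1::real) \<in> Basis" for j :: 'n by (simp add: axis_in_Basis_iff)
  let ?G = "\<lambda>x. \<Sum>j. grad_rot a b (F j) x"
  show "rs (Suc k) \<le> 1 / 4 * (1 / 8) ^ DIM(real^'n) * rs k" for k using rs(4)[of k] by simp
  show "norm ((1 / 4) *\<^sub>R (axis a 1 + axis b 1) :: real^'n) \<le> 1 / 2"
    using norm_triangle_ineq[of "axis a 1 :: real^'n" "axis b 1"] by (simp add: norm_axis)
  show "\<exists>k\<ge>m. ball (xs k) (2 * rs k) \<subseteq> \<Omega>0" for m by (rule dense[OF \<Omega>0])
  show "fact (Suc k) * (real (Suc k) / 8 - (2 * C + A)) \<le> norm (sym_part (?G x))"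
    if x: "x \<in> ball (xs k + rs k *\<^sub>R ((1 / 4) *\<^sub>R (axis a 1 + axis b 1))) (rs k / 8)"
      and t: "x \<notin> (\<Union>i. cball (xs (k + Suc i)) (rs (k + Suc i)))" for k x
  proof -
    have t': "x \<notin> tail k" using t by (simp add: tail_def)
    have "amp k / 8 \<le> dderiv (axis a 1) (dderiv (axis b 1) (B k)) x"
      unfolding B_def using x ab by (intro dderiv2_scaled_bump_ge rs ax less_imp_le[OF amp_pos]) (auto simp: axis_eq_axis)
    moreover have "\<bar>?G x $ a $ a - dderiv (axis a 1) (dderiv (axis b 1) (B k)) x\<bar> \<le> (2 * C + A) * fact (Suc k)"
      using second_derivative_sum(1)[OF t' ax ax] by (simp add: G_entry[OF t'] del: fact_Suc)
    ultimately have "amp k / 8 - (2 * C + A) * fact (Suc k) \<le> \<bar>?G x $ a $ a\<bar>" by linarith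
    also have "\<dots> \<le> norm (sym_part (?G x))" by (rule norm_sym_part_ge)
    finally show ?thesis by (simp add: amp_def algebra_simps del: fact_Suc)
  qed
  show "norm (sym_part (?G x)) \<le> real CARD('n) * real CARD('n) * (2 * C + A) * fact (Suc k)"
    if x: "x \<in> ball (xs k) (2 * rs k)" "x \<notin> cball (xs k) (rs k)"
      and t: "x \<notin> (\<Union>i. cball (xs (k + Suc i)) (rs (k + Suc i)))" for k x
  proof -
    have t': "x \<notin> tail k" using t by (simp add: tail_def)
    have e: "\<bar>\<Sum>j. dderiv d (dderiv c (F j)) x\<bar> \<le> (2 * C + A) * fact (Suc k)" if "c \<in> Basis" "d \<in> Basis" for c d
      using second_derivative_sum(1)[OF t' that] by (simp add: B_dd_zero(2)[OF x(2)] del: fact_Suc)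
    have "0 \<le> (2 * C + A) * fact (Suc k)" using C A by simp
    then have "norm (sym_part (?G x)) \<le> real CARD('n) * real CARD('n) * ((2 * C + A) * fact (Suc k))"
      by (intro norm_sym_part_le) (auto simp: G_entry[OF t'] simp del: fact_Suc intro: e ax)
    then show ?thesis by (simp only: mult.assoc)
  qed
qed (use rs(1) C A p \<Omega>0 in auto)

end

section \<open>The counterexample\<close>

text \<open>\<open>g\<close> is the height above the graph. Its slope along \<open>e\<close> is
  exactly 1, which gives both the shift identity and a gradient that never vanishes. The projection
  has norm at most 2 and is applied twice, inside and outside \<open>\<gamma>'\<close>, hence the
  constant \<open>4 * L\<close>.\<close>

lemma graph_defining_function:
  fixes e :: "'a::euclidean_space"
  assumes e: "norm e = 1" and \<gamma>: "C11_function \<gamma>"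
  obtains g g' L where "\<And>y. GDERIV g y :> g' y" "L-lipschitz_on UNIV g'" "\<And>x t. g (x + t *\<^sub>R e) = g x + t"
    "\<And>x. g x = x \<bullet> e - \<gamma> (x - (x \<bullet> e) *\<^sub>R e)" "\<And>x. g' x \<bullet> e = 1"
proof -
  obtain \<gamma>' L where G: "\<And>y. GDERIV \<gamma> y :> \<gamma>' y" and L: "L-lipschitz_on UNIV \<gamma>'"
    using \<gamma> unfolding C11_function_def by blast
  have L0: "0 \<le> L" using L by (rule lipschitz_on_nonneg)
  have ee: "e \<bullet> e = 1" using e by (simp add: norm_eq_1)
  define P where "P x = x - (x \<bullet> e) *\<^sub>R e" for x
  define g where "g x = x \<bullet> e - \<gamma> (P x)" for x
  define g' where "g' x = e - P (\<gamma>' (P x))" for x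
  have Plin: "P x - P y = P (x - y)" for x y by (simp add: P_def inner_diff_left algebra_simps)
  have Pnorm: "norm (P x) \<le> 2 * norm x" for x
  proof -
    have "norm (P x) \<le> norm x + \<bar>x \<bullet> e\<bar>" unfolding P_def using norm_triangle_ineq4[of x "(x \<bullet> e) *\<^sub>R e"] e by simp
    also have "\<bar>x \<bullet> e\<bar> \<le> norm x" using Cauchy_Schwarz_ineq2[of x e] e by simp
    finally show ?thesis by simp
  qed
  show thesis
  proof (rule that[of g g' "4 * L"])
    fix y
    have "(\<gamma> has_derivative (\<lambda>h. h \<bullet> \<gamma>' (P y))) (at (P y))" using G unfolding gderiv_def .
    moreover have "(P has_derivative P) (at y)" unfolding P_def by (auto intro!: derivative_eq_intros)
    ultimately have "((\<lambda>x. \<gamma> (P x)) has_derivative (\<lambda>h. P h \<bullet> \<gamma>' (P y))) (at y)"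
      by (rule has_derivative_compose[rotated])
    then have "(g has_derivative (\<lambda>h. h \<bullet> e - P h \<bullet> \<gamma>' (P y))) (at y)"
      unfolding g_def[abs_def] by (intro has_derivative_diff) (auto intro!: derivative_eq_intros)
    moreover have "h \<bullet> e - P h \<bullet> v = h \<bullet> (e - P v)" for h v
      by (simp add: P_def inner_diff_left inner_diff_right inner_commute)
    ultimately show "GDERIV g y :> g' y" unfolding gderiv_def g'_def by simp
  next
    show "(4 * L)-lipschitz_on UNIV g'"
    proof (rule lipschitz_onI)
      fix x y
      have "dist (g' x) (g' y) = norm (P (\<gamma>' (P x) - \<gamma>' (P y)))"
        by (simp add: g'_def dist_norm Plin[symmetric] norm_minus_commute)
      also have "\<dots> \<le> 2 * norm (\<gamma>' (P x) - \<gamma>' (P y))" by (rule Pnorm)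
      also have "norm (\<gamma>' (P x) - \<gamma>' (P y)) \<le> L * norm (P (x - y))"
        using lipschitz_onD[OF L, of "P x" "P y"] by (simp add: dist_norm Plin)
      also have "L * norm (P (x - y)) \<le> L * (2 * norm (x - y))" by (intro mult_left_mono Pnorm L0)
      finally show "dist (g' x) (g' y) \<le> 4 * L * dist x y" by (simp add: dist_norm)
    qed (use L0 in auto)
  next
    show "g (x + t *\<^sub>R e) = g x + t" for x t
    proof -
      have "P (x + t *\<^sub>R e) = P x" by (simp add: P_def inner_add_left ee algebra_simps)
      then show ?thesis by (simp add: g_def inner_add_left ee)
    qed
    show "g' x \<bullet> e = 1" for x by (simp add: g'_def P_def inner_diff_left ee)
  qed (simp add: g_def P_def)
qed

text \<open>Points of the ball with negative \<open>g\<close> have a neighbourhood disjoint from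
  \<Omega>, and from a zero of \<open>g\<close> one enters \<Omega> by moving along
  \<open>e\<close>.\<close>

lemma frontier_graph:
  fixes g :: "'a::euclidean_space \<Rightarrow> real"
  assumes \<Omega>: "open \<Omega>" "\<Omega> \<inter> ball x0 \<rho> = {x \<in> ball x0 \<rho>. 0 < g x}"
    and g: "continuous_on UNIV g" "\<And>x t. g (x + t *\<^sub>R e) = g x + t" and x: "x \<in> ball x0 \<rho>"
  shows "x \<in> frontier \<Omega> \<longleftrightarrow> g x = 0"
proof
  assume fr: "x \<in> frontier \<Omega>"
  then have xc: "x \<in> closure \<Omega>" "x \<notin> \<Omega>" using \<Omega>(1) by (auto simp: frontier_def interior_open)
  then have "\<not> 0 < g x" using \<Omega>(2) x by blast
  moreover have "\<not> g x < 0"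
  proof
    assume neg: "g x < 0"
    have "open (ball x0 \<rho> \<inter> g -` {..<0})" using g(1) by (intro open_Int open_ball open_vimage) auto
    moreover have "x \<in> ball x0 \<rho> \<inter> g -` {..<0}" using x neg by simp
    ultimately obtain y where y: "y \<in> \<Omega>" "y \<in> ball x0 \<rho>" "g y < 0"
      using xc(1) open_Int_closure_eq_empty[of "ball x0 \<rho> \<inter> g -` {..<0}" \<Omega>] by blast
    then have "y \<in> {x \<in> ball x0 \<rho>. 0 < g x}" using \<Omega>(2) by blast
    with y(3) show False by simp
  qed
  ultimately show "g x = 0" by linarith
next
  assume g0: "g x = 0"
  have "x \<notin> \<Omega>"
  proof
    assume "x \<in> \<Omega>"
    then have "x \<in> {x \<in> ball x0 \<rho>. 0 < g x}" using \<Omega>(2) x by blast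
    with g0 show False by simp
  qed
  moreover have "x \<in> closure \<Omega>"
  proof -
    have lim: "((\<lambda>t. x + t *\<^sub>R e) \<longlongrightarrow> x + 0 *\<^sub>R e) (at_right 0)" by (intro tendsto_intros)
    then have "\<forall>\<^sub>F t in at_right 0. x + t *\<^sub>R e \<in> ball x0 \<rho>"
      using x by (intro topological_tendstoD[OF lim]) auto
    moreover have "\<forall>\<^sub>F t :: real in at_right 0. 0 < t" by (rule eventually_at_right_less)
    ultimately have "\<forall>\<^sub>F t in at_right 0. x + t *\<^sub>R e \<in> \<Omega>"
    proof eventually_elim
      case (elim t)
      then have "0 < g (x + t *\<^sub>R e)" using g(2)[of x t] g0 by simp
      then show ?case using \<Omega>(2) elim by blast
    qed
    then have "\<forall>\<^sub>F t in at_right 0. x + t *\<^sub>R e \<in> closure \<Omega>"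
      by eventually_elim (use closure_subset in blast)
    from Lim_in_closed_set[OF closed_closure this _ lim] show ?thesis by simp
  qed
  ultimately show "x \<in> frontier \<Omega>" using \<Omega>(1) by (simp add: frontier_def interior_open)
qed

lemma lipschitz_on_cball:
  fixes g :: "'a::euclidean_space \<Rightarrow> real"
  assumes g: "\<And>y. GDERIV g y :> g' y" and lip: "L-lipschitz_on UNIV g'"
  obtains K where "1 \<le> K" "\<And>x y. x \<in> cball x0 R \<Longrightarrow> y \<in> cball x0 R \<Longrightarrow> \<bar>g x - g y\<bar> \<le> K * dist x y"
proof -
  have "continuous_on UNIV g'" using lip by (rule lipschitz_on_continuous_on)
  then have "compact (g' ` cball x0 R)"
    by (intro compact_continuous_image) (auto intro: continuous_on_subset)
  then have "bounded (g' ` cball x0 R)" by (rule compact_imp_bounded)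
  then obtain D where D: "\<And>x. x \<in> cball x0 R \<Longrightarrow> norm (g' x) \<le> D" unfolding bounded_iff by blast
  show thesis
  proof (rule that[of "max 1 D"])
    fix x y assume xy: "x \<in> cball x0 R" "y \<in> cball x0 R"
    have "norm (g x - g y) \<le> max 1 D * norm (x - y)"
    proof (rule differentiable_bound[OF convex_cball _ _ xy])
      fix z assume z: "z \<in> cball x0 R"
      show "(g has_derivative (\<lambda>h. h \<bullet> g' z)) (at z within cball x0 R)"
        using g[of z] unfolding gderiv_def by (rule has_derivative_at_withinI)
      show "onorm (\<lambda>h. h \<bullet> g' z) \<le> max 1 D"
      proof (rule onorm_le)
        fix h
        have "\<bar>h \<bullet> g' z\<bar> \<le> norm h * norm (g' z)" by (rule Cauchy_Schwarz_ineq2)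
        also have "\<dots> \<le> norm h * max 1 D" using D[OF z] by (intro mult_left_mono) auto
        finally show "norm (h \<bullet> g' z) \<le> max 1 D * norm h" by (simp add: mult.commute)
      qed
    qed
    then show "\<bar>g x - g y\<bar> \<le> max 1 D * dist x y" by (simp add: dist_norm)
  qed simp
qed

text \<open>Moving \<open>y\<close> by \<open>- g y\<close> along \<open>e\<close> leads onto the
  graph. So the tube over the graph contains a ball about \<open>x0\<close>, and the graph has
  positive surface measure by \<open>hausdorff_outer_pos\<close>.\<close>

lemma surface_not_AE_zero:
  fixes T :: "'a::euclidean_space \<Rightarrow> 'b::euclidean_space"
  assumes T: "T \<in> borel_measurable borel" and n2: "2 \<le> DIM('a)"
    and g: "continuous_on UNIV g" "\<And>x t. g (x + t *\<^sub>R e) = g x + t" "norm e = 1" "g x0 = 0"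
    and r: "0 < r" and sub: "\<And>x. x \<in> ball x0 r \<Longrightarrow> g x = 0 \<Longrightarrow> x \<in> frontier \<Omega> \<and> T x \<noteq> 0"
  shows "\<not> (AE x in surface_measure \<Omega>. T x = 0)"
proof
  assume AE: "AE x in surface_measure \<Omega>. T x = 0"
  let ?H = "hausdorff_measure (real DIM('a) - 1) :: 'a measure"
  define A where "A = {x \<in> ball x0 r. g x = 0}"
  have "A = ball x0 r \<inter> g -` {0}" by (auto simp: A_def)
  moreover have "closed (g -` {0})" using g(1) by (intro closed_vimage) auto
  ultimately have A: "A \<in> sets borel" by auto
  have fr: "frontier \<Omega> \<in> sets borel" by (simp add: frontier_closed borel_closed)
  have "AE x in ?H. x \<in> frontier \<Omega> \<longrightarrow> T x = 0"
    using AE unfolding surface_measure_def by (subst (asm) AE_restrict_space_iff) (use fr in auto)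
  then have "AE x in ?H. x \<notin> A" by eventually_elim (use sub in \<open>auto simp: A_def\<close>)
  then have "emeasure ?H A = 0"
    using A by (subst (asm) AE_iff_measurable[where N=A]) auto
  then have z: "hausdorff_outer (real DIM('a) - 1) A = 0" using A by (simp add: emeasure_hausdorff_measure)
  have "isCont g x0" using g(1) by (simp add: continuous_on_eq_continuous_at)
  then obtain d where d: "0 < d" "\<And>y. dist y x0 < d \<Longrightarrow> \<bar>g y\<bar> < min 1 (r / 2)"
    using r g(4) unfolding continuous_at_eps_delta dist_real_def by (metis diff_zero half_gt_zero min_less_iff_conj zero_less_one)
  have "0 < hausdorff_outer (real DIM('a) - 1) A"
  proof (rule hausdorff_outer_pos[OF g(3) _ n2])
    show "0 < min d (r / 2)" using d r by simp
    show "ball x0 (min d (r / 2)) \<subseteq> {x + t *\<^sub>R e | x t. x \<in> A \<and> \<bar>t\<bar> \<le> 1}"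
    proof
      fix y assume y: "y \<in> ball x0 (min d (r / 2))"
      then have gy: "\<bar>g y\<bar> < 1" "\<bar>g y\<bar> < r / 2" using d(2)[of y] by (auto simp: dist_commute)
      have "dist x0 (y - g y *\<^sub>R e) \<le> dist x0 y + dist y (y - g y *\<^sub>R e)" by (rule dist_triangle)
      also have "dist y (y - g y *\<^sub>R e) = \<bar>g y\<bar>" by (simp add: dist_norm g(3))
      finally have "y - g y *\<^sub>R e \<in> ball x0 r" using y gy by simp
      moreover have "g (y - g y *\<^sub>R e) = 0" using g(2)[of y "- g y"] by simp
      ultimately have "y - g y *\<^sub>R e \<in> A" by (simp add: A_def)
      moreover have "y = (y - g y *\<^sub>R e) + g y *\<^sub>R e" by simp
      ultimately show "y \<in> {x + t *\<^sub>R e | x t. x \<in> A \<and> \<bar>t\<bar> \<le> 1}" using gy(1) less_imp_le by blast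
    qed
  qed
  with z show False by simp
qed

theorem theorem5:
  fixes \<Omega> :: "(real^'n) set"
  assumes "CARD('n) \<ge> 2"
    and "bounded_C11_domain \<Omega>"
  shows "\<exists>(u :: real^'n \<Rightarrow> real^'n) (G :: real^'n \<Rightarrow> real^'n^'n).
    has_weak_gradient \<Omega> u G \<and>
    (\<forall>q s. 1 < q \<and> q < real CARD('n) \<and> 1 < s \<longrightarrow>
       u \<in> sobolev 2 q \<Omega> \<inter> sobolev_zero_trace s \<Omega>) \<and>
    (\<exists>T. (\<forall>q. 1 < q \<and> q < real CARD('n) \<longrightarrow> has_trace q \<Omega> G T) \<and>
       \<not> (AE x in surface_measure \<Omega>. T x = 0)) \<and>
    (AE x in lebesgue_on \<Omega>. trace (G x) = 0) \<and>
    (\<forall>p \<Omega>0. 1 < p \<and> p \<noteq> 2 \<and> open \<Omega>0 \<and> \<Omega>0 \<noteq> {} \<and> \<Omega>0 \<subseteq> \<Omega> \<longrightarrow>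
       (\<lambda>x. if x \<in> \<Omega> then (1 + norm (sym_part (G x))) powr (p - 2) else 0)
         \<notin> muckenhoupt_infty \<Omega>0)"
proof -
  note n2 = assms(1)
  have \<Omega>: "open \<Omega>" "\<Omega> \<noteq> {}" "bounded \<Omega>" and bdry: "C11_boundary \<Omega>"
    using assms(2) by (auto simp: bounded_C11_domain_def)
  \<comment> \<open>A set without frontier would be empty or the whole space, which is not
    bounded.\<close>
  have "frontier \<Omega> \<noteq> {}" using \<Omega> not_bounded_UNIV by (auto simp: frontier_eq_empty)
  then obtain x0 where x0: "x0 \<in> frontier \<Omega>" by blast
  then obtain \<rho> e \<gamma> where \<rho>: "0 < \<rho>" and e: "norm e = 1" and \<gamma>: "C11_function \<gamma>"
    and loc: "\<Omega> \<inter> ball x0 \<rho> = {x \<in> ball x0 \<rho>. \<gamma> (x - (x \<bullet> e) *\<^sub>R e) < x \<bullet> e}"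
    using bdry unfolding C11_boundary_def by blast
  obtain g g' L where g: "\<And>y. GDERIV g y :> g' y" and lip: "L-lipschitz_on UNIV g'"
    and shift: "\<And>x t. g (x + t *\<^sub>R e) = g x + t" and geq: "\<And>x. g x = x \<bullet> e - \<gamma> (x - (x \<bullet> e) *\<^sub>R e)"
    and ge: "\<And>x. g' x \<bullet> e = 1"
    using graph_defining_function[OF e \<gamma>] by metis
  have loc': "\<Omega> \<inter> ball x0 \<rho> = {x \<in> ball x0 \<rho>. 0 < g x}" unfolding loc geq by auto
  define r where "r = \<rho> / 2"
  have r: "0 < r" "cball x0 r \<subseteq> ball x0 \<rho>" using \<rho> by (auto simp: r_def)
  obtain p where box: "cball x0 (r + 2) \<subseteq> cbox (- p) p" using bounded_subset_cbox_symmetric[OF bounded_cball] by blast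
  obtain A where A: "0 \<le> A" "\<forall>\<epsilon> a b f F (x::real^'n). 0 < \<epsilon> \<longrightarrow> continuous_on UNIV f \<longrightarrow> cball x \<epsilon> \<subseteq> cbox a b \<longrightarrow>
     (\<forall>y\<in>cball x \<epsilon>. \<bar>f y\<bar> \<le> F) \<longrightarrow> deriv_bound 3 (1 / \<epsilon>) (A * F) (conv a b (moll_kernel \<epsilon>) f) x"
    using moll_bd[where 'a="real^'n"] by blast
  interpret gm: graph_mollification g g' L A r x0 "- p" p
    by unfold_locales (use g lip r box A in \<open>simp_all\<close>)
  note cg = gm.continuous_g
  have fr: "x \<in> frontier \<Omega> \<longleftrightarrow> g x = 0" if "x \<in> cball x0 r" for x
    by (rule frontier_graph[OF \<Omega>(1) loc' cg shift]) (use that r in blast)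
  have gx0: "g x0 = 0" using fr[of x0] x0 r by simp
  obtain N C where C: "0 \<le> C" and N: "\<And>k. Ck 3 (N k)" "\<And>k x. deriv_bound 3 (2 ^ k) (C * (1 / 8) ^ k) (N k) x"
    and Nz: "\<And>k x. (\<exists>U. open U \<and> x \<in> U \<and> (\<forall>y\<in>U. N k y = 0)) \<or> (x \<in> cball x0 r \<and> \<bar>g x\<bar> \<le> C * (1 / 2) ^ k)"
    and Ns: "\<And>x c. x \<in> cball x0 r \<Longrightarrow> g x = 0 \<Longrightarrow> c \<in> Basis \<Longrightarrow> (\<lambda>k. dderiv c (N k) x) sums 0 \<and>
        (\<lambda>k. dderiv c (dderiv c (N k)) x) sums (2 * gm.eta x * (g' x \<bullet> c)\<^sup>2)"
    using gm.boundary_sequence by blast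
  \<comment> \<open>\<open>b\<close> is chosen as a coordinate in which the normal has a nonzero
    component, because the entry (a, b) of the gradient will be 2 \<eta> (D_b g)^2 on the boundary.
    Any other coordinate serves as \<open>a\<close>; one exists as n \<ge> 2.\<close>
  have "g' x0 \<noteq> 0" using ge[of x0] by auto
  then obtain b where b: "g' x0 $ b \<noteq> 0" by (auto simp: vec_eq_iff)
  obtain a where ab: "a \<noteq> b"
  proof -
    have "\<exists>a. a \<noteq> b"
    proof (rule ccontr)
      assume "\<nexists>a. a \<noteq> b"
      then have "(UNIV :: 'n set) = {b}" by auto
      then have "CARD('n) = 1" by (metis card_1_singleton_iff One_nat_def)
      with n2 show False by simp
    qed
    then show ?thesis using that by blast
  qed
  obtain Ab where Ab: "0 \<le> Ab" "\<And>z::real^'n. deriv_bound 3 1 Ab bump z" using deriv_bound_bump by blast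
  define q where "q = (1 / 4) * (1 / 8 :: real) ^ CARD('n)"
  have q: "0 < q" "q \<le> 1 / 2" using power_le_one[of "1 / 8 :: real" "CARD('n)"] by (auto simp: q_def)
  obtain xs rs where rs: "\<And>k. 0 < rs k" "\<And>k. rs k \<le> rad_bound k" "\<And>k. cball (xs k) (2 * rs k) \<subseteq> \<Omega>"
    "\<And>k. rs (Suc k) \<le> q * rs k"
    and dense: "\<And>\<Omega>0 m. open \<Omega>0 \<Longrightarrow> \<Omega>0 \<noteq> {} \<Longrightarrow> \<Omega>0 \<subseteq> \<Omega> \<Longrightarrow> \<exists>k\<ge>m. ball (xs k) (2 * rs k) \<subseteq> \<Omega>0"
    by (rule bump_positions[OF \<Omega>(1,2) q]) (rule that, assumption+)
  \<comment> \<open>\<open>C + 1\<close> in place of \<open>C\<close> makes the width of the strip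
    positive, as \<open>strip_volume\<close> requires, also when \<open>C\<close> is 0.\<close>
  define S where "S k = {x \<in> cball x0 r. \<bar>g x\<bar> \<le> (C + 1) * (1 / 2) ^ k}" for k :: nat
  define D where "D = 6 * unit_ball_vol (real CARD('n)) * (r + 1) ^ CARD('n) * (C + 1)"
  have S1: "S k \<in> lmeasurable" for k
  proof -
    have "closed (g -` {-((C + 1) * (1 / 2) ^ k)..(C + 1) * (1 / 2) ^ k})" using cg by (intro closed_vimage) auto
    then have "compact (cball x0 r \<inter> g -` {-((C + 1) * (1 / 2) ^ k)..(C + 1) * (1 / 2) ^ k})"
      by (rule compact_Int_closed[OF compact_cball])
    also have "cball x0 r \<inter> g -` {-((C + 1) * (1 / 2) ^ k)..(C + 1) * (1 / 2) ^ k} = S k" by (auto simp: S_def abs_le_iff)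
    finally show ?thesis by (rule lmeasurable_compact)
  qed
  have S2: "measure lebesgue (S k) \<le> D * (1 / 2) ^ k" for k
  proof -
    have "measure lebesgue (S k) \<le> 6 * unit_ball_vol (real DIM(real^'n)) * (r + 1) ^ DIM(real^'n) * ((C + 1) * (1 / 2) ^ k)"
      unfolding S_def by (rule strip_volume[OF cg shift e]) (use C r in auto)
    then show ?thesis unfolding D_def by (simp only: DIM_cart DIM_real mult_1_right mult.assoc)
  qed
  have S3: "\<exists>U. open U \<and> x \<in> U \<and> (\<forall>y\<in>U. N k y = 0)" if x: "x \<notin> S k" for k x
  proof -
    have "C * (1 / 2) ^ k \<le> (C + 1) * (1 / 2 :: real) ^ k" by (intro mult_right_mono) auto
    then have "x \<in> S k" if "x \<in> cball x0 r \<and> \<bar>g x\<bar> \<le> C * (1 / 2) ^ k"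
      unfolding S_def using that by (intro CollectI conjI) linarith+
    then have "\<not> (x \<in> cball x0 r \<and> \<bar>g x\<bar> \<le> C * (1 / 2) ^ k)" using x by blast
    then show ?thesis using Nz[of x k] by blast
  qed
  interpret bs: bumps \<Omega> N C Ab a b xs rs S D
    by unfold_locales (use \<Omega> ab n2 N C S1 S2 S3 Ab rs dense in \<open>simp_all add: q_def\<close>)
  interpret ss: stream_series \<Omega> a b bs.F "C + Ab" by (rule bs.stream)
  have ax: "axis j (1::real) \<in> Basis" for j :: 'n by (simp add: axis_in_Basis_iff)
  have out: "x \<notin> \<Omega>" if "x \<in> frontier \<Omega>" for x using that \<Omega>(1) by (simp add: frontier_def interior_open)
  have far: "dderiv c (N k) x = 0" "dderiv d (dderiv c (N k)) x = 0" if "x \<notin> cball x0 r" for k x c d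
  proof -
    have "\<exists>U. open U \<and> x \<in> U \<and> (\<forall>y\<in>U. N k y = 0)" using Nz[of x k] that by simp
    then obtain U where U: "open U" "x \<in> U" "\<And>y. y \<in> U \<Longrightarrow> N k y = 0" by (elim exE conjE) (rule that, auto)
    show "dderiv c (N k) x = 0" "dderiv d (dderiv c (N k)) x = 0" by (rule dderiv_zero_germ[OF U(1,2)], erule U(3))+
  qed
  \<comment> \<open>On the boundary the bumps vanish, and the first derivatives of the N_k sum to 0:
    by telescoping inside \<open>cball x0 r\<close>, and because all terms vanish outside
    it.\<close>
  have u0: "ss.u x = 0" if x: "x \<in> frontier \<Omega>" for x
  proof -
    have s: "(\<lambda>k. dderiv c (bs.F k) x) sums 0" if c: "c \<in> Basis" for c
    proof (cases "x \<in> cball x0 r")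
      case True
      then show ?thesis using Ns[OF True _ c] fr[OF True] x by (simp add: bs.F_outside[OF out[OF x]])
    next
      case False
      then show ?thesis by (simp add: bs.F_outside[OF out[OF x]] far)
    qed
    have "(\<lambda>k. rot a b (bs.F k) x) sums (0 *\<^sub>R axis a 1 + 0 *\<^sub>R (- axis b 1))"
      unfolding rot_def
      by (intro sums_add bounded_linear.sums[OF bounded_linear_scaleR_left] s ax)
    then show ?thesis unfolding ss.u_def by (simp add: sums_iff)
  qed
  have F2: "\<bar>dderiv d (dderiv c (bs.F k)) x\<bar> \<le> C * (1 / 2) ^ k" if "x \<in> frontier \<Omega>" "c \<in> Basis" "d \<in> Basis" for k x c d
    using bs.N_dd(2)[OF that(2,3,3)] by (simp add: bs.F_outside[OF out[OF that(1)]])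
  have G_bound: "norm (grad_rot a b (bs.F k) x) \<le> (real CARD('n) * (2 * C)) * (1 / 2) ^ k" if "x \<in> frontier \<Omega>" for k x
    using norm_grad_rot_le[of "bs.F k" x "C * (1 / 2) ^ k" a b] F2[OF that] by (simp add: mult.assoc)
  let ?S = "{x \<in> cball x0 r. g x = 0}"
  obtain K where K: "1 \<le> K" "\<And>x y. x \<in> cball x0 (r + 1) \<Longrightarrow> y \<in> cball x0 (r + 1) \<Longrightarrow> \<bar>g x - g y\<bar> \<le> K * dist x y"
    using lipschitz_on_cball[OF g lip] by blast
  have S_fin: "hausdorff_outer (real CARD('n) - 1) ?S < \<infinity>"
    using hausdorff_outer_graph_finite[OF shift e less_imp_le[OF r(1)] K(2,1)] n2 by simp
  have S_borel: "?S \<in> sets borel"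
  proof -
    have "closed (g -` {0})" using cg by (intro closed_vimage) auto
    then have "cball x0 r \<inter> g -` {0} \<in> sets borel" by auto
    also have "cball x0 r \<inter> g -` {0} = ?S" by auto
    finally show ?thesis .
  qed
  have G_far: "grad_rot a b (bs.F k) x = 0" if "x \<in> frontier \<Omega>" "x \<notin> ?S" for k x
  proof -
    have "x \<notin> cball x0 r" using that fr by auto
    then show ?thesis unfolding grad_rot_def by (simp add: bs.F_outside[OF out[OF that(1)]] far)
  qed
  \<comment> \<open>The representative \<open>ss.G\<close> serves as its own boundary values: on the
    frontier its series converges uniformly by \<open>G_bound\<close>.\<close>
  have trace: "has_trace s \<Omega> ss.G ss.G" if "1 < s" "s < real CARD('n)" for s
    by (rule ss.G_trace[OF _ that(2) G_bound S_borel S_fin G_far]) (use that in auto)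
  have nonzero: "\<not> (AE x in surface_measure \<Omega>. ss.G x = 0)"
  proof -
    have "continuous_on UNIV g'" using lip by (rule lipschitz_on_continuous_on)
    then have "continuous_on UNIV (\<lambda>x. g' x $ b)" by (intro continuous_intros)
    then have "open ((\<lambda>x. g' x $ b) -` (- {0}))" by (intro open_vimage) auto
    moreover have "x0 \<in> (\<lambda>x. g' x $ b) -` (- {0})" using b by simp
    ultimately obtain d where d: "0 < d" "ball x0 d \<subseteq> (\<lambda>x. g' x $ b) -` (- {0})" by (rule openE)
    have "ss.G \<in> borel_measurable borel"
      unfolding ss.G_def[abs_def]
      by (intro borel_measurable_suminf borel_measurable_continuous_onI Ck_continuous[OF ss.Ck_grad_rot])
    then show ?thesis
    proof (rule surface_not_AE_zero[OF _ _ cg shift e gx0])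
      show "0 < min r d" using r d by simp
      fix x assume x: "x \<in> ball x0 (min r d)" "g x = 0"
      then have xr: "x \<in> cball x0 r" and xf: "x \<in> frontier \<Omega>" using fr[of x] by auto
      have sm: "summable (\<lambda>k. grad_rot a b (bs.F k) x)"
      proof (rule summable_comparison_test)
        show "\<exists>M. \<forall>k\<ge>M. norm (grad_rot a b (bs.F k) x) \<le> (real CARD('n) * (2 * C)) * (1 / 2) ^ k"
          using G_bound[OF xf] by blast
        show "summable (\<lambda>k. (real CARD('n) * (2 * C)) * (1 / 2 :: real) ^ k)"
          by (intro summable_mult summable_geometric) simp
      qed
      \<comment> \<open>This entry is the second derivative D_b D_b of the stream function, whose
        value on the graph the telescoping has determined.\<close>
      have "ss.G x $ a $ b = (\<Sum>k. grad_rot a b (bs.F k) x $ a $ b)"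
        unfolding ss.G_def by (rule bounded_linear.suminf[OF entry_linear sm])
      also have "\<dots> = (\<Sum>k. dderiv (axis b 1) (dderiv (axis b 1) (N k)) x)"
        by (simp add: grad_rot_entry[OF ab] bs.F_outside[OF out[OF xf]])
      also have "\<dots> = 2 * gm.eta x * (g' x \<bullet> axis b 1)\<^sup>2"
        using Ns[OF xr x(2) ax, of b] by (simp add: sums_iff)
      also have "\<dots> \<noteq> 0"
      proof -
        have "norm ((1 / r) *\<^sub>R (x - x0)) < 1"
          using x r by (simp only: norm_scaleR) (simp add: dist_norm norm_minus_commute field_simps)
        then have "0 < gm.eta x" unfolding gm.eta_def by (rule bump_pos)
        moreover have "g' x $ b \<noteq> 0" using x d(2) by auto
        ultimately show ?thesis by (simp add: inner_axis)
      qed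
      finally have "ss.G x \<noteq> 0" by auto
      then show "x \<in> frontier \<Omega> \<and> ss.G x \<noteq> 0" using xf by simp
    qed (use n2 in simp)
  qed
  show ?thesis
  proof (rule exI[of _ ss.u], rule exI[of _ ss.G], intro conjI allI impI)
    show "has_weak_gradient \<Omega> ss.u ss.G" by (rule ss.has_weak_gradient_u)
    show "ss.u \<in> sobolev 2 q \<Omega> \<inter> sobolev_zero_trace s \<Omega>" if "1 < q \<and> q < real CARD('n) \<and> 1 < s" for q s
      using ss.u_sobolev(2)[of q] ss.u_zero_trace[OF _ u0, of s] that by simp
    show "\<exists>T. (\<forall>q. 1 < q \<and> q < real CARD('n) \<longrightarrow> has_trace q \<Omega> ss.G T) \<and> \<not> (AE x in surface_measure \<Omega>. T x = 0)"
      using trace nonzero by blast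
    show "AE x in lebesgue_on \<Omega>. trace (ss.G x) = 0" by (rule ss.AE_trace_G)
    show "(\<lambda>x. if x \<in> \<Omega> then (1 + norm (sym_part (ss.G x))) powr (p - 2) else 0) \<notin> muckenhoupt_infty \<Omega>0"
      if "1 < p \<and> p \<noteq> 2 \<and> open \<Omega>0 \<and> \<Omega>0 \<noteq> {} \<and> \<Omega>0 \<subseteq> \<Omega>" for p \<Omega>0
      using bs.weight_not_muckenhoupt[of \<Omega>0 p] that unfolding ss.G_def by blast
  qed
qed

end
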